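(* Let $n\geq1$ be an integer. If $(\mathcal{C},\mathbb{E},\mathfrak{s})$ is an $n$-exangulated category that is $n$-exact, then the idempotent completion $(\widetilde{\mathcal{C}},\mathbb{F},\mathfrak{t})$ (an $n$-exangulated category, with $\mathbb{F}$ and $\mathfrak{t}$ as defined in the context) is $n$-exact.
   Context: **$n$-exangulated categories.** Let $\mathcal{C}$ be an additive category and $\mathbb{E}\colon\mathcal{C}^{\mathrm{op}}\times\mathcal{C}\to\mathsf{Ab}$ a biadditive functor. An $\mathbb{E}$-extension is an element $\delta\in\mathbb{E}(C,A)$. For $a\colon A\to B$ and $d\colon D\to C$ put $a_{\mathbb{E}}\delta=\mathbb{E}(C,a)(\delta)$ and $d^{\mathbb{E}}\delta=\mathbb{E}(d,A)(\delta)$. The zero of $\mathbb{E}(C,A)$ is ${}_A0_C$. A morphism of $\mathbb{E}$-extensions from $\delta\in\mathbb{E}(C,A)$ to $\rho\in\mathbb{E}(D,B)$ is a pair $(a\colon A\to B,\,c\colon C\to D)$ with $a_{\mathbb{E}}\delta=c^{\mathbb{E}}\rho$. $\mathsf{Ch}(\mathcal{C})^n$ is the category of complexes $X_\bullet\colon X_0\xrightarrow{d^X_0}X_1\to\cdots\xrightarrow{d^X_n}X_{n+1}$ concentrated in degrees $0,\dots,n+1$. An $\mathbb{E}$-attached complex $\langle X_\bullet,\delta\rangle$ consists of $X_\bullet\in\mathsf{Ch}(\mathcal{C})^n$ and $\delta\in\mathbb{E}(X_{n+1},X_0)$ with $(d^X_0)_{\mathbb{E}}\delta=0$ and $(d^X_n)^{\mathbb{E}}\delta=0$.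 It is an $n$-exangle if for every $Y\in\mathcal{C}$ the sequences $\mathcal{C}(Y,X_0)\to\cdots\to\mathcal{C}(Y,X_{n+1})\to\mathbb{E}(Y,X_0)$ (last map $u\mapsto u^{\mathbb{E}}\delta$) and $\mathcal{C}(X_{n+1},Y)\to\cdots\to\mathcal{C}(X_0,Y)\to\mathbb{E}(X_{n+1},Y)$ (last map $u\mapsto u_{\mathbb{E}}\delta$) are exact. For $A,C\in\mathcal{C}$, $\mathsf{Ch}(\mathcal{C})^n_{(A,C)}$ has as objects the $X_\bullet\in\mathsf{Ch}(\mathcal{C})^n$ with $X_0=A$, $X_{n+1}=C$, and as morphisms the chain maps $f_\bullet$ with $f_0=\mathrm{id}_A$, $f_{n+1}=\mathrm{id}_C$; $\mathsf{K}(\mathcal{C})^n_{(A,C)}$ is its quotient by the usual chain homotopy relation, and $[X_\bullet]$ is the isomorphism class of $X_\bullet$ in $\mathsf{K}(\mathcal{C})^n_{(A,C)}$. An exact realisation $\mathfrak{s}$ of $\mathbb{E}$ assigns to each $\delta\in\mathbb{E}(C,A)$ a class $\mathfrak{s}(\delta)=[X_\bullet]$ in $\mathsf{K}(\mathcal{C})^n_{(A,C)}$ such that: (R0) for each morphism $(a,c)\colon\delta\to\rho$ with $\mathfrak{s}(\delta)=[X_\bullet]$, $\mathfrak{s}(\rho)=[Y_\bullet]$ there is a chain map $f_\bullet\colon X_\bullet\to Y_\bullet$ with $f_0=a$, $f_{n+1}=c$ (a lift of $(a,c)$); (R1) if $\mathfrak{s}(\delta)=[X_\bullet]$ then $\langle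 X_\bullet,\delta\rangle$ is an $n$-exangle; (R2) $\mathfrak{s}({}_A0_0)=[A\xrightarrow{\mathrm{id}}A\to0\to\cdots\to0]$ and $\mathfrak{s}({}_00_A)=[0\to\cdots\to0\to A\xrightarrow{\mathrm{id}}A]$. If $\mathfrak{s}(\delta)=[X_\bullet]$, then $\langle X_\bullet,\delta\rangle$ is called $\mathfrak{s}$-distinguished, $d^X_0$ an $\mathfrak{s}$-inflation and $d^X_n$ an $\mathfrak{s}$-deflation. For a chain map $f_\bullet\colon X_\bullet\to Y_\bullet$ in $\mathsf{Ch}(\mathcal{C})^n$ with $X_0=Y_0$, $f_0=\mathrm{id}$, the mapping cone $M_f$ is the complex $X_1\to X_2\oplus Y_1\to\cdots\to X_{n+1}\oplus Y_n\to Y_{n+1}$ with differentials $\begin{pmatrix}-d^X_1\\ f_1\end{pmatrix}$, $\begin{pmatrix}-d^X_{i+1}&0\\ f_{i+1}&d^Y_i\end{pmatrix}$ ($1\le i\le n-1$), $\begin{pmatrix}f_{n+1}&d^Y_n\end{pmatrix}$. $(\mathcal{C},\mathbb{E},\mathfrak{s})$ is an $n$-exangulated category if $\mathfrak{s}$ is an exact realisation of $\mathbb{E}$ and: (EA1) $\mathfrak{s}$-inflations are closed under composition and $\mathfrak{s}$-deflations are closed under composition; (EA2) for $\delta\in\mathbb{E}(D,A)$, $c\colon C\to D$, $\mathfrak{s}(c^{\mathbb{E}}\delta)=[Y_\bullet]$, $\mathfrak{s}(\delta)=[X_\bullet]$, there is a lift $f_\bullet\colon Y_\bullet\to X_\bullet$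 of $(\mathrm{id}_A,c)$ with $\mathfrak{s}((d^Y_0)_{\mathbb{E}}\delta)=[M_f]$; (EA2)$^{\mathrm{op}}$ the dual of (EA2). **Being $n$-exact.** An $n$-exact category (Jasso) is a pair $(\mathcal{C},\mathcal{X})$ with $\mathcal{C}$ additive and $\mathcal{X}$ an $n$-exact structure. Here an $n$-exact sequence is a complex $X_0\to\cdots\to X_{n+1}$ such that $0\to\mathcal{C}(Y,X_0)\to\cdots\to\mathcal{C}(Y,X_{n+1})$ and $0\to\mathcal{C}(X_{n+1},Y)\to\cdots\to\mathcal{C}(X_0,Y)$ are exact for all $Y$. An $n$-exact structure is a class $\mathcal{X}$ of $n$-exact sequences, closed under weak isomorphisms (chain maps with two cyclically consecutive components, modulo $n+2$, isomorphisms), containing the zero sequence, whose first maps (admissible monomorphisms) and whose last maps (admissible epimorphisms) are each closed under composition, and such that for each $X_\bullet\in\mathcal{X}$ and $f_0\colon X_0\to Y_0$ there is a chain map from $X_0\to\cdots\to X_n$ to some $Y_0\to\cdots\to Y_n$ extending $f_0$, with $Y_0\to Y_1$ an admissible monomorphism and with mapping cone $X_0\to X_1\oplus Y_0\to\cdots\to X_n\oplus Y_{n-1}\to Y_n$ satisfying that $0\to\mathcal{C}(Y_n,Z)\to\mathcal{C}(X_n\oplus Y_{n-1},Z)\to\cdots\to\mathcal{C}(X_0,Z)$ is exact for all $Z$ ($n$-pushout), together with the dual condition. If for all $A,C$ the collection $\mathrm{Ext}^n_{\mathcal{C}}(C,A)$ of homotopy equivalence classes in $\mathsf{Ch}(\mathcal{C})^n_{(A,C)}$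 of sequences in $\mathcal{X}$ from $A$ to $C$ is a set, then $\mathbb{E}=\mathrm{Ext}^n_{\mathcal{C}}$ (functorial via $n$-pushouts and $n$-pullbacks, with Baer sum) together with the realisation sending a class to itself makes $\mathcal{C}$ an $n$-exangulated category. An $n$-exangulated category is called $n$-exact if its $n$-exangulated structure arises in this way. It is known (Klapproth) that an $n$-exangulated category is $n$-exact if and only if all its inflations are monomorphisms and all its deflations are epimorphisms. **Idempotent completion.** Objects of $\widetilde{\mathcal{C}}$ are pairs $(X,e)$ with $e\in\mathrm{End}_{\mathcal{C}}(X)$, $e^2=e$. Morphisms $(X,e)\to(Y,e')$ are triplets $(e',r,e)$ with $r\in\mathcal{C}(X,Y)$, $re=r=e'r$. Composition: $(e'',s,e')\circ(e',r,e)=(e'',sr,e)$; the identity of $(X,e)$ is $(e,e,e)$. $\mathbb{F}((Z,e'),(X,e))=\{(e,\delta,e')\mid\delta\in\mathbb{E}(Z,X),\ e_{\mathbb{E}}\delta=\delta=(e')^{\mathbb{E}}\delta\}$ with addition inherited from $\mathbb{E}(Z,X)$; for morphisms $\tilde a=(e_1,a,e)\colon(X,e)\to(X_1,e_1)$ and $\tilde c=(e',c,e_2)\colon(Z_2,e_2)\to(Z,e')$, $\mathbb{F}(\tilde c,\tilde a)(e,\delta,e')=(e_1,\mathbb{E}(c,a)(\delta),e_2)$. For $\tilde\delta=(e_0,\delta,e_{n+1})\in\mathbb{F}((X_{n+1},e_{n+1}),(X_0,e_0))$ choose $X_\bullet$ with $\mathfrak{s}(\delta)=[X_\bullet]$ and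 an idempotent chain map $e_\bullet\colon X_\bullet\to X_\bullet$ with the given end terms $e_0$ and $e_{n+1}$ (such exists), and set $\mathfrak{t}(\tilde\delta)=[(X_\bullet,e_\bullet)]$, where $(X_\bullet,e_\bullet)$ is the complex in $\widetilde{\mathcal{C}}$ with objects $(X_i,e_i)$ and differentials $(e_{i+1},e_{i+1}d^X_ie_i,e_i)$; this class is independent of the choices. The triplet $(\widetilde{\mathcal{C}},\mathbb{F},\mathfrak{t})$ is an $n$-exangulated category. *)

theory Defs
  imports "HOL-Algebra.Group"
begin

section \<open>Additive categories\<close>

text \<open>
  A category is given by a set of objects, hom-groups, identities and composition
  (\<open>g \<cdot> f\<close> is \<open>g\<close> after \<open>f\<close>). Abelian groups are commutative groups of HOL-Algebra, hence written
  multiplicatively: \<open>f \<otimes>\<^bsub>Hom C X Y\<^esub> g\<close> is the sum \<open>f + g\<close> and \<open>\<one>\<^bsub>Hom C X Y\<^esub>\<close> is the zero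
  morphism \<open>X \<rightarrow> Y\<close>. Hom-sets of distinct pairs of objects are disjoint, so that a
  morphism determines its domain and codomain.
\<close>

record ('o, 'm) addcat =
  Ob :: "'o set"
  Hom :: "'o \<Rightarrow> 'o \<Rightarrow> 'm monoid"
  Idn :: "'o \<Rightarrow> 'm"
  Cmp :: "'m \<Rightarrow> 'm \<Rightarrow> 'm" (infixl "\<cdot>\<index>" 75)

abbreviation arr :: "('o, 'm, 'z) addcat_scheme \<Rightarrow> 'o \<Rightarrow> 'o \<Rightarrow> 'm set" where
  "arr C X Y \<equiv> carrier (Hom C X Y)"

definition zero_object :: "('o, 'm, 'z) addcat_scheme \<Rightarrow> 'o \<Rightarrow> bool" where
  "zero_object C Z \<longleftrightarrow> Z \<in> Ob C \<and>
     (\<forall>X\<in>Ob C. (\<exists>!f. f \<in> arr C X Z) \<and> (\<exists>!f. f \<in> arr C Z X))"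

definition biproduct ::
  "('o, 'm, 'z) addcat_scheme \<Rightarrow> 'o \<Rightarrow> 'o \<Rightarrow> 'o \<Rightarrow> 'm \<Rightarrow> 'm \<Rightarrow> 'm \<Rightarrow> 'm \<Rightarrow> bool" where
  "biproduct C A B P i1 i2 p1 p2 \<longleftrightarrow>
     A \<in> Ob C \<and> B \<in> Ob C \<and> P \<in> Ob C \<and>
     i1 \<in> arr C A P \<and> i2 \<in> arr C B P \<and> p1 \<in> arr C P A \<and> p2 \<in> arr C P B \<and>
     p1 \<cdot>\<^bsub>C\<^esub> i1 = Idn C A \<and> p2 \<cdot>\<^bsub>C\<^esub> i2 = Idn C B \<and>
     p1 \<cdot>\<^bsub>C\<^esub> i2 = \<one>\<^bsub>Hom C B A\<^esub> \<and> p2 \<cdot>\<^bsub>C\<^esub> i1 = \<one>\<^bsub>Hom C A B\<^esub> \<and>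
     (i1 \<cdot>\<^bsub>C\<^esub> p1) \<otimes>\<^bsub>Hom C P P\<^esub> (i2 \<cdot>\<^bsub>C\<^esub> p2) = Idn C P"

locale additive_category =
  fixes C :: "('o, 'm, 'z) addcat_scheme" (structure)
  assumes hom_group: "\<lbrakk>X \<in> Ob C; Y \<in> Ob C\<rbrakk> \<Longrightarrow> comm_group (Hom C X Y)"
    and hom_disjoint:
      "\<lbrakk>X \<in> Ob C; Y \<in> Ob C; X' \<in> Ob C; Y' \<in> Ob C; f \<in> arr C X Y; f \<in> arr C X' Y'\<rbrakk>
         \<Longrightarrow> X = X' \<and> Y = Y'"
    and id_closed: "X \<in> Ob C \<Longrightarrow> Idn C X \<in> arr C X X"
    and comp_closed:
      "\<lbrakk>X \<in> Ob C; Y \<in> Ob C; Z \<in> Ob C; f \<in> arr C X Y; g \<in> arr C Y Z\<rbrakk> \<Longrightarrow> g \<cdot> f \<in> arr C X Z"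
    and comp_assoc:
      "\<lbrakk>W \<in> Ob C; X \<in> Ob C; Y \<in> Ob C; Z \<in> Ob C; f \<in> arr C W X; g \<in> arr C X Y; h \<in> arr C Y Z\<rbrakk>
         \<Longrightarrow> (h \<cdot> g) \<cdot> f = h \<cdot> (g \<cdot> f)"
    and comp_id_left: "\<lbrakk>X \<in> Ob C; Y \<in> Ob C; f \<in> arr C X Y\<rbrakk> \<Longrightarrow> Idn C Y \<cdot> f = f"
    and comp_id_right: "\<lbrakk>X \<in> Ob C; Y \<in> Ob C; f \<in> arr C X Y\<rbrakk> \<Longrightarrow> f \<cdot> Idn C X = f"
    and comp_add_left:
      "\<lbrakk>X \<in> Ob C; Y \<in> Ob C; Z \<in> Ob C; f \<in> arr C X Y; g \<in> arr C Y Z; g' \<in> arr C Y Z\<rbrakk>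
         \<Longrightarrow> (g \<otimes>\<^bsub>Hom C Y Z\<^esub> g') \<cdot> f = (g \<cdot> f) \<otimes>\<^bsub>Hom C X Z\<^esub> (g' \<cdot> f)"
    and comp_add_right:
      "\<lbrakk>X \<in> Ob C; Y \<in> Ob C; Z \<in> Ob C; f \<in> arr C X Y; f' \<in> arr C X Y; g \<in> arr C Y Z\<rbrakk>
         \<Longrightarrow> g \<cdot> (f \<otimes>\<^bsub>Hom C X Y\<^esub> f') = (g \<cdot> f) \<otimes>\<^bsub>Hom C X Z\<^esub> (g \<cdot> f')"
    and zero_object_exists: "\<exists>Z. zero_object C Z"
    and biproduct_exists:
      "\<lbrakk>A \<in> Ob C; B \<in> Ob C\<rbrakk> \<Longrightarrow> \<exists>P i1 i2 p1 p2. biproduct C A B P i1 i2 p1 p2"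

definition isomorphism :: "('o, 'm, 'z) addcat_scheme \<Rightarrow> 'o \<Rightarrow> 'o \<Rightarrow> 'm \<Rightarrow> bool" where
  "isomorphism C X Y f \<longleftrightarrow> f \<in> arr C X Y \<and>
     (\<exists>g\<in>arr C Y X. g \<cdot>\<^bsub>C\<^esub> f = Idn C X \<and> f \<cdot>\<^bsub>C\<^esub> g = Idn C Y)"

definition op_cat :: "('o, 'm, 'z) addcat_scheme \<Rightarrow> ('o, 'm, 'z) addcat_scheme" where
  "op_cat C = C\<lparr>Hom := \<lambda>X Y. Hom C Y X, Cmp := \<lambda>g f. f \<cdot>\<^bsub>C\<^esub> g\<rparr>"


section \<open>Complexes\<close>

text \<open>
  A complex \<open>X\<close> concentrated in degrees \<open>0, \<dots>, m\<close> has objects \<open>obj X i\<close> for \<open>i \<le> m\<close> and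
  differentials \<open>dif X i\<close> from degree \<open>i\<close> to degree \<open>i + 1\<close> for \<open>i < m\<close>. The values of \<open>obj X\<close> and
  \<open>dif X\<close> at other indices are arbitrary, and no notion below depends on them; in particular the
  classes of complexes below are closed under changing these values. The same convention applies
  to the components of chain maps. The complexes of length \<open>n\<close> in the theory of \<open>n\<close>-exangulated
  categories are those with \<open>m = n + 1\<close>.
\<close>

datatype ('o, 'm) cplx = Cplx (obj: "nat \<Rightarrow> 'o") (dif: "nat \<Rightarrow> 'm")

definition complex :: "('o, 'm, 'z) addcat_scheme \<Rightarrow> nat \<Rightarrow> ('o, 'm) cplx \<Rightarrow> bool" where
  "complex C m X \<longleftrightarrow>
     (\<forall>i\<le>m. obj X i \<in> Ob C) \<and>
     (\<forall>i<m. dif X i \<in> arr C (obj X i) (obj X (Suc i))) \<and>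
     (\<forall>i. Suc i < m \<longrightarrow>
        dif X (Suc i) \<cdot>\<^bsub>C\<^esub> dif X i = \<one>\<^bsub>Hom C (obj X i) (obj X (Suc (Suc i)))\<^esub>)"

definition chain_map ::
  "('o, 'm, 'z) addcat_scheme \<Rightarrow> nat \<Rightarrow> ('o, 'm) cplx \<Rightarrow> ('o, 'm) cplx \<Rightarrow> (nat \<Rightarrow> 'm) \<Rightarrow> bool" where
  "chain_map C m X Y f \<longleftrightarrow>
     (\<forall>i\<le>m. f i \<in> arr C (obj X i) (obj Y i)) \<and>
     (\<forall>i<m. f (Suc i) \<cdot>\<^bsub>C\<^esub> dif X i = dif Y i \<cdot>\<^bsub>C\<^esub> f i)"

definition rev_cplx :: "nat \<Rightarrow> ('o, 'm) cplx \<Rightarrow> ('o, 'm) cplx" where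
  "rev_cplx m X = Cplx (\<lambda>i. obj X (m - i)) (\<lambda>i. dif X (m - 1 - i))"

definition shift_cplx :: "('o, 'm) cplx \<Rightarrow> ('o, 'm) cplx" where
  "shift_cplx X = Cplx (\<lambda>i. obj X (Suc i)) (\<lambda>i. dif X (Suc i))"

text \<open>
  Left exactness means that \<open>0 \<rightarrow> \<C>(Y, X\<^sub>0) \<rightarrow> \<dots> \<rightarrow> \<C>(Y, X\<^sub>m)\<close> is exact for all \<open>Y\<close>; right exactness
  means that \<open>0 \<rightarrow> \<C>(X\<^sub>m, Y) \<rightarrow> \<dots> \<rightarrow> \<C>(X\<^sub>0, Y)\<close> is exact for all \<open>Y\<close>.
\<close>

definition left_exact :: "('o, 'm, 'z) addcat_scheme \<Rightarrow> nat \<Rightarrow> ('o, 'm) cplx \<Rightarrow> bool" where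
  "left_exact C m X \<longleftrightarrow> (\<forall>Y\<in>Ob C.
     (\<forall>u\<in>arr C Y (obj X 0).
        dif X 0 \<cdot>\<^bsub>C\<^esub> u = \<one>\<^bsub>Hom C Y (obj X 1)\<^esub> \<longrightarrow> u = \<one>\<^bsub>Hom C Y (obj X 0)\<^esub>) \<and>
     (\<forall>i. Suc i < m \<longrightarrow> (\<forall>u\<in>arr C Y (obj X (Suc i)).
        dif X (Suc i) \<cdot>\<^bsub>C\<^esub> u = \<one>\<^bsub>Hom C Y (obj X (Suc (Suc i)))\<^esub>
          \<longleftrightarrow> (\<exists>v\<in>arr C Y (obj X i). u = dif X i \<cdot>\<^bsub>C\<^esub> v))))"

definition right_exact :: "('o, 'm, 'z) addcat_scheme \<Rightarrow> nat \<Rightarrow> ('o, 'm) cplx \<Rightarrow> bool" where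
  "right_exact C m X \<longleftrightarrow> left_exact (op_cat C) m (rev_cplx m X)"

text \<open>
  \<open>M\<close> is a mapping cone, i.e.
  \<open>X\<^sub>0 \<rightarrow> X\<^sub>1 \<oplus> Y\<^sub>0 \<rightarrow> \<dots> \<rightarrow> X\<^sub>m \<oplus> Y\<^bsub>m-1\<^esub> \<rightarrow> Y\<^sub>m\<close>, of a chain map \<open>f\<close> between
  complexes in degrees \<open>0, \<dots>, m\<close> with \<open>m \<ge> 1\<close>, for some choice of the biproducts involved.
\<close>

definition mapping_cone ::
  "('o, 'm, 'z) addcat_scheme \<Rightarrow> nat \<Rightarrow> ('o, 'm) cplx \<Rightarrow> ('o, 'm) cplx \<Rightarrow> (nat \<Rightarrow> 'm)
     \<Rightarrow> ('o, 'm) cplx \<Rightarrow> bool" where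
  "mapping_cone C m X Y f M \<longleftrightarrow>
     obj M 0 = obj X 0 \<and> obj M (Suc m) = obj Y m \<and>
     (\<exists>i1 i2 p1 p2.
        (\<forall>j<m. biproduct C (obj X (Suc j)) (obj Y j) (obj M (Suc j)) (i1 j) (i2 j) (p1 j) (p2 j)) \<and>
        dif M 0 =
          (i1 0 \<cdot>\<^bsub>C\<^esub> (inv\<^bsub>Hom C (obj X 0) (obj X 1)\<^esub> (dif X 0)))
            \<otimes>\<^bsub>Hom C (obj M 0) (obj M 1)\<^esub> (i2 0 \<cdot>\<^bsub>C\<^esub> f 0) \<and>
        (\<forall>j. Suc j < m \<longrightarrow> dif M (Suc j) =
          (i1 (Suc j) \<cdot>\<^bsub>C\<^esub> (inv\<^bsub>Hom C (obj X (Suc j)) (obj X (Suc (Suc j)))\<^esub> (dif X (Suc j))) \<cdot>\<^bsub>C\<^esub> p1 j)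
            \<otimes>\<^bsub>Hom C (obj M (Suc j)) (obj M (Suc (Suc j)))\<^esub>
          ((i2 (Suc j) \<cdot>\<^bsub>C\<^esub> f (Suc j) \<cdot>\<^bsub>C\<^esub> p1 j)
            \<otimes>\<^bsub>Hom C (obj M (Suc j)) (obj M (Suc (Suc j)))\<^esub>
           (i2 (Suc j) \<cdot>\<^bsub>C\<^esub> dif Y j \<cdot>\<^bsub>C\<^esub> p2 j))) \<and>
        dif M m =
          (f m \<cdot>\<^bsub>C\<^esub> p1 (m - 1)) \<otimes>\<^bsub>Hom C (obj M m) (obj M (Suc m))\<^esub> (dif Y (m - 1) \<cdot>\<^bsub>C\<^esub> p2 (m - 1)))"

definition direct_sum ::
  "('o, 'm, 'z) addcat_scheme \<Rightarrow> nat \<Rightarrow> ('o, 'm) cplx \<Rightarrow> ('o, 'm) cplx \<Rightarrow> ('o, 'm) cplx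
     \<Rightarrow> (nat \<Rightarrow> 'm) \<Rightarrow> (nat \<Rightarrow> 'm) \<Rightarrow> (nat \<Rightarrow> 'm) \<Rightarrow> (nat \<Rightarrow> 'm) \<Rightarrow> bool" where
  "direct_sum C m X Y S i1 i2 p1 p2 \<longleftrightarrow>
     (\<forall>j\<le>m. biproduct C (obj X j) (obj Y j) (obj S j) (i1 j) (i2 j) (p1 j) (p2 j)) \<and>
     (\<forall>j<m. dif S j =
        (i1 (Suc j) \<cdot>\<^bsub>C\<^esub> dif X j \<cdot>\<^bsub>C\<^esub> p1 j)
          \<otimes>\<^bsub>Hom C (obj S j) (obj S (Suc j))\<^esub> (i2 (Suc j) \<cdot>\<^bsub>C\<^esub> dif Y j \<cdot>\<^bsub>C\<^esub> p2 j))"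


subsection \<open>Complexes with fixed end terms, up to homotopy\<close>

definition cplx_between ::
  "nat \<Rightarrow> ('o, 'm, 'z) addcat_scheme \<Rightarrow> 'o \<Rightarrow> 'o \<Rightarrow> ('o, 'm) cplx set" where
  "cplx_between n C A Z = {X. complex C (n + 1) X \<and> obj X 0 = A \<and> obj X (n + 1) = Z}"

definition end_fixing ::
  "nat \<Rightarrow> ('o, 'm, 'z) addcat_scheme \<Rightarrow> ('o, 'm) cplx \<Rightarrow> ('o, 'm) cplx \<Rightarrow> (nat \<Rightarrow> 'm) \<Rightarrow> bool" where
  "end_fixing n C X Y f \<longleftrightarrow> chain_map C (n + 1) X Y f \<and>
     f 0 = Idn C (obj X 0) \<and> f (n + 1) = Idn C (obj X (n + 1))"

text \<open>
  The component \<open>h i\<close> of a homotopy goes from degree \<open>i\<close> of \<open>X\<close> to degree \<open>i - 1\<close> of \<open>Y\<close>.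
\<close>

definition homotopic ::
  "('o, 'm, 'z) addcat_scheme \<Rightarrow> nat \<Rightarrow> ('o, 'm) cplx \<Rightarrow> ('o, 'm) cplx
     \<Rightarrow> (nat \<Rightarrow> 'm) \<Rightarrow> (nat \<Rightarrow> 'm) \<Rightarrow> bool" where
  "homotopic C m X Y f g \<longleftrightarrow> (\<exists>h.
     (\<forall>i<m. h (Suc i) \<in> arr C (obj X (Suc i)) (obj Y i)) \<and>
     f 0 = g 0 \<otimes>\<^bsub>Hom C (obj X 0) (obj Y 0)\<^esub> (h 1 \<cdot>\<^bsub>C\<^esub> dif X 0) \<and>
     (\<forall>i. Suc i < m \<longrightarrow> f (Suc i) =
        g (Suc i) \<otimes>\<^bsub>Hom C (obj X (Suc i)) (obj Y (Suc i))\<^esub>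
          ((h (Suc (Suc i)) \<cdot>\<^bsub>C\<^esub> dif X (Suc i))
             \<otimes>\<^bsub>Hom C (obj X (Suc i)) (obj Y (Suc i))\<^esub> (dif Y i \<cdot>\<^bsub>C\<^esub> h (Suc i)))) \<and>
     f m = g m \<otimes>\<^bsub>Hom C (obj X m) (obj Y m)\<^esub> (dif Y (m - 1) \<cdot>\<^bsub>C\<^esub> h m))"

text \<open>\<open>htpy_class n C X\<close> is the class \<open>[X]\<close>: all complexes isomorphic to \<open>X\<close> in \<open>K(\<C>)\<^sup>n\<^bsub>(A,C)\<^esub>\<close>.\<close>

definition htpy_equiv ::
  "nat \<Rightarrow> ('o, 'm, 'z) addcat_scheme \<Rightarrow> ('o, 'm) cplx \<Rightarrow> ('o, 'm) cplx \<Rightarrow> bool" where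
  "htpy_equiv n C X Y \<longleftrightarrow> (\<exists>f g. end_fixing n C X Y f \<and> end_fixing n C Y X g \<and>
     homotopic C (n + 1) X X (\<lambda>i. g i \<cdot>\<^bsub>C\<^esub> f i) (\<lambda>i. Idn C (obj X i)) \<and>
     homotopic C (n + 1) Y Y (\<lambda>i. f i \<cdot>\<^bsub>C\<^esub> g i) (\<lambda>i. Idn C (obj Y i)))"

definition htpy_class ::
  "nat \<Rightarrow> ('o, 'm, 'z) addcat_scheme \<Rightarrow> ('o, 'm) cplx \<Rightarrow> ('o, 'm) cplx set" where
  "htpy_class n C X = {Y \<in> cplx_between n C (obj X 0) (obj X (n + 1)). htpy_equiv n C X Y}"


section \<open>\<open>n\<close>-exangulated categories\<close>

text \<open>
  \<open>Ext E C A\<close> is the abelian group \<open>\<E>(C, A)\<close>, \<open>Act E c a\<close> is the map \<open>\<E>(c, a)\<close>, and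
  \<open>Rlz E C A \<delta>\<close> is the class \<open>\<s>(\<delta>)\<close> of \<open>\<delta> \<in> \<E>(C, A)\<close>.
\<close>

record ('o, 'm, 'x) exang = "('o, 'm) addcat" +
  Ext :: "'o \<Rightarrow> 'o \<Rightarrow> 'x monoid"
  Act :: "'m \<Rightarrow> 'm \<Rightarrow> 'x \<Rightarrow> 'x"
  Rlz :: "'o \<Rightarrow> 'o \<Rightarrow> 'x \<Rightarrow> ('o, 'm) cplx set"

locale biadditive_functor =
  fixes E :: "('o, 'm, 'x) exang" (structure)
  assumes ext_group: "\<lbrakk>Z \<in> Ob E; A \<in> Ob E\<rbrakk> \<Longrightarrow> comm_group (Ext E Z A)"
    and act_hom:
      "\<lbrakk>Z \<in> Ob E; Z' \<in> Ob E; A \<in> Ob E; A' \<in> Ob E; c \<in> arr E Z' Z; a \<in> arr E A A'\<rbrakk>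
         \<Longrightarrow> Act E c a \<in> hom (Ext E Z A) (Ext E Z' A')"
    and act_id:
      "\<lbrakk>Z \<in> Ob E; A \<in> Ob E; \<delta> \<in> carrier (Ext E Z A)\<rbrakk> \<Longrightarrow> Act E (Idn E Z) (Idn E A) \<delta> = \<delta>"
    and act_comp:
      "\<lbrakk>Z \<in> Ob E; Z' \<in> Ob E; Z'' \<in> Ob E; A \<in> Ob E; A' \<in> Ob E; A'' \<in> Ob E;
        c \<in> arr E Z' Z; c' \<in> arr E Z'' Z'; a \<in> arr E A A'; a' \<in> arr E A' A'';
        \<delta> \<in> carrier (Ext E Z A)\<rbrakk>
         \<Longrightarrow> Act E (c \<cdot> c') (a' \<cdot> a) \<delta> = Act E c' a' (Act E c a \<delta>)"
    and act_add_left: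
      "\<lbrakk>Z \<in> Ob E; Z' \<in> Ob E; A \<in> Ob E; A' \<in> Ob E; c \<in> arr E Z' Z; c' \<in> arr E Z' Z;
        a \<in> arr E A A'; \<delta> \<in> carrier (Ext E Z A)\<rbrakk>
         \<Longrightarrow> Act E (c \<otimes>\<^bsub>Hom E Z' Z\<^esub> c') a \<delta> = Act E c a \<delta> \<otimes>\<^bsub>Ext E Z' A'\<^esub> Act E c' a \<delta>"
    and act_add_right:
      "\<lbrakk>Z \<in> Ob E; Z' \<in> Ob E; A \<in> Ob E; A' \<in> Ob E; c \<in> arr E Z' Z; a \<in> arr E A A';
        a' \<in> arr E A A'; \<delta> \<in> carrier (Ext E Z A)\<rbrakk>
         \<Longrightarrow> Act E c (a \<otimes>\<^bsub>Hom E A A'\<^esub> a') \<delta> = Act E c a \<delta> \<otimes>\<^bsub>Ext E Z' A'\<^esub> Act E c a' \<delta>"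

text \<open>
  For \<open>\<delta> \<in> \<E>(Z, A)\<close>: \<open>push E Z a \<delta> = a\<^sub>\<E>\<delta>\<close> and \<open>pull E A c \<delta> = c\<^sup>\<E>\<delta>\<close>.
\<close>

definition push :: "('o, 'm, 'x) exang \<Rightarrow> 'o \<Rightarrow> 'm \<Rightarrow> 'x \<Rightarrow> 'x" where
  "push E Z a = Act E (Idn E Z) a"

definition pull :: "('o, 'm, 'x) exang \<Rightarrow> 'o \<Rightarrow> 'm \<Rightarrow> 'x \<Rightarrow> 'x" where
  "pull E A c = Act E c (Idn E A)"

text \<open>
  The realisation is transported by taking preimages under \<^const>\<open>rev_cplx\<close>, because \<^const>\<open>rev_cplx\<close> forgets
  the irrelevant values of a complex.
\<close>

definition op_exang :: "nat \<Rightarrow> ('o, 'm, 'x) exang \<Rightarrow> ('o, 'm, 'x) exang" where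
  "op_exang n E = (op_cat E)\<lparr>
     Ext := \<lambda>Z A. Ext E A Z,
     Act := \<lambda>c a. Act E a c,
     Rlz := \<lambda>Z A \<delta>. rev_cplx (n + 1) -` Rlz E A Z \<delta>\<rparr>"

definition attached :: "nat \<Rightarrow> ('o, 'm, 'x) exang \<Rightarrow> ('o, 'm) cplx \<Rightarrow> 'x \<Rightarrow> bool" where
  "attached n E X \<delta> \<longleftrightarrow> complex E (n + 1) X \<and> \<delta> \<in> carrier (Ext E (obj X (n + 1)) (obj X 0)) \<and>
     push E (obj X (n + 1)) (dif X 0) \<delta> = \<one>\<^bsub>Ext E (obj X (n + 1)) (obj X 1)\<^esub> \<and>
     pull E (obj X 0) (dif X n) \<delta> = \<one>\<^bsub>Ext E (obj X n) (obj X 0)\<^esub>"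

text \<open>Exactness of \<open>\<C>(Y, X\<^sub>0) \<rightarrow> \<dots> \<rightarrow> \<C>(Y, X\<^bsub>n+1\<^esub>) \<rightarrow> \<E>(Y, X\<^sub>0)\<close> for all \<open>Y\<close>.\<close>

definition covariant_exact :: "nat \<Rightarrow> ('o, 'm, 'x) exang \<Rightarrow> ('o, 'm) cplx \<Rightarrow> 'x \<Rightarrow> bool" where
  "covariant_exact n E X \<delta> \<longleftrightarrow> (\<forall>Y\<in>Ob E.
     (\<forall>i<n. \<forall>u\<in>arr E Y (obj X (Suc i)).
        dif X (Suc i) \<cdot>\<^bsub>E\<^esub> u = \<one>\<^bsub>Hom E Y (obj X (Suc (Suc i)))\<^esub>
          \<longleftrightarrow> (\<exists>v\<in>arr E Y (obj X i). u = dif X i \<cdot>\<^bsub>E\<^esub> v)) \<and>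
     (\<forall>u\<in>arr E Y (obj X (n + 1)).
        pull E (obj X 0) u \<delta> = \<one>\<^bsub>Ext E Y (obj X 0)\<^esub>
          \<longleftrightarrow> (\<exists>v\<in>arr E Y (obj X n). u = dif X n \<cdot>\<^bsub>E\<^esub> v)))"

definition exangle :: "nat \<Rightarrow> ('o, 'm, 'x) exang \<Rightarrow> ('o, 'm) cplx \<Rightarrow> 'x \<Rightarrow> bool" where
  "exangle n E X \<delta> \<longleftrightarrow> attached n E X \<delta> \<and> covariant_exact n E X \<delta> \<and>
     covariant_exact n (op_exang n E) (rev_cplx (n + 1) X) \<delta>"

text \<open>\<open>realised_by n E A Z \<delta> X\<close> is the assertion \<open>\<s>(\<delta>) = [X]\<close> for \<open>\<delta> \<in> \<E>(Z, A)\<close>.\<close>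

definition realised_by ::
  "nat \<Rightarrow> ('o, 'm, 'x) exang \<Rightarrow> 'o \<Rightarrow> 'o \<Rightarrow> 'x \<Rightarrow> ('o, 'm) cplx \<Rightarrow> bool" where
  "realised_by n E A Z \<delta> X \<longleftrightarrow> X \<in> cplx_between n E A Z \<and> Rlz E Z A \<delta> = htpy_class n E X"

locale exact_realisation =
  fixes n :: nat and E :: "('o, 'm, 'x) exang" (structure)
  assumes realised:
      "\<lbrakk>A \<in> Ob E; Z \<in> Ob E; \<delta> \<in> carrier (Ext E Z A)\<rbrakk> \<Longrightarrow> \<exists>X. realised_by n E A Z \<delta> X"
    and R0:
      "\<lbrakk>A \<in> Ob E; Z \<in> Ob E; B \<in> Ob E; D \<in> Ob E;
        \<delta> \<in> carrier (Ext E Z A); \<rho> \<in> carrier (Ext E D B); a \<in> arr E A B; c \<in> arr E Z D;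
        push E Z a \<delta> = pull E B c \<rho>; realised_by n E A Z \<delta> X; realised_by n E B D \<rho> Y\<rbrakk>
         \<Longrightarrow> \<exists>f. chain_map E (n + 1) X Y f \<and> f 0 = a \<and> f (n + 1) = c"
    and R1:
      "\<lbrakk>A \<in> Ob E; Z \<in> Ob E; \<delta> \<in> carrier (Ext E Z A); realised_by n E A Z \<delta> X\<rbrakk>
         \<Longrightarrow> exangle n E X \<delta>"
    and R2_left:
      "\<lbrakk>A \<in> Ob E; zero_object E N\<rbrakk> \<Longrightarrow>
         realised_by n E A N \<one>\<^bsub>Ext E N A\<^esub>
           (Cplx (\<lambda>i. if i \<le> 1 then A else N)
                 (\<lambda>i. if i = 0 then Idn E A
                      else if i = 1 then \<one>\<^bsub>Hom E A N\<^esub> else \<one>\<^bsub>Hom E N N\<^esub>))"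
    and R2_right:
      "\<lbrakk>A \<in> Ob E; zero_object E N\<rbrakk> \<Longrightarrow>
         realised_by n E N A \<one>\<^bsub>Ext E A N\<^esub>
           (Cplx (\<lambda>i. if i < n then N else A)
                 (\<lambda>i. if i = n then Idn E A
                      else if i + 1 = n then \<one>\<^bsub>Hom E N A\<^esub> else \<one>\<^bsub>Hom E N N\<^esub>))"

definition inflation :: "nat \<Rightarrow> ('o, 'm, 'x) exang \<Rightarrow> 'm \<Rightarrow> bool" where
  "inflation n E f \<longleftrightarrow> (\<exists>A\<in>Ob E. \<exists>Z\<in>Ob E. \<exists>\<delta>\<in>carrier (Ext E Z A). \<exists>X.
     realised_by n E A Z \<delta> X \<and> f = dif X 0)"

definition deflation :: "nat \<Rightarrow> ('o, 'm, 'x) exang \<Rightarrow> 'm \<Rightarrow> bool" where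
  "deflation n E f \<longleftrightarrow> (\<exists>A\<in>Ob E. \<exists>Z\<in>Ob E. \<exists>\<delta>\<in>carrier (Ext E Z A). \<exists>X.
     realised_by n E A Z \<delta> X \<and> f = dif X n)"

definition closed_under_comp :: "('o, 'm, 'z) addcat_scheme \<Rightarrow> ('m \<Rightarrow> bool) \<Rightarrow> bool" where
  "closed_under_comp C P \<longleftrightarrow> (\<forall>X\<in>Ob C. \<forall>Y\<in>Ob C. \<forall>Z\<in>Ob C. \<forall>f\<in>arr C X Y. \<forall>g\<in>arr C Y Z.
     P f \<longrightarrow> P g \<longrightarrow> P (g \<cdot>\<^bsub>C\<^esub> f))"

text \<open>
  For \<open>f: Y \<rightarrow> X\<close> with \<open>f 0\<close> an identity, the mapping cone used in (EA2) omits degree \<open>0\<close>, i.e. it is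
  the usual cone of the shifted chain map.
\<close>

definition EA2 :: "nat \<Rightarrow> ('o, 'm, 'x) exang \<Rightarrow> bool" where
  "EA2 n E \<longleftrightarrow> (\<forall>A\<in>Ob E. \<forall>D\<in>Ob E. \<forall>Z\<in>Ob E. \<forall>\<delta>\<in>carrier (Ext E D A). \<forall>c\<in>arr E Z D. \<forall>X Y.
     realised_by n E A Z (pull E A c \<delta>) Y \<longrightarrow> realised_by n E A D \<delta> X \<longrightarrow>
     (\<exists>f M. chain_map E (n + 1) Y X f \<and> f 0 = Idn E A \<and> f (n + 1) = c \<and>
        mapping_cone E n (shift_cplx Y) (shift_cplx X) (\<lambda>i. f (Suc i)) M \<and>
        realised_by n E (obj Y 1) D (push E D (dif Y 0) \<delta>) M))"

definition n_exangulated :: "nat \<Rightarrow> ('o, 'm, 'x) exang \<Rightarrow> bool" where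
  "n_exangulated n E \<longleftrightarrow>
     additive_category E \<and> biadditive_functor E \<and> exact_realisation n E \<and>
     closed_under_comp E (inflation n E) \<and> closed_under_comp E (deflation n E) \<and>
     EA2 n E \<and> EA2 n (op_exang n E)"


section \<open>\<open>n\<close>-exact categories\<close>

definition n_exact_sequence :: "nat \<Rightarrow> ('o, 'm, 'z) addcat_scheme \<Rightarrow> ('o, 'm) cplx \<Rightarrow> bool" where
  "n_exact_sequence n C X \<longleftrightarrow>
     complex C (n + 1) X \<and> left_exact C (n + 1) X \<and> right_exact C (n + 1) X"

definition weak_isomorphism ::
  "nat \<Rightarrow> ('o, 'm, 'z) addcat_scheme \<Rightarrow> ('o, 'm) cplx \<Rightarrow> ('o, 'm) cplx \<Rightarrow> (nat \<Rightarrow> 'm) \<Rightarrow> bool" where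
  "weak_isomorphism n C X Y f \<longleftrightarrow> chain_map C (n + 1) X Y f \<and>
     (\<exists>i\<le>n + 1. \<forall>j\<in>{i, Suc i mod (n + 2)}. isomorphism C (obj X j) (obj Y j) (f j))"

definition adm_mono :: "('o, 'm) cplx set \<Rightarrow> 'm \<Rightarrow> bool" where
  "adm_mono \<X> g \<longleftrightarrow> (\<exists>X\<in>\<X>. g = dif X 0)"

definition adm_epi :: "nat \<Rightarrow> ('o, 'm) cplx set \<Rightarrow> 'm \<Rightarrow> bool" where
  "adm_epi n \<X> g \<longleftrightarrow> (\<exists>X\<in>\<X>. g = dif X n)"

definition n_pushout ::
  "nat \<Rightarrow> ('o, 'm, 'z) addcat_scheme \<Rightarrow> ('o, 'm) cplx \<Rightarrow> ('o, 'm) cplx \<Rightarrow> (nat \<Rightarrow> 'm) \<Rightarrow> bool" where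
  "n_pushout n C X Y f \<longleftrightarrow> complex C n X \<and> complex C n Y \<and> chain_map C n X Y f \<and>
     (\<exists>M. mapping_cone C n X Y f M \<and> right_exact C (n + 1) M)"

definition has_n_pushouts ::
  "nat \<Rightarrow> ('o, 'm, 'z) addcat_scheme \<Rightarrow> ('o, 'm) cplx set \<Rightarrow> bool" where
  "has_n_pushouts n C \<X> \<longleftrightarrow> (\<forall>X\<in>\<X>. \<forall>B\<in>Ob C. \<forall>a\<in>arr C (obj X 0) B.
     \<exists>Y f. obj Y 0 = B \<and> f 0 = a \<and> n_pushout n C X Y f \<and> adm_mono \<X> (dif Y 0))"

definition n_exact_structure ::
  "nat \<Rightarrow> ('o, 'm, 'z) addcat_scheme \<Rightarrow> ('o, 'm) cplx set \<Rightarrow> bool" where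
  "n_exact_structure n C \<X> \<longleftrightarrow>
     (\<forall>X\<in>\<X>. n_exact_sequence n C X) \<and>
     (\<forall>X Y f. n_exact_sequence n C X \<longrightarrow> n_exact_sequence n C Y \<longrightarrow> weak_isomorphism n C X Y f \<longrightarrow>
        (X \<in> \<X> \<longleftrightarrow> Y \<in> \<X>)) \<and>
     (\<forall>X. complex C (n + 1) X \<longrightarrow> (\<forall>i\<le>n + 1. zero_object C (obj X i)) \<longrightarrow> X \<in> \<X>) \<and>
     closed_under_comp C (adm_mono \<X>) \<and> closed_under_comp C (adm_epi n \<X>) \<and>
     has_n_pushouts n C \<X> \<and> has_n_pushouts n (op_cat C) (rev_cplx (n + 1) -` \<X>)"

definition n_exact_category ::
  "nat \<Rightarrow> ('o, 'm, 'z) addcat_scheme \<Rightarrow> ('o, 'm) cplx set \<Rightarrow> bool" where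
  "n_exact_category n C \<X> \<longleftrightarrow> additive_category C \<and> n_exact_structure n C \<X>"


subsection \<open>The \<open>n\<close>-exangulated structure of an \<open>n\<close>-exact category\<close>

definition ext_classes ::
  "nat \<Rightarrow> ('o, 'm, 'z) addcat_scheme \<Rightarrow> ('o, 'm) cplx set \<Rightarrow> 'o \<Rightarrow> 'o \<Rightarrow> ('o, 'm) cplx set set" where
  "ext_classes n C \<X> Z A = htpy_class n C ` (\<X> \<inter> cplx_between n C A Z)"

text \<open>
  An \<open>n\<close>-pushout of \<open>X\<^sub>0 \<rightarrow> \<dots> \<rightarrow> X\<^sub>n\<close> along \<open>a\<close> extends uniquely to a morphism \<open>f: X \<rightarrow> Y\<close> of \<open>n\<close>-exact
  sequences with \<open>f (n + 1)\<close> an identity; the class of \<open>Y\<close> does not depend on the choices made.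
\<close>

definition ext_push ::
  "nat \<Rightarrow> ('o, 'm, 'z) addcat_scheme \<Rightarrow> ('o, 'm) cplx set \<Rightarrow> 'm \<Rightarrow> ('o, 'm) cplx set
     \<Rightarrow> ('o, 'm) cplx set" where
  "ext_push n C \<X> a \<xi> = htpy_class n C (SOME Y. Y \<in> \<X> \<and> (\<exists>X\<in>\<xi>. \<exists>f.
     chain_map C (n + 1) X Y f \<and> f 0 = a \<and>
     obj Y (n + 1) = obj X (n + 1) \<and> f (n + 1) = Idn C (obj X (n + 1)) \<and>
     n_pushout n C X Y f))"

definition ext_pull ::
  "nat \<Rightarrow> ('o, 'm, 'z) addcat_scheme \<Rightarrow> ('o, 'm) cplx set \<Rightarrow> 'm \<Rightarrow> ('o, 'm) cplx set
     \<Rightarrow> ('o, 'm) cplx set" where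
  "ext_pull n C \<X> c \<xi> =
     rev_cplx (n + 1) -` ext_push n (op_cat C) (rev_cplx (n + 1) -` \<X>) c (rev_cplx (n + 1) -` \<xi>)"

text \<open>
  The Baer sum of \<open>[X]\<close> and \<open>[Y]\<close> is obtained from \<open>[X \<oplus> Y]\<close> by pushing out along the codiagonal
  \<open>A \<oplus> A \<rightarrow> A\<close> and pulling back along the diagonal \<open>Z \<rightarrow> Z \<oplus> Z\<close>.
\<close>

definition baer_sum ::
  "nat \<Rightarrow> ('o, 'm, 'z) addcat_scheme \<Rightarrow> ('o, 'm) cplx set \<Rightarrow> 'o \<Rightarrow> 'o
     \<Rightarrow> ('o, 'm) cplx set \<Rightarrow> ('o, 'm) cplx set \<Rightarrow> ('o, 'm) cplx set" where
  "baer_sum n C \<X> Z A \<xi> \<eta> = (SOME \<zeta>. \<exists>X\<in>\<xi>. \<exists>Y\<in>\<eta>. \<exists>S i1 i2 p1 p2.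
     direct_sum C (n + 1) X Y S i1 i2 p1 p2 \<and>
     \<zeta> = ext_pull n C \<X> (i1 (n + 1) \<otimes>\<^bsub>Hom C Z (obj S (n + 1))\<^esub> i2 (n + 1))
           (ext_push n C \<X> (p1 0 \<otimes>\<^bsub>Hom C (obj S 0) A\<^esub> p2 0) (htpy_class n C S)))"

definition ext_group ::
  "nat \<Rightarrow> ('o, 'm, 'z) addcat_scheme \<Rightarrow> ('o, 'm) cplx set \<Rightarrow> 'o \<Rightarrow> 'o
     \<Rightarrow> ('o, 'm) cplx set monoid" where
  "ext_group n C \<X> Z A = \<lparr>
     carrier = ext_classes n C \<X> Z A,
     mult = baer_sum n C \<X> Z A,
     one = (THE \<zeta>. \<zeta> \<in> ext_classes n C \<X> Z A \<and>
              (\<forall>\<xi>\<in>ext_classes n C \<X> Z A. baer_sum n C \<X> Z A \<zeta> \<xi> = \<xi>))\<rparr>"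

definition exact_to_exang ::
  "nat \<Rightarrow> ('o, 'm, 'z) addcat_scheme \<Rightarrow> ('o, 'm) cplx set
     \<Rightarrow> ('o, 'm, ('o, 'm) cplx set) exang" where
  "exact_to_exang n C \<X> = \<lparr>
     Ob = Ob C, Hom = Hom C, Idn = Idn C, Cmp = Cmp C,
     Ext = ext_group n C \<X>,
     Act = (\<lambda>c a \<xi>. ext_pull n C \<X> c (ext_push n C \<X> a \<xi>)),
     Rlz = (\<lambda>Z A \<xi>. \<xi>)\<rparr>"

text \<open>
  Two structures on the same category are identified along an isomorphism of the functors of
  extensions which is compatible with the realisations.
\<close>

definition same_exang_structure :: "('o, 'm, 'x) exang \<Rightarrow> ('o, 'm, 'y) exang \<Rightarrow> bool" where
  "same_exang_structure E E' \<longleftrightarrow>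
     addcat.truncate E = addcat.truncate E' \<and>
     (\<exists>\<Gamma>.
        (\<forall>Z\<in>Ob E. \<forall>A\<in>Ob E. \<Gamma> Z A \<in> iso (Ext E Z A) (Ext E' Z A)) \<and>
        (\<forall>Z\<in>Ob E. \<forall>Z'\<in>Ob E. \<forall>A\<in>Ob E. \<forall>A'\<in>Ob E. \<forall>c\<in>arr E Z' Z. \<forall>a\<in>arr E A A'.
           \<forall>\<delta>\<in>carrier (Ext E Z A). \<Gamma> Z' A' (Act E c a \<delta>) = Act E' c a (\<Gamma> Z A \<delta>)) \<and>
        (\<forall>Z\<in>Ob E. \<forall>A\<in>Ob E. \<forall>\<delta>\<in>carrier (Ext E Z A). Rlz E Z A \<delta> = Rlz E' Z A (\<Gamma> Z A \<delta>)))"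

definition n_exact_exangulated :: "nat \<Rightarrow> ('o, 'm, 'x) exang \<Rightarrow> bool" where
  "n_exact_exangulated n E \<longleftrightarrow> n_exangulated n E \<and>
     (\<exists>\<X>. n_exact_category n E \<X> \<and> same_exang_structure E (exact_to_exang n E \<X>))"


section \<open>The idempotent completion\<close>

definition idem_objects :: "('o, 'm, 'z) addcat_scheme \<Rightarrow> ('o \<times> 'm) set" where
  "idem_objects C = {(X, e). X \<in> Ob C \<and> e \<in> arr C X X \<and> e \<cdot>\<^bsub>C\<^esub> e = e}"

definition idem_hom ::
  "('o, 'm, 'z) addcat_scheme \<Rightarrow> 'o \<times> 'm \<Rightarrow> 'o \<times> 'm \<Rightarrow> ('m \<times> 'm \<times> 'm) monoid" where
  "idem_hom C = (\<lambda>(X, e) (Y, e'). \<lparr>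
     carrier = {(e', r, e) | r. r \<in> arr C X Y \<and> r \<cdot>\<^bsub>C\<^esub> e = r \<and> e' \<cdot>\<^bsub>C\<^esub> r = r},
     mult = (\<lambda>(_, r, _) (_, s, _). (e', r \<otimes>\<^bsub>Hom C X Y\<^esub> s, e)),
     one = (e', \<one>\<^bsub>Hom C X Y\<^esub>, e)\<rparr>)"

definition idem_cat ::
  "('o, 'm, 'z) addcat_scheme \<Rightarrow> ('o \<times> 'm, 'm \<times> 'm \<times> 'm) addcat" where
  "idem_cat C = \<lparr>
     Ob = idem_objects C,
     Hom = idem_hom C,
     Idn = (\<lambda>(X, e). (e, e, e)),
     Cmp = (\<lambda>(e'', s, _) (_, r, e). (e'', s \<cdot>\<^bsub>C\<^esub> r, e))\<rparr>"

definition idem_ext ::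
  "('o, 'm, 'x) exang \<Rightarrow> 'o \<times> 'm \<Rightarrow> 'o \<times> 'm \<Rightarrow> ('m \<times> 'x \<times> 'm) monoid" where
  "idem_ext E = (\<lambda>(Z, e') (X, e). \<lparr>
     carrier = {(e, \<delta>, e') | \<delta>. \<delta> \<in> carrier (Ext E Z X) \<and> push E Z e \<delta> = \<delta> \<and> pull E X e' \<delta> = \<delta>},
     mult = (\<lambda>(_, \<delta>, _) (_, \<rho>, _). (e, \<delta> \<otimes>\<^bsub>Ext E Z X\<^esub> \<rho>, e')),
     one = (e, \<one>\<^bsub>Ext E Z X\<^esub>, e')\<rparr>)"

definition idem_act ::
  "('o, 'm, 'x) exang \<Rightarrow> 'm \<times> 'm \<times> 'm \<Rightarrow> 'm \<times> 'm \<times> 'm \<Rightarrow> 'm \<times> 'x \<times> 'm \<Rightarrow> 'm \<times> 'x \<times> 'm" where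
  "idem_act E = (\<lambda>(_, c, e\<^sub>2) (e\<^sub>1, a, _) (_, \<delta>, _). (e\<^sub>1, Act E c a \<delta>, e\<^sub>2))"

definition idem_cplx ::
  "('o, 'm, 'z) addcat_scheme \<Rightarrow> ('o, 'm) cplx \<Rightarrow> (nat \<Rightarrow> 'm) \<Rightarrow> ('o \<times> 'm, 'm \<times> 'm \<times> 'm) cplx" where
  "idem_cplx C X e =
     Cplx (\<lambda>i. (obj X i, e i)) (\<lambda>i. (e (Suc i), e (Suc i) \<cdot>\<^bsub>C\<^esub> dif X i \<cdot>\<^bsub>C\<^esub> e i, e i))"

text \<open>
  A choice of a complex \<open>X\<close> realising \<open>\<delta> \<in> \<E>(Z, A)\<close> together with an idempotent endomorphism of \<open>X\<close>
  with prescribed end terms; the class of the resulting complex is independent of the choice.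
\<close>

definition idem_choice ::
  "nat \<Rightarrow> ('o, 'm, 'x) exang \<Rightarrow> 'o \<Rightarrow> 'o \<Rightarrow> 'm \<times> 'x \<times> 'm \<Rightarrow> ('o, 'm) cplx \<times> (nat \<Rightarrow> 'm)" where
  "idem_choice n E A Z = (\<lambda>(e\<^sub>0, \<delta>, e\<^sub>1). SOME (X, e).
     realised_by n E A Z \<delta> X \<and> chain_map E (n + 1) X X e \<and>
     (\<forall>i\<le>n + 1. e i \<cdot>\<^bsub>E\<^esub> e i = e i) \<and> e 0 = e\<^sub>0 \<and> e (n + 1) = e\<^sub>1)"

definition idem_rlz ::
  "nat \<Rightarrow> ('o, 'm, 'x) exang \<Rightarrow> 'o \<times> 'm \<Rightarrow> 'o \<times> 'm \<Rightarrow> 'm \<times> 'x \<times> 'm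
     \<Rightarrow> ('o \<times> 'm, 'm \<times> 'm \<times> 'm) cplx set" where
  "idem_rlz n E = (\<lambda>(Z, _) (A, _) \<delta>.
     case idem_choice n E A Z \<delta> of (X, e) \<Rightarrow> htpy_class n (idem_cat E) (idem_cplx E X e))"

definition idem_completion ::
  "nat \<Rightarrow> ('o, 'm, 'x) exang \<Rightarrow> ('o \<times> 'm, 'm \<times> 'm \<times> 'm, 'm \<times> 'x \<times> 'm) exang" where
  "idem_completion n E = \<lparr>
     Ob = Ob (idem_cat E), Hom = Hom (idem_cat E), Idn = Idn (idem_cat E), Cmp = Cmp (idem_cat E),
     Ext = idem_ext E,
     Act = idem_act E,
     Rlz = idem_rlz n E\<rparr>"

end

theory Submission
  imports Defs
begin

text \<open>
  Suppose that an additive category carries a biadditive functor and an exact realisation all of whose values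
  are classes of \<open>n\<close>-exact sequences. Then (EA1) is all that is needed for an
  \<open>n\<close>-exangulated category that comes from an \<open>n\<close>-exact category
  (\<open>exact_exangulated\<close>). The reason is that \<open>n\<close>-exact sequences allow chain maps to be
  extended in both directions, uniquely up to homotopy. It follows that every chain map between realisations is
  a morphism of the extensions (\<open>naturality\<close>), so that an extension is determined by its
  realisation. The cones in (EA2) are \<open>n\<close>-exact sequences and hence can be compared with
  realisations (\<open>cone_realises\<close>). This gives (EA2) and, by the argument for the obscure axiom of
  exact categories, a criterion for an \<open>n\<close>-exact sequence to be a realisation
  (\<open>realised_if_factorisation\<close>, \<open>realised_if_section\<close>), from which the axioms of an
  \<open>n\<close>-exact structure follow; pushouts and Baer sums of realisations then correspond to the
  operations on extensions.

  In the idempotent completion, realisations are complexes \<open>(X, \<eta>)\<close> for an idempotent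
  endomorphism \<open>\<eta>\<close> of an \<open>n\<close>-exact sequence \<open>X\<close>. Since
  \<open>\<eta>\<close> splits off a summand, \<open>(X, \<eta>)\<close> is \<open>n\<close>-exact, and lifts
  of morphisms of extensions exist as they can be cut down by idempotents. So only (EA1) remains. If
  \<open>f: (A, e) \<rightarrow> (Q, e')\<close> is an inflation of the completion, then \<open>f\<close>,
  considered in the original category, becomes an inflation after adding a component \<open>u\<close> with
  \<open>u \<cdot> e = 0\<close> (\<open>inflation_rep\<close>). By (EA1) in the original category, a
  composite \<open>g \<cdot> f\<close> likewise is a component of an inflation
  \<open>K = (g \<cdot> f, u)\<close>. The idempotents \<open>e\<close> and \<open>q\<close> of the ends of
  \<open>K\<close> that single out \<open>g \<cdot> f\<close> extend to an endomorphism of a complex with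
  first differential \<open>K\<close>. It is idempotent only up to homotopy, but becomes idempotent after adding
  contractible complexes in degrees where \<open>K\<close> is not involved (\<open>rigidify\<close>). The
  complex that belongs to this idempotent shows that \<open>g \<cdot> f\<close> is an inflation of the
  completion (\<open>inflations_compose\<close>). Deflations are treated by duality.
\<close>


section \<open>Additive categories through sources and targets\<close>

text \<open>
  Morphisms are handled through their source and target rather than through membership in hom-groups. Side
  conditions then are equations between objects, and the simplifier can compute with composites and sums of
  morphisms. The values of \<open>src\<close> and \<open>tgt\<close> are meaningful for morphisms only.
\<close>

definition mor :: "('o, 'm, 'z) addcat_scheme \<Rightarrow> 'm \<Rightarrow> bool" where
  "mor C f \<longleftrightarrow> (\<exists>X\<in>Ob C. \<exists>Y\<in>Ob C. f \<in> arr C X Y)"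

definition src :: "('o, 'm, 'z) addcat_scheme \<Rightarrow> 'm \<Rightarrow> 'o" where
  "src C f = (THE X. X \<in> Ob C \<and> (\<exists>Y\<in>Ob C. f \<in> arr C X Y))"

definition tgt :: "('o, 'm, 'z) addcat_scheme \<Rightarrow> 'm \<Rightarrow> 'o" where
  "tgt C f = (THE Y. Y \<in> Ob C \<and> (\<exists>X\<in>Ob C. f \<in> arr C X Y))"

definition madd :: "('o, 'm, 'z) addcat_scheme \<Rightarrow> 'm \<Rightarrow> 'm \<Rightarrow> 'm" (infixl "\<oplus>\<index>" 65) where
  "f \<oplus>\<^bsub>C\<^esub> g = f \<otimes>\<^bsub>Hom C (src C f) (tgt C f)\<^esub> g"

definition mneg :: "('o, 'm, 'z) addcat_scheme \<Rightarrow> 'm \<Rightarrow> 'm" ("\<ominus>\<index> _" [81] 80) where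
  "\<ominus>\<^bsub>C\<^esub> f = inv\<^bsub>Hom C (src C f) (tgt C f)\<^esub> f"

abbreviation zr :: "('o, 'm, 'z) addcat_scheme \<Rightarrow> 'o \<Rightarrow> 'o \<Rightarrow> 'm" where
  "zr C X Y \<equiv> \<one>\<^bsub>Hom C X Y\<^esub>"

context additive_category
begin

lemma arr_iff [simp]:
  assumes "X \<in> Ob C" "Y \<in> Ob C"
  shows "f \<in> arr C X Y \<longleftrightarrow> mor C f \<and> src C f = X \<and> tgt C f = Y"
proof
  assume f: "f \<in> arr C X Y"
  have "src C f = X" "tgt C f = Y"
    unfolding src_def tgt_def using f assms hom_disjoint by (blast intro: the_equality)+
  then show "mor C f \<and> src C f = X \<and> tgt C f = Y" using f assms by (auto simp: mor_def)
next
  assume r: "mor C f \<and> src C f = X \<and> tgt C f = Y"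
  then obtain X' Y' where f: "f \<in> arr C X' Y'" "X' \<in> Ob C" "Y' \<in> Ob C" by (auto simp: mor_def)
  have "src C f = X'" "tgt C f = Y'"
    unfolding src_def tgt_def using f assms hom_disjoint by (blast intro: the_equality)+
  with r f show "f \<in> arr C X Y" by simp
qed

lemma mor_ob [simp]: "mor C f \<Longrightarrow> src C f \<in> Ob C" "mor C f \<Longrightarrow> tgt C f \<in> Ob C"
  by (metis arr_iff mor_def)+

lemma mor_arr: "mor C f \<Longrightarrow> f \<in> arr C (src C f) (tgt C f)" by simp

lemma arrI: "mor C f \<Longrightarrow> src C f = X \<Longrightarrow> tgt C f = Y \<Longrightarrow> f \<in> arr C X Y" using mor_arr by blast

lemma mor_id [simp]: assumes "X \<in> Ob C"
  shows "mor C (Idn C X)" "src C (Idn C X) = X" "tgt C (Idn C X) = X"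
  using id_closed[of X] assms by auto

lemma mor_zero [simp]: assumes "X \<in> Ob C" "Y \<in> Ob C"
  shows "mor C (zr C X Y)" "src C (zr C X Y) = X" "tgt C (zr C X Y) = Y"
proof -
  interpret comm_group "Hom C X Y" using assms by (rule hom_group)
  have "zr C X Y \<in> arr C X Y" by simp
  then show "mor C (zr C X Y)" "src C (zr C X Y) = X" "tgt C (zr C X Y) = Y"
    using arr_iff[OF assms, of "zr C X Y"] by blast+
qed

lemma mor_comp [simp]: assumes "mor C g" "mor C f" "src C g = tgt C f"
  shows "mor C (g \<cdot> f)" "src C (g \<cdot> f) = src C f" "tgt C (g \<cdot> f) = tgt C g"
proof -
  have "g \<cdot> f \<in> arr C (src C f) (tgt C g)"
    by (rule comp_closed[where Y="tgt C f"]) (use assms in auto)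
  then show "mor C (g \<cdot> f)" "src C (g \<cdot> f) = src C f" "tgt C (g \<cdot> f) = tgt C g"
    using assms by auto
qed

lemma mult_madd [simp]:
  assumes "mor C f" "src C f = X" "tgt C f = Y"
  shows "f \<otimes>\<^bsub>Hom C X Y\<^esub> g = f \<oplus> g"
  using assms by (simp add: madd_def)

lemma inv_mneg [simp]:
  assumes "mor C f" "src C f = X" "tgt C f = Y"
  shows "inv\<^bsub>Hom C X Y\<^esub> f = \<ominus> f"
  using assms by (simp add: mneg_def)

lemma mor_add [simp]: assumes "mor C f" "mor C g" "src C g = src C f" "tgt C g = tgt C f"
  shows "mor C (f \<oplus> g)" "src C (f \<oplus> g) = src C f" "tgt C (f \<oplus> g) = tgt C f"
proof -
  interpret comm_group "Hom C (src C f) (tgt C f)" using assms by (auto intro: hom_group)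
  have "f \<oplus> g \<in> arr C (src C f) (tgt C f)" unfolding madd_def
    by (rule m_closed) (use assms in \<open>auto intro!: arrI simp del: arr_iff\<close>)
  then show "mor C (f \<oplus> g)" "src C (f \<oplus> g) = src C f" "tgt C (f \<oplus> g) = tgt C f" using assms by auto
qed

lemma mor_neg [simp]: assumes "mor C f"
  shows "mor C (\<ominus> f)" "src C (\<ominus> f) = src C f" "tgt C (\<ominus> f) = tgt C f"
proof -
  interpret comm_group "Hom C (src C f) (tgt C f)" using assms by (auto intro: hom_group)
  have "\<ominus> f \<in> arr C (src C f) (tgt C f)" unfolding mneg_def
    by (rule inv_closed) (use assms in \<open>auto intro!: arrI simp del: arr_iff\<close>)
  then show "mor C (\<ominus> f)" "src C (\<ominus> f) = src C f" "tgt C (\<ominus> f) = tgt C f" using assms by auto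
qed

lemma add_assoc:
  assumes "mor C f" "mor C g" "mor C h" "src C g = src C f" "tgt C g = tgt C f"
    "src C h = src C f" "tgt C h = tgt C f"
  shows "(f \<oplus> g) \<oplus> h = f \<oplus> (g \<oplus> h)"
proof -
  interpret comm_group "Hom C (src C f) (tgt C f)" using assms by (auto intro: hom_group)
  have a: "f \<in> arr C (src C f) (tgt C f)" "g \<in> arr C (src C f) (tgt C f)" "h \<in> arr C (src C f) (tgt C f)"
    by (use assms in \<open>auto intro!: arrI simp del: arr_iff\<close>)
  show ?thesis using m_assoc[OF a] assms by simp
qed

lemma add_comm:
  assumes "mor C f" "mor C g" "src C g = src C f" "tgt C g = tgt C f"
  shows "f \<oplus> g = g \<oplus> f"
proof -
  interpret comm_group "Hom C (src C f) (tgt C f)" using assms by (auto intro: hom_group)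
  have a: "f \<in> arr C (src C f) (tgt C f)" "g \<in> arr C (src C f) (tgt C f)"
    by (use assms in \<open>auto intro!: arrI simp del: arr_iff\<close>)
  show ?thesis using m_comm[OF a] assms by simp
qed

lemma add_lcomm:
  assumes "mor C f" "mor C g" "mor C h" "src C g = src C f" "tgt C g = tgt C f"
    "src C h = src C f" "tgt C h = tgt C f"
  shows "f \<oplus> (g \<oplus> h) = g \<oplus> (f \<oplus> h)"
  using add_assoc[of f g h] add_assoc[of g f h] add_comm[of f g] assms by simp

lemma add_zero [simp]:
  assumes "mor C f" "src C f = X" "tgt C f = Y"
  shows "zr C X Y \<oplus> f = f" "f \<oplus> zr C X Y = f"
proof -
  interpret comm_group "Hom C X Y" using assms by (auto intro: hom_group)
  have a: "f \<in> arr C X Y" using assms arrI by blast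
  have "zr C X Y \<otimes>\<^bsub>Hom C X Y\<^esub> f = f" using a by (rule l_one)
  then show 1: "zr C X Y \<oplus> f = f" using assms by auto
  show "f \<oplus> zr C X Y = f" using r_one[OF a] assms by auto
qed

lemma add_neg [simp]:
  assumes "mor C f"
  shows "f \<oplus> \<ominus> f = zr C (src C f) (tgt C f)" "\<ominus> f \<oplus> f = zr C (src C f) (tgt C f)"
proof -
  interpret comm_group "Hom C (src C f) (tgt C f)" using assms by (auto intro: hom_group)
  have a: "f \<in> arr C (src C f) (tgt C f)" using assms arrI by blast
  have "f \<otimes>\<^bsub>Hom C (src C f) (tgt C f)\<^esub> inv\<^bsub>Hom C (src C f) (tgt C f)\<^esub> f = zr C (src C f) (tgt C f)"
    using a by (rule r_inv)
  then show 1: "f \<oplus> \<ominus> f = zr C (src C f) (tgt C f)" using assms by simp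
  then show "\<ominus> f \<oplus> f = zr C (src C f) (tgt C f)" using add_comm[of f "\<ominus> f"] assms by simp
qed

lemma add_neg_cancel [simp]:
  assumes "mor C f" "mor C g" "src C g = src C f" "tgt C g = tgt C f"
  shows "f \<oplus> (\<ominus> f \<oplus> g) = g" "\<ominus> f \<oplus> (f \<oplus> g) = g"
  using add_assoc[of f "\<ominus> f" g] add_assoc[of "\<ominus> f" f g] assms by simp_all

lemma add_left_cancel:
  assumes "mor C f" "mor C g" "mor C h" "src C g = src C f" "tgt C g = tgt C f"
    "src C h = src C f" "tgt C h = tgt C f"
  shows "f \<oplus> g = f \<oplus> h \<longleftrightarrow> g = h"
proof
  assume "f \<oplus> g = f \<oplus> h"
  then have "\<ominus> f \<oplus> (f \<oplus> g) = \<ominus> f \<oplus> (f \<oplus> h)" by simp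
  then show "g = h" using assms by simp
qed simp

lemma neg_unique:
  assumes "mor C f" "mor C g" "src C g = src C f" "tgt C g = tgt C f"
    "f \<oplus> g = zr C (src C f) (tgt C f)"
  shows "g = \<ominus> f"
  using add_left_cancel[of f g "\<ominus> f"] assms by simp

lemma neg_neg [simp]: "mor C f \<Longrightarrow> \<ominus> (\<ominus> f) = f"
  using neg_unique[of "\<ominus> f" f] by simp

lemma neg_zero [simp]: "X \<in> Ob C \<Longrightarrow> Y \<in> Ob C \<Longrightarrow> \<ominus> zr C X Y = zr C X Y"
  using neg_unique[of "zr C X Y" "zr C X Y"] by simp

lemma neg_add [simp]:
  assumes "mor C f" "mor C g" "src C g = src C f" "tgt C g = tgt C f"
  shows "\<ominus> (f \<oplus> g) = \<ominus> f \<oplus> \<ominus> g"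
proof -
  have "(f \<oplus> g) \<oplus> (\<ominus> f \<oplus> \<ominus> g) = zr C (src C f) (tgt C f)"
    using assms by (simp add: add_assoc add_lcomm[of g "\<ominus> f"])
  then show ?thesis using neg_unique[of "f \<oplus> g" "\<ominus> f \<oplus> \<ominus> g"] assms by simp
qed

lemma eq_iff_diff:
  assumes "mor C f" "mor C g" "src C g = src C f" "tgt C g = tgt C f"
  shows "f = g \<longleftrightarrow> f \<oplus> \<ominus> g = zr C (src C f) (tgt C f)"
proof
  assume "f \<oplus> \<ominus> g = zr C (src C f) (tgt C f)"
  then have "\<ominus> g = \<ominus> f" using assms neg_unique by simp
  then have "\<ominus> (\<ominus> g) = \<ominus> (\<ominus> f)" by simp
  then show "f = g" using assms by simp
qed (use assms in simp)

lemma add_comp [simp]: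
  assumes "mor C f" "mor C g" "mor C h" "src C g = src C f" "tgt C g = tgt C f" "src C f = tgt C h"
  shows "(f \<oplus> g) \<cdot> h = (f \<cdot> h) \<oplus> (g \<cdot> h)"
  using comp_add_left[of "src C h" "tgt C h" "tgt C f" h f g] assms by simp

lemma comp_add [simp]:
  assumes "mor C f" "mor C g" "mor C h" "src C g = src C f" "tgt C g = tgt C f" "src C h = tgt C f"
  shows "h \<cdot> (f \<oplus> g) = (h \<cdot> f) \<oplus> (h \<cdot> g)"
  using comp_add_right[of "src C f" "tgt C f" "tgt C h" f g h] assms by simp

lemma comp_asc [simp]:
  assumes "mor C f" "mor C g" "mor C h" "src C h = tgt C g" "src C g = tgt C f"
  shows "(h \<cdot> g) \<cdot> f = h \<cdot> (g \<cdot> f)"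
  using comp_assoc[of "src C f" "tgt C f" "tgt C g" "tgt C h" f g h] assms by simp

lemma comp_idn [simp]:
  assumes "mor C f"
  shows "tgt C f = Y \<Longrightarrow> Idn C Y \<cdot> f = f" "src C f = X \<Longrightarrow> f \<cdot> Idn C X = f"
  using comp_id_left[of "src C f" "tgt C f" f] comp_id_right[of "src C f" "tgt C f" f] assms by auto

lemma idem_zero_add:
  assumes "mor C f" "src C f = X" "tgt C f = Y" "f \<oplus> f = f" shows "f = zr C X Y"
proof -
  have "f \<oplus> f = f \<oplus> zr C X Y" using assms by simp
  moreover have "X \<in> Ob C" "Y \<in> Ob C" using assms by auto
  ultimately show ?thesis using add_left_cancel[of f f "zr C X Y"] assms(1-3) by (metis mor_zero)
qed

lemma zero_comp [simp]:
  assumes "mor C f" "tgt C f = Y" "Z \<in> Ob C"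
  shows "zr C Y Z \<cdot> f = zr C (src C f) Z"
proof -
  have "zr C Y Z \<oplus> zr C Y Z = zr C Y Z" using assms by auto
  then have "(zr C Y Z \<cdot> f) \<oplus> (zr C Y Z \<cdot> f) = zr C Y Z \<cdot> f"
    using add_comp[of "zr C Y Z" "zr C Y Z" f] assms by auto
  then show ?thesis using idem_zero_add[of "zr C Y Z \<cdot> f" "src C f" Z] assms by auto
qed

lemma comp_zero [simp]:
  assumes "mor C f" "src C f = Y" "X \<in> Ob C"
  shows "f \<cdot> zr C X Y = zr C X (tgt C f)"
proof -
  have "zr C X Y \<oplus> zr C X Y = zr C X Y" using assms by auto
  then have "(f \<cdot> zr C X Y) \<oplus> (f \<cdot> zr C X Y) = f \<cdot> zr C X Y"
    using comp_add[of "zr C X Y" "zr C X Y" f] assms by auto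
  then show ?thesis using idem_zero_add[of "f \<cdot> zr C X Y" X "tgt C f"] assms by auto
qed

lemma neg_comp [simp]:
  assumes "mor C f" "mor C g" "src C g = tgt C f"
  shows "(\<ominus> g) \<cdot> f = \<ominus> (g \<cdot> f)"
  using neg_unique[of "g \<cdot> f" "(\<ominus> g) \<cdot> f"] add_comp[of g "\<ominus> g" f, symmetric] assms by simp

lemma comp_neg [simp]:
  assumes "mor C f" "mor C g" "src C g = tgt C f"
  shows "g \<cdot> (\<ominus> f) = \<ominus> (g \<cdot> f)"
  using neg_unique[of "g \<cdot> f" "g \<cdot> (\<ominus> f)"] comp_add[of f "\<ominus> f" g, symmetric] assms by simp

lemmas add_ac = add_assoc add_comm add_lcomm

text \<open>
  Composites are associated to the right, so that an equation for \<open>a \<cdot> b\<close> does not match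
  within \<open>a \<cdot> (b \<cdot> x)\<close>; here and below the variant with a further factor
  \<open>x\<close> makes up for this.
\<close>

lemma comp_eq:
  assumes "a \<cdot> b = c" "mor C a" "mor C b" "src C a = tgt C b" "mor C x" "tgt C x = src C b"
  shows "a \<cdot> (b \<cdot> x) = c \<cdot> x"
  using assms comp_asc[of x b a] by simp

lemma comp_eq2:
  assumes "a \<cdot> b = c \<cdot> d" "mor C a" "mor C b" "src C a = tgt C b" "mor C c" "mor C d" "src C c = tgt C d"
    "mor C x" "tgt C x = src C b"
  shows "a \<cdot> (b \<cdot> x) = c \<cdot> (d \<cdot> x)"
proof -
  have "src C b = src C d" using mor_comp(2)[of a b] mor_comp(2)[of c d] assms(1-7) by metis
  then show ?thesis using assms comp_asc[of x b a] comp_asc[of x d c] by simp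
qed

end

lemma op_cat_simps [simp]:
  "Ob (op_cat C) = Ob C" "Hom (op_cat C) X Y = Hom C Y X" "Idn (op_cat C) = Idn C"
  "Cmp (op_cat C) g f = Cmp C f g"
  by (simp_all add: op_cat_def)

lemma op_op_cat [simp]: "op_cat (op_cat C) = C"
  by (simp add: op_cat_def)

lemma mor_op [simp]: "mor (op_cat C) = mor C" "src (op_cat C) = tgt C" "tgt (op_cat C) = src C"
  by (auto simp: mor_def src_def tgt_def fun_eq_iff intro!: arg_cong[where f=The])

lemma madd_op [simp]: "madd (op_cat C) = madd C" "mneg (op_cat C) = mneg C"
  by (auto simp: madd_def mneg_def fun_eq_iff)

lemma zero_object_op [simp]: "zero_object (op_cat C) Z \<longleftrightarrow> zero_object C Z"
  by (auto simp: zero_object_def)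

lemma biproduct_op: "biproduct C A B P i1 i2 p1 p2 \<Longrightarrow> biproduct (op_cat C) A B P p1 p2 i1 i2"
  by (auto simp: biproduct_def)

lemma additive_category_op:
  assumes "additive_category C" shows "additive_category (op_cat C)"
proof -
  interpret additive_category C by fact
  show ?thesis
  proof (rule additive_category.intro)
    show "\<exists>P i1 i2 p1 p2. biproduct (op_cat C) A B P i1 i2 p1 p2"
      if "A \<in> Ob (op_cat C)" "B \<in> Ob (op_cat C)" for A B
      using biproduct_exists[of A B] biproduct_op[of C] that by simp blast
    show "\<exists>Z. zero_object (op_cat C) Z" using zero_object_exists by simp
    show "comm_group (Hom (op_cat C) X Y)" if "X \<in> Ob (op_cat C)" "Y \<in> Ob (op_cat C)" for X Y
      using hom_group that by simp
  qed auto
qed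

context additive_category
begin

lemma biprod_mor:
  assumes "biproduct C A B P i1 i2 p1 p2"
  shows "mor C i1" "mor C i2" "mor C p1" "mor C p2" "src C i1 = A" "src C i2 = B" "src C p1 = P" "src C p2 = P"
    "tgt C i1 = P" "tgt C i2 = P" "tgt C p1 = A" "tgt C p2 = B" "A \<in> Ob C" "B \<in> Ob C" "P \<in> Ob C"
  using assms by (auto simp: biproduct_def)

lemma biprod_eq:
  assumes "biproduct C A B P i1 i2 p1 p2"
  shows "p1 \<cdot> i1 = Idn C A" "p2 \<cdot> i2 = Idn C B" "p1 \<cdot> i2 = zr C B A" "p2 \<cdot> i1 = zr C A B"
    "(i1 \<cdot> p1) \<oplus> (i2 \<cdot> p2) = Idn C P"
  using assms by (auto simp: biproduct_def)

lemma biprod_eq':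
  assumes "biproduct C A B P i1 i2 p1 p2" and x: "mor C x"
  shows "tgt C x = A \<Longrightarrow> p1 \<cdot> (i1 \<cdot> x) = x" "tgt C x = B \<Longrightarrow> p2 \<cdot> (i2 \<cdot> x) = x"
    "tgt C x = B \<Longrightarrow> p1 \<cdot> (i2 \<cdot> x) = zr C (src C x) A" "tgt C x = A \<Longrightarrow> p2 \<cdot> (i1 \<cdot> x) = zr C (src C x) B"
  using biprod_mor[OF assms(1)] biprod_eq[OF assms(1)] x
  by (auto simp: comp_eq)

lemma biprod_id:
  assumes "biproduct C A B P i1 i2 p1 p2" and x: "mor C x"
  shows "tgt C x = P \<Longrightarrow> (i1 \<cdot> (p1 \<cdot> x)) \<oplus> (i2 \<cdot> (p2 \<cdot> x)) = x"
    "src C x = P \<Longrightarrow> (x \<cdot> (i1 \<cdot> p1)) \<oplus> (x \<cdot> (i2 \<cdot> p2)) = x"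
proof -
  note m [simp] = biprod_mor[OF assms(1)] biprod_eq[OF assms(1)] x
  show "(i1 \<cdot> (p1 \<cdot> x)) \<oplus> (i2 \<cdot> (p2 \<cdot> x)) = x" if "tgt C x = P"
    using add_comp[of "i1 \<cdot> p1" "i2 \<cdot> p2" x] that by simp
  show "(x \<cdot> (i1 \<cdot> p1)) \<oplus> (x \<cdot> (i2 \<cdot> p2)) = x" if "src C x = P"
    using comp_add[of "i1 \<cdot> p1" "i2 \<cdot> p2" x] that by simp
qed

lemma biprod_eqI:
  assumes B: "biproduct C A B P i1 i2 p1 p2" and x: "mor C x" "mor C y" "tgt C x = P" "tgt C y = P" "src C y = src C x"
    and "p1 \<cdot> x = p1 \<cdot> y" "p2 \<cdot> x = p2 \<cdot> y"
  shows "x = y"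
  using biprod_id(1)[OF B, of x] biprod_id(1)[OF B, of y] assms by metis

lemma biprod_coeqI:
  assumes B: "biproduct C A B P i1 i2 p1 p2" and x: "mor C x" "mor C y" "src C x = P" "src C y = P" "tgt C y = tgt C x"
    and e: "x \<cdot> i1 = y \<cdot> i1" "x \<cdot> i2 = y \<cdot> i2"
  shows "x = y"
proof -
  note m [simp] = biprod_mor[OF B]
  have "x \<cdot> (i1 \<cdot> p1) = y \<cdot> (i1 \<cdot> p1)" by (rule comp_eq2[OF e(1)]) (use x in auto)
  moreover have "x \<cdot> (i2 \<cdot> p2) = y \<cdot> (i2 \<cdot> p2)" by (rule comp_eq2[OF e(2)]) (use x in auto)
  ultimately show ?thesis
    using biprod_id(2)[OF B, of x] biprod_id(2)[OF B, of y] x by metis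
qed

lemma zero_ob_eq:
  assumes "zero_object C N"
  shows "N \<in> Ob C" "mor C f \<Longrightarrow> src C f = X \<Longrightarrow> tgt C f = N \<Longrightarrow> f = zr C X N"
    "mor C f \<Longrightarrow> src C f = N \<Longrightarrow> tgt C f = Y \<Longrightarrow> f = zr C N Y" "Idn C N = zr C N N"
proof -
  show N: "N \<in> Ob C" using assms by (simp add: zero_object_def)
  show 1: "f = zr C X N" if "mor C f" "src C f = X" "tgt C f = N" for f X
  proof -
    have X: "X \<in> Ob C" using that by auto
    then have "\<exists>!g. g \<in> arr C X N" using assms by (simp add: zero_object_def del: arr_iff)
    moreover have "f \<in> arr C X N" "zr C X N \<in> arr C X N" using that N X by (auto intro: arrI simp del: arr_iff)
    ultimately show ?thesis by blast
  qed
  show "f = zr C N Y" if "mor C f" "src C f = N" "tgt C f = Y" for f Y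
  proof -
    have X: "Y \<in> Ob C" using that by auto
    then have "\<exists>!g. g \<in> arr C N Y" using assms by (simp add: zero_object_def del: arr_iff)
    moreover have "f \<in> arr C N Y" "zr C N Y \<in> arr C N Y" using that N X by (auto intro: arrI simp del: arr_iff)
    ultimately show ?thesis by blast
  qed
  show "Idn C N = zr C N N" using 1[of "Idn C N" N] N by simp
qed

end


section \<open>Extending chain maps and homotopies\<close>

text \<open>
  Chain maps are constructed degree by degree, starting from some components; this describes the intermediate
  stages.
\<close>

definition chain_on ::
  "('o, 'm, 'z) addcat_scheme \<Rightarrow> nat \<Rightarrow> nat \<Rightarrow> ('o, 'm) cplx \<Rightarrow> ('o, 'm) cplx \<Rightarrow> (nat \<Rightarrow> 'm) \<Rightarrow> bool" where
  "chain_on C a b X Y f \<longleftrightarrow>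
     (\<forall>i. a \<le> i \<and> i \<le> b \<longrightarrow> mor C (f i) \<and> src C (f i) = obj X i \<and> tgt C (f i) = obj Y i) \<and>
     (\<forall>i. a \<le> i \<and> i < b \<longrightarrow> f (Suc i) \<cdot>\<^bsub>C\<^esub> dif X i = dif Y i \<cdot>\<^bsub>C\<^esub> f i)"

text \<open>
  Reversing a complex twice does not return the complex itself, but one that agrees with it in the relevant
  degrees.
\<close>

definition agree :: "nat \<Rightarrow> ('o, 'm) cplx \<Rightarrow> ('o, 'm) cplx \<Rightarrow> bool" where
  "agree m X Y \<longleftrightarrow> (\<forall>i\<le>m. obj X i = obj Y i) \<and> (\<forall>i<m. dif X i = dif Y i)"

lemma rev_cplx_sel [simp]:
  "obj (rev_cplx m X) i = obj X (m - i)" "dif (rev_cplx m X) i = dif X (m - Suc i)"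
  by (simp_all add: rev_cplx_def)

lemma agree_rev_rev: "agree m (rev_cplx m (rev_cplx m X)) X"
  by (auto simp: agree_def)

lemma agree_sym: "agree m X Y \<Longrightarrow> agree m Y X"
  by (simp add: agree_def)

lemma complex_agree: "agree m X Y \<Longrightarrow> complex C m X \<Longrightarrow> complex C m Y"
  unfolding complex_def agree_def by (metis Suc_leI Suc_lessD less_imp_le_nat)

lemma chain_map_agree:
  "agree m X X' \<Longrightarrow> agree m Y Y' \<Longrightarrow> chain_map C m X Y f \<Longrightarrow> chain_map C m X' Y' f"
  by (auto simp: chain_map_def agree_def)

lemma end_fixing_agree:
  "agree (Suc n) X X' \<Longrightarrow> agree (Suc n) Y Y' \<Longrightarrow> end_fixing n C X Y f \<Longrightarrow> end_fixing n C X' Y' f"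
  using chain_map_agree[of "Suc n" X X' Y Y' C f] by (auto simp: end_fixing_def agree_def)

lemma homotopic_agree:
  assumes "agree m X X'" "agree m Y Y'" "1 \<le> m" "homotopic C m X Y f g"
  shows "homotopic C m X' Y' f g"
proof -
  from assms(4) obtain h where
   h: "\<forall>i<m. h (Suc i) \<in> arr C (obj X (Suc i)) (obj Y i)"
     "f 0 = g 0 \<otimes>\<^bsub>Hom C (obj X 0) (obj Y 0)\<^esub> (h 1 \<cdot>\<^bsub>C\<^esub> dif X 0)"
     "\<forall>i. Suc i < m \<longrightarrow> f (Suc i) =
        g (Suc i) \<otimes>\<^bsub>Hom C (obj X (Suc i)) (obj Y (Suc i))\<^esub>
          ((h (Suc (Suc i)) \<cdot>\<^bsub>C\<^esub> dif X (Suc i))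
             \<otimes>\<^bsub>Hom C (obj X (Suc i)) (obj Y (Suc i))\<^esub> (dif Y i \<cdot>\<^bsub>C\<^esub> h (Suc i)))"
     "f m = g m \<otimes>\<^bsub>Hom C (obj X m) (obj Y m)\<^esub> (dif Y (m - 1) \<cdot>\<^bsub>C\<^esub> h m)"
    unfolding homotopic_def by blast
  show ?thesis unfolding homotopic_def
    by (rule exI[of _ h]) (use h assms in \<open>auto simp: agree_def\<close>)
qed

lemma htpy_equiv_agree:
  assumes "agree (Suc n) X X'" "agree (Suc n) Y Y'" "htpy_equiv n C X Y"
  shows "htpy_equiv n C X' Y'"
proof -
  from assms(3) obtain f g where
    fg: "end_fixing n C X Y f" "end_fixing n C Y X g"
     "homotopic C (Suc n) X X (\<lambda>i. g i \<cdot>\<^bsub>C\<^esub> f i) (\<lambda>i. Idn C (obj X i))"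
     "homotopic C (Suc n) Y Y (\<lambda>i. f i \<cdot>\<^bsub>C\<^esub> g i) (\<lambda>i. Idn C (obj Y i))"
    unfolding htpy_equiv_def by auto
  have cong: "homotopic C (Suc n) Z Z k (\<lambda>i. Idn C (obj Z i)) \<Longrightarrow> agree (Suc n) Z Z' \<Longrightarrow>
    homotopic C (Suc n) Z' Z' k (\<lambda>i. Idn C (obj Z' i))" for Z Z' k
  proof -
    assume "homotopic C (Suc n) Z Z k (\<lambda>i. Idn C (obj Z i))" and a: "agree (Suc n) Z Z'"
    then have "homotopic C (Suc n) Z' Z' k (\<lambda>i. Idn C (obj Z i))" using homotopic_agree by fastforce
    then show "homotopic C (Suc n) Z' Z' k (\<lambda>i. Idn C (obj Z' i))"
      using a unfolding homotopic_def by (auto simp: agree_def)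
  qed
  show ?thesis unfolding htpy_equiv_def
    using end_fixing_agree[OF assms(1,2) fg(1)] end_fixing_agree[OF assms(2,1) fg(2)]
      cong[OF fg(3) assms(1)] cong[OF fg(4) assms(2)] by auto
qed

lemma cplx_between_agree: "agree (Suc n) X Y \<Longrightarrow> X \<in> cplx_between n C A Z \<Longrightarrow> Y \<in> cplx_between n C A Z"
  using complex_agree[of "Suc n" X Y C] by (auto simp: cplx_between_def agree_def)

lemma htpy_class_agree:
  assumes "agree (Suc n) X Y" shows "htpy_class n C X = htpy_class n C Y"
proof -
  have "htpy_equiv n C X Z \<longleftrightarrow> htpy_equiv n C Y Z" for Z
    using htpy_equiv_agree assms agree_sym by (metis agree_def)
  then show ?thesis using assms by (auto simp: htpy_class_def agree_def)
qed

lemma htpy_class_closed: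
  assumes "agree (Suc n) Y Y'" "Y \<in> htpy_class n C X" shows "Y' \<in> htpy_class n C X"
  using assms cplx_between_agree[OF assms(1)] htpy_equiv_agree[of n X X Y Y' C]
  by (auto simp: htpy_class_def agree_def)

lemma htpy_equiv_sym: "htpy_equiv n C X Y \<Longrightarrow> htpy_equiv n C Y X"
  by (auto simp: htpy_equiv_def)

context additive_category
begin

lemma diffD:
  assumes "f \<oplus> \<ominus> g = w" "mor C f" "mor C g" "src C g = src C f" "tgt C g = tgt C f"
  shows "f = g \<oplus> w"
  unfolding assms(1)[symmetric] using assms(2-) add_lcomm[of g f "\<ominus> g"] by simp

lemma complexD:
  assumes "complex C m X"
  shows "i \<le> m \<Longrightarrow> obj X i \<in> Ob C" "i < m \<Longrightarrow> mor C (dif X i)" "i < m \<Longrightarrow> src C (dif X i) = obj X i"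
    "i < m \<Longrightarrow> tgt C (dif X i) = obj X (Suc i)"
    "Suc i < m \<Longrightarrow> dif X (Suc i) \<cdot> dif X i = zr C (obj X i) (obj X (Suc (Suc i)))"
    "Suc i < m \<Longrightarrow> mor C x \<Longrightarrow> tgt C x = obj X i \<Longrightarrow>
       dif X (Suc i) \<cdot> (dif X i \<cdot> x) = zr C (src C x) (obj X (Suc (Suc i)))"
proof -
  have a: "i < m \<Longrightarrow> mor C (dif X i) \<and> src C (dif X i) = obj X i \<and> tgt C (dif X i) = obj X (Suc i)" for i
    using assms unfolding complex_def by auto
  show "i \<le> m \<Longrightarrow> obj X i \<in> Ob C" "i < m \<Longrightarrow> mor C (dif X i)" "i < m \<Longrightarrow> src C (dif X i) = obj X i"
    "i < m \<Longrightarrow> tgt C (dif X i) = obj X (Suc i)"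
    using a assms by (auto simp: complex_def)
  show b: "Suc i < m \<Longrightarrow> dif X (Suc i) \<cdot> dif X i = zr C (obj X i) (obj X (Suc (Suc i)))"
    using assms by (simp add: complex_def)
  show "Suc i < m \<Longrightarrow> mor C x \<Longrightarrow> tgt C x = obj X i \<Longrightarrow>
       dif X (Suc i) \<cdot> (dif X i \<cdot> x) = zr C (src C x) (obj X (Suc (Suc i)))"
    using comp_eq[OF b, of x] a[of i] a[of "Suc i"] assms by (simp add: complex_def)
qed

lemma complexI:
  assumes "\<And>i. i \<le> m \<Longrightarrow> obj X i \<in> Ob C"
    "\<And>i. i < m \<Longrightarrow> mor C (dif X i) \<and> src C (dif X i) = obj X i \<and> tgt C (dif X i) = obj X (Suc i)"
    "\<And>i. Suc i < m \<Longrightarrow> dif X (Suc i) \<cdot> dif X i = zr C (obj X i) (obj X (Suc (Suc i)))"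
  shows "complex C m X"
  using assms by (auto simp: complex_def)

lemma chain_map_iff:
  assumes "complex C m X" "complex C m Y"
  shows "chain_map C m X Y f \<longleftrightarrow> chain_on C 0 m X Y f"
  using assms by (auto simp: chain_map_def chain_on_def complex_def)

lemma chain_onD:
  assumes "chain_on C a b X Y f" "complex C m X" "complex C m Y" "b \<le> m"
  shows "a \<le> i \<Longrightarrow> i \<le> b \<Longrightarrow> mor C (f i)" "a \<le> i \<Longrightarrow> i \<le> b \<Longrightarrow> src C (f i) = obj X i"
    "a \<le> i \<Longrightarrow> i \<le> b \<Longrightarrow> tgt C (f i) = obj Y i"
    "a \<le> i \<Longrightarrow> i < b \<Longrightarrow> f (Suc i) \<cdot> dif X i = dif Y i \<cdot> f i"
    "a \<le> i \<Longrightarrow> i < b \<Longrightarrow> mor C x \<Longrightarrow> tgt C x = obj X i \<Longrightarrow> f (Suc i) \<cdot> (dif X i \<cdot> x) = dif Y i \<cdot> (f i \<cdot> x)"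
proof -
  note cx = complexD(1-4)[OF assms(2)] complexD(1-4)[OF assms(3)]
  show a: "a \<le> i \<Longrightarrow> i \<le> b \<Longrightarrow> mor C (f i)" "a \<le> i \<Longrightarrow> i \<le> b \<Longrightarrow> src C (f i) = obj X i"
    "a \<le> i \<Longrightarrow> i \<le> b \<Longrightarrow> tgt C (f i) = obj Y i" for i
    using assms by (auto simp: chain_on_def)
  show b: "a \<le> i \<Longrightarrow> i < b \<Longrightarrow> f (Suc i) \<cdot> dif X i = dif Y i \<cdot> f i" for i
    using assms by (auto simp: chain_on_def)
  show "a \<le> i \<Longrightarrow> i < b \<Longrightarrow> mor C x \<Longrightarrow> tgt C x = obj X i \<Longrightarrow> f (Suc i) \<cdot> (dif X i \<cdot> x) = dif Y i \<cdot> (f i \<cdot> x)"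
    by (rule comp_eq2[OF b]) (use a assms(4) cx in auto)
qed

lemmas chain_mapD = chain_onD[OF iffD1[OF chain_map_iff], simplified]

lemma chain_mapI:
  assumes "complex C m X" "complex C m Y"
   "\<And>i. i \<le> m \<Longrightarrow> mor C (f i) \<and> src C (f i) = obj X i \<and> tgt C (f i) = obj Y i"
   "\<And>i. i < m \<Longrightarrow> f (Suc i) \<cdot> dif X i = dif Y i \<cdot> f i"
  shows "chain_map C m X Y f"
  using assms by (auto simp: chain_map_iff chain_on_def)

lemma chain_on_comp:
  assumes "chain_on C a b X Y f" "chain_on C a b Y Z g"
    and "complex C m X" "complex C m Y" "complex C m Z" "b \<le> m"
  shows "chain_on C a b X Z (\<lambda>i. g i \<cdot> f i)"
  unfolding chain_on_def
  using chain_onD[OF assms(1,3,4,6)] chain_onD[OF assms(2,4,5,6)]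
    complexD[OF assms(3)] complexD[OF assms(4)] complexD[OF assms(5)] assms(6)
  by auto

lemma chain_on_add:
  assumes "chain_on C a b X Y f" "chain_on C a b X Y g"
    and "complex C m X" "complex C m Y" "b \<le> m"
  shows "chain_on C a b X Y (\<lambda>i. f i \<oplus> g i)"
  unfolding chain_on_def
  using chain_onD[OF assms(1,3,4,5)] chain_onD[OF assms(2,3,4,5)]
    complexD[OF assms(3)] complexD[OF assms(4)] assms(5)
  by auto

lemma chain_on_neg:
  assumes "chain_on C a b X Y f"
    and "complex C m X" "complex C m Y" "b \<le> m"
  shows "chain_on C a b X Y (\<lambda>i. \<ominus> f i)"
  unfolding chain_on_def
  using chain_onD[OF assms(1,2,3,4)]
    complexD[OF assms(2)] complexD[OF assms(3)] assms(4)
  by auto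

lemma chain_on_id:
  assumes "complex C m X" "b \<le> m"
  shows "chain_on C a b X X (\<lambda>i. Idn C (obj X i))"
  unfolding chain_on_def using complexD[OF assms(1)] assms(2) by auto

lemma chain_map_comp:
  assumes "chain_map C m X Y f" "chain_map C m Y Z g"
    and "complex C m X" "complex C m Y" "complex C m Z"
  shows "chain_map C m X Z (\<lambda>i. g i \<cdot> f i)"
  using chain_on_comp[of 0 m X Y f Z g m] assms chain_map_iff by simp

lemma chain_map_add:
  assumes "chain_map C m X Y f" "chain_map C m X Y g"
    and "complex C m X" "complex C m Y"
  shows "chain_map C m X Y (\<lambda>i. f i \<oplus> g i)"
  using chain_on_add[of 0 m X Y f g m] assms chain_map_iff by simp

lemma left_exact_iff:
  assumes X: "complex C m X" and m: "1 \<le> m"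
  shows "left_exact C m X \<longleftrightarrow>
    (\<forall>u. mor C u \<longrightarrow> tgt C u = obj X 0 \<longrightarrow> dif X 0 \<cdot> u = zr C (src C u) (obj X 1) \<longrightarrow> u = zr C (src C u) (obj X 0)) \<and>
    (\<forall>i u. Suc i < m \<longrightarrow> mor C u \<longrightarrow> tgt C u = obj X (Suc i) \<longrightarrow>
       dif X (Suc i) \<cdot> u = zr C (src C u) (obj X (Suc (Suc i))) \<longrightarrow>
       (\<exists>v. mor C v \<and> src C v = src C u \<and> tgt C v = obj X i \<and> u = dif X i \<cdot> v))"
    (is "_ \<longleftrightarrow> ?A \<and> ?B")
proof
  note x = complexD[OF X]
  assume L: "left_exact C m X"
  show "?A \<and> ?B"
  proof (intro conjI allI impI)
    fix u assume u: "mor C u" "tgt C u = obj X 0" "dif X 0 \<cdot> u = zr C (src C u) (obj X 1)"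
    have "u \<in> arr C (src C u) (obj X 0)" using u by (auto intro: arrI simp del: arr_iff)
    then show "u = zr C (src C u) (obj X 0)" using L mor_ob(1)[OF u(1)] u(3) unfolding left_exact_def by blast
  next
    fix i u assume u: "Suc i < m" "mor C u" "tgt C u = obj X (Suc i)" "dif X (Suc i) \<cdot> u = zr C (src C u) (obj X (Suc (Suc i)))"
    have "u \<in> arr C (src C u) (obj X (Suc i))" using u by (auto intro: arrI simp del: arr_iff)
    then obtain v where "v \<in> arr C (src C u) (obj X i)" "u = dif X i \<cdot> v"
      using L mor_ob(1)[OF u(2)] u(1,4) unfolding left_exact_def by blast
    then show "\<exists>v. mor C v \<and> src C v = src C u \<and> tgt C v = obj X i \<and> u = dif X i \<cdot> v"
      using x(1)[of i] u arr_iff[of "src C u" "obj X i" v] by (metis Suc_lessD less_imp_le_nat mor_ob(1))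
  qed
next
  note x = complexD[OF X]
  assume R: "?A \<and> ?B"
  show "left_exact C m X" unfolding left_exact_def
  proof (intro conjI ballI allI impI)
    fix Y u assume "Y \<in> Ob C" "u \<in> arr C Y (obj X 0)" "dif X 0 \<cdot> u = zr C Y (obj X 1)"
    then show "u = zr C Y (obj X 0)" using R x(1)[of 0] by auto
  next
    fix Y i u assume Y: "Y \<in> Ob C" and i: "Suc i < m" and u: "u \<in> arr C Y (obj X (Suc i))"
    have u': "mor C u" "src C u = Y" "tgt C u = obj X (Suc i)" using Y u i x(1)[of "Suc i"] by auto
    show "dif X (Suc i) \<cdot> u = zr C Y (obj X (Suc (Suc i))) \<longleftrightarrow> (\<exists>v\<in>arr C Y (obj X i). u = dif X i \<cdot> v)"
    proof
      assume "dif X (Suc i) \<cdot> u = zr C Y (obj X (Suc (Suc i)))"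
      then obtain v where "mor C v \<and> src C v = Y \<and> tgt C v = obj X i \<and> u = dif X i \<cdot> v"
        using R u' i by blast
      then show "\<exists>v\<in>arr C Y (obj X i). u = dif X i \<cdot> v" using arrI by blast
    next
      assume "\<exists>v\<in>arr C Y (obj X i). u = dif X i \<cdot> v"
      then obtain v where v: "v \<in> arr C Y (obj X i)" "u = dif X i \<cdot> v" by blast
      then have "mor C v" "src C v = Y" "tgt C v = obj X i" using Y i x(1)[of i] by auto
      then show "dif X (Suc i) \<cdot> u = zr C Y (obj X (Suc (Suc i)))" using v(2) i x by auto
    qed
  qed
qed

end

lemma complex_op:
  assumes "additive_category C" "complex C m X" shows "complex (op_cat C) m (rev_cplx m X)"
proof -
  interpret additive_category C by fact
  interpret op: additive_category "op_cat C" using assms(1) by (rule additive_category_op)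
  note x = complexD[OF assms(2)]
  show ?thesis
  proof (rule op.complexI)
    fix i assume "i \<le> m" then show "obj (rev_cplx m X) i \<in> Ob (op_cat C)" using x(1) by simp
  next
    fix i assume i: "i < m"
    then have "Suc (m - Suc i) = m - i" by simp
    then show "mor (op_cat C) (dif (rev_cplx m X) i) \<and> src (op_cat C) (dif (rev_cplx m X) i) = obj (rev_cplx m X) i \<and>
         tgt (op_cat C) (dif (rev_cplx m X) i) = obj (rev_cplx m X) (Suc i)"
      using x(2-4)[of "m - Suc i"] i by simp
  next
    fix i assume i: "Suc i < m"
    then have "Suc (m - Suc (Suc i)) = m - Suc i" "Suc (Suc (m - Suc (Suc i))) = m - i" by simp_all
    then show "dif (rev_cplx m X) (Suc i) \<cdot>\<^bsub>op_cat C\<^esub> dif (rev_cplx m X) i =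
         zr (op_cat C) (obj (rev_cplx m X) i) (obj (rev_cplx m X) (Suc (Suc i)))"
      using x(5)[of "m - Suc (Suc i)"] i by simp
  qed
qed

lemma complex_op_iff:
  assumes "additive_category C" shows "complex (op_cat C) m (rev_cplx m X) \<longleftrightarrow> complex C m X"
  using complex_op[OF assms, of m X] complex_op[OF additive_category_op[OF assms], of m "rev_cplx m X"]
    complex_agree[OF agree_rev_rev, of C m X] by auto

lemma chain_on_op:
  assumes "chain_on C a b X Y f" "a \<le> b" "b \<le> m"
  shows "chain_on (op_cat C) (m - b) (m - a) (rev_cplx m Y) (rev_cplx m X) (\<lambda>i. f (m - i))"
  unfolding chain_on_def
proof (intro conjI allI impI; (elim conjE)?)
  fix i assume i: "m - b \<le> i" "i < m - a"
  then have "Suc (m - Suc i) = m - i" "a \<le> m - Suc i" "m - Suc i < b" by linarith+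
  then show "f (m - Suc i) \<cdot>\<^bsub>op_cat C\<^esub> dif (rev_cplx m Y) i = dif (rev_cplx m X) i \<cdot>\<^bsub>op_cat C\<^esub> f (m - i)"
    using i assms chain_on_def[of C a b X Y f, THEN iffD1, THEN conjunct2, rule_format, of "m - Suc i"] by simp
next
  fix i assume i: "m - b \<le> i" "i \<le> m - a"
  then have "a \<le> m - i" "m - i \<le> b" using assms(2,3) by linarith+
  then show "mor (op_cat C) (f (m - i))" "src (op_cat C) (f (m - i)) = obj (rev_cplx m Y) i"
    "tgt (op_cat C) (f (m - i)) = obj (rev_cplx m X) i"
    using assms(1) by (simp_all add: chain_on_def)
qed

lemma chain_map_op:
  assumes "additive_category C" "complex C m X" "complex C m Y" "chain_map C m X Y f"
  shows "chain_map (op_cat C) m (rev_cplx m Y) (rev_cplx m X) (\<lambda>i. f (m - i))"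
  using additive_category.chain_map_iff[OF assms(1-3)] chain_on_op[of C 0 m X Y f m] assms(4)
    additive_category.chain_map_iff[OF additive_category_op[OF assms(1)] complex_op[OF assms(1,3)] complex_op[OF assms(1,2)]]
  by simp

context additive_category
begin

lemma op: "additive_category (op_cat C)" by (rule additive_category_op) unfold_locales

lemma right_exact_iff:
  assumes X: "complex C m X" and m: "1 \<le> m"
  shows "right_exact C m X \<longleftrightarrow>
    (\<forall>u. mor C u \<longrightarrow> src C u = obj X m \<longrightarrow> u \<cdot> dif X (m - 1) = zr C (obj X (m - 1)) (tgt C u) \<longrightarrow> u = zr C (obj X m) (tgt C u)) \<and>
    (\<forall>i u. Suc i < m \<longrightarrow> mor C u \<longrightarrow> src C u = obj X (Suc i) \<longrightarrow>
       u \<cdot> dif X i = zr C (obj X i) (tgt C u) \<longrightarrow>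
       (\<exists>v. mor C v \<and> src C v = obj X (Suc (Suc i)) \<and> tgt C v = tgt C u \<and> u = v \<cdot> dif X (Suc i)))"
    (is "_ \<longleftrightarrow> ?A \<and> ?B")
proof -
  interpret op: additive_category "op_cat C" by (rule op)
  have "right_exact C m X \<longleftrightarrow> ?A \<and> (\<forall>i u. Suc i < m \<longrightarrow> mor C u \<longrightarrow> src C u = obj X (m - Suc i) \<longrightarrow>
       u \<cdot> dif X (m - Suc (Suc i)) = zr C (obj X (m - Suc (Suc i))) (tgt C u) \<longrightarrow>
       (\<exists>v. mor C v \<and> tgt C v = tgt C u \<and> src C v = obj X (m - i) \<and> u = v \<cdot> dif X (m - Suc i)))"
    (is "_ \<longleftrightarrow> ?A \<and> (\<forall>i. ?P i)")
    unfolding right_exact_def op.left_exact_iff[OF complex_op[OF additive_category_axioms X] m] by simp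
  moreover have "(\<forall>i. ?P i) \<longleftrightarrow> ?B"
  proof
    assume P: "\<forall>i. ?P i"
    show ?B
    proof (intro allI impI)
      fix i u assume i: "Suc i < m" and u: "mor C u" "src C u = obj X (Suc i)" "u \<cdot> dif X i = zr C (obj X i) (tgt C u)"
      have e: "m - Suc (m - Suc (Suc i)) = Suc i" "m - Suc (Suc (m - Suc (Suc i))) = i" "m - (m - Suc (Suc i)) = Suc (Suc i)"
        "Suc (m - Suc (Suc i)) < m"
        using i by linarith+
      show "\<exists>v. mor C v \<and> src C v = obj X (Suc (Suc i)) \<and> tgt C v = tgt C u \<and> u = v \<cdot> dif X (Suc i)"
        using P[rule_format, of "m - Suc (Suc i)" u, unfolded e] e(4) u by auto
    qed
  next
    assume B: ?B
    show "\<forall>i. ?P i"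
    proof (intro allI impI)
      fix i u assume i: "Suc i < m" and u: "mor C u" "src C u = obj X (m - Suc i)" "u \<cdot> dif X (m - Suc (Suc i)) = zr C (obj X (m - Suc (Suc i))) (tgt C u)"
      have e: "Suc (m - Suc (Suc i)) = m - Suc i" "Suc (m - Suc i) = m - i" "m - Suc i < m"
        using i by simp_all
      show "\<exists>v. mor C v \<and> tgt C v = tgt C u \<and> src C v = obj X (m - i) \<and> u = v \<cdot> dif X (m - Suc i)"
        using B[rule_format, of "m - Suc (Suc i)" u, unfolded e] e(3) u by auto
    qed
  qed
  ultimately show ?thesis by simp
qed

lemma right_exactD:
  assumes "right_exact C m X" "complex C m X" "1 \<le> m"
  shows "mor C u \<Longrightarrow> src C u = obj X m \<Longrightarrow> u \<cdot> dif X (m - 1) = zr C (obj X (m - 1)) (tgt C u) \<Longrightarrow> u = zr C (obj X m) (tgt C u)"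
    "Suc i < m \<Longrightarrow> mor C u \<Longrightarrow> src C u = obj X (Suc i) \<Longrightarrow>
       u \<cdot> dif X i = zr C (obj X i) (tgt C u) \<Longrightarrow>
       (\<exists>v. mor C v \<and> src C v = obj X (Suc (Suc i)) \<and> tgt C v = tgt C u \<and> u = v \<cdot> dif X (Suc i))"
  using assms(1) unfolding right_exact_iff[OF assms(2,3)] by blast+

lemma left_exactD:
  assumes "left_exact C m X" "complex C m X" "1 \<le> m"
  shows "mor C u \<Longrightarrow> tgt C u = obj X 0 \<Longrightarrow> dif X 0 \<cdot> u = zr C (src C u) (obj X 1) \<Longrightarrow> u = zr C (src C u) (obj X 0)"
    "Suc i < m \<Longrightarrow> mor C u \<Longrightarrow> tgt C u = obj X (Suc i) \<Longrightarrow>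
       dif X (Suc i) \<cdot> u = zr C (src C u) (obj X (Suc (Suc i))) \<Longrightarrow>
       (\<exists>v. mor C v \<and> src C v = src C u \<and> tgt C v = obj X i \<and> u = dif X i \<cdot> v)"
  using assms(1) unfolding left_exact_iff[OF assms(2,3)] by blast+

text \<open>
  The composite of \<open>dif Y\<close> with the last component constructed so far annihilates the preceding
  differential of \<open>X\<close> and hence factors through the next one. Two consecutive components are needed
  to start with.
\<close>

lemma extend_up:
  assumes X: "complex C m X" and Y: "complex C m Y" and R: "right_exact C m X"
    and f: "chain_on C a b X Y f" and ab: "a < b" "b \<le> m"
  shows "\<exists>f'. (\<forall>i\<le>b. f' i = f i) \<and> chain_on C a m X Y f'"
proof -
  note x = complexD[OF X] complexD[OF Y]
  have "b + k \<le> m \<Longrightarrow> \<exists>f'. (\<forall>i\<le>b. f' i = f i) \<and> chain_on C a (b + k) X Y f'" for k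
  proof (induction k)
    case 0 then show ?case using f by auto
  next
    case (Suc k)
    then obtain f' where f': "\<forall>i\<le>b. f' i = f i" "chain_on C a (b + k) X Y f'" by auto
    define c where "c = b + k - 1"
    have c: "b + k = Suc c" "a \<le> c" "Suc c < m" using ab Suc.prems by (auto simp: c_def)
    note g = chain_onD[OF f'(2)[unfolded c(1)] X Y less_imp_le_nat[OF c(3)]]
    have "\<exists>v. mor C v \<and> src C v = obj X (Suc (Suc c)) \<and> tgt C v = tgt C (dif Y (Suc c) \<cdot> f' (Suc c)) \<and>
        dif Y (Suc c) \<cdot> f' (Suc c) = v \<cdot> dif X (Suc c)"
      by (rule right_exactD(2)[OF R X]) (use c ab x g in auto)
    then obtain v where v: "mor C v" "src C v = obj X (Suc (Suc c))" "tgt C v = obj Y (Suc (Suc c))"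
      "v \<cdot> dif X (Suc c) = dif Y (Suc c) \<cdot> f' (Suc c)"
      using c x g by auto
    have "chain_on C a (Suc (Suc c)) X Y (f'(Suc (Suc c) := v))"
      unfolding chain_on_def using g v by (auto simp: le_Suc_eq less_Suc_eq)
    moreover have "\<forall>i\<le>b. (f'(Suc (Suc c) := v)) i = f i" using f'(1) c(1) by auto
    ultimately show ?case using c(1) by (metis add_Suc_right)
  qed
  from this[of "m - b"] show ?thesis using ab by simp
qed

lemma left_exact_agree:
  assumes "agree m X Y" "1 \<le> m" "left_exact C m X" shows "left_exact C m Y"
proof -
  have "obj Y i = obj X i" "i < m \<Longrightarrow> dif Y i = dif X i" if "i \<le> m" for i
    using assms(1) that by (auto simp: agree_def)
  then show ?thesis using assms(2,3) by (simp add: left_exact_def)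
qed

lemma right_exact_op:
  assumes "1 \<le> m"
  shows "right_exact (op_cat C) m (rev_cplx m Y) \<longleftrightarrow> left_exact C m Y"
  unfolding right_exact_def op_op_cat
  using left_exact_agree[OF agree_rev_rev assms] left_exact_agree[OF agree_sym[OF agree_rev_rev] assms]
  by blast

lemma chain_on_agree:
  "chain_on C a b X Y f \<Longrightarrow> agree m X X' \<Longrightarrow> agree m Y Y' \<Longrightarrow> b \<le> m \<Longrightarrow> chain_on C a b X' Y' f"
  by (auto simp: chain_on_def agree_def)

lemma chain_on_op_back:
  assumes "chain_on (op_cat C) a b (rev_cplx m Y) (rev_cplx m X) f" "a \<le> b" "b \<le> m"
  shows "chain_on C (m - b) (m - a) X Y (\<lambda>i. f (m - i))"
  using chain_on_agree[OF chain_on_op[OF assms, unfolded op_op_cat] agree_rev_rev agree_rev_rev] by simp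

lemma extend_down:
  assumes X: "complex C m X" and Y: "complex C m Y" and L: "left_exact C m Y"
    and f: "chain_on C a b X Y f" and ab: "a < b" "b \<le> m"
  shows "\<exists>f'. (\<forall>i. a \<le> i \<and> i \<le> m \<longrightarrow> f' i = f i) \<and> chain_on C 0 b X Y f'"
proof -
  interpret op: additive_category "op_cat C" by (rule op)
  note X' = complex_op[OF additive_category_axioms X] and Y' = complex_op[OF additive_category_axioms Y]
  have R: "right_exact (op_cat C) m (rev_cplx m Y)" using right_exact_op L ab by simp
  have "m - b < m - a" "m - a \<le> m" using ab by auto
  from op.extend_up[OF Y' X' R chain_on_op[OF f less_imp_le_nat[OF ab(1)] ab(2)] this]
  obtain f'' where f'': "\<forall>i\<le>m - a. f'' i = f (m - i)"
    "chain_on (op_cat C) (m - b) m (rev_cplx m Y) (rev_cplx m X) f''" by blast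
  have "chain_on C 0 b X Y (\<lambda>i. f'' (m - i))"
    using chain_on_op_back[OF f''(2)] ab by simp
  moreover have "f'' (m - i) = f i" if "a \<le> i" "i \<le> m" for i
    using f''(1)[rule_format, of "m - i"] that ab by auto
  ultimately show ?thesis by (intro exI[of _ "\<lambda>i. f'' (m - i)"]) auto
qed

text \<open>
  In each degree the part of \<open>k\<close> that is not yet accounted for by the homotopy vanishes on the
  preceding differential of \<open>X\<close>, hence extends along the next one.
\<close>

lemma null_up:
  assumes X: "complex C m X" and Y: "complex C m Y" and R: "right_exact C m X"
    and k: "chain_on C a m X Y k" and am: "a < m" and k0: "k a = zr C (obj X a) (obj Y a)"
  shows "\<exists>h. (\<forall>i. a \<le> i \<and> i < m \<longrightarrow> mor C (h (Suc i)) \<and> src C (h (Suc i)) = obj X (Suc i) \<and> tgt C (h (Suc i)) = obj Y i) \<and>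
     h (Suc a) = zr C (obj X (Suc a)) (obj Y a) \<and>
     (\<forall>i. a \<le> i \<and> Suc i < m \<longrightarrow> k (Suc i) = (h (Suc (Suc i)) \<cdot> dif X (Suc i)) \<oplus> (dif Y i \<cdot> h (Suc i))) \<and>
     k m = dif Y (m - 1) \<cdot> h m"
proof -
  note x = complexD[OF X] complexD[OF Y] and kk = chain_onD[OF k X Y order_refl]
  define T where "T h c \<longleftrightarrow> (\<forall>i. a \<le> i \<and> i \<le> c \<longrightarrow> mor C (h (Suc i)) \<and> src C (h (Suc i)) = obj X (Suc i) \<and> tgt C (h (Suc i)) = obj Y i) \<and>
     h (Suc a) = zr C (obj X (Suc a)) (obj Y a) \<and>
     (\<forall>i. a \<le> i \<and> Suc i \<le> c \<longrightarrow> k (Suc i) = (h (Suc (Suc i)) \<cdot> dif X (Suc i)) \<oplus> (dif Y i \<cdot> h (Suc i))) \<and>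
     dif Y c \<cdot> (h (Suc c) \<cdot> dif X c) = dif Y c \<cdot> k c" for h c
  have "a + j < m \<Longrightarrow> \<exists>h. T h (a + j)" for j
  proof (induction j)
    case 0
    then show ?case
      by (intro exI[of _ "\<lambda>i. zr C (obj X (Suc a)) (obj Y a)"]) (use x k0 kk in \<open>auto simp: T_def le_antisym\<close>)
  next
    case (Suc j)
    define c where "c = a + j"
    obtain h where h: "T h c" using Suc by (auto simp: c_def)
    have c: "Suc c < m" "a \<le> c" "c < m" "a \<le> Suc c" "Suc c \<le> m" "c \<le> m" using Suc.prems by (auto simp: c_def)
    have hc: "mor C (h (Suc c))" "src C (h (Suc c)) = obj X (Suc c)" "tgt C (h (Suc c)) = obj Y c"
      "dif Y c \<cdot> (h (Suc c) \<cdot> dif X c) = dif Y c \<cdot> k c"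
      using h c by (auto simp: T_def)
    let ?e = "k (Suc c) \<oplus> \<ominus> (dif Y c \<cdot> h (Suc c))"
    have "?e \<cdot> dif X c = zr C (obj X c) (tgt C ?e)"
      using hc c kk x by simp
    then obtain v where v: "mor C v" "src C v = obj X (Suc (Suc c))" "tgt C v = tgt C ?e" "?e = v \<cdot> dif X (Suc c)"
      using right_exactD(2)[OF R X, of c ?e] c kk x hc by auto
    have v3: "tgt C v = obj Y (Suc c)" using v(3) by (simp add: c kk x hc(1-3))
    have e: "k (Suc c) = (v \<cdot> dif X (Suc c)) \<oplus> (dif Y c \<cdot> h (Suc c))"
      using diffD[OF v(4)] by (simp add: c kk x hc(1-3) v(1,2) v3 add_comm)
    have "T (h(Suc (Suc c) := v)) (Suc c)"
      unfolding T_def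
    proof (intro conjI allI impI; (elim conjE)?)
      show "dif Y (Suc c) \<cdot> ((h(Suc (Suc c) := v)) (Suc (Suc c)) \<cdot> dif X (Suc c)) = dif Y (Suc c) \<cdot> k (Suc c)"
        unfolding e by (simp add: c kk x hc(1-3) v(1,2) v3)
    next
      show "(h(Suc (Suc c) := v)) (Suc a) = zr C (obj X (Suc a)) (obj Y a)" using h c(2) by (simp add: T_def)
    next
      fix i assume i: "a \<le> i" "i \<le> Suc c"
      have "i \<le> c \<or> i = Suc c" using i by linarith
      then show "mor C ((h(Suc (Suc c) := v)) (Suc i))" "src C ((h(Suc (Suc c) := v)) (Suc i)) = obj X (Suc i)"
        "tgt C ((h(Suc (Suc c) := v)) (Suc i)) = obj Y i"
        using h i(1) v(1,2) v3 by (auto simp: T_def)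
    next
      fix i assume i: "a \<le> i" "Suc i \<le> Suc c"
      show "k (Suc i) = ((h(Suc (Suc c) := v)) (Suc (Suc i)) \<cdot> dif X (Suc i)) \<oplus> (dif Y i \<cdot> (h(Suc (Suc c) := v)) (Suc i))"
      proof (cases "i = c")
        case True then show ?thesis using e by simp
      next
        case False
        then have "Suc i \<le> c" using i by simp
        then have "k (Suc i) = (h (Suc (Suc i)) \<cdot> dif X (Suc i)) \<oplus> (dif Y i \<cdot> h (Suc i))"
          using h i(1) unfolding T_def by blast
        then show ?thesis using False i by simp
      qed
    qed
    then show ?case by (auto simp: c_def)
  qed
  from this[of "m - 1 - a"] obtain h where h: "T h (m - 1)" using am by auto
  define c where "c = m - 1"
  have c: "m = Suc c" "a \<le> c" using am by (auto simp: c_def)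
  have hc: "mor C (h m)" "src C (h m) = obj X m" "tgt C (h m) = obj Y c"
      "dif Y c \<cdot> (h m \<cdot> dif X c) = dif Y c \<cdot> k c"
    using h c by (auto simp: T_def)
  let ?e = "k m \<oplus> \<ominus> (dif Y c \<cdot> h m)"
  have "?e \<cdot> dif X (m - 1) = zr C (obj X (m - 1)) (tgt C ?e)"
    using hc c kk x by simp
  then have "?e = zr C (obj X m) (tgt C ?e)"
    by (intro right_exactD(1)[OF R X]) (use c hc kk x in auto)
  then have "k m = dif Y c \<cdot> h m" using eq_iff_diff[of "k m" "dif Y c \<cdot> h m"] hc c kk x by auto
  then show ?thesis using h c by (intro exI[of _ h]) (auto simp: T_def)
qed

text \<open>
  Dual to \<open>null_up\<close>, of which only the last step is kept.
\<close>

lemma null_down: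
  assumes X: "complex C m X" and Y: "complex C m Y" and L: "left_exact C m Y"
    and k: "chain_on C 0 b X Y k" and bm: "0 < b" "b \<le> m" and k0: "k b = zr C (obj X b) (obj Y b)"
  shows "\<exists>h. mor C h \<and> src C h = obj X 1 \<and> tgt C h = obj Y 0 \<and> k 0 = h \<cdot> dif X 0"
proof -
  interpret op: additive_category "op_cat C" by (rule op)
  note X' = complex_op[OF additive_category_axioms X] and Y' = complex_op[OF additive_category_axioms Y]
  have R: "right_exact (op_cat C) m (rev_cplx m Y)" using right_exact_op L bm by simp
  have k': "chain_on (op_cat C) (m - b) m (rev_cplx m Y) (rev_cplx m X) (\<lambda>i. k (m - i))"
    using chain_on_op[OF k] bm by simp
  have "m - b < m" using bm by simp
  from op.null_up[OF Y' X' R k' this] obtain h where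
    h: "\<forall>i. m - b \<le> i \<and> i < m \<longrightarrow> mor C (h (Suc i)) \<and> tgt C (h (Suc i)) = obj Y (m - Suc i) \<and> src C (h (Suc i)) = obj X (m - i)"
    "k 0 = h m \<cdot> dif X (m - Suc (m - Suc 0))"
    using k0 bm by auto
  have "Suc (m - 1) = m" "m - (m - 1) = 1" "m - Suc (m - Suc 0) = 0" "m - b \<le> m - 1" "m - 1 < m" using bm by auto
  then show ?thesis using h(1)[rule_format, of "m - 1"] h(2) by auto
qed

lemma homotopicI:
  assumes X: "complex C m X" and Y: "complex C m Y" and R: "right_exact C m X" and m: "1 \<le> m"
    and f: "chain_map C m X Y f" and g: "chain_map C m X Y g" and fg: "f 0 = g 0"
  shows "homotopic C m X Y f g"
proof -
  note x = complexD[OF X] complexD[OF Y] and ff = chain_mapD[OF X Y f X Y order_refl] and gg = chain_mapD[OF X Y g X Y order_refl]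
  have k: "chain_on C 0 m X Y (\<lambda>i. f i \<oplus> \<ominus> g i)"
    using chain_on_add[OF _ chain_on_neg[OF _ X Y order_refl] X Y order_refl] f g chain_map_iff[OF X Y] by blast
  have "f 0 \<oplus> \<ominus> g 0 = zr C (obj X 0) (obj Y 0)" using fg gg by simp
  from null_up[OF X Y R k _ this] m obtain h where
   h: "\<forall>i. i < m \<longrightarrow> mor C (h (Suc i)) \<and> src C (h (Suc i)) = obj X (Suc i) \<and> tgt C (h (Suc i)) = obj Y i"
     "h 1 = zr C (obj X 1) (obj Y 0)"
     "\<And>i. Suc i < m \<Longrightarrow> f (Suc i) \<oplus> \<ominus> g (Suc i) = (h (Suc (Suc i)) \<cdot> dif X (Suc i)) \<oplus> (dif Y i \<cdot> h (Suc i))"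
     "f m \<oplus> \<ominus> g m = dif Y (m - 1) \<cdot> h m" by auto
  obtain c where c: "m = Suc c" using m by (cases m) auto
  have "f m = g m \<oplus> (dif Y (m - 1) \<cdot> h m)"
    by (rule diffD[OF h(4)]) (use ff gg in auto)
  moreover have "f (Suc i) = g (Suc i) \<oplus> ((h (Suc (Suc i)) \<cdot> dif X (Suc i)) \<oplus> (dif Y i \<cdot> h (Suc i)))" if "Suc i < m" for i
    by (rule diffD[OF h(3)]) (use ff gg that in auto)
  ultimately show ?thesis unfolding homotopic_def
    by (intro exI[of _ h]) (use h x ff gg m fg c in auto)
qed

text \<open>
  Changing a chain map by a homotopy that is concentrated in the top degree replaces its top component.
\<close>

lemma adjust_top:
  assumes X: "complex C (Suc n) X" and Y: "complex C (Suc n) Y" and n: "1 \<le> n"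
    and f: "chain_map C (Suc n) X Y f"
    and g: "mor C g" "src C g = obj X (Suc n)" "tgt C g = obj Y (Suc n)"
    and h: "mor C h" "src C h = obj X (Suc n)" "tgt C h = obj Y n" and e: "f (Suc n) = g \<oplus> (dif Y n \<cdot> h)"
  shows "\<exists>f'. chain_map C (Suc n) X Y f' \<and> f' (Suc n) = g \<and> (\<forall>i<n. f' i = f i)"
proof (intro exI conjI)
  note x = complexD[OF X] complexD[OF Y] and ff = chain_mapD[OF X Y f X Y order_refl]
  let ?f = "f(n := f n \<oplus> \<ominus> (h \<cdot> dif X n), Suc n := g)"
  have "dif Y n \<cdot> f n = (g \<cdot> dif X n) \<oplus> (dif Y n \<cdot> (h \<cdot> dif X n))"
    using ff(4)[of n] e x g h by simp
  then have e2: "g \<cdot> dif X n = (dif Y n \<cdot> f n) \<oplus> \<ominus> (dif Y n \<cdot> (h \<cdot> dif X n))"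
    using x g h by (simp add: add_assoc)
  show "chain_map C (Suc n) X Y ?f"
  proof (rule chain_mapI[OF X Y])
    show "mor C (?f i) \<and> src C (?f i) = obj X i \<and> tgt C (?f i) = obj Y i" if "i \<le> Suc n" for i
      using that ff x g h by auto
    show "?f (Suc i) \<cdot> dif X i = dif Y i \<cdot> ?f i" if i: "i < Suc n" for i
    proof -
      consider "i = n" | "Suc i = n" | "i < n" "Suc i \<noteq> n" using i by linarith
      then show ?thesis using i ff x g h n e2 by cases auto
    qed
  qed
qed auto

lemma adjust_bot:
  assumes X: "complex C (Suc n) X" and Y: "complex C (Suc n) Y" and n: "1 \<le> n"
    and f: "chain_map C (Suc n) X Y f"
    and g: "mor C g" "src C g = obj X 0" "tgt C g = obj Y 0"
    and h: "mor C h" "src C h = obj X 1" "tgt C h = obj Y 0" and e: "f 0 = g \<oplus> (h \<cdot> dif X 0)"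
  shows "\<exists>f'. chain_map C (Suc n) X Y f' \<and> f' 0 = g \<and> (\<forall>i>1. f' i = f i)"
proof (intro exI conjI)
  note x = complexD[OF X] complexD[OF Y] and ff = chain_mapD[OF X Y f X Y order_refl]
  let ?f = "f(1 := f 1 \<oplus> \<ominus> (dif Y 0 \<cdot> h), 0 := g)"
  have "f 1 \<cdot> dif X 0 = (dif Y 0 \<cdot> g) \<oplus> (dif Y 0 \<cdot> (h \<cdot> dif X 0))"
    using ff(4)[of 0] e x g h by simp
  then have e2: "dif Y 0 \<cdot> g = (f 1 \<cdot> dif X 0) \<oplus> \<ominus> (dif Y 0 \<cdot> (h \<cdot> dif X 0))"
    using x g h by (simp add: add_assoc)
  show "chain_map C (Suc n) X Y ?f"
  proof (rule chain_mapI[OF X Y])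
    show "mor C (?f i) \<and> src C (?f i) = obj X i \<and> tgt C (?f i) = obj Y i" if "i \<le> Suc n" for i
      using that ff x g h by auto
    show "?f (Suc i) \<cdot> dif X i = dif Y i \<cdot> ?f i" if i: "i < Suc n" for i
    proof -
      consider "i = 0" | "i = 1" | "i > 1" using i by linarith
      then show ?thesis
      proof cases
        case 2
        have "dif Y 1 \<cdot> (dif Y 0 \<cdot> h) = zr C (src C h) (obj Y 2)" using x(12)[of 0 h] i 2 h by (simp add: numeral_2_eq_2)
        then show ?thesis using 2 i ff[of 1] x h n by (simp add: numeral_2_eq_2)
      qed (use i ff x g h n e2 in auto)
    qed
  qed
qed auto

text \<open>
  Chain maps out of a right exact complex that agree in degree \<open>0\<close> are homotopic. So the two
  composites are homotopic to identities.
\<close>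

lemma htpy_equivI:
  assumes X: "complex C (Suc n) X" and Y: "complex C (Suc n) Y" and R: "right_exact C (Suc n) X" "right_exact C (Suc n) Y"
   and f: "end_fixing n C X Y f" and g: "end_fixing n C Y X g"
 shows "htpy_equiv n C X Y"
proof -
  have fg: "chain_map C (Suc n) X Y f" "chain_map C (Suc n) Y X g" "f 0 = Idn C (obj X 0)" "g 0 = Idn C (obj Y 0)"
    using f g by (auto simp: end_fixing_def)
  note x = complexD[OF X] complexD[OF Y]
   and ff = chain_mapD[OF X Y fg(1) X Y order_refl] and gg = chain_mapD[OF Y X fg(2) Y X order_refl]
  have e: "obj Y 0 = obj X 0" using ff(3)[of 0] fg(3) x by simp
  have "homotopic C (Suc n) X X (\<lambda>i. g i \<cdot> f i) (\<lambda>i. Idn C (obj X i))"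
    by (rule homotopicI[OF X X R(1) _ chain_map_comp[OF fg(1,2) X Y X]])
      (use chain_on_id[OF X] chain_map_iff[OF X X] fg e x in auto)
  moreover have "homotopic C (Suc n) Y Y (\<lambda>i. f i \<cdot> g i) (\<lambda>i. Idn C (obj Y i))"
    by (rule homotopicI[OF Y Y R(2) _ chain_map_comp[OF fg(2,1) Y X Y]])
      (use chain_on_id[OF Y] chain_map_iff[OF Y Y] fg e x in auto)
  ultimately show ?thesis using f g unfolding htpy_equiv_def by auto
qed

text \<open>
  The map back need only be an identity in degree \<open>0\<close>. Its composite with \<open>f\<close> is then
  homotopic to the identity, so that its top component is an identity up to a map through the last differential,
  and can be corrected.
\<close>

lemma htpy_equivI':
  assumes X: "complex C (Suc n) X" and Y: "complex C (Suc n) Y" and R: "right_exact C (Suc n) X" "right_exact C (Suc n) Y"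
    and n: "1 \<le> n"
    and f: "end_fixing n C X Y f" and g: "chain_map C (Suc n) Y X g" "g 0 = Idn C (obj Y 0)"
 shows "htpy_equiv n C X Y"
proof -
  have fg: "chain_map C (Suc n) X Y f" "f 0 = Idn C (obj X 0)" "f (Suc n) = Idn C (obj X (Suc n))"
    using f by (auto simp: end_fixing_def)
  note x = complexD[OF X] complexD[OF Y]
   and ff = chain_mapD[OF X Y fg(1) X Y order_refl] and gg = chain_mapD[OF Y X g(1) Y X order_refl]
  have e: "obj Y 0 = obj X 0" "obj Y (Suc n) = obj X (Suc n)"
    using ff(3)[of 0] ff(3)[of "Suc n"] fg x by simp_all
  have 1: "chain_on C 0 (Suc n) X X (\<lambda>i. (g i \<cdot> f i) \<oplus> \<ominus> Idn C (obj X i))"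
    using chain_map_iff[OF X X] chain_map_comp[OF fg(1) g(1) X Y X]
      chain_on_add[OF _ chain_on_neg[OF chain_on_id[OF X order_refl] X X order_refl] X X order_refl] by blast
  have 2: "(g 0 \<cdot> f 0) \<oplus> \<ominus> Idn C (obj X 0) = zr C (obj X 0) (obj X 0)" using fg g e x by simp
  from null_up[OF X X R(1) 1 _ 2] obtain h where
   h: "\<forall>i. i < Suc n \<longrightarrow> mor C (h (Suc i)) \<and> src C (h (Suc i)) = obj X (Suc i) \<and> tgt C (h (Suc i)) = obj X i"
    "(g (Suc n) \<cdot> f (Suc n)) \<oplus> \<ominus> Idn C (obj X (Suc n)) = dif X n \<cdot> h (Suc n)" by auto
  have "g (Suc n) = Idn C (obj X (Suc n)) \<oplus> (dif X n \<cdot> h (Suc n))"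
    by (rule diffD) (use h fg gg x e in auto)
  from adjust_top[OF Y X n g(1) _ _ _ _ _ _ this] h(1) x e obtain g' where
   g': "chain_map C (Suc n) Y X g'" "g' (Suc n) = Idn C (obj X (Suc n))" "\<forall>i<n. g' i = g i" by auto
  then have "end_fixing n C Y X g'" using g n e by (auto simp: end_fixing_def)
  then show ?thesis using htpy_equivI[OF X Y R f] by blast
qed

end


section \<open>Duality and homotopy classes\<close>

text \<open>
  Notions that involve only the additive structure do not distinguish the opposite of an exangulated category
  from the opposite of the underlying category, although these are different records.
\<close>

definition same_cat :: "('o, 'm, 'z) addcat_scheme \<Rightarrow> ('o, 'm, 'y) addcat_scheme \<Rightarrow> bool" where
  "same_cat C D \<longleftrightarrow> Ob C = Ob D \<and> Hom C = Hom D \<and> Idn C = Idn D \<and> Cmp C = Cmp D"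

lemma same_cat_cong:
  assumes "same_cat C D"
  shows "zero_object C = zero_object D" "biproduct C = biproduct D" "complex C = complex D"
    "chain_map C = chain_map D" "homotopic C = homotopic D" "left_exact C = left_exact D"
    "mapping_cone C = mapping_cone D" "mor C = mor D" "src C = src D" "tgt C = tgt D"
    "madd C = madd D" "mneg C = mneg D" "isomorphism C = isomorphism D" "direct_sum C = direct_sum D"
    "closed_under_comp C = closed_under_comp D" "same_cat (op_cat C) (op_cat D)"
  using assms
  by (simp_all add: same_cat_def fun_eq_iff zero_object_def biproduct_def complex_def chain_map_def
    homotopic_def left_exact_def mapping_cone_def mor_def src_def tgt_def madd_def mneg_def isomorphism_def direct_sum_def
    closed_under_comp_def op_cat_def)

lemma same_cat_cong2:
  assumes "same_cat C D"
  shows "right_exact C = right_exact D" "end_fixing n C = end_fixing n D" "cplx_between n C = cplx_between n D"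
  using assms same_cat_cong[OF assms] same_cat_cong[OF same_cat_cong(16)[OF assms]]
  by (simp_all add: fun_eq_iff right_exact_def end_fixing_def cplx_between_def same_cat_def)

lemma same_cat_cong3:
  assumes "same_cat C D"
  shows "htpy_equiv n C = htpy_equiv n D" "n_exact_sequence n C = n_exact_sequence n D"
     "weak_isomorphism n C = weak_isomorphism n D" "n_pushout n C = n_pushout n D"
  using assms same_cat_cong[OF assms] same_cat_cong2[OF assms]
  by (simp_all add: fun_eq_iff htpy_equiv_def n_exact_sequence_def weak_isomorphism_def n_pushout_def same_cat_def)

lemma same_cat_cong4:
  assumes "same_cat C D"
  shows "htpy_class n C = htpy_class n D" "has_n_pushouts n C = has_n_pushouts n D"
    "additive_category C \<longleftrightarrow> additive_category D"
  using assms same_cat_cong[OF assms] same_cat_cong2[OF assms] same_cat_cong3[OF assms]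
  by (simp_all add: fun_eq_iff htpy_class_def has_n_pushouts_def same_cat_def additive_category_def)

lemma same_cat_cong5:
  assumes "same_cat C D"
  shows "ext_push n C = ext_push n D"
  using assms same_cat_cong[OF assms] same_cat_cong2[OF assms] same_cat_cong3[OF assms] same_cat_cong4[OF assms]
  by (simp add: fun_eq_iff ext_push_def same_cat_def)

lemma homotopic_op:
  assumes C: "additive_category C" and X: "complex C m X" and Y: "complex C m Y" and m: "1 \<le> m"
    and "homotopic C m X Y f g"
  shows "homotopic (op_cat C) m (rev_cplx m Y) (rev_cplx m X) (\<lambda>i. f (m - i)) (\<lambda>i. g (m - i))"
proof -
  interpret additive_category C by fact
  note x = complexD[OF X] complexD[OF Y]
  from assms(5) obtain h where
   h: "\<forall>i<m. h (Suc i) \<in> arr C (obj X (Suc i)) (obj Y i)"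
     "f 0 = g 0 \<otimes>\<^bsub>Hom C (obj X 0) (obj Y 0)\<^esub> (h 1 \<cdot>\<^bsub>C\<^esub> dif X 0)"
     "\<forall>i. Suc i < m \<longrightarrow> f (Suc i) =
        g (Suc i) \<otimes>\<^bsub>Hom C (obj X (Suc i)) (obj Y (Suc i))\<^esub>
          ((h (Suc (Suc i)) \<cdot>\<^bsub>C\<^esub> dif X (Suc i))
             \<otimes>\<^bsub>Hom C (obj X (Suc i)) (obj Y (Suc i))\<^esub> (dif Y i \<cdot>\<^bsub>C\<^esub> h (Suc i)))"
     "f m = g m \<otimes>\<^bsub>Hom C (obj X m) (obj Y m)\<^esub> (dif Y (m - 1) \<cdot>\<^bsub>C\<^esub> h m)"
    unfolding homotopic_def by blast
  have ht: "mor C (h (Suc i)) \<and> src C (h (Suc i)) = obj X (Suc i) \<and> tgt C (h (Suc i)) = obj Y i" if "i < m" for i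
    using h(1)[rule_format, OF that] x(1,7)[of i] x(1,7)[of "Suc i"] that by simp
  show ?thesis unfolding homotopic_def
  proof (intro exI[of _ "\<lambda>j. h (Suc m - j)"] conjI allI impI)
    fix i assume i: "i < m"
    have "Suc (m - Suc i) = m - i" using i by simp
    then show "h (Suc m - Suc i) \<in> arr (op_cat C) (obj (rev_cplx m Y) (Suc i)) (obj (rev_cplx m X) i)"
      using h(1)[rule_format, of "m - Suc i"] i by (simp del: arr_iff)
  next
    fix i assume i: "Suc i < m"
    define j where "j = m - Suc (Suc i)"
    have e: "m - Suc i = Suc j" "m - i = Suc (Suc j)" "Suc m - Suc (Suc i) = Suc j" "Suc m - Suc i = Suc (Suc j)" "m - Suc (Suc i) = j" "Suc j < m"
      using i by (auto simp: j_def)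
    have "(h (Suc (Suc j)) \<cdot>\<^bsub>C\<^esub> dif X (Suc j)) \<oplus>\<^bsub>C\<^esub> (dif Y j \<cdot>\<^bsub>C\<^esub> h (Suc j)) = (dif Y j \<cdot>\<^bsub>C\<^esub> h (Suc j)) \<oplus>\<^bsub>C\<^esub> (h (Suc (Suc j)) \<cdot>\<^bsub>C\<^esub> dif X (Suc j))"
      using x ht[of j] ht[of "Suc j"] e(6) by (simp add: add_comm)
    then show "f (m - Suc i) = g (m - Suc i) \<otimes>\<^bsub>Hom (op_cat C) (obj (rev_cplx m Y) (Suc i)) (obj (rev_cplx m X) (Suc i))\<^esub>
       (h (Suc m - Suc (Suc i)) \<cdot>\<^bsub>op_cat C\<^esub> dif (rev_cplx m Y) (Suc i) \<otimes>\<^bsub>Hom (op_cat C) (obj (rev_cplx m Y) (Suc i)) (obj (rev_cplx m X) (Suc i))\<^esub>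
       dif (rev_cplx m X) i \<cdot>\<^bsub>op_cat C\<^esub> h (Suc m - Suc i))"
      using h(3)[rule_format, OF e(6)] x ht[of j] ht[of "Suc j"] e(6) by (simp add: e(1-5))
  qed (use h m in auto)
qed

lemma end_fixing_op:
  assumes C: "additive_category C" and X: "complex C (Suc n) X" and Y: "complex C (Suc n) Y"
    and f: "end_fixing n C X Y f"
  shows "end_fixing n (op_cat C) (rev_cplx (Suc n) Y) (rev_cplx (Suc n) X) (\<lambda>i. f (Suc n - i))"
    and "obj Y 0 = obj X 0" "obj Y (Suc n) = obj X (Suc n)"
proof -
  interpret additive_category C by fact
  note x = complexD[OF X] complexD[OF Y]
  have f1: "chain_map C (Suc n) X Y f" "f 0 = Idn C (obj X 0)" "f (Suc n) = Idn C (obj X (Suc n))"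
    using f by (auto simp: end_fixing_def)
  note ff = chain_mapD[OF X Y f1(1) X Y order_refl]
  show e: "obj Y 0 = obj X 0" "obj Y (Suc n) = obj X (Suc n)"
    using ff(3)[of 0] ff(3)[of "Suc n"] f1 x by simp_all
  show "end_fixing n (op_cat C) (rev_cplx (Suc n) Y) (rev_cplx (Suc n) X) (\<lambda>i. f (Suc n - i))"
    using chain_map_op[OF C X Y f1(1)] f1 e by (simp add: end_fixing_def)
qed

lemma htpy_equiv_op:
  assumes C: "additive_category C" and X: "complex C (Suc n) X" and Y: "complex C (Suc n) Y"
    and e: "htpy_equiv n C X Y"
  shows "htpy_equiv n (op_cat C) (rev_cplx (Suc n) X) (rev_cplx (Suc n) Y)"
proof -
  from e obtain f g where fg: "end_fixing n C X Y f" "end_fixing n C Y X g"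
     "homotopic C (Suc n) X X (\<lambda>i. g i \<cdot>\<^bsub>C\<^esub> f i) (\<lambda>i. Idn C (obj X i))"
     "homotopic C (Suc n) Y Y (\<lambda>i. f i \<cdot>\<^bsub>C\<^esub> g i) (\<lambda>i. Idn C (obj Y i))"
    unfolding htpy_equiv_def by auto
  show ?thesis unfolding htpy_equiv_def
    using end_fixing_op(1)[OF C X Y fg(1)] end_fixing_op(1)[OF C Y X fg(2)]
      homotopic_op[OF C X X _ fg(3)] homotopic_op[OF C Y Y _ fg(4)]
    by (intro exI[of _ "\<lambda>i. f (Suc n - i)"] exI[of _ "\<lambda>i. g (Suc n - i)"]) simp
qed

lemma complex_op_iff':
  assumes "additive_category C" shows "complex C m (rev_cplx m X) \<longleftrightarrow> complex (op_cat C) m X"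
  using complex_op_iff[OF additive_category_op[OF assms], of m X] by simp

lemma htpy_class_op:
  assumes C: "additive_category C" and X: "complex C (Suc n) X"
  shows "htpy_class n (op_cat C) (rev_cplx (Suc n) X) = rev_cplx (Suc n) -` htpy_class n C X"
proof -
  note oC = additive_category_op[OF C]
  have "Z \<in> htpy_class n (op_cat C) (rev_cplx (Suc n) X) \<longleftrightarrow> rev_cplx (Suc n) Z \<in> htpy_class n C X" for Z
  proof
    assume Z: "Z \<in> htpy_class n (op_cat C) (rev_cplx (Suc n) X)"
    then have "htpy_equiv n C (rev_cplx (Suc n) (rev_cplx (Suc n) X)) (rev_cplx (Suc n) Z)"
      using htpy_equiv_op[OF oC complex_op[OF C X], of Z] by (auto simp: htpy_class_def cplx_between_def)
    then have "htpy_equiv n C X (rev_cplx (Suc n) Z)"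
      using htpy_equiv_agree[OF agree_rev_rev] by (metis agree_def)
    then show "rev_cplx (Suc n) Z \<in> htpy_class n C X"
      using Z complex_op_iff'[OF C] by (auto simp: htpy_class_def cplx_between_def)
  next
    assume Z: "rev_cplx (Suc n) Z \<in> htpy_class n C X"
    then have "htpy_equiv n (op_cat C) (rev_cplx (Suc n) X) (rev_cplx (Suc n) (rev_cplx (Suc n) Z))"
      using htpy_equiv_op[OF C X, of "rev_cplx (Suc n) Z"] by (auto simp: htpy_class_def cplx_between_def)
    then have "htpy_equiv n (op_cat C) (rev_cplx (Suc n) X) Z"
      using htpy_equiv_agree[OF _ agree_rev_rev] by (metis agree_def)
    then show "Z \<in> htpy_class n (op_cat C) (rev_cplx (Suc n) X)"
      using Z complex_op_iff'[OF C] by (auto simp: htpy_class_def cplx_between_def)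
  qed
  then show ?thesis by blast
qed

context additive_category
begin

lemma left_exact_htpy:
  assumes X: "complex C (Suc n) X" and Y: "complex C (Suc n) Y" and e: "htpy_equiv n C X Y"
    and L: "left_exact C (Suc n) X"
  shows "left_exact C (Suc n) Y"
proof -
  from e obtain f g where fg: "chain_map C (Suc n) X Y f" "chain_map C (Suc n) Y X g" "g 0 = Idn C (obj Y 0)"
     "homotopic C (Suc n) Y Y (\<lambda>i. f i \<cdot> g i) (\<lambda>i. Idn C (obj Y i))"
    unfolding htpy_equiv_def end_fixing_def by auto
  note x = complexD[OF X] complexD[OF Y]
   and ff = chain_mapD[OF X Y fg(1) X Y order_refl] and gg = chain_mapD[OF Y X fg(2) Y X order_refl]
  have e: "obj Y 0 = obj X 0" using gg(3)[of 0] fg(3) x by simp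
  from fg(4) obtain h where
   h: "\<forall>i<Suc n. h (Suc i) \<in> arr C (obj Y (Suc i)) (obj Y i)"
     "\<forall>i. Suc i < Suc n \<longrightarrow> f (Suc i) \<cdot> g (Suc i) =
        Idn C (obj Y (Suc i)) \<otimes>\<^bsub>Hom C (obj Y (Suc i)) (obj Y (Suc i))\<^esub>
          ((h (Suc (Suc i)) \<cdot>\<^bsub>C\<^esub> dif Y (Suc i))
             \<otimes>\<^bsub>Hom C (obj Y (Suc i)) (obj Y (Suc i))\<^esub> (dif Y i \<cdot>\<^bsub>C\<^esub> h (Suc i)))"
    unfolding homotopic_def by blast
  have ht: "mor C (h (Suc i)) \<and> src C (h (Suc i)) = obj Y (Suc i) \<and> tgt C (h (Suc i)) = obj Y i" if "i < Suc n" for i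
    using h(1)[rule_format, OF that] x(7)[of i] x(7)[of "Suc i"] that by simp
  show ?thesis
    unfolding left_exact_iff[OF Y, simplified]
  proof (intro conjI allI impI)
    fix u assume u: "mor C u" "tgt C u = obj Y 0" "dif Y 0 \<cdot> u = zr C (src C u) (obj Y (Suc 0))"
    have "dif X 0 \<cdot> u = g 1 \<cdot> (dif Y 0 \<cdot> u)" using gg(5)[of 0 u] fg(3) u e x by simp
    also have "\<dots> = zr C (src C u) (obj X 1)" unfolding u(3) using u gg x by simp
    finally show "u = zr C (src C u) (obj Y 0)"
      using left_exactD(1)[OF L X, of u] u e by simp
  next
    fix i u assume "i < n" then have i: "Suc i < Suc n" by simp
    assume u: "mor C u" "tgt C u = obj Y (Suc i)" "dif Y (Suc i) \<cdot> u = zr C (src C u) (obj Y (Suc (Suc i)))"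
    have "dif X (Suc i) \<cdot> (g (Suc i) \<cdot> u) = g (Suc (Suc i)) \<cdot> (dif Y (Suc i) \<cdot> u)"
      using gg(5)[of "Suc i" u] u i x by simp
    also have "\<dots> = zr C (src C u) (obj X (Suc (Suc i)))" unfolding u(3) using u gg x i by simp
    finally obtain v where v: "mor C v" "src C v = src C u" "tgt C v = obj X i" "g (Suc i) \<cdot> u = dif X i \<cdot> v"
      using left_exactD(2)[OF L X _ i, of "g (Suc i) \<cdot> u"] gg u i by auto
    have hi: "mor C (h (Suc i))" "src C (h (Suc i)) = obj Y (Suc i)" "tgt C (h (Suc i)) = obj Y i"
      "mor C (h (Suc (Suc i)))" "src C (h (Suc (Suc i))) = obj Y (Suc (Suc i))" "tgt C (h (Suc (Suc i))) = obj Y (Suc i)"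
      using ht i by auto
    have "f (Suc i) \<cdot> g (Suc i) = Idn C (obj Y (Suc i)) \<oplus> ((h (Suc (Suc i)) \<cdot> dif Y (Suc i)) \<oplus> (dif Y i \<cdot> h (Suc i)))"
      using h(2)[rule_format, OF i] x i hi by simp
    then have "(f (Suc i) \<cdot> g (Suc i)) \<cdot> u = (Idn C (obj Y (Suc i)) \<oplus> ((h (Suc (Suc i)) \<cdot> dif Y (Suc i)) \<oplus> (dif Y i \<cdot> h (Suc i)))) \<cdot> u"
      by simp
    then have "f (Suc i) \<cdot> (dif X i \<cdot> v) = u \<oplus> (dif Y i \<cdot> (h (Suc i) \<cdot> u))"
      using x i hi u v ff gg by simp
    then have "dif Y i \<cdot> (f i \<cdot> v) = u \<oplus> (dif Y i \<cdot> (h (Suc i) \<cdot> u))"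
      using ff(5)[of i v] i v x by simp
    then have "u = dif Y i \<cdot> ((f i \<cdot> v) \<oplus> \<ominus> (h (Suc i) \<cdot> u))"
      using x i hi u v ff by (simp add: add_assoc)
    then show "\<exists>v. mor C v \<and> src C v = src C u \<and> tgt C v = obj Y i \<and> u = dif Y i \<cdot> v"
      using x i hi u v ff by (intro exI[of _ "(f i \<cdot> v) \<oplus> \<ominus> (h (Suc i) \<cdot> u)"]) auto
  qed
qed

end

text \<open>
  The complexes here have length \<open>Suc n\<close>; this is the normal form of \<open>n + 1\<close> in all
  proofs.
\<close>

definition exact_seq where "exact_seq n C X \<longleftrightarrow> complex C (Suc n) X \<and> left_exact C (Suc n) X \<and> right_exact C (Suc n) X"

lemma n_exact_sequence_iff: "n_exact_sequence n C X \<longleftrightarrow> exact_seq n C X"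
  by (simp add: n_exact_sequence_def exact_seq_def)

lemma exact_seq_op:
  assumes "additive_category C" "exact_seq n C X" shows "exact_seq n (op_cat C) (rev_cplx (Suc n) X)"
  using assms complex_op[OF assms(1)] additive_category.right_exact_op[OF assms(1), of "Suc n" X]
  by (auto simp: exact_seq_def right_exact_def)

context additive_category
begin

lemma exact_seq_htpy:
  assumes X: "exact_seq n C X" and Y: "complex C (Suc n) Y" and e: "htpy_equiv n C X Y"
  shows "exact_seq n C Y"
proof -
  interpret op: additive_category "op_cat C" by (rule op)
  have X': "complex C (Suc n) X" "left_exact C (Suc n) X" "right_exact C (Suc n) X" using X by (auto simp: exact_seq_def)
  have "left_exact (op_cat C) (Suc n) (rev_cplx (Suc n) Y)"
    by (rule op.left_exact_htpy[OF complex_op[OF additive_category_axioms X'(1)] complex_op[OF additive_category_axioms Y]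
         htpy_equiv_op[OF additive_category_axioms X'(1) Y e]])
       (use X' in \<open>simp add: right_exact_def\<close>)
  then show ?thesis using left_exact_htpy[OF X'(1) Y e X'(2)] Y by (auto simp: exact_seq_def right_exact_def)
qed

lemma end_fixing_comp:
  assumes "end_fixing n C X Y f" "end_fixing n C Y Z g"
    and "complex C (Suc n) X" "complex C (Suc n) Y" "complex C (Suc n) Z"
  shows "end_fixing n C X Z (\<lambda>i. g i \<cdot> f i)"
  using chain_map_comp[of "Suc n" X Y f Z g] assms complexD(1)[OF assms(3), of 0] complexD(1)[OF assms(3), of "Suc n"]
    end_fixing_op(2,3)[OF additive_category_axioms assms(3,4,1)]
  by (auto simp: end_fixing_def)

text \<open>
  Exact sequences are homotopy equivalent as soon as there are end-fixing maps in both directions.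
\<close>

lemma htpy_class_eqI:
  assumes X: "exact_seq n C X" and Y: "exact_seq n C Y" and f: "end_fixing n C X Y f" and g: "end_fixing n C Y X g"
  shows "htpy_class n C X = htpy_class n C Y"
proof -
  have 1: "htpy_class n C X \<subseteq> htpy_class n C Y" if X: "exact_seq n C X" and Y: "exact_seq n C Y"
    and f: "end_fixing n C X Y f" and g: "end_fixing n C Y X g" for X Y f g
  proof
    fix Z assume "Z \<in> htpy_class n C X"
    then have Z: "complex C (Suc n) Z" "obj Z 0 = obj X 0" "obj Z (Suc n) = obj X (Suc n)" "htpy_equiv n C X Z"
      by (auto simp: htpy_class_def cplx_between_def)
    have nz: "exact_seq n C Z" using exact_seq_htpy[OF X Z(1,4)] .
    have c: "complex C (Suc n) X" "complex C (Suc n) Y" "right_exact C (Suc n) Y" "right_exact C (Suc n) Z"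
      using X Y nz by (auto simp: exact_seq_def)
    from Z(4) obtain a b where "end_fixing n C X Z a" "end_fixing n C Z X b" by (auto simp: htpy_equiv_def)
    then have "htpy_equiv n C Y Z"
      using end_fixing_comp[OF g _ c(2,1) Z(1)] end_fixing_comp[OF _ f Z(1) c(1,2)]
        htpy_equivI[OF c(2) Z(1) c(3,4)] by blast
    then show "Z \<in> htpy_class n C Y"
      using Z end_fixing_op(2,3)[OF additive_category_axioms c(1,2) f] by (auto simp: htpy_class_def cplx_between_def)
  qed
  show ?thesis using 1[OF X Y f g] 1[OF Y X g f] by blast
qed

lemma htpy_class_self:
  assumes "exact_seq n C X" shows "X \<in> htpy_class n C X"
proof -
  have X: "complex C (Suc n) X" "right_exact C (Suc n) X" using assms by (auto simp: exact_seq_def)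
  have "chain_map C (Suc n) X X (\<lambda>i. Idn C (obj X i))"
    using chain_on_id[OF X(1) order_refl] chain_map_iff[OF X(1,1)] by simp
  then have "end_fixing n C X X (\<lambda>i. Idn C (obj X i))" by (simp add: end_fixing_def)
  then show ?thesis using htpy_equivI[OF X(1,1,2,2)] X by (auto simp: htpy_class_def cplx_between_def)
qed

lemma htpy_class_eq:
  assumes "exact_seq n C X" "Y \<in> htpy_class n C X"
  shows "exact_seq n C Y" "htpy_class n C Y = htpy_class n C X"
proof -
  have Y: "complex C (Suc n) Y" "htpy_equiv n C X Y" using assms(2) by (auto simp: htpy_class_def cplx_between_def)
  show "exact_seq n C Y" by (rule exact_seq_htpy[OF assms(1) Y])
  then show "htpy_class n C Y = htpy_class n C X"
    using Y(2) htpy_class_eqI[OF assms(1)] by (auto simp: htpy_equiv_def)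
qed

end


section \<open>Realisations by \<open>n\<close>-exact sequences\<close>

lemma op_exang_simps [simp]:
  "Ob (op_exang n E) = Ob E" "Hom (op_exang n E) X Y = Hom E Y X" "Idn (op_exang n E) = Idn E"
  "Cmp (op_exang n E) g f = Cmp E f g" "Ext (op_exang n E) Z A = Ext E A Z" "Act (op_exang n E) c a = Act E a c"
  "Rlz (op_exang n E) Z A \<delta> = rev_cplx (Suc n) -` Rlz E A Z \<delta>"
  by (simp_all add: op_exang_def)

lemma same_cat_op_exang: "same_cat (op_exang n E) (op_cat E)"
  by (simp add: same_cat_def fun_eq_iff)

text \<open>
  The relation \<open>\<s>(\<delta>) = [X]\<close> for \<open>\<delta> \<in> \<E>(Z, A)\<close>.
\<close>

definition realises :: "nat \<Rightarrow> ('o, 'm, 'x) exang \<Rightarrow> 'o \<Rightarrow> 'o \<Rightarrow> 'x \<Rightarrow> ('o, 'm) cplx \<Rightarrow> bool" where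
  "realises n E A Z \<delta> X \<longleftrightarrow> A \<in> Ob E \<and> Z \<in> Ob E \<and> \<delta> \<in> carrier (Ext E Z A) \<and> realised_by n E A Z \<delta> X"

locale additive_bifunctor = additive_category E + biadditive_functor E for E :: "('o, 'm, 'x) exang" (structure)
begin

lemma act_in [simp]:
  assumes "mor E c" "mor E a" "\<delta> \<in> carrier (Ext E (tgt E c) (src E a))" "src E c = Z" "tgt E a = A"
  shows "Act E c a \<delta> \<in> carrier (Ext E Z A)"
proof -
  have "Act E c a \<in> hom (Ext E (tgt E c) (src E a)) (Ext E (src E c) (tgt E a))"
    by (rule act_hom) (use assms in auto)
  then show ?thesis using assms by (auto simp: hom_def)
qed

lemma act_act [simp]:
  assumes "mor E c" "mor E a" "mor E c'" "mor E a'" "\<delta> \<in> carrier (Ext E (tgt E c) (src E a))"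
    "tgt E c' = src E c" "src E a' = tgt E a"
  shows "Act E c' a' (Act E c a \<delta>) = Act E (c \<cdot> c') (a' \<cdot> a) \<delta>"
  using act_comp[of "tgt E c" "src E c" "src E c'" "src E a" "tgt E a" "tgt E a'" c c' a a' \<delta>] assms by simp

lemma act_idn [simp]:
  assumes "\<delta> \<in> carrier (Ext E Z A)" "Z \<in> Ob E" "A \<in> Ob E"
  shows "Act E (Idn E Z) (Idn E A) \<delta> = \<delta>"
  using act_id assms by simp

lemma act_mult:
  assumes "mor E c" "mor E a" "tgt E c = Z" "src E a = A" "src E c = Z'" "tgt E a = A'"
    "\<delta> \<in> carrier (Ext E Z A)" "\<rho> \<in> carrier (Ext E Z A)"
  shows "Act E c a (\<delta> \<otimes>\<^bsub>Ext E Z A\<^esub> \<rho>) = Act E c a \<delta> \<otimes>\<^bsub>Ext E Z' A'\<^esub> Act E c a \<rho>"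
proof -
  have "Act E c a \<in> hom (Ext E (tgt E c) (src E a)) (Ext E (src E c) (tgt E a))"
    by (rule act_hom) (use assms in auto)
  then show ?thesis using assms by (auto simp: hom_def)
qed

lemma act_one [simp]:
  assumes "mor E c" "mor E a" "tgt E c = Z" "src E a = A"
  shows "Act E c a \<one>\<^bsub>Ext E Z A\<^esub> = \<one>\<^bsub>Ext E (src E c) (tgt E a)\<^esub>"
proof -
  have "Act E c a \<in> hom (Ext E (tgt E c) (src E a)) (Ext E (src E c) (tgt E a))"
    by (rule act_hom) (use assms in auto)
  moreover have "group (Ext E (tgt E c) (src E a))" "group (Ext E (src E c) (tgt E a))"
    using ext_group assms by (auto simp: comm_group_def)
  ultimately show ?thesis using hom_one assms by fastforce
qed

lemma ext_one [simp]: "Z \<in> Ob E \<Longrightarrow> A \<in> Ob E \<Longrightarrow> \<one>\<^bsub>Ext E Z A\<^esub> \<in> carrier (Ext E Z A)"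
  using ext_group[of Z A] by (simp add: comm_group_def group.is_monoid monoid.one_closed)

lemma act_add_l:
  assumes "mor E c" "mor E c'" "mor E a" "src E c' = src E c" "tgt E c' = tgt E c"
    "\<delta> \<in> carrier (Ext E (tgt E c) (src E a))"
  shows "Act E (c \<oplus> c') a \<delta> = Act E c a \<delta> \<otimes>\<^bsub>Ext E (src E c) (tgt E a)\<^esub> Act E c' a \<delta>"
  using act_add_left[of "tgt E c" "src E c" "src E a" "tgt E a" c c' a \<delta>] assms by simp

lemma act_add_r:
  assumes "mor E a" "mor E a'" "mor E c" "src E a' = src E a" "tgt E a' = tgt E a"
    "\<delta> \<in> carrier (Ext E (tgt E c) (src E a))"
  shows "Act E c (a \<oplus> a') \<delta> = Act E c a \<delta> \<otimes>\<^bsub>Ext E (src E c) (tgt E a)\<^esub> Act E c a' \<delta>"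
  using act_add_right[of "tgt E c" "src E c" "src E a" "tgt E a" c a a' \<delta>] assms by simp

lemma act_zero_r [simp]:
  assumes "mor E c" "\<delta> \<in> carrier (Ext E (tgt E c) A)" "A \<in> Ob E" "A' \<in> Ob E"
  shows "Act E c (zr E A A') \<delta> = \<one>\<^bsub>Ext E (src E c) A'\<^esub>"
proof -
  interpret G: comm_group "Ext E (src E c) A'" using assms by (intro ext_group) auto
  have "zr E A A' \<oplus> zr E A A' = zr E A A'" using assms by simp
  then have "Act E c (zr E A A') \<delta> \<otimes>\<^bsub>Ext E (src E c) A'\<^esub> Act E c (zr E A A') \<delta> = Act E c (zr E A A') \<delta>"
    using act_add_r[of "zr E A A'" "zr E A A'" c \<delta>] assms by simp
  then show ?thesis using G.l_cancel_one[of "Act E c (zr E A A') \<delta>" "Act E c (zr E A A') \<delta>"] assms by simp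
qed

lemma act_neg_r:
  assumes "mor E c" "mor E a" "\<delta> \<in> carrier (Ext E (tgt E c) (src E a))"
  shows "Act E c (\<ominus> a) \<delta> = inv\<^bsub>Ext E (src E c) (tgt E a)\<^esub> (Act E c a \<delta>)"
proof -
  interpret G: comm_group "Ext E (src E c) (tgt E a)" using assms by (intro ext_group) auto
  have "Act E c (\<ominus> a) \<delta> \<otimes>\<^bsub>Ext E (src E c) (tgt E a)\<^esub> Act E c a \<delta> = \<one>\<^bsub>Ext E (src E c) (tgt E a)\<^esub>"
    using act_add_r[of "\<ominus> a" a c \<delta>] assms by simp
  then show ?thesis using G.inv_equality assms by simp
qed

lemma covariant_exactI:
  assumes X: "complex E (Suc n) X" "left_exact E (Suc n) X" and n: "1 \<le> n"
    and d: "\<delta> \<in> carrier (Ext E (obj X (Suc n)) (obj X 0))"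
    and p: "Act E (dif X n) (Idn E (obj X 0)) \<delta> = \<one>\<^bsub>Ext E (obj X n) (obj X 0)\<^esub>"
    and f: "\<And>u. mor E u \<Longrightarrow> tgt E u = obj X (Suc n) \<Longrightarrow> Act E u (Idn E (obj X 0)) \<delta> = \<one>\<^bsub>Ext E (src E u) (obj X 0)\<^esub> \<Longrightarrow>
      \<exists>v. mor E v \<and> src E v = src E u \<and> tgt E v = obj X n \<and> u = dif X n \<cdot> v"
  shows "covariant_exact n E X \<delta>"
  unfolding covariant_exact_def
proof (intro ballI conjI allI impI)
  note x = complexD[OF X(1)]
  fix Y u assume Y: "Y \<in> Ob E" and u: "u \<in> arr E Y (obj X (n + 1))"
  have u': "mor E u" "src E u = Y" "tgt E u = obj X (Suc n)" using u Y x by auto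
  show "(pull E (obj X 0) u \<delta> = \<one>\<^bsub>Ext E Y (obj X 0)\<^esub>) = (\<exists>v\<in>arr E Y (obj X n). u = dif X n \<cdot> v)"
  proof
    assume "pull E (obj X 0) u \<delta> = \<one>\<^bsub>Ext E Y (obj X 0)\<^esub>"
    then obtain v where "mor E v" "src E v = Y" "tgt E v = obj X n" "u = dif X n \<cdot> v"
      using f[OF u'(1,3)] unfolding u'(2) pull_def by blast
    then show "\<exists>v\<in>arr E Y (obj X n). u = dif X n \<cdot> v" using arrI by blast
  next
    assume "\<exists>v\<in>arr E Y (obj X n). u = dif X n \<cdot> v"
    then obtain v where v: "v \<in> arr E Y (obj X n)" "u = dif X n \<cdot> v" by blast
    have v1: "mor E v" "src E v = Y" "tgt E v = obj X n" using v(1) Y x(1)[of n] by auto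
    have "Act E v (Idn E (obj X 0)) (Act E (dif X n) (Idn E (obj X 0)) \<delta>) = \<one>\<^bsub>Ext E Y (obj X 0)\<^esub>"
      unfolding p using v1 x by simp
    then show "pull E (obj X 0) u \<delta> = \<one>\<^bsub>Ext E Y (obj X 0)\<^esub>"
      using v1 x d by (simp add: pull_def v(2))
  qed
next
  fix Y i u assume "Y \<in> Ob E" "i < n" "u \<in> arr E Y (obj X (Suc i))"
  then show "(dif X (Suc i) \<cdot> u = zr E Y (obj X (Suc (Suc i)))) = (\<exists>v\<in>arr E Y (obj X i). u = dif X i \<cdot> v)"
    using X(2) unfolding left_exact_def by (simp del: arr_iff)
qed

lemma additive_bifunctor_op: "additive_bifunctor (op_exang n E)"
proof -
  have 1: "additive_category (op_exang n E)" using op same_cat_cong4(3)[OF same_cat_op_exang] by blast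
  have 2: "biadditive_functor (op_exang n E)"
    by (rule biadditive_functor.intro)
      (simp_all add: ext_group act_hom act_id act_comp act_add_left act_add_right del: arr_iff mult_madd act_act)
  show ?thesis using 1 2 by (simp add: additive_bifunctor_def)
qed

end

lemma covariant_exact_cong:
  assumes "agree (Suc n) X X'" "1 \<le> n" "same_cat E E'" "Ext E = Ext E'" "Act E = Act E'"
  shows "covariant_exact n E X \<delta> = covariant_exact n E' X' \<delta>"
proof -
  have "obj X i = obj X' i" "i \<le> n \<Longrightarrow> dif X i = dif X' i" if "i \<le> Suc n" for i
    using assms(1) that by (auto simp: agree_def)
  then show ?thesis
    using assms(3-5) by (simp add: covariant_exact_def pull_def same_cat_def)
qed

lemma right_exact_agree:
  assumes "agree m X Y" "1 \<le> m" "right_exact C m X" shows "right_exact C m Y"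
proof -
  have "agree m (rev_cplx m X) (rev_cplx m Y)" using assms(1,2) by (auto simp: agree_def)
  then show ?thesis using assms additive_category.left_exact_agree unfolding right_exact_def
    by (auto simp: left_exact_def agree_def)
qed

lemma exact_seq_agree: "agree (Suc n) X Y \<Longrightarrow> exact_seq n C X \<Longrightarrow> exact_seq n C Y"
  using complex_agree[of "Suc n" X Y C] right_exact_agree[of "Suc n" X Y C]
  by (auto simp: exact_seq_def left_exact_def agree_def)

text \<open>
  Exact realisations by \<open>n\<close>-exact sequences. For these (EA2) and its dual hold automatically; so
  they come from an \<open>n\<close>-exact category as soon as (EA1) holds. The assumptions are self-dual.
\<close>

locale exact_exang = additive_bifunctor E + exact_realisation n E for n :: nat and E :: "('o, 'm, 'x) exang" (structure) +
  assumes n1: "1 \<le> n"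
    and realises_exact: "\<And>A Z \<delta> X. realises n E A Z \<delta> X \<Longrightarrow> exact_seq n E X"
begin

lemma rzD:
  assumes "realises n E A Z \<delta> X"
  shows "A \<in> Ob E" "Z \<in> Ob E" "\<delta> \<in> carrier (Ext E Z A)" "obj X 0 = A" "obj X (Suc n) = Z"
    "complex E (Suc n) X" "left_exact E (Suc n) X" "right_exact E (Suc n) X"
    "Act E (Idn E Z) (dif X 0) \<delta> = \<one>\<^bsub>Ext E Z (obj X (Suc 0))\<^esub>"
    "Act E (dif X n) (Idn E A) \<delta> = \<one>\<^bsub>Ext E (obj X n) A\<^esub>"
    "exangle n E X \<delta>"
proof -
  note a = assms[unfolded realises_def]
  show "A \<in> Ob E" "Z \<in> Ob E" "\<delta> \<in> carrier (Ext E Z A)" using a by auto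
  show 1: "obj X 0 = A" "obj X (Suc n) = Z" using a by (auto simp: realised_by_def cplx_between_def)
  show "complex E (Suc n) X" "left_exact E (Suc n) X" "right_exact E (Suc n) X"
    using realises_exact[OF assms] by (auto simp: exact_seq_def)
  show "exangle n E X \<delta>" using R1 a by blast
  then show "Act E (Idn E Z) (dif X 0) \<delta> = \<one>\<^bsub>Ext E Z (obj X (Suc 0))\<^esub>"
    "Act E (dif X n) (Idn E A) \<delta> = \<one>\<^bsub>Ext E (obj X n) A\<^esub>"
    using 1 by (auto simp: exangle_def attached_def push_def pull_def)
qed

lemma realises_pull:
  assumes "realises n E A Z \<delta> X" "mor E u" "tgt E u = Z" "Act E u (Idn E A) \<delta> = \<one>\<^bsub>Ext E (src E u) A\<^esub>"
  shows "\<exists>v. mor E v \<and> src E v = src E u \<and> tgt E v = obj X n \<and> u = dif X n \<cdot> v"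
proof -
  note r = rzD[OF assms(1)]
  have "u \<in> arr E (src E u) (obj X (n + 1))" "src E u \<in> Ob E" using assms(2,3) r(1-5) by auto
  moreover have "pull E (obj X 0) u \<delta> = \<one>\<^bsub>Ext E (src E u) (obj X 0)\<^esub>"
    unfolding pull_def r(4) by (rule assms(4))
  moreover have "covariant_exact n E X \<delta>" using r(11) by (simp only: exangle_def)
  ultimately obtain v where v: "v \<in> arr E (src E u) (obj X n)" "u = dif X n \<cdot> v"
    unfolding covariant_exact_def by blast
  have "mor E v" "src E v = src E u" "tgt E v = obj X n"
    using v(1) \<open>src E u \<in> Ob E\<close> complexD(1)[OF r(6), of n] by auto
  then show ?thesis using v(2) by blast
qed

lemma realises_push:
  assumes "realises n E A Z \<delta> X" "mor E u" "src E u = A" "Act E (Idn E Z) u \<delta> = \<one>\<^bsub>Ext E Z (tgt E u)\<^esub>"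
  shows "\<exists>v. mor E v \<and> src E v = obj X 1 \<and> tgt E v = tgt E u \<and> u = v \<cdot> dif X 0"
proof -
  note r = rzD[OF assms(1)]
  have "u \<in> arr E (obj X 0) (tgt E u)" "tgt E u \<in> Ob E" using assms(2,3) r(1-5) by auto
  moreover have "Act E (Idn E (obj X (Suc n))) u \<delta> = \<one>\<^bsub>Ext E (obj X (Suc n)) (tgt E u)\<^esub>"
    unfolding r(5) by (rule assms(4))
  moreover have "covariant_exact n (op_exang n E) (rev_cplx (Suc n) X) \<delta>" using r(11) by (simp add: exangle_def)
  then have "\<forall>Y\<in>Ob E. \<forall>u\<in>arr E (obj X 0) Y. Act E (Idn E (obj X (Suc n))) u \<delta> = \<one>\<^bsub>Ext E (obj X (Suc n)) Y\<^esub> \<longrightarrow>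
      (\<exists>v\<in>arr E (obj X 1) Y. u = v \<cdot> dif X 0)"
    unfolding covariant_exact_def by (simp add: pull_def del: arr_iff)
  ultimately obtain v where v: "v \<in> arr E (obj X 1) (tgt E u)" "u = v \<cdot> dif X 0"
    by blast
  have "mor E v" "src E v = obj X 1" "tgt E v = tgt E u"
    using v(1) \<open>tgt E u \<in> Ob E\<close> complexD(1)[OF r(6), of 1] by auto
  then show ?thesis using v(2) by blast
qed

lemma realises_exists:
  assumes "A \<in> Ob E" "Z \<in> Ob E" "\<delta> \<in> carrier (Ext E Z A)" obtains X where "realises n E A Z \<delta> X"
  using realised[OF assms] assms by (auto simp: realises_def)

lemma realises_lift:
  assumes "realises n E A Z \<delta> X" "realises n E B D \<rho> Y" "mor E a" "src E a = A" "tgt E a = B"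
    "mor E c" "src E c = Z" "tgt E c = D" "Act E (Idn E Z) a \<delta> = Act E c (Idn E B) \<rho>"
  obtains f where "chain_map E (Suc n) X Y f" "f 0 = a" "f (Suc n) = c"
  using R0[of A Z B D \<delta> \<rho> a c X Y] assms by (auto simp: realises_def push_def pull_def)

lemma realises_class:
  assumes "realises n E A Z \<delta> X" "Y \<in> htpy_class n E X" shows "realises n E A Z \<delta> Y"
proof -
  have "Y \<in> cplx_between n E A Z" using assms(2) rzD(4,5)[OF assms(1)] by (auto simp: htpy_class_def)
  moreover have "htpy_class n E Y = htpy_class n E X" by (rule htpy_class_eq(2)[OF realises_exact[OF assms(1)] assms(2)])
  ultimately show ?thesis using assms(1) by (simp add: realises_def realised_by_def)
qed

lemma realises_Rlz:
  assumes "realises n E A Z \<delta> X" shows "Rlz E Z A \<delta> = htpy_class n E X"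
  using assms by (auto simp: realises_def realised_by_def)

lemma realises_end_fixing2:
  assumes "realises n E A Z \<delta> X" "exact_seq n E Y" "end_fixing n E X Y f" "end_fixing n E Y X g"
  shows "realises n E A Z \<delta> Y"
proof (rule realises_class[OF assms(1)])
  show "Y \<in> htpy_class n E X"
    using htpy_class_self[OF assms(2)] htpy_class_eqI[OF realises_exact[OF assms(1)] assms(2-4)] by simp
qed

text \<open>
  By assumption \<open>dif Y 0\<close> factors through \<open>dif X 0\<close>. The factorisation starts a
  chain map from \<open>X\<close> back to \<open>Y\<close>, which is an identity in degree \<open>0\<close>.
\<close>

lemma realises_end_fixing:
  assumes X: "realises n E A Z \<delta> X" and Y: "exact_seq n E Y" and f: "end_fixing n E Y X f"
    and d: "Act E (Idn E Z) (dif Y 0) \<delta> = \<one>\<^bsub>Ext E Z (obj Y 1)\<^esub>"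
  shows "realises n E A Z \<delta> Y"
proof -
  note r = rzD[OF X]
  have Y': "complex E (Suc n) Y" "right_exact E (Suc n) Y" using Y by (auto simp: exact_seq_def)
  note x = complexD[OF r(6)] complexD[OF Y'(1)]
  have e: "obj Y 0 = A" "obj Y (Suc n) = Z" using end_fixing_op(2,3)[OF additive_category_axioms Y'(1) r(6) f] r by auto
  obtain v where v: "mor E v" "src E v = obj X 1" "tgt E v = obj Y 1" "dif Y 0 = v \<cdot> dif X 0"
    using realises_push[OF X, of "dif Y 0"] d e x by auto
  let ?g = "\<lambda>i. if i = 0 then Idn E A else v"
  have "chain_on E 0 1 X Y ?g"
    unfolding chain_on_def using v e r x by (auto simp: le_Suc_eq)
  from extend_up[OF r(6) Y'(1) r(8) this] obtain g where
    g: "\<forall>i\<le>1. g i = ?g i" "chain_on E 0 (Suc n) X Y g" by auto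
  have "chain_map E (Suc n) X Y g" "g 0 = Idn E (obj X 0)"
    using g r chain_map_iff[OF r(6) Y'(1)] by auto
  then have "htpy_equiv n E Y X"
    using htpy_equivI'[OF Y'(1) r(6) Y'(2) r(8) n1 f] by blast
  then show ?thesis using realises_end_fixing2[OF X Y] by (auto simp: htpy_equiv_def)
qed

text \<open>
  Let \<open>c\<close> be the top component of \<open>f\<close> and let \<open>N\<close> realise
  \<open>\<eta> = i\<^sub>1 \<delta> + i\<^sub>2 c\<^sup>*\<rho>\<close> in
  \<open>\<E>(Z, A \<oplus> B)\<close>, so that the projections lift to
  \<open>\<alpha>: N \<rightarrow> X\<close> and \<open>\<beta>: N \<rightarrow> Y\<close>. The maps
  \<open>f \<cdot> \<alpha>\<close> and \<open>\<beta>\<close> agree in the top degree. Hence in degree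
  \<open>0\<close> they differ by a map through \<open>dif N 0\<close>, which annihilates
  \<open>\<eta>\<close>; so both push \<open>\<eta>\<close> to the same extension.
\<close>

lemma naturality:
  assumes X: "realises n E A Z \<delta> X" and Y: "realises n E B D \<rho> Y" and f: "chain_map E (Suc n) X Y f"
  shows "Act E (Idn E Z) (f 0) \<delta> = Act E (f (Suc n)) (Idn E B) \<rho>"
proof -
  note r = rzD[OF X] and s = rzD[OF Y]
  note ff = chain_mapD[OF r(6) s(6) f r(6) s(6) order_refl]
  note x = complexD[OF r(6)] complexD[OF s(6)]
  define a where "a = f 0" define c where "c = f (Suc n)"
  have ac: "mor E a" "src E a = A" "tgt E a = B" "mor E c" "src E c = Z" "tgt E c = D"
    using ff[of 0] ff[of "Suc n"] r s by (auto simp: a_def c_def)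
  obtain P i1 i2 p1 p2 where bp: "biproduct E A B P i1 i2 p1 p2"
    using biproduct_exists[OF r(1) s(1)] by blast
  note bm = biprod_mor[OF bp] and be = biprod_eq[OF bp]
  define \<delta>1 where "\<delta>1 = Act E (Idn E Z) i1 \<delta>" define \<rho>1 where "\<rho>1 = Act E c i2 \<rho>"
  have d1: "\<delta>1 \<in> carrier (Ext E Z P)" "\<rho>1 \<in> carrier (Ext E Z P)"
    using r s ac bm by (auto simp: \<delta>1_def \<rho>1_def)
  interpret G: comm_group "Ext E Z P" using r bm by (intro ext_group)
  interpret GA: comm_group "Ext E Z A" using r bm by (intro ext_group)
  interpret GB: comm_group "Ext E Z B" using r bm by (intro ext_group)
  define \<eta> where "\<eta> = \<delta>1 \<otimes>\<^bsub>Ext E Z P\<^esub> \<rho>1"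
  have eta: "\<eta> \<in> carrier (Ext E Z P)" using d1 by (simp add: \<eta>_def)
  have p1: "Act E (Idn E Z) p1 \<eta> = \<delta>"
    using act_mult[of "Idn E Z" p1 Z P Z A \<delta>1 \<rho>1] d1 r s ac bm be by (simp add: \<eta>_def \<delta>1_def \<rho>1_def)
  have p2: "Act E (Idn E Z) p2 \<eta> = Act E c (Idn E B) \<rho>"
    using act_mult[of "Idn E Z" p2 Z P Z B \<delta>1 \<rho>1] d1 r s ac bm be by (simp add: \<eta>_def \<delta>1_def \<rho>1_def)
  obtain N where N: "realises n E P Z \<eta> N" using realises_exists r bm eta by metis
  note t = rzD[OF N]
  obtain \<alpha> where al: "chain_map E (Suc n) N X \<alpha>" "\<alpha> 0 = p1" "\<alpha> (Suc n) = Idn E Z"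
    by (rule realises_lift[OF N X, of p1 "Idn E Z"]) (use p1 bm r in auto)
  obtain \<beta> where bt: "chain_map E (Suc n) N Y \<beta>" "\<beta> 0 = p2" "\<beta> (Suc n) = c"
    by (rule realises_lift[OF N Y, of p2 c]) (use p2 bm ac r in auto)
  have k: "chain_on E 0 (Suc n) N Y (\<lambda>i. (f i \<cdot> \<alpha> i) \<oplus> \<ominus> \<beta> i)"
    using chain_on_add[OF _ chain_on_neg[OF _ t(6) s(6) order_refl] t(6) s(6) order_refl]
      chain_map_comp[OF al(1) f t(6) r(6) s(6)] bt(1) chain_map_iff[OF t(6) s(6)] by blast
  have k1: "(f (Suc n) \<cdot> \<alpha> (Suc n)) \<oplus> \<ominus> \<beta> (Suc n) = zr E (obj N (Suc n)) (obj Y (Suc n))"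
    using al bt ac t s by (simp add: c_def)
  from null_down[OF t(6) s(6) s(7) k _ _ k1] obtain h where
    h: "mor E h" "src E h = obj N 1" "tgt E h = B" "(a \<cdot> p1) \<oplus> \<ominus> p2 = h \<cdot> dif N 0"
    using al bt s by (auto simp: a_def)
  have "Act E (Idn E Z) (h \<cdot> dif N 0) \<eta> = Act E (Idn E Z) h (Act E (Idn E Z) (dif N 0) \<eta>)"
    using h(1-3) r(1-3) complexD(1-4)[OF t(6), of 0] t(4) eta by simp
  also have "\<dots> = \<one>\<^bsub>Ext E Z B\<^esub>"
    unfolding t(9) using h r by simp
  finally have "Act E (Idn E Z) (h \<cdot> dif N 0) \<eta> = \<one>\<^bsub>Ext E Z B\<^esub>" .
  then have "Act E (Idn E Z) (a \<cdot> p1) \<eta> \<otimes>\<^bsub>Ext E Z B\<^esub> inv\<^bsub>Ext E Z B\<^esub> (Act E (Idn E Z) p2 \<eta>) = \<one>\<^bsub>Ext E Z B\<^esub>"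
    unfolding h(4)[symmetric] using act_add_r[of "a \<cdot> p1" "\<ominus> p2" "Idn E Z" \<eta>] act_neg_r[of "Idn E Z" p2 \<eta>] ac bm r eta by simp
  then have "Act E (Idn E Z) (a \<cdot> p1) \<eta> = Act E (Idn E Z) p2 \<eta>"
    using GB.inv_equality[of "Act E (Idn E Z) (a \<cdot> p1) \<eta>" "inv\<^bsub>Ext E Z B\<^esub> (Act E (Idn E Z) p2 \<eta>)"] ac bm r eta by simp
  moreover have "Act E (Idn E Z) (a \<cdot> p1) \<eta> = Act E (Idn E Z) a \<delta>"
    unfolding p1[symmetric] using ac bm r eta by simp
  ultimately show ?thesis using p2 by (simp add: a_def c_def)
qed

lemma realises_inj:
  assumes "realises n E A Z \<delta> X" "realises n E A Z \<rho> X" shows "\<delta> = \<rho>"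
proof -
  note r = rzD[OF assms(1)] and s = rzD[OF assms(2)]
  have "chain_map E (Suc n) X X (\<lambda>i. Idn E (obj X i))"
    using chain_on_id[OF r(6) order_refl] chain_map_iff[OF r(6,6)] by simp
  from naturality[OF assms this] show ?thesis using r s by simp
qed

lemma realises_op:
  "realises n (op_exang n E) Z A \<delta> X \<longleftrightarrow> realises n E A Z \<delta> (rev_cplx (Suc n) X)"
proof
  note sc = same_cat_cong4(1)[OF same_cat_op_exang] same_cat_cong[OF same_cat_op_exang]
  assume a: "realises n E A Z \<delta> (rev_cplx (Suc n) X)"
  have "Rlz (op_exang n E) A Z \<delta> = htpy_class n (op_exang n E) X"
    using realises_Rlz[OF a] htpy_class_op[OF additive_category_axioms rzD(6)[OF a]]
      htpy_class_agree[OF agree_rev_rev[of "Suc n" X], of "op_cat E"]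
    by (simp add: sc)
  then show "realises n (op_exang n E) Z A \<delta> X"
    using a complex_op_iff'[OF additive_category_axioms] by (simp add: realises_def realised_by_def cplx_between_def sc)
next
  note sc = same_cat_cong4(1)[OF same_cat_op_exang] same_cat_cong[OF same_cat_op_exang]
  assume a: "realises n (op_exang n E) Z A \<delta> X"
  then have d: "A \<in> Ob E" "Z \<in> Ob E" "\<delta> \<in> carrier (Ext E Z A)" by (auto simp: realises_def)
  obtain X0 where X0: "realises n E A Z \<delta> X0" using realises_exists[OF d] .
  have "htpy_class n (op_exang n E) X = rev_cplx (Suc n) -` Rlz E Z A \<delta>"
    using a by (simp add: realises_def realised_by_def)
  then have 1: "htpy_class n (op_cat E) X = htpy_class n (op_cat E) (rev_cplx (Suc n) X0)"
    using realises_Rlz[OF X0] htpy_class_op[OF additive_category_axioms rzD(6)[OF X0]] by (simp add: sc)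
  interpret op: additive_category "op_cat E" by (rule op)
  have 2: "rev_cplx (Suc n) X0 \<in> htpy_class n (op_cat E) (rev_cplx (Suc n) X0)"
    by (rule op.htpy_class_self[OF exact_seq_op[OF additive_category_axioms realises_exact[OF X0]]])
  have X: "complex (op_cat E) (Suc n) X" "obj X 0 = Z" "obj X (Suc n) = A"
    using a by (auto simp: realises_def realised_by_def cplx_between_def sc)
  have "X \<in> htpy_class n (op_cat E) (rev_cplx (Suc n) X0)"
    using 2[folded 1] X rzD(4,5)[OF X0] htpy_equiv_sym by (auto simp: htpy_class_def cplx_between_def)
  then have "rev_cplx (Suc n) X \<in> htpy_class n E X0"
    using htpy_class_op[OF additive_category_axioms rzD(6)[OF X0]] by blast
  then show "realises n E A Z \<delta> (rev_cplx (Suc n) X)" using realises_class[OF X0] by blast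
qed

lemma realises_op':
  "realises n (op_exang n E) Z A \<delta> (rev_cplx (Suc n) X) \<longleftrightarrow> realises n E A Z \<delta> X"
  unfolding realises_op using realises_class htpy_class_self htpy_class_closed agree_rev_rev agree_sym realises_exact
  by metis

lemma realises_agree: "agree (Suc n) X Y \<Longrightarrow> realises n E A Z \<delta> X \<Longrightarrow> realises n E A Z \<delta> Y"
  using realises_class htpy_class_closed htpy_class_self realises_exact by metis

lemma exact_exang_op: "exact_exang n (op_exang n E)"
proof -
  interpret op: additive_bifunctor "op_exang n E" by (rule additive_bifunctor_op)
  note sc = same_cat_cong4[OF same_cat_op_exang] same_cat_cong2[OF same_cat_op_exang] same_cat_cong[OF same_cat_op_exang]
  have 1: "exact_realisation n (op_exang n E)"
  proof
    fix A Z \<delta> assume a: "A \<in> Ob (op_exang n E)" "Z \<in> Ob (op_exang n E)" "\<delta> \<in> carrier (Ext (op_exang n E) Z A)"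
    then obtain X where X: "realises n E Z A \<delta> X" using realises_exists[of Z A \<delta>] by auto
    then show "\<exists>X. realised_by n (op_exang n E) A Z \<delta> X" using realises_op' unfolding realises_def by blast
  next
    fix A Z B D \<delta> \<rho> a c X Y
    assume a: "A \<in> Ob (op_exang n E)" "Z \<in> Ob (op_exang n E)" "B \<in> Ob (op_exang n E)" "D \<in> Ob (op_exang n E)"
      "\<delta> \<in> carrier (Ext (op_exang n E) Z A)" "\<rho> \<in> carrier (Ext (op_exang n E) D B)"
      "a \<in> arr (op_exang n E) A B" "c \<in> arr (op_exang n E) Z D"
      "push (op_exang n E) Z a \<delta> = pull (op_exang n E) B c \<rho>"
      "realised_by n (op_exang n E) A Z \<delta> X" "realised_by n (op_exang n E) B D \<rho> Y"
    have X: "realises n E Z A \<delta> (rev_cplx (Suc n) X)" "realises n E D B \<rho> (rev_cplx (Suc n) Y)"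
      using a realises_op[of A Z \<delta> X] realises_op[of B D \<rho> Y] unfolding realises_def by auto
    obtain f where f: "chain_map E (Suc n) (rev_cplx (Suc n) Y) (rev_cplx (Suc n) X) f" "f 0 = c" "f (Suc n) = a"
      by (rule realises_lift[OF X(2,1), of c a]) (use a in \<open>simp_all add: push_def pull_def\<close>)
    have "chain_map (op_cat E) (Suc n) X Y (\<lambda>i. f (Suc n - i))"
      using chain_map_op[OF additive_category_axioms rzD(6)[OF X(2)] rzD(6)[OF X(1)] f(1)]
        chain_map_agree[OF agree_rev_rev agree_rev_rev] by blast
    then show "\<exists>f. chain_map (op_exang n E) (n + 1) X Y f \<and> f 0 = a \<and> f (n + 1) = c"
      using f by (intro exI[of _ "\<lambda>i. f (Suc n - i)"]) (simp add: sc)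
  next
    fix A Z \<delta> X assume a: "A \<in> Ob (op_exang n E)" "Z \<in> Ob (op_exang n E)" "\<delta> \<in> carrier (Ext (op_exang n E) Z A)"
      "realised_by n (op_exang n E) A Z \<delta> X"
    then have X: "realises n E Z A \<delta> (rev_cplx (Suc n) X)" using realises_op[of A Z \<delta> X] unfolding realises_def by auto
    note r = rzD[OF X]
    have c: "complex (op_cat E) (Suc n) X" using r(6) complex_op_iff'[OF additive_category_axioms] by simp
    have "covariant_exact n (op_exang n E) X \<delta>"
      using r(11) covariant_exact_cong[OF agree_rev_rev n1, of "op_exang n E" "op_exang n E" X \<delta>]
      by (simp add: exangle_def same_cat_def)
    moreover have "covariant_exact n (op_exang n (op_exang n E)) (rev_cplx (Suc n) X) \<delta>"
      using r(11) covariant_exact_cong[OF _ n1, of "rev_cplx (Suc n) X" "rev_cplx (Suc n) X" "op_exang n (op_exang n E)" E \<delta>]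
      by (simp add: exangle_def same_cat_def agree_def fun_eq_iff)
    ultimately show "exangle n (op_exang n E) X \<delta>"
      using r c by (simp add: exangle_def attached_def push_def pull_def sc)
  next
    fix A N assume a: "A \<in> Ob (op_exang n E)" "zero_object (op_exang n E) N"
    have N: "zero_object E N" using a(2) by (simp add: sc)
    let ?X = "Cplx (\<lambda>i. if i < n then N else A)
                 (\<lambda>i. if i = n then Idn E A else if i + 1 = n then zr E N A else zr E N N)"
    let ?Y = "Cplx (\<lambda>i. if i \<le> 1 then A else N) (\<lambda>i. if i = 0 then Idn E A else if i = 1 then zr E N A else zr E N N)"
    have "realises n E N A \<one>\<^bsub>Ext E A N\<^esub> ?X"
      using R2_right[of A N] a N zero_ob_eq(1)[OF N] by (simp add: realises_def)
    moreover have "agree (Suc n) ?X (rev_cplx (Suc n) ?Y)" using n1 by (auto simp: agree_def)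
    ultimately have "realises n (op_exang n E) A N \<one>\<^bsub>Ext E A N\<^esub> ?Y" using realises_op realises_agree by blast
    then show "realised_by n (op_exang n E) A N \<one>\<^bsub>Ext (op_exang n E) N A\<^esub>
      (Cplx (\<lambda>i. if i \<le> 1 then A else N)
        (\<lambda>i. if i = 0 then Idn (op_exang n E) A else if i = 1 then zr (op_exang n E) A N else zr (op_exang n E) N N))"
      by (simp add: realises_def cong: if_cong)
  next
    fix A N assume a: "A \<in> Ob (op_exang n E)" "zero_object (op_exang n E) N"
    have N: "zero_object E N" using a(2) by (simp add: sc)
    let ?X = "Cplx (\<lambda>i. if i \<le> 1 then A else N) (\<lambda>i. if i = 0 then Idn E A else if i = 1 then zr E A N else zr E N N)"
    let ?Y = "Cplx (\<lambda>i. if i < n then N else A)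
                 (\<lambda>i. if i = n then Idn E A else if i + 1 = n then zr E A N else zr E N N)"
    have "realises n E A N \<one>\<^bsub>Ext E N A\<^esub> ?X"
      using R2_left[of A N] a N zero_ob_eq(1)[OF N] by (simp add: realises_def)
    moreover have "agree (Suc n) ?X (rev_cplx (Suc n) ?Y)" using n1 by (auto simp: agree_def)
    ultimately have "realises n (op_exang n E) N A \<one>\<^bsub>Ext E N A\<^esub> ?Y" using realises_op realises_agree by blast
    then show "realised_by n (op_exang n E) N A \<one>\<^bsub>Ext (op_exang n E) A N\<^esub>
      (Cplx (\<lambda>i. if i < n then N else A)
        (\<lambda>i. if i = n then Idn (op_exang n E) A else if i + 1 = n then zr (op_exang n E) N A else zr (op_exang n E) N N))"
      by (simp add: realises_def cong: if_cong)
  qed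
  have 2: "exact_seq n (op_exang n E) X" if "realises n (op_exang n E) A Z \<delta> X" for A Z \<delta> X
  proof -
    have X: "realises n E Z A \<delta> (rev_cplx (Suc n) X)" using that by (simp add: realises_op)
    have "exact_seq n (op_cat E) (rev_cplx (Suc n) (rev_cplx (Suc n) X))"
      by (rule exact_seq_op[OF additive_category_axioms realises_exact[OF X]])
    moreover have "agree (Suc n) (rev_cplx (Suc n) (rev_cplx (Suc n) X)) X" by (rule agree_rev_rev)
    ultimately show ?thesis
      using exact_seq_agree by (metis exact_seq_def sc(1) same_cat_cong[OF same_cat_op_exang] same_cat_cong2[OF same_cat_op_exang])
  qed
  show ?thesis
    by (intro exact_exang.intro exact_exang_axioms.intro op.additive_bifunctor_axioms 1 n1 2)
qed

end


section \<open>Cones\<close>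

text \<open>
  The mapping cone of \<open>f\<close> is the twisted cone of \<open>f\<close> for the complex \<open>X\<close>
  with negated differentials, with respect to which \<open>f\<close> anticommutes. Without signs the
  construction is self-dual, which reduces left exactness to right exactness.
\<close>

definition twisted_cone ::
  "('o, 'm, 'z) addcat_scheme \<Rightarrow> nat \<Rightarrow> ('o, 'm) cplx \<Rightarrow> ('o, 'm) cplx \<Rightarrow> (nat \<Rightarrow> 'm) \<Rightarrow> ('o, 'm) cplx
    \<Rightarrow> (nat \<Rightarrow> 'm) \<Rightarrow> (nat \<Rightarrow> 'm) \<Rightarrow> (nat \<Rightarrow> 'm) \<Rightarrow> (nat \<Rightarrow> 'm) \<Rightarrow> bool" where
  "twisted_cone C m X Y f M i1 i2 p1 p2 \<longleftrightarrow>
     obj M 0 = obj X 0 \<and> obj M (Suc m) = obj Y m \<and>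
     (\<forall>j<m. biproduct C (obj X (Suc j)) (obj Y j) (obj M (Suc j)) (i1 j) (i2 j) (p1 j) (p2 j)) \<and>
     dif M 0 = (i1 0 \<cdot>\<^bsub>C\<^esub> dif X 0) \<oplus>\<^bsub>C\<^esub> (i2 0 \<cdot>\<^bsub>C\<^esub> f 0) \<and>
     (\<forall>j. Suc j < m \<longrightarrow> dif M (Suc j) =
        (i1 (Suc j) \<cdot>\<^bsub>C\<^esub> (dif X (Suc j) \<cdot>\<^bsub>C\<^esub> p1 j)) \<oplus>\<^bsub>C\<^esub>
          ((i2 (Suc j) \<cdot>\<^bsub>C\<^esub> (f (Suc j) \<cdot>\<^bsub>C\<^esub> p1 j)) \<oplus>\<^bsub>C\<^esub> (i2 (Suc j) \<cdot>\<^bsub>C\<^esub> (dif Y j \<cdot>\<^bsub>C\<^esub> p2 j)))) \<and>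
     dif M m = (f m \<cdot>\<^bsub>C\<^esub> p1 (m - 1)) \<oplus>\<^bsub>C\<^esub> (dif Y (m - 1) \<cdot>\<^bsub>C\<^esub> p2 (m - 1))"

definition anticommuting ::
  "('o, 'm, 'z) addcat_scheme \<Rightarrow> nat \<Rightarrow> ('o, 'm) cplx \<Rightarrow> ('o, 'm) cplx \<Rightarrow> (nat \<Rightarrow> 'm) \<Rightarrow> bool" where
  "anticommuting C m X Y f \<longleftrightarrow>
     (\<forall>i\<le>m. mor C (f i) \<and> src C (f i) = obj X i \<and> tgt C (f i) = obj Y i) \<and>
     (\<forall>i<m. (f (Suc i) \<cdot>\<^bsub>C\<^esub> dif X i) \<oplus>\<^bsub>C\<^esub> (dif Y i \<cdot>\<^bsub>C\<^esub> f i) = zr C (obj X i) (obj Y (Suc i)))"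

definition neg_cplx :: "('o, 'm, 'z) addcat_scheme \<Rightarrow> ('o, 'm) cplx \<Rightarrow> ('o, 'm) cplx" where
  "neg_cplx C X = Cplx (obj X) (\<lambda>i. \<ominus>\<^bsub>C\<^esub> dif X i)"

lemma neg_cplx_sel [simp]: "obj (neg_cplx C X) = obj X" "dif (neg_cplx C X) i = \<ominus>\<^bsub>C\<^esub> dif X i"
  by (simp_all add: neg_cplx_def)

lemma shift_cplx_sel [simp]: "obj (shift_cplx X) i = obj X (Suc i)" "dif (shift_cplx X) i = dif X (Suc i)"
  by (simp_all add: shift_cplx_def)

context additive_category
begin

lemma complex_neg: "complex C m X \<Longrightarrow> complex C m (neg_cplx C X)"
  by (rule complexI) (auto simp: complexD)

lemma complex_shift: "complex C (Suc m) X \<Longrightarrow> complex C m (shift_cplx X)"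
  by (rule complexI) (auto simp: complexD)

lemma tconeD:
  assumes T: "twisted_cone C m X Y f M i1 i2 p1 p2" and X: "complex C m X" and Y: "complex C m Y" and m: "1 \<le> m"
    and f: "anticommuting C m X Y f"
  shows "obj M 0 = obj X 0" "obj M (Suc m) = obj Y m"
    "j < m \<Longrightarrow> biproduct C (obj X (Suc j)) (obj Y j) (obj M (Suc j)) (i1 j) (i2 j) (p1 j) (p2 j)"
    "mor C (dif M 0) \<and> src C (dif M 0) = obj M 0 \<and> tgt C (dif M 0) = obj M 1"
    "Suc j < m \<Longrightarrow> mor C (dif M (Suc j)) \<and> src C (dif M (Suc j)) = obj M (Suc j) \<and> tgt C (dif M (Suc j)) = obj M (Suc (Suc j))"
    "mor C (dif M m) \<and> src C (dif M m) = obj M m \<and> tgt C (dif M m) = obj M (Suc m)"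
    "p1 0 \<cdot> dif M 0 = dif X 0" "p2 0 \<cdot> dif M 0 = f 0"
    "Suc j < m \<Longrightarrow> dif M (Suc j) \<cdot> i1 j = (i1 (Suc j) \<cdot> dif X (Suc j)) \<oplus> (i2 (Suc j) \<cdot> f (Suc j))"
    "Suc j < m \<Longrightarrow> dif M (Suc j) \<cdot> i2 j = i2 (Suc j) \<cdot> dif Y j"
    "dif M m \<cdot> i1 (m - 1) = f m" "dif M m \<cdot> i2 (m - 1) = dif Y (m - 1)"
    "dif M 0 = (i1 0 \<cdot> dif X 0) \<oplus> (i2 0 \<cdot> f 0)"
proof -
  note x = complexD[OF X] complexD[OF Y]
  note t = T[unfolded twisted_cone_def]
  have ff: "mor C (f i)" "src C (f i) = obj X i" "tgt C (f i) = obj Y i" if "i \<le> m" for i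
    using f that by (auto simp: anticommuting_def)
  show 1: "obj M 0 = obj X 0" "obj M (Suc m) = obj Y m" using t by auto
  show b: "j < m \<Longrightarrow> biproduct C (obj X (Suc j)) (obj Y j) (obj M (Suc j)) (i1 j) (i2 j) (p1 j) (p2 j)" for j
    using t by auto
  note bm = biprod_mor[OF b] and be = biprod_eq[OF b] biprod_eq'[OF b]
  have d0: "dif M 0 = (i1 0 \<cdot> dif X 0) \<oplus> (i2 0 \<cdot> f 0)" using t by blast
  have ds: "Suc j < m \<Longrightarrow> dif M (Suc j) = (i1 (Suc j) \<cdot> (dif X (Suc j) \<cdot> p1 j)) \<oplus>
          ((i2 (Suc j) \<cdot> (f (Suc j) \<cdot> p1 j)) \<oplus> (i2 (Suc j) \<cdot> (dif Y j \<cdot> p2 j)))" for j using t by blast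
  have dm: "dif M m = (f m \<cdot> p1 (m - 1)) \<oplus> (dif Y (m - 1) \<cdot> p2 (m - 1))" using t by blast
  have m': "0 < m" "m - 1 < m" "Suc (m - 1) = m" using m by auto
  note bm0 = bm[OF m'(1)] and bmm = bm[OF m'(2), unfolded m'(3)]
  show "mor C (dif M 0) \<and> src C (dif M 0) = obj M 0 \<and> tgt C (dif M 0) = obj M 1"
    unfolding d0 using m' x[of 0] ff[of 0] bm0 1 by simp
  show "mor C (dif M (Suc j)) \<and> src C (dif M (Suc j)) = obj M (Suc j) \<and> tgt C (dif M (Suc j)) = obj M (Suc (Suc j))" if "Suc j < m"
    unfolding ds[OF that] using that x ff[of "Suc j"] bm[of j] bm[of "Suc j"] by simp
  show "mor C (dif M m) \<and> src C (dif M m) = obj M m \<and> tgt C (dif M m) = obj M (Suc m)"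
    unfolding dm using m' x(7-10)[of "m - 1"] ff[of m] bmm 1 by simp
  show "p1 0 \<cdot> dif M 0 = dif X 0" "p2 0 \<cdot> dif M 0 = f 0"
    unfolding d0 using m' x[of 0] ff[of 0] bm0 be[OF m'(1)] by simp_all
  show "dif M (Suc j) \<cdot> i1 j = (i1 (Suc j) \<cdot> dif X (Suc j)) \<oplus> (i2 (Suc j) \<cdot> f (Suc j))"
    "dif M (Suc j) \<cdot> i2 j = i2 (Suc j) \<cdot> dif Y j" if "Suc j < m"
    unfolding ds[OF that] using that x ff[of "Suc j"] bm[of j] bm[of "Suc j"] be[of j] by simp_all
  show "dif M m \<cdot> i1 (m - 1) = f m" "dif M m \<cdot> i2 (m - 1) = dif Y (m - 1)"
    unfolding dm using m' x(7-10)[of "m - 1"] ff[of m] bmm be[OF m'(2)] m'(3) by simp_all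
  show "dif M 0 = (i1 0 \<cdot> dif X 0) \<oplus> (i2 0 \<cdot> f 0)" by (rule d0)
qed

lemma twisted_cone_cases:
  assumes "i \<le> m" "1 \<le> m" obtains "i = 0" | j where "i = Suc j" "Suc j < m" | "i = m" "0 < i"
  using assms by (cases i) (auto simp: le_less)

lemma twisted_cone_complex:
  assumes T: "twisted_cone C m X Y f M i1 i2 p1 p2" and X: "complex C m X" and Y: "complex C m Y" and m: "1 \<le> m"
    and f: "anticommuting C m X Y f"
  shows "complex C (Suc m) M"
proof (rule complexI)
  note t = tconeD[OF assms] and x = complexD[OF X] complexD[OF Y]
  have ff: "mor C (f i)" "src C (f i) = obj X i" "tgt C (f i) = obj Y i" if "i \<le> m" for i
    using f that by (auto simp: anticommuting_def)
  have ac: "(f (Suc i) \<cdot> dif X i) \<oplus> (dif Y i \<cdot> f i) = zr C (obj X i) (obj Y (Suc i))" if "i < m" for i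
    using f that by (auto simp: anticommuting_def)
  note bm = biprod_mor[OF t(3)]
  have mc: "mor C (dif M i) \<and> src C (dif M i) = obj M i \<and> tgt C (dif M i) = obj M (Suc i)" if "i < Suc m" for i
    by (rule twisted_cone_cases[of i m]) (use that t(4-6) m in auto)
  then show "mor C (dif M i) \<and> src C (dif M i) = obj M i \<and> tgt C (dif M i) = obj M (Suc i)" if "i < Suc m" for i
    using that .
  have ob: "obj M i \<in> Ob C" if "i \<le> Suc m" for i
    using that mc[of i] mc[of m] mor_ob by (metis le_Suc_eq less_Suc_eq_le lessI)
  then show "obj M i \<in> Ob C" if "i \<le> Suc m" for i using that .
  have step: "dif M (Suc i) \<cdot> i1 i = (if Suc i < m then (i1 (Suc i) \<cdot> dif X (Suc i)) \<oplus> (i2 (Suc i) \<cdot> f (Suc i)) else f m)"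
     "dif M (Suc i) \<cdot> i2 i = (if Suc i < m then i2 (Suc i) \<cdot> dif Y i else dif Y i)" if "i < m" for i
    using t(9)[of i] t(10)[of i] t(11,12) that by (auto simp: not_less le_Suc_eq less_Suc_eq_le Suc_le_eq)
  fix i assume i: "Suc i < Suc m"
  then have im: "i < m" by simp
  note m1 = mc[of i] mc[of "Suc i"]
  show "dif M (Suc i) \<cdot> dif M i = zr C (obj M i) (obj M (Suc (Suc i)))"
  proof (cases i)
    case 0
    note b = bm[OF im] and mm = m1
    have s: "dif M (Suc 0) \<cdot> (i1 0 \<cdot> dif X 0) = (dif M (Suc 0) \<cdot> i1 0) \<cdot> dif X 0"
      "dif M (Suc 0) \<cdot> (i2 0 \<cdot> f 0) = (dif M (Suc 0) \<cdot> i2 0) \<cdot> f 0"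
      using m1 b x[of 0] ff[of 0] 0 im by simp_all
    have "dif M (Suc 0) \<cdot> dif M 0 = (dif M (Suc 0) \<cdot> (i1 0 \<cdot> dif X 0)) \<oplus> (dif M (Suc 0) \<cdot> (i2 0 \<cdot> f 0))"
      unfolding t(13) using m1 b x[of 0] ff[of 0] 0 im by simp
    also have "\<dots> = zr C (obj M 0) (obj M (Suc (Suc 0)))"
    proof (cases "Suc 0 < m")
      case True
      have "(i2 (Suc 0) \<cdot> (f (Suc 0) \<cdot> dif X 0)) \<oplus> (i2 (Suc 0) \<cdot> (dif Y 0 \<cdot> f 0)) = i2 (Suc 0) \<cdot> ((f (Suc 0) \<cdot> dif X 0) \<oplus> (dif Y 0 \<cdot> f 0))"
        using True x[of 0] ff[of 0] ff[of 1] bm[OF True] by simp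
      also have "\<dots> = zr C (obj X 0) (obj M (Suc (Suc 0)))" unfolding ac[OF im, unfolded 0] using bm[OF True] x True by simp
      finally have "(i2 (Suc 0) \<cdot> (f (Suc 0) \<cdot> dif X 0)) \<oplus> (i2 (Suc 0) \<cdot> (dif Y 0 \<cdot> f 0)) = zr C (obj X 0) (obj M (Suc (Suc 0)))" .
      then show ?thesis unfolding s step[OF im, unfolded 0] using True x[of 0] x[of 1] ff[of 0] ff[of 1] bm[OF True] t(1) by simp
    next
      case False
      then have m1: "m = Suc 0" using 0 im by simp
      show ?thesis unfolding s step[OF im, unfolded 0] using False ac[OF im] 0 m1 t(1,2) by simp
    qed
    finally show ?thesis using 0 by simp
  next
    case (Suc k)
    have k: "Suc k < m" "k < m" using Suc im by auto
    note b = bm[OF k(1)] bm[OF k(2)]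
    have mk: "mor C (dif M (Suc k))" "src C (dif M (Suc k)) = obj M (Suc k)" "tgt C (dif M (Suc k)) = obj M (Suc (Suc k))"
      "mor C (dif M (Suc (Suc k)))" "src C (dif M (Suc (Suc k))) = obj M (Suc (Suc k))" "tgt C (dif M (Suc (Suc k))) = obj M (Suc (Suc (Suc k)))"
      using mc[of "Suc k"] mc[of "Suc (Suc k)"] k by auto
    have s: "dif M (Suc (Suc k)) \<cdot> (i1 (Suc k) \<cdot> z) = (dif M (Suc (Suc k)) \<cdot> i1 (Suc k)) \<cdot> z" if "mor C z" "tgt C z = obj X (Suc (Suc k))" for z
      using mk b that by simp
    have s': "dif M (Suc (Suc k)) \<cdot> (i2 (Suc k) \<cdot> z) = (dif M (Suc (Suc k)) \<cdot> i2 (Suc k)) \<cdot> z" if "mor C z" "tgt C z = obj Y (Suc k)" for z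
      using mk b that by simp
    have e1: "(dif M (Suc (Suc k)) \<cdot> dif M (Suc k)) \<cdot> i1 k = zr C (obj X (Suc k)) (obj M (Suc (Suc (Suc k))))"
    proof -
      have "(dif M (Suc (Suc k)) \<cdot> dif M (Suc k)) \<cdot> i1 k = (dif M (Suc (Suc k)) \<cdot> (i1 (Suc k) \<cdot> dif X (Suc k))) \<oplus> (dif M (Suc (Suc k)) \<cdot> (i2 (Suc k) \<cdot> f (Suc k)))"
        using t(9)[OF k(1)] mk b x[of "Suc k"] ff[of "Suc k"] k by simp
      also have "\<dots> = zr C (obj X (Suc k)) (obj M (Suc (Suc (Suc k))))"
      proof (cases "Suc (Suc k) < m")
        case True
        let ?K = "Suc (Suc k)"
        have "(i2 ?K \<cdot> (f ?K \<cdot> dif X (Suc k))) \<oplus> (i2 ?K \<cdot> (dif Y (Suc k) \<cdot> f (Suc k))) = i2 ?K \<cdot> ((f ?K \<cdot> dif X (Suc k)) \<oplus> (dif Y (Suc k) \<cdot> f (Suc k)))"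
          using True x[of "Suc k"] ff[of ?K] ff[of "Suc k"] bm[OF True] by simp
        also have "\<dots> = zr C (obj X (Suc k)) (obj M (Suc ?K))" unfolding ac[OF k(1)] using bm[OF True] x True by simp
        finally have "(i2 ?K \<cdot> (f ?K \<cdot> dif X (Suc k))) \<oplus> (i2 ?K \<cdot> (dif Y (Suc k) \<cdot> f (Suc k))) = zr C (obj X (Suc k)) (obj M (Suc ?K))" .
        then show ?thesis unfolding s[OF x(2,4)[OF k(1)]] s'[OF ff(1,3)[OF less_imp_le_nat[OF k(1)]]] step[OF k(1)]
          using True x[of "Suc k"] x[of ?K] ff[of "Suc k"] ff[of ?K] bm[OF True] by simp
      next
        case False
        then have mm: "m = Suc (Suc k)" using k by simp
        show ?thesis unfolding s[OF x(2,4)[OF k(1)]] s'[OF ff(1,3)[OF less_imp_le_nat[OF k(1)]]] step[OF k(1)]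
          using False ac[OF k(1)] mm t(2) by simp
      qed
      finally show ?thesis .
    qed
    have e2: "(dif M (Suc (Suc k)) \<cdot> dif M (Suc k)) \<cdot> i2 k = zr C (obj Y k) (obj M (Suc (Suc (Suc k))))"
    proof -
      have "(dif M (Suc (Suc k)) \<cdot> dif M (Suc k)) \<cdot> i2 k = dif M (Suc (Suc k)) \<cdot> (i2 (Suc k) \<cdot> dif Y k)"
        using t(10)[OF k(1)] mk b x[of k] k by simp
      also have "\<dots> = zr C (obj Y k) (obj M (Suc (Suc (Suc k))))"
        unfolding s'[OF x(8,10)[OF k(2)]] step[OF k(1)]
        using x[of k] x[of "Suc k"] k bm[of "Suc (Suc k)"] t(2) by (auto simp: not_less le_Suc_eq)
      finally show ?thesis .
    qed
    show ?thesis unfolding Suc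
      by (rule biprod_coeqI[OF t(3)[OF k(2)]]) (use mk ob[of "Suc k"] ob[of "Suc (Suc (Suc k))"] k b e1 e2 in auto)
  qed
qed

text \<open>
  Exactness of \<open>X\<close> and \<open>Y\<close> is required degree by degree, because the complexes in
  question are truncated: the cones of (EA2) omit degree \<open>0\<close> and those of \<open>n\<close>-pushouts
  omit degree \<open>n + 1\<close>. The conditions \<open>E\<close>, \<open>H0\<close> and \<open>HL\<close>
  replace exactness at the ends.
\<close>

lemma twisted_cone_right_exact:
  assumes T: "twisted_cone C m X Y f M i1 i2 p1 p2" and X: "complex C m X" and Y: "complex C m Y" and m: "1 \<le> m"
    and f: "anticommuting C m X Y f"
    and E: "\<And>u. mor C u \<Longrightarrow> src C u = obj Y m \<Longrightarrow> u \<cdot> f m = zr C (obj X m) (tgt C u) \<Longrightarrow>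
        u \<cdot> dif Y (m - 1) = zr C (obj Y (m - 1)) (tgt C u) \<Longrightarrow> u = zr C (obj Y m) (tgt C u)"
    and H0: "\<And>a b. mor C a \<Longrightarrow> mor C b \<Longrightarrow> src C a = obj X 1 \<Longrightarrow> src C b = obj Y 0 \<Longrightarrow> tgt C a = tgt C b \<Longrightarrow>
        (a \<cdot> dif X 0) \<oplus> (b \<cdot> f 0) = zr C (obj X 0) (tgt C b) \<Longrightarrow>
        \<exists>b'. mor C b' \<and> src C b' = obj Y 1 \<and> tgt C b' = tgt C b \<and> b = b' \<cdot> dif Y 0"
    and YE: "\<And>j b. Suc j < m \<Longrightarrow> mor C b \<Longrightarrow> src C b = obj Y (Suc j) \<Longrightarrow> b \<cdot> dif Y j = zr C (obj Y j) (tgt C b) \<Longrightarrow>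
        \<exists>b'. mor C b' \<and> src C b' = obj Y (Suc (Suc j)) \<and> tgt C b' = tgt C b \<and> b = b' \<cdot> dif Y (Suc j)"
    and XE: "\<And>j c. Suc j < m \<Longrightarrow> mor C c \<Longrightarrow> src C c = obj X (Suc j) \<Longrightarrow> c \<cdot> dif X j = zr C (obj X j) (tgt C c) \<Longrightarrow>
        \<exists>a'. mor C a' \<and> src C a' = obj X (Suc (Suc j)) \<and> tgt C a' = tgt C c \<and> c = a' \<cdot> dif X (Suc j)"
    and HL: "\<And>c. mor C c \<Longrightarrow> src C c = obj X m \<Longrightarrow> c \<cdot> dif X (m - 1) = zr C (obj X (m - 1)) (tgt C c) \<Longrightarrow>
        \<exists>b''. mor C b'' \<and> src C b'' = obj Y m \<and> tgt C b'' = tgt C c \<and> b'' \<cdot> dif Y (m - 1) = zr C (obj Y (m - 1)) (tgt C c) \<and> b'' \<cdot> f m = c"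
  shows "right_exact C (Suc m) M"
proof -
  note t = tconeD[OF T X Y m f] and x = complexD[OF X] complexD[OF Y]
  have M: "complex C (Suc m) M" by (rule twisted_cone_complex[OF T X Y m f])
  note mx = complexD[OF M]
  have ff: "mor C (f i)" "src C (f i) = obj X i" "tgt C (f i) = obj Y i" if "i \<le> m" for i
    using f that by (auto simp: anticommuting_def)
  have ac: "(f (Suc i) \<cdot> dif X i) \<oplus> (dif Y i \<cdot> f i) = zr C (obj X i) (obj Y (Suc i))" if "i < m" for i
    using f that by (auto simp: anticommuting_def)
  note bm = biprod_mor[OF t(3)]
  have m': "0 < m" "m - 1 < m" "Suc (m - 1) = m" using m by auto
  have 1: "u = zr C (obj M (Suc m)) (tgt C u)"
    if u: "mor C u" "src C u = obj M (Suc m)" "u \<cdot> dif M m = zr C (obj M m) (tgt C u)" for u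
  proof -
    note b = bm[OF m'(2)] and d = mx(1-4)[of m]
    have "u \<cdot> (dif M m \<cdot> i1 (m - 1)) = zr C (obj X m) (tgt C u)"
      by (subst comp_eq[OF u(3)]) (use u d b m'(3) in auto)
    moreover have "u \<cdot> (dif M m \<cdot> i2 (m - 1)) = zr C (obj Y (m - 1)) (tgt C u)"
      by (subst comp_eq[OF u(3)]) (use u d b m'(3) in auto)
    ultimately show ?thesis using E[of u] u t(2,11,12) by simp
  qed
  have 2: "\<exists>v. mor C v \<and> src C v = obj M (Suc (Suc j)) \<and> tgt C v = tgt C u \<and> u = v \<cdot> dif M (Suc j)"
    if j: "j < m" and u: "mor C u" "src C u = obj M (Suc j)" "u \<cdot> dif M j = zr C (obj M j) (tgt C u)" for j u
  proof -
    note b = bm[OF j] and d = mx(1-4)[of j] mx(1-4)[of "Suc j"]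
    define W where "W = tgt C u"
    define a where "a = u \<cdot> i1 j" define c where "c = u \<cdot> i2 j"
    have ab: "mor C a" "src C a = obj X (Suc j)" "tgt C a = W" "mor C c" "src C c = obj Y j" "tgt C c = W" "W \<in> Ob C"
      using u b by (auto simp: a_def c_def W_def)
    have "((a \<cdot> dif X j) \<oplus> (c \<cdot> f j) = zr C (obj X j) W) \<and>
        (\<exists>b'. mor C b' \<and> src C b' = obj Y (Suc j) \<and> tgt C b' = W \<and> c = b' \<cdot> dif Y j)"
    proof (cases j)
      case 0
      have "(a \<cdot> dif X 0) \<oplus> (c \<cdot> f 0) = u \<cdot> dif M 0"
        unfolding t(13) a_def c_def using u b 0 j x(1-4)[of 0] ff[of 0] by simp
      also have "\<dots> = zr C (obj X 0) W" using u(3) 0 t(1) by (simp add: W_def)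
      finally have "(a \<cdot> dif X 0) \<oplus> (c \<cdot> f 0) = zr C (obj X 0) W" .
      then show ?thesis using H0[of a c] ab 0 by auto
    next
      case (Suc k)
      have k: "Suc k < m" "k < m" using j Suc by auto
      note b' = bm[OF k(2)] bm[OF k(1)] and d' = mx(1-4)[of "Suc k"]
      have "(a \<cdot> dif X j) \<oplus> (c \<cdot> f j) = u \<cdot> (dif M (Suc k) \<cdot> i1 k)"
        unfolding t(9)[OF k(1)] a_def c_def using u b Suc k x(1-4)[of "Suc k"] ff[of "Suc k"] by simp
      also have "\<dots> = zr C (obj X j) W"
        by (subst comp_eq[OF u(3)[unfolded Suc]]) (use u d' b' k ab Suc in \<open>auto simp: W_def\<close>)
      finally have 1: "(a \<cdot> dif X j) \<oplus> (c \<cdot> f j) = zr C (obj X j) W" .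
      have "c \<cdot> dif Y k = u \<cdot> (dif M (Suc k) \<cdot> i2 k)"
        unfolding t(10)[OF k(1)] a_def c_def using u b Suc k x(7-10)[of k] by simp
      also have "\<dots> = zr C (obj Y k) W"
        by (subst comp_eq[OF u(3)[unfolded Suc]]) (use u d' b' k ab Suc in \<open>auto simp: W_def\<close>)
      finally show ?thesis using 1 YE[of k c] k ab Suc by auto
    qed
    then obtain b' where b': "(a \<cdot> dif X j) \<oplus> (c \<cdot> f j) = zr C (obj X j) W"
      "mor C b'" "src C b' = obj Y (Suc j)" "tgt C b' = W" "c = b' \<cdot> dif Y j" by blast
    define e where "e = a \<oplus> \<ominus> (b' \<cdot> f (Suc j))"
    note xj = x(1-4)[of j] x(7-10)[of j] ff[of j] ff[of "Suc j"]
    have em: "mor C e" "src C e = obj X (Suc j)" "tgt C e = W"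
      using ab b' j xj by (auto simp: e_def)
    have ae: "a = (b' \<cdot> f (Suc j)) \<oplus> e" unfolding e_def
      by (rule diffD[OF refl]) (use ab b' j xj in auto)
    have "f (Suc j) \<cdot> dif X j = \<ominus> (dif Y j \<cdot> f j)"
      using neg_unique[of "dif Y j \<cdot> f j" "f (Suc j) \<cdot> dif X j"] ac[OF j] j xj
      by (simp add: add_comm)
    then have "e \<cdot> dif X j = (a \<cdot> dif X j) \<oplus> (c \<cdot> f j)"
      unfolding e_def using ab b' j xj by simp
    then have e0: "e \<cdot> dif X j = zr C (obj X j) W" using b'(1) by simp
    show ?thesis
    proof (cases "Suc j < m")
      case True
      obtain a' where a': "mor C a'" "src C a' = obj X (Suc (Suc j))" "tgt C a' = W" "e = a' \<cdot> dif X (Suc j)"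
        using XE[OF True, of e] em e0 by auto
      note bt = bm[OF True] and xs = x(1-4)[of "Suc j"]
      let ?v = "(a' \<cdot> p1 (Suc j)) \<oplus> (b' \<cdot> p2 (Suc j))"
      have vm: "mor C ?v" "src C ?v = obj M (Suc (Suc j))" "tgt C ?v = W"
        using a' b' bt by auto
      have vi: "?v \<cdot> i1 (Suc j) = a'" "?v \<cdot> i2 (Suc j) = b'"
        using a' b' bt biprod_eq[OF t(3)[OF True]] by simp_all
      have vz: "?v \<cdot> (i1 (Suc j) \<cdot> z) = a' \<cdot> z" if "mor C z" "tgt C z = obj X (Suc (Suc j))" for z
        using comp_eq[OF vi(1)] vm bt that by auto
      have vz2: "?v \<cdot> (i2 (Suc j) \<cdot> z) = b' \<cdot> z" if "mor C z" "tgt C z = obj Y (Suc j)" for z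
        using comp_eq[OF vi(2)] vm bt that by auto
      have "u = ?v \<cdot> dif M (Suc j)"
      proof (rule biprod_coeqI[OF t(3)[OF j]])
        have "(?v \<cdot> dif M (Suc j)) \<cdot> i1 j = ?v \<cdot> (dif M (Suc j) \<cdot> i1 j)"
          using vm b d True by (simp del: add_comp)
        also have "\<dots> = (?v \<cdot> (i1 (Suc j) \<cdot> dif X (Suc j))) \<oplus> (?v \<cdot> (i2 (Suc j) \<cdot> f (Suc j)))"
          unfolding t(9)[OF True] using vm bt xs ff[of "Suc j"] True by (simp del: add_comp)
        also have "\<dots> = (a' \<cdot> dif X (Suc j)) \<oplus> (b' \<cdot> f (Suc j))"
          using vz[of "dif X (Suc j)"] vz2[of "f (Suc j)"] xs ff[of "Suc j"] True by simp
        also have "\<dots> = a" unfolding ae a'(4)[symmetric] using em b' xj j by (simp add: add_comm)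
        finally show "u \<cdot> i1 j = (?v \<cdot> dif M (Suc j)) \<cdot> i1 j" by (simp add: a_def)
        have "(?v \<cdot> dif M (Suc j)) \<cdot> i2 j = ?v \<cdot> (dif M (Suc j) \<cdot> i2 j)"
          using vm b d True by (simp del: add_comp)
        also have "\<dots> = c" unfolding t(10)[OF True] b'(5) by (rule vz2) (use xj j in auto)
        finally show "u \<cdot> i2 j = (?v \<cdot> dif M (Suc j)) \<cdot> i2 j" by (simp add: c_def)
      qed (use u vm d True W_def in auto)
      then show ?thesis using vm W_def by blast
    next
      case False
      then have jm: "Suc j = m" "j = m - 1" using j by auto
      obtain b'' where b'': "mor C b''" "src C b'' = obj Y m" "tgt C b'' = W" "b'' \<cdot> dif Y j = zr C (obj Y j) W" "b'' \<cdot> f m = e"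
        using HL[of e] em e0 unfolding jm(1) jm(2)[symmetric] by auto
      let ?v = "b' \<oplus> b''"
      have vm: "mor C ?v" "src C ?v = obj M (Suc (Suc j))" "tgt C ?v = W" using b' b'' jm(1) t(2) by auto
      have di: "dif M (Suc j) \<cdot> i1 j = f (Suc j)" "dif M (Suc j) \<cdot> i2 j = dif Y j" using t(11,12) jm by auto
      have "u = ?v \<cdot> dif M (Suc j)"
      proof (rule biprod_coeqI[OF t(3)[OF j]])
        have "(?v \<cdot> dif M (Suc j)) \<cdot> i1 j = ?v \<cdot> (dif M (Suc j) \<cdot> i1 j)"
          using vm b d jm by (simp del: add_comp)
        also have "\<dots> = a" unfolding di ae using b' b'' jm(1) xj j by simp
        finally show "u \<cdot> i1 j = (?v \<cdot> dif M (Suc j)) \<cdot> i1 j" by (simp add: a_def)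
        have "(?v \<cdot> dif M (Suc j)) \<cdot> i2 j = ?v \<cdot> (dif M (Suc j) \<cdot> i2 j)"
          using vm b d jm by (simp del: add_comp)
        also have "\<dots> = c" unfolding di b'(5) using b'(2-4) b'' jm(1) xj j by simp
        finally show "u \<cdot> i2 j = (?v \<cdot> dif M (Suc j)) \<cdot> i2 j" by (simp add: c_def)
      qed (use u vm d jm W_def in auto)
      then show ?thesis using vm W_def by blast
    qed
  qed
  show ?thesis unfolding right_exact_iff[OF M, simplified] using 1 2 by auto
qed

end

context additive_category
begin

lemma biproduct_op_swap:
  assumes "biproduct C A B P i1 i2 p1 p2" shows "biproduct (op_cat C) B A P p2 p1 i2 i1"
  using biprod_mor[OF assms] biprod_eq[OF assms] by (simp add: biproduct_def add_comm)

lemma anticommuting_op: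
  assumes "anticommuting C m X Y f" and X: "complex C m X" and Y: "complex C m Y"
  shows "anticommuting (op_cat C) m (rev_cplx m Y) (rev_cplx m X) (\<lambda>i. f (m - i))"
proof -
  note x = complexD[OF X] complexD[OF Y]
  have ff: "mor C (f i)" "src C (f i) = obj X i" "tgt C (f i) = obj Y i" if "i \<le> m" for i
    using assms that by (auto simp: anticommuting_def)
  have ac: "(f (Suc i) \<cdot> dif X i) \<oplus> (dif Y i \<cdot> f i) = zr C (obj X i) (obj Y (Suc i))" if "i < m" for i
    using assms that by (auto simp: anticommuting_def)
  show ?thesis unfolding anticommuting_def
  proof (intro conjI allI impI)
    fix i assume i: "i < m"
    define j where "j = m - Suc i"
    have j: "m - Suc i = j" "m - i = Suc j" "j < m" using i by (auto simp: j_def)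
    show "(f (m - Suc i) \<cdot>\<^bsub>op_cat C\<^esub> dif (rev_cplx m Y) i) \<oplus>\<^bsub>op_cat C\<^esub> (dif (rev_cplx m X) i \<cdot>\<^bsub>op_cat C\<^esub> f (m - i)) =
         zr (op_cat C) (obj (rev_cplx m Y) i) (obj (rev_cplx m X) (Suc i))"
      using ac[OF j(3)] x(1-4)[of j] x(7-10)[of j] ff[of j] ff[of "Suc j"] j(3) by (simp add: j(1,2) add_comm)
  qed (use ff in auto)
qed

lemma twisted_cone_op:
  assumes T: "twisted_cone C m X Y f M i1 i2 p1 p2" and X: "complex C m X" and Y: "complex C m Y" and m: "1 \<le> m"
    and f: "anticommuting C m X Y f"
  shows "twisted_cone (op_cat C) m (rev_cplx m Y) (rev_cplx m X) (\<lambda>i. f (m - i)) (rev_cplx (Suc m) M)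
    (\<lambda>j. p2 (m - Suc j)) (\<lambda>j. p1 (m - Suc j)) (\<lambda>j. i2 (m - Suc j)) (\<lambda>j. i1 (m - Suc j))"
proof -
  note x = complexD[OF X] complexD[OF Y] and t = T[unfolded twisted_cone_def]
  have ff: "mor C (f i)" "src C (f i) = obj X i" "tgt C (f i) = obj Y i" if "i \<le> m" for i
    using f that by (auto simp: anticommuting_def)
  have b: "j < m \<Longrightarrow> biproduct C (obj X (Suc j)) (obj Y j) (obj M (Suc j)) (i1 j) (i2 j) (p1 j) (p2 j)" for j
    using t by auto
  note bm = biprod_mor[OF b]
  have m': "0 < m" "m - 1 < m" "Suc (m - 1) = m" using m by auto
  have d0: "dif M 0 = (i1 0 \<cdot> dif X 0) \<oplus> (i2 0 \<cdot> f 0)" using t by blast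
  have ds: "Suc j < m \<Longrightarrow> dif M (Suc j) = (i1 (Suc j) \<cdot> (dif X (Suc j) \<cdot> p1 j)) \<oplus>
          ((i2 (Suc j) \<cdot> (f (Suc j) \<cdot> p1 j)) \<oplus> (i2 (Suc j) \<cdot> (dif Y j \<cdot> p2 j)))" for j using t by blast
  have dm: "dif M m = (f m \<cdot> p1 (m - 1)) \<oplus> (dif Y (m - 1) \<cdot> p2 (m - 1))" using t by blast
  note bm0 = bm[OF m'(1)] and bmm = bm[OF m'(2), unfolded m'(3)]
  show ?thesis unfolding twisted_cone_def
  proof (intro conjI allI impI)
    fix j assume j: "j < m"
    then have "Suc (m - Suc j) = m - j" "m - Suc j < m" by auto
    then show "biproduct (op_cat C) (obj (rev_cplx m Y) (Suc j)) (obj (rev_cplx m X) j) (obj (rev_cplx (Suc m) M) (Suc j))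
          (p2 (m - Suc j)) (p1 (m - Suc j)) (i2 (m - Suc j)) (i1 (m - Suc j))"
      using biproduct_op_swap[OF b[of "m - Suc j"]] by simp
  next
    show "dif (rev_cplx (Suc m) M) 0 =
      (p2 (m - Suc 0) \<cdot>\<^bsub>op_cat C\<^esub> dif (rev_cplx m Y) 0) \<oplus>\<^bsub>op_cat C\<^esub> (p1 (m - Suc 0) \<cdot>\<^bsub>op_cat C\<^esub> f (m - 0))"
      using dm x(7-10)[of "m - 1"] ff[of m] bmm m' by (simp add: add_comm)
    have "m - Suc (m - Suc 0) = 0" using m' by auto
    then show "dif (rev_cplx (Suc m) M) m =
      (f (m - m) \<cdot>\<^bsub>op_cat C\<^esub> i2 (m - Suc (m - 1))) \<oplus>\<^bsub>op_cat C\<^esub> (dif (rev_cplx m X) (m - 1) \<cdot>\<^bsub>op_cat C\<^esub> i1 (m - Suc (m - 1)))"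
      using d0 x(1-4)[of 0] ff[of 0] bm0 m' by (simp add: add_comm)
  next
    fix j assume j: "Suc j < m"
    define k where "k = m - Suc (Suc j)"
    have k: "m - Suc j = Suc k" "m - Suc (Suc j) = k" "Suc k < m" "k < m" using j by (auto simp: k_def)
    show "dif (rev_cplx (Suc m) M) (Suc j) =
         (p2 (m - Suc (Suc j)) \<cdot>\<^bsub>op_cat C\<^esub> (dif (rev_cplx m Y) (Suc j) \<cdot>\<^bsub>op_cat C\<^esub> i2 (m - Suc j))) \<oplus>\<^bsub>op_cat C\<^esub>
         ((p1 (m - Suc (Suc j)) \<cdot>\<^bsub>op_cat C\<^esub> (f (m - Suc j) \<cdot>\<^bsub>op_cat C\<^esub> i2 (m - Suc j))) \<oplus>\<^bsub>op_cat C\<^esub>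
          (p1 (m - Suc (Suc j)) \<cdot>\<^bsub>op_cat C\<^esub> (dif (rev_cplx m X) j \<cdot>\<^bsub>op_cat C\<^esub> i1 (m - Suc j))))"
      using ds[OF k(3)] x(1-4)[of "Suc k"] x(7-10)[of k] ff[of "Suc k"] bm[OF k(3)] bm[OF k(4)] k(3)
      by (simp add: k(1,2) add_ac)
  qed (use t in auto)
qed

lemma twisted_cone_left_exact:
  assumes T: "twisted_cone C m X Y f M i1 i2 p1 p2" and X: "complex C m X" and Y: "complex C m Y" and m: "1 \<le> m"
    and f: "anticommuting C m X Y f"
    and E: "\<And>u. mor C u \<Longrightarrow> tgt C u = obj X 0 \<Longrightarrow> f 0 \<cdot> u = zr C (src C u) (obj Y 0) \<Longrightarrow>
        dif X 0 \<cdot> u = zr C (src C u) (obj X 1) \<Longrightarrow> u = zr C (src C u) (obj X 0)"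
    and H0: "\<And>a b. mor C a \<Longrightarrow> mor C b \<Longrightarrow> tgt C a = obj Y (m - 1) \<Longrightarrow> tgt C b = obj X m \<Longrightarrow> src C a = src C b \<Longrightarrow>
        (dif Y (m - 1) \<cdot> a) \<oplus> (f m \<cdot> b) = zr C (src C b) (obj Y m) \<Longrightarrow>
        \<exists>b'. mor C b' \<and> tgt C b' = obj X (m - 1) \<and> src C b' = src C b \<and> b = dif X (m - 1) \<cdot> b'"
    and XE: "\<And>j b. Suc j < m \<Longrightarrow> mor C b \<Longrightarrow> tgt C b = obj X (Suc j) \<Longrightarrow> dif X (Suc j) \<cdot> b = zr C (src C b) (obj X (Suc (Suc j))) \<Longrightarrow>
        \<exists>b'. mor C b' \<and> tgt C b' = obj X j \<and> src C b' = src C b \<and> b = dif X j \<cdot> b'"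
    and YE: "\<And>j c. Suc j < m \<Longrightarrow> mor C c \<Longrightarrow> tgt C c = obj Y (Suc j) \<Longrightarrow> dif Y (Suc j) \<cdot> c = zr C (src C c) (obj Y (Suc (Suc j))) \<Longrightarrow>
        \<exists>a'. mor C a' \<and> tgt C a' = obj Y j \<and> src C a' = src C c \<and> c = dif Y j \<cdot> a'"
    and HL: "\<And>c. mor C c \<Longrightarrow> tgt C c = obj Y 0 \<Longrightarrow> dif Y 0 \<cdot> c = zr C (src C c) (obj Y 1) \<Longrightarrow>
        \<exists>b''. mor C b'' \<and> tgt C b'' = obj X 0 \<and> src C b'' = src C c \<and> dif X 0 \<cdot> b'' = zr C (src C c) (obj X 1) \<and> f 0 \<cdot> b'' = c"
  shows "left_exact C (Suc m) M"
proof -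
  interpret op: additive_category "op_cat C" by (rule op)
  have m': "0 < m" "m - 1 < m" "Suc (m - Suc 0) = m" "m - Suc (m - Suc 0) = 0" using m by auto
  have m1: "m - (m - Suc 0) = 1" using m by auto
  have "right_exact (op_cat C) (Suc m) (rev_cplx (Suc m) M)"
  proof (rule op.twisted_cone_right_exact[OF twisted_cone_op[OF T X Y m f] complex_op[OF additive_category_axioms Y]
        complex_op[OF additive_category_axioms X] m anticommuting_op[OF f X Y]], goal_cases)
    case (1 u) then show ?case using E[of u] m' m1 by simp
  next
    case (2 a b) then show ?case using H0[of a b] by simp
  next
    case (3 j b)
    then have "Suc (m - Suc (Suc j)) = m - Suc j" "Suc (Suc (m - Suc (Suc j))) = m - j" by auto
    then show ?case using XE[of "m - Suc (Suc j)" b] 3 by simp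
  next
    case (4 j b)
    then have "Suc (m - Suc (Suc j)) = m - Suc j" "Suc (Suc (m - Suc (Suc j))) = m - j" by auto
    then show ?case using YE[of "m - Suc (Suc j)" b] 4 by simp
  next
    case (5 c) then show ?case using HL[of c] m' m1 by simp
  qed
  then show ?thesis using right_exact_op[of "Suc m" M] by simp
qed

lemma anticommuting_neg:
  assumes "chain_map C m X Y f" and X: "complex C m X" and Y: "complex C m Y"
  shows "anticommuting C m (neg_cplx C X) Y f"
  using chain_mapD[OF X Y assms(1) X Y order_refl] complexD[OF X] complexD[OF Y]
  by (auto simp: anticommuting_def)

lemma mapping_cone_twisted_cone:
  assumes M: "mapping_cone C m X Y f M" and f: "chain_map C m X Y f" and X: "complex C m X" and Y: "complex C m Y" and m: "1 \<le> m"
  obtains i1 i2 p1 p2 where "twisted_cone C m (neg_cplx C X) Y f M i1 i2 p1 p2"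
proof -
  note x = complexD[OF X] complexD[OF Y]
  note ff = chain_mapD[OF X Y f X Y order_refl, simplified]
  from M obtain i1 i2 p1 p2 where o: "obj M 0 = obj X 0" "obj M (Suc m) = obj Y m" and
    b: "\<And>j. j < m \<Longrightarrow> biproduct C (obj X (Suc j)) (obj Y j) (obj M (Suc j)) (i1 j) (i2 j) (p1 j) (p2 j)" and
    d0: "dif M 0 =
          (i1 0 \<cdot>\<^bsub>C\<^esub> (inv\<^bsub>Hom C (obj X 0) (obj X 1)\<^esub> (dif X 0)))
            \<otimes>\<^bsub>Hom C (obj M 0) (obj M 1)\<^esub> (i2 0 \<cdot>\<^bsub>C\<^esub> f 0)" and
    ds: "\<And>j. Suc j < m \<Longrightarrow> dif M (Suc j) =
          (i1 (Suc j) \<cdot>\<^bsub>C\<^esub> (inv\<^bsub>Hom C (obj X (Suc j)) (obj X (Suc (Suc j)))\<^esub> (dif X (Suc j))) \<cdot>\<^bsub>C\<^esub> p1 j)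
            \<otimes>\<^bsub>Hom C (obj M (Suc j)) (obj M (Suc (Suc j)))\<^esub>
          ((i2 (Suc j) \<cdot>\<^bsub>C\<^esub> f (Suc j) \<cdot>\<^bsub>C\<^esub> p1 j)
            \<otimes>\<^bsub>Hom C (obj M (Suc j)) (obj M (Suc (Suc j)))\<^esub>
           (i2 (Suc j) \<cdot>\<^bsub>C\<^esub> dif Y j \<cdot>\<^bsub>C\<^esub> p2 j))" and
    dm: "dif M m =
          (f m \<cdot>\<^bsub>C\<^esub> p1 (m - 1)) \<otimes>\<^bsub>Hom C (obj M m) (obj M (Suc m))\<^esub> (dif Y (m - 1) \<cdot>\<^bsub>C\<^esub> p2 (m - 1))"
    unfolding mapping_cone_def by blast
  note bm = biprod_mor[OF b]
  have m': "0 < m" "m - 1 < m" "Suc (m - 1) = m" using m by auto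
  note bm0 = bm[OF m'(1)] and bmm = bm[OF m'(2), unfolded m'(3)]
  have "twisted_cone C m (neg_cplx C X) Y f M i1 i2 p1 p2"
    unfolding twisted_cone_def
  proof (intro conjI allI impI)
    show "dif M 0 = (i1 0 \<cdot> dif (neg_cplx C X) 0) \<oplus> (i2 0 \<cdot> f 0)"
      unfolding d0 using bm0 x(1-4)[of 0] ff[of 0] o m' by simp
    show "dif M m = (f m \<cdot> p1 (m - 1)) \<oplus> (dif Y (m - 1) \<cdot> p2 (m - 1))"
      unfolding dm using bmm x(7-10)[of "m - 1"] ff[of m] o m' by simp
    fix j assume j: "Suc j < m"
    then have j': "j < m" by simp
    show "dif M (Suc j) = (i1 (Suc j) \<cdot> (dif (neg_cplx C X) (Suc j) \<cdot> p1 j)) \<oplus>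
             ((i2 (Suc j) \<cdot> (f (Suc j) \<cdot> p1 j)) \<oplus> (i2 (Suc j) \<cdot> (dif Y j \<cdot> p2 j)))"
      unfolding ds[OF j] using bm[OF j] bm[OF j'] x(1-4)[of "Suc j"] x(7-10)[of j] ff[of "Suc j"] j by simp
  qed (use o b in auto)
  then show thesis using that by blast
qed

lemma mapping_cone_exists:
  assumes X: "complex C m X" and Y: "complex C m Y" and m: "1 \<le> m"
  shows "\<exists>M. mapping_cone C m X Y f M"
proof -
  have "\<forall>j. \<exists>t. j < m \<longrightarrow> (case t of (P, i1, i2, p1, p2) \<Rightarrow> biproduct C (obj X (Suc j)) (obj Y j) P i1 i2 p1 p2)"
    using biproduct_exists complexD(1)[OF X] complexD(1)[OF Y] by (metis (mono_tags, lifting) Suc_leI case_prodI less_imp_le_nat)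
  then obtain T where T: "\<And>j. j < m \<Longrightarrow> case T j of (P, i1, i2, p1, p2) \<Rightarrow> biproduct C (obj X (Suc j)) (obj Y j) P i1 i2 p1 p2"
    by metis
  define P where "P j = fst (T j)" for j
  define i1 where "i1 j = fst (snd (T j))" for j
  define i2 where "i2 j = fst (snd (snd (T j)))" for j
  define p1 where "p1 j = fst (snd (snd (snd (T j))))" for j
  define p2 where "p2 j = snd (snd (snd (snd (T j))))" for j
  have b: "j < m \<Longrightarrow> biproduct C (obj X (Suc j)) (obj Y j) (P j) (i1 j) (i2 j) (p1 j) (p2 j)" for j
    using T[of j] by (simp add: P_def i1_def i2_def p1_def p2_def split: prod.splits)
  define Q where "Q i = (if i = 0 then obj X 0 else if i = Suc m then obj Y m else P (i - 1))" for i
  let ?M = "Cplx Q (\<lambda>i. if i = 0 then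
          (i1 0 \<cdot> (inv\<^bsub>Hom C (obj X 0) (obj X 1)\<^esub> (dif X 0))) \<otimes>\<^bsub>Hom C (Q 0) (Q 1)\<^esub> (i2 0 \<cdot> f 0)
     else if i = m then (f m \<cdot> p1 (m - 1)) \<otimes>\<^bsub>Hom C (Q m) (Q (Suc m))\<^esub> (dif Y (m - 1) \<cdot> p2 (m - 1))
     else (i1 i \<cdot> (inv\<^bsub>Hom C (obj X i) (obj X (Suc i))\<^esub> (dif X i)) \<cdot> p1 (i - 1))
            \<otimes>\<^bsub>Hom C (Q i) (Q (Suc i))\<^esub>
          ((i2 i \<cdot> f i \<cdot> p1 (i - 1)) \<otimes>\<^bsub>Hom C (Q i) (Q (Suc i))\<^esub> (i2 i \<cdot> dif Y (i - 1) \<cdot> p2 (i - 1))))"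
  have "mapping_cone C m X Y f ?M"
    unfolding mapping_cone_def
  proof (intro conjI, goal_cases)
    case 3
    show ?case
    proof (rule exI[of _ i1], rule exI[of _ i2], rule exI[of _ p1], rule exI[of _ p2], intro conjI allI impI)
      fix j assume "j < m"
      then show "biproduct C (obj X (Suc j)) (obj Y j) (obj ?M (Suc j)) (i1 j) (i2 j) (p1 j) (p2 j)"
        using b by (simp add: Q_def)
    qed (use m in \<open>auto simp: Q_def simp del: mult_madd inv_mneg comp_asc\<close>)
  qed (use m in \<open>auto simp: Q_def\<close>)
  then show ?thesis ..
qed

end

context exact_exang
begin

text \<open>
  The cone \<open>M\<close> is an exact sequence. To compare it with a realisation \<open>M'\<close> of the
  extension pushed along \<open>dif Y 0\<close>, let \<open>l: X \<rightarrow> M'\<close> be a lift of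
  \<open>(dif Y 0, 1)\<close>. It gives the \<open>X\<close>-part of a chain map
  \<open>\<theta>: M \<rightarrow> M'\<close> in degree \<open>1\<close>. The restriction of
  \<open>\<theta>\<close> along \<open>X \<rightarrow> M\<close> agrees with \<open>l\<close> in degree
  \<open>0\<close>, hence up to homotopy, so that the top component of \<open>\<theta>\<close> can be corrected
  to an identity.
\<close>

lemma cone_realises:
  assumes X: "realises n E A D \<delta> X" and c: "mor E c" "src E c = Z" "tgt E c = D"
    and Y: "realises n E A Z (Act E c (Idn E A) \<delta>) Y"
    and f: "chain_map E (Suc n) Y X f" "f 0 = Idn E A" "f (Suc n) = c"
    and M: "mapping_cone E n (shift_cplx Y) (shift_cplx X) (\<lambda>i. f (Suc i)) M"
  shows "realises n E (obj Y 1) D (Act E (Idn E D) (dif Y 0) \<delta>) M"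
    and "\<exists>i1 i2 p1 p2. biproduct E Z (obj X n) (obj M n) i1 i2 p1 p2 \<and> dif M n = (c \<cdot> p1) \<oplus> (dif X n \<cdot> p2)"
proof -
  note r = rzD[OF X] and s = rzD[OF Y]
  note x = complexD[OF r(6)] and y = complexD[OF s(6)]
  note ff = chain_mapD[OF s(6) r(6) f(1) s(6) r(6) order_refl]
  note cX = complex_shift[OF r(6)] and cY = complex_shift[OF s(6)]
  have n': "0 < n" "Suc (n - Suc 0) = n" using n1 by auto
  have g: "chain_map E n (shift_cplx Y) (shift_cplx X) (\<lambda>i. f (Suc i))"
    by (rule chain_mapI[OF cY cX]) (use ff in auto)
  obtain i1 i2 p1 p2 where T: "twisted_cone E n (neg_cplx E (shift_cplx Y)) (shift_cplx X) (\<lambda>i. f (Suc i)) M i1 i2 p1 p2"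
    using mapping_cone_twisted_cone[OF M g cY cX n1] .
  note cN = complex_neg[OF cY] and an = anticommuting_neg[OF g cY cX]
  note t = tconeD[OF T cN cX n1 an, simplified]
  have bn: "biproduct E Z (obj X n) (obj M n) (i1 (n - 1)) (i2 (n - 1)) (p1 (n - 1)) (p2 (n - 1))"
    using t(3)[of "n - 1"] n' s by simp
  have "dif M n = (c \<cdot> p1 (n - 1)) \<oplus> (dif X n \<cdot> p2 (n - 1))"
    using T n' f(3) unfolding twisted_cone_def by simp
  then show "\<exists>i1 i2 p1 p2. biproduct E Z (obj X n) (obj M n) i1 i2 p1 p2 \<and> dif M n = (c \<cdot> p1) \<oplus> (dif X n \<cdot> p2)"
    using bn by blast
  have f1: "f (Suc 0) \<cdot> dif Y 0 = dif X 0" using ff(4)[of 0] f(2) x r by simp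
  have cM: "complex E (Suc n) M" by (rule twisted_cone_complex[OF T cN cX n1 an])
  note mx = complexD[OF cM]
  have negz: "u = zr E V W" if "\<ominus> u = zr E V W" "mor E u" "src E u = V" "tgt E u = W" for u V W
    using that by (metis neg_neg neg_zero mor_ob)
  have R: "right_exact E (Suc n) M"
  proof (rule twisted_cone_right_exact[OF T cN cX n1 an], goal_cases)
    case (1 u) then show ?case using right_exactD(1)[OF r(8) r(6), of u] n' by simp
  next
    case (2 a b)
    have "a \<cdot> dif Y 1 = b \<cdot> f 1"
      using eq_iff_diff[of "b \<cdot> f 1" "a \<cdot> dif Y 1"] 2 y(1-4)[of 1] ff[of 1] n' by (simp add: add_comm)
    then have "b \<cdot> (f 1 \<cdot> dif Y 0) = (a \<cdot> dif Y 1) \<cdot> dif Y 0"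
      using 2 y(1-4)[of 0] ff[of 1] n' by simp
    also have "\<dots> = zr E (obj X 0) (tgt E b)" using 2 y[of 0] y[of 1] n' r s by simp
    finally show ?case using right_exactD(2)[OF r(8) r(6), of 0 b] 2 n' f1 by simp
  next
    case (3 j b) then show ?case using right_exactD(2)[OF r(8) r(6), of "Suc j" b] by simp
  next
    case (4 j d)
    have "d \<cdot> dif Y (Suc j) = zr E (obj Y (Suc j)) (tgt E d)"
      by (rule negz) (use 4 y[of "Suc j"] in auto)
    then obtain v where v: "mor E v" "src E v = obj Y (Suc (Suc (Suc j)))" "tgt E v = tgt E d" "d = v \<cdot> dif Y (Suc (Suc j))"
      using right_exactD(2)[OF s(8) s(6), of "Suc j" d] 4 by auto
    then show ?case using y[of "Suc (Suc j)"] 4 by (intro exI[of _ "\<ominus> v"]) simp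
  next
    case (5 d)
    have "d \<cdot> dif Y n = zr E (obj Y n) (tgt E d)"
      by (rule negz) (use 5 y[of n] n' in auto)
    then have "d = zr E (obj Y (Suc n)) (tgt E d)"
      using right_exactD(1)[OF s(8) s(6), of d] 5 by simp
    then show ?case using 5 x y ff[of "Suc n"] n'
      by (intro exI[of _ "zr E (obj X (Suc n)) (tgt E d)"]) auto
  qed
  have L: "left_exact E (Suc n) M"
  proof (rule twisted_cone_left_exact[OF T cN cX n1 an], goal_cases)
    case (1 u)
    note u = 1[simplified]
    have "dif Y (Suc 0) \<cdot> u = zr E (src E u) (obj Y (Suc (Suc 0)))"
      by (rule negz) (use u y(2-4)[of "Suc 0"] n' in auto)
    from left_exactD(2)[OF s(7) s(6) _ _ u(1,2) this] n'
    obtain w where w: "mor E w" "src E w = src E u" "tgt E w = obj Y 0" "u = dif Y 0 \<cdot> w" by auto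
    have "dif X 0 \<cdot> w = f (Suc 0) \<cdot> (dif Y 0 \<cdot> w)"
      by (rule comp_eq[OF f1, symmetric]) (use w y(1-4)[of 0] ff(1-3)[of 1] in auto)
    also have "\<dots> = zr E (src E w) (obj X 1)" using u(3) unfolding w(4)[symmetric] w(2) by simp
    finally have "dif X 0 \<cdot> w = zr E (src E w) (obj X 1)" .
    moreover have "tgt E w = obj X 0" using w(3) r(4) s(4) by simp
    ultimately have "w = zr E (src E w) (obj Y 0)"
      using left_exactD(1)[OF r(7) r(6) _ w(1)] r(4) s(4) by simp
    then have "u = dif Y 0 \<cdot> zr E (src E u) (obj Y 0)" using w(2,4) by metis
    also have "\<dots> = zr E (src E u) (obj Y (Suc 0))" using u(1) y(2-4)[of 0] by simp
    finally show ?case by simp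
  next
    case (2 a b)
    have b: "mor E b" "tgt E b = Z" using 2 s by auto
    have "c \<cdot> b = \<ominus> (dif X n \<cdot> a)"
      by (rule neg_unique) (use 2 c b x(1-4)[of n] n' f(3) r(5) in auto)
    then have e: "c \<cdot> b = dif X n \<cdot> (\<ominus> a)" using 2 x(1-4)[of n] n' by simp
    have am: "mor E a" "tgt E a = obj X n" "src E a = src E b" using 2 n' by auto
    have "Act E b (Idn E A) (Act E c (Idn E A) \<delta>) = Act E (c \<cdot> b) (Idn E A) \<delta>" using b c r(1-5) by simp
    also have "\<dots> = Act E (\<ominus> a) (Idn E A) (Act E (dif X n) (Idn E A) \<delta>)"
      unfolding e using am x(1-4)[of n] r(1-5) by simp
    also have "\<dots> = \<one>\<^bsub>Ext E (src E b) A\<^esub>" unfolding r(10) using am r(1) by simp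
    finally obtain v where v: "mor E v" "src E v = src E b" "tgt E v = obj Y n" "b = dif Y n \<cdot> v"
      using realises_pull[OF Y b] by blast
    then show ?case using y[of n] n' by (intro exI[of _ "\<ominus> v"]) simp
  next
    case (3 j b)
    have "dif Y (Suc (Suc j)) \<cdot> b = zr E (src E b) (obj Y (Suc (Suc (Suc j))))"
      by (rule negz) (use 3 y[of "Suc (Suc j)"] in auto)
    then obtain v where v: "mor E v" "src E v = src E b" "tgt E v = obj Y (Suc j)" "b = dif Y (Suc j) \<cdot> v"
      using left_exactD(2)[OF s(7) s(6), of "Suc j" b] 3 by auto
    then show ?case using y[of "Suc j"] 3 by (intro exI[of _ "\<ominus> v"]) simp
  next
    case (4 j b) then show ?case using left_exactD(2)[OF r(7) r(6), of "Suc j" b] by auto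
  next
    case (5 d)
    then obtain w where w: "mor E w" "src E w = src E d" "tgt E w = obj X 0" "d = dif X 0 \<cdot> w"
      using left_exactD(2)[OF r(7) r(6), of 0 d] n' by auto
    note w3 = w(3)[unfolded r(4)]
    have 1: "f (Suc 0) \<cdot> (dif Y 0 \<cdot> w) = d"
      unfolding w(4) by (rule comp_eq[OF f1]) (use w(1) w3 y(1-4)[of 0] ff(1-3)[of 1] s(4) in auto)
    have 2: "mor E (dif Y 0 \<cdot> w)" "tgt E (dif Y 0 \<cdot> w) = obj Y (Suc 0)" "src E (dif Y 0 \<cdot> w) = src E d"
      using w(1,2) w3 y(1-4)[of 0] s(4) by simp_all
    have 3: "dif Y (Suc 0) \<cdot> (dif Y 0 \<cdot> w) = zr E (src E d) (obj Y (Suc (Suc 0)))"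
      using y(6)[of 0 w] w(1,2) w3 s(4) n' by simp
    have "dif (neg_cplx E (shift_cplx Y)) 0 \<cdot> (dif Y 0 \<cdot> w) = \<ominus> (dif Y (Suc 0) \<cdot> (dif Y 0 \<cdot> w))"
      using 2 y(1-4)[of "Suc 0"] n' by simp
    also have "\<dots> = zr E (src E d) (obj Y (Suc (Suc 0)))" unfolding 3
      using y(1)[of "Suc (Suc 0)"] n' mor_ob(1)[OF 5(1)] by simp
    finally show ?case using 1 2 by (intro exI[of _ "dif Y 0 \<cdot> w"]) simp
  qed
  have nM: "exact_seq n E M" using cM L R by (simp add: exact_seq_def)
  define \<rho> where "\<rho> = Act E (Idn E D) (dif Y 0) \<delta>"
  have Y1: "obj Y 1 \<in> Ob E" using y(1)[of 1] by simp
  have rho: "\<rho> \<in> carrier (Ext E D (obj Y 1))" using r(1-5) s(4) y(1-4)[of 0] by (simp add: \<rho>_def)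
  obtain M' where M': "realises n E (obj Y 1) D \<rho> M'" using realises_exists[OF Y1 r(2) rho] .
  note q = rzD[OF M'] and z = complexD[OF rzD(6)[OF M']]
  obtain l where l: "chain_map E (Suc n) X M' l" "l 0 = dif Y 0" "l (Suc n) = Idn E D"
    by (rule realises_lift[OF X M', of "dif Y 0" "Idn E D"])
      (use y(1-4)[of 0] r(2) s(4) Y1 rho in \<open>auto simp: \<rho>_def[symmetric]\<close>)
  note ll = chain_mapD[OF r(6) q(6) l(1) r(6) q(6) order_refl]
  note b0 = biprod_mor[OF t(3)[of 0]] and be0 = biprod_eq[OF t(3)[of 0]] biprod_eq'[OF t(3)[of 0]]
  obtain s1 where s1: "mor E s1" "src E s1 = obj Y 2" "tgt E s1 = obj M' 1"
    "(l 1 \<cdot> f 1) \<oplus> \<ominus> dif M' 0 = s1 \<cdot> dif Y 1"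
  proof -
    let ?u = "(l 1 \<cdot> f 1) \<oplus> \<ominus> dif M' 0"
    have m: "mor E ?u" "src E ?u = obj Y 1" "tgt E ?u = obj M' 1"
      using ll[of 1] ff[of 1] z(1-4)[of 0] q(4) by auto
    have "?u \<cdot> dif Y 0 = (l 1 \<cdot> (f 1 \<cdot> dif Y 0)) \<oplus> \<ominus> (dif M' 0 \<cdot> dif Y 0)"
      using ll[of 1] ff[of 1] z(1-4)[of 0] q(4) y(1-4)[of 0] by simp
    also have "\<dots> = zr E (obj Y 0) (tgt E ?u)"
      using ll(4)[of 0] l(2) f1 m(3) y(1-4)[of 0] z(1-4)[of 0] q(4) r(4) s(4) by simp
    finally show thesis using that right_exactD(2)[OF s(8) s(6), of 0 ?u] m n' by (auto simp: numeral_2_eq_2)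
  qed
  \<comment> \<open>the first two components of \<open>\<theta>\<close>\<close>
  define th where "th i = (if i = 0 then Idn E (obj Y 1) else (s1 \<cdot> p1 0) \<oplus> (l 1 \<cdot> p2 0))" for i :: nat
  have th1m: "mor E (th 1)" "src E (th 1) = obj M 1" "tgt E (th 1) = obj M' 1"
    using s1 b0 n' ll[of 1] by (auto simp: th_def numeral_2_eq_2)
  have "th 1 \<cdot> dif M 0 = (s1 \<cdot> (p1 0 \<cdot> dif M 0)) \<oplus> (l 1 \<cdot> (p2 0 \<cdot> dif M 0))"
    using s1 b0 n' ll[of 1] mx(1-4)[of 0] by (simp add: th_def numeral_2_eq_2)
  also have "\<dots> = \<ominus> (s1 \<cdot> dif Y 1) \<oplus> (l 1 \<cdot> f 1)"
    using t(7,8) s1(1-3) y(1-4)[of 1] n' by (simp add: numeral_2_eq_2)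
  also have "\<dots> = dif M' 0 \<cdot> th 0"
    unfolding s1(4)[symmetric] using ll[of 1] ff[of 1] z(1-4)[of 0] q(4)
    by (simp add: th_def add_comm[of "\<ominus> (l (Suc 0) \<cdot> f (Suc 0))"] add_assoc)
  finally have th0: "th 1 \<cdot> dif M 0 = dif M' 0 \<cdot> th 0" .
  have "chain_on E 0 1 M M' th"
    unfolding chain_on_def using th0 th1m t(1) q(4) Y1 by (auto simp: le_Suc_eq th_def)
  from extend_up[OF cM q(6) R this] obtain \<theta> where th: "\<theta> 0 = th 0" "\<theta> 1 = th 1" "chain_on E 0 (Suc n) M M' \<theta>" by auto
  have thc: "chain_map E (Suc n) M M' \<theta>" using chain_map_iff[OF cM q(6)] th by simp
  note tt = chain_mapD[OF cM q(6) thc cM q(6) order_refl]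
  \<comment> \<open>the chain map \<open>X \<rightarrow> M\<close>, which is \<open>dif Y 0\<close> in degree \<open>0\<close> and a biproduct injection in the inner degrees\<close>
  define io where "io i = (if i = 0 then dif Y 0 else if i = Suc n then Idn E D else i2 (i - 1))" for i
  have ioc: "chain_map E (Suc n) X M io"
  proof (rule chain_mapI[OF r(6) cM])
    show "mor E (io i) \<and> src E (io i) = obj X i \<and> tgt E (io i) = obj M i" if iS: "i \<le> Suc n" for i
    proof -
      consider "i = 0" | "i = Suc n" | j where "i = Suc j" "j < n" using iS by (cases i) (auto simp: le_less)
      then show ?thesis
        using y(1-4)[of 0] r(2,4,5) s(4) t(1,2) biprod_mor[OF t(3)] n' by cases (auto simp: io_def)
    qed
    fix i assume "i < Suc n"
    then consider "i = 0" | j where "i = Suc j" "Suc j < n" | "i = n" "0 < i" by (cases i) (auto simp: less_Suc_eq)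
    then show "io (Suc i) \<cdot> dif X i = dif M i \<cdot> io i"
    proof cases
      case 1
      have e1: "p1 0 \<cdot> (dif M 0 \<cdot> dif Y 0) = zr E A (obj Y 2)"
        using comp_eq[OF t(7), of "dif Y 0"] b0 n' mx(1-4)[of 0] y[of 0] y[of 1] t(1) s(4) by (simp add: numeral_2_eq_2)
      have e2: "p2 0 \<cdot> (dif M 0 \<cdot> dif Y 0) = dif X 0"
        using comp_eq[OF t(8), of "dif Y 0"] b0 n' mx(1-4)[of 0] y[of 0] t(1) f1 by simp
      have "i2 0 \<cdot> dif X 0 = dif M 0 \<cdot> dif Y 0"
        by (rule biprod_eqI[OF t(3)[OF n'(1)]])
          (use e1 e2 be0 b0 n' x(1-4)[of 0] y(1-4)[of 0] mx(1-4)[of 0] r(4) s(4) t(1) in \<open>auto simp: numeral_2_eq_2\<close>)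
      then show ?thesis using 1 n' by (simp add: io_def)
    next
      case 2 then show ?thesis using t(10)[of j] by (simp add: io_def)
    next
      case 3 then show ?thesis using t(12) n' x(1-4)[of n] r(5) by (simp add: io_def)
    qed
  qed
  note ii = chain_mapD[OF r(6) cM ioc r(6) cM order_refl]
  have k: "chain_on E 0 (Suc n) X M' (\<lambda>i. (\<theta> i \<cdot> io i) \<oplus> \<ominus> l i)"
    using chain_on_add[OF _ chain_on_neg[OF _ r(6) q(6) order_refl] r(6) q(6) order_refl]
      chain_map_comp[OF ioc thc r(6) cM q(6)] l(1) chain_map_iff[OF r(6) q(6)] by blast
  have "(\<theta> 0 \<cdot> io 0) \<oplus> \<ominus> l 0 = zr E (obj X 0) (obj M' 0)"
    using th(1) l(2) y(1-4)[of 0] s(4) r(4) q(4) by (simp add: th_def io_def)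
  from null_up[OF r(6) q(6) r(8) k _ this] obtain h where
    h: "\<forall>i. i < Suc n \<longrightarrow> mor E (h (Suc i)) \<and> src E (h (Suc i)) = obj X (Suc i) \<and> tgt E (h (Suc i)) = obj M' i"
      "(\<theta> (Suc n) \<cdot> io (Suc n)) \<oplus> \<ominus> l (Suc n) = dif M' n \<cdot> h (Suc n)" by auto
  have tn: "\<theta> (Suc n) \<cdot> io (Suc n) = \<theta> (Suc n)" using tt(1-3)[of "Suc n"] t(2) r(5) by (simp add: io_def)
  have "\<theta> (Suc n) = Idn E D \<oplus> (dif M' n \<cdot> h (Suc n))"
    by (rule diffD[OF h(2)[unfolded tn l(3)]]) (use tt[of "Suc n"] t(2) r(2,5) q(5) in auto)
  from adjust_top[OF cM q(6) n1 thc _ _ _ _ _ _ this] h(1) t(2) r(2,5) q(5) obtain \<theta>' where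
    t': "chain_map E (Suc n) M M' \<theta>'" "\<theta>' (Suc n) = Idn E D" "\<forall>i<n. \<theta>' i = \<theta> i" by auto
  have ef: "end_fixing n E M M' \<theta>'" using t' th(1) n' t(1,2) r(5) by (auto simp: end_fixing_def th_def)
  have "Act E (Idn E D) (dif M 0) \<rho> = Act E (Idn E D) (dif M 0 \<cdot> dif Y 0) \<delta>"
    unfolding \<rho>_def using mx(1-4)[of 0] y(1-4)[of 0] r(1-5) s(4) t(1) by simp
  also have "dif M 0 \<cdot> dif Y 0 = i2 0 \<cdot> dif X 0" using ii(4)[of 0] n' by (simp add: io_def)
  also have "Act E (Idn E D) (i2 0 \<cdot> dif X 0) \<delta> = Act E (Idn E D) (i2 0) (Act E (Idn E D) (dif X 0) \<delta>)"
    using b0 n' x(1-4)[of 0] r(1-5) by simp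
  also have "\<dots> = \<one>\<^bsub>Ext E D (obj M 1)\<^esub>" unfolding r(9) using b0 n' r(2) x(1)[of 1] by simp
  finally show "realises n E (obj Y 1) D (Act E (Idn E D) (dif Y 0) \<delta>) M"
    using realises_end_fixing[OF M' nM ef] by (simp add: \<rho>_def)
qed

lemma EA2_holds: "EA2 n E"
  unfolding EA2_def
proof (intro ballI allI impI)
  fix A D Z \<delta> c X Y
  assume a: "A \<in> Ob E" "D \<in> Ob E" "Z \<in> Ob E" "\<delta> \<in> carrier (Ext E D A)" "c \<in> arr E Z D"
    "realised_by n E A Z (pull E A c \<delta>) Y" "realised_by n E A D \<delta> X"
  have c: "mor E c" "src E c = Z" "tgt E c = D" using a by auto
  have X: "realises n E A D \<delta> X" using a by (simp add: realises_def)
  have Y: "realises n E A Z (Act E c (Idn E A) \<delta>) Y" using a c by (simp add: realises_def pull_def)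
  obtain f where f: "chain_map E (Suc n) Y X f" "f 0 = Idn E A" "f (Suc n) = c"
    by (rule realises_lift[OF Y X, of "Idn E A" c]) (use a c in auto)
  obtain M where M: "mapping_cone E n (shift_cplx Y) (shift_cplx X) (\<lambda>i. f (Suc i)) M"
    using mapping_cone_exists[OF complex_shift[OF rzD(6)[OF Y]] complex_shift[OF rzD(6)[OF X]] n1] by blast
  then show "\<exists>f M. chain_map E (n + 1) Y X f \<and> f 0 = Idn E A \<and> f (n + 1) = c \<and>
        mapping_cone E n (shift_cplx Y) (shift_cplx X) (\<lambda>i. f (Suc i)) M \<and>
        realised_by n E (obj Y 1) D (push E D (dif Y 0) \<delta>) M"
    using f cone_realises(1)[OF X c Y f M] by (intro exI[of _ f] exI[of _ M]) (simp add: realises_def push_def)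
qed

text \<open>
  The maps \<open>a\<close> and \<open>b\<close> extend downwards to chain maps
  \<open>f: M \<rightarrow> Y\<close> and \<open>g: Y \<rightarrow> M\<close> that are identities in the
  top degree. Then \<open>Y\<close> realises \<open>f\<^sub>0 \<delta>\<close>: in degree \<open>0\<close> the
  composite \<open>f \<cdot> g\<close> is an identity up to a map through \<open>dif Y 0\<close>, so that a
  realisation of this extension can be compared with \<open>Y\<close>.
\<close>

lemma realised_if_mutual_factorisation:
  assumes Y: "exact_seq n E Y" and M: "realises n E B D \<delta> M" and e: "obj Y (Suc n) = D"
    and a: "mor E a" "src E a = obj M n" "tgt E a = obj Y n" "dif Y n \<cdot> a = dif M n"
    and b: "mor E b" "src E b = obj Y n" "tgt E b = obj M n" "dif M n \<cdot> b = dif Y n"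
  shows "\<exists>\<rho>. realises n E (obj Y 0) D \<rho> Y"
proof -
  note r = rzD[OF M] and mx = complexD[OF rzD(6)[OF M]]
  have Y': "complex E (Suc n) Y" "left_exact E (Suc n) Y" "right_exact E (Suc n) Y" using Y by (auto simp: exact_seq_def)
  note y = complexD[OF Y'(1)]
  have "chain_on E n (Suc n) M Y (\<lambda>i. if i = n then a else Idn E D)"
    unfolding chain_on_def using a e r(2,5) mx(1-4)[of n] by (auto simp: le_Suc_eq dest: antisym)
  from extend_down[OF r(6) Y'(1,2) this] obtain f where
    f: "chain_on E 0 (Suc n) M Y f" "f (Suc n) = Idn E D" by auto
  have "chain_on E n (Suc n) Y M (\<lambda>i. if i = n then b else Idn E D)"
    unfolding chain_on_def using b e r(2,5) y(1-4)[of n] by (auto simp: le_Suc_eq dest: antisym)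
  from extend_down[OF Y'(1) r(6,7) this] obtain g where
    g: "chain_on E 0 (Suc n) Y M g" "g (Suc n) = Idn E D" by auto
  note fc = iffD2[OF chain_map_iff[OF r(6) Y'(1)] f(1)] and gc = iffD2[OF chain_map_iff[OF Y'(1) r(6)] g(1)]
  note ff = chain_onD[OF f(1) r(6) Y'(1) order_refl] and gg = chain_onD[OF g(1) Y'(1) r(6) order_refl]
  have k: "chain_on E 0 (Suc n) Y Y (\<lambda>i. (f i \<cdot> g i) \<oplus> \<ominus> Idn E (obj Y i))"
    using chain_on_add[OF chain_on_comp[OF g(1) f(1) Y'(1) r(6) Y'(1) order_refl]
       chain_on_neg[OF chain_on_id[OF Y'(1) order_refl] Y'(1,1) order_refl] Y'(1,1) order_refl] .
  have "(f (Suc n) \<cdot> g (Suc n)) \<oplus> \<ominus> Idn E (obj Y (Suc n)) = zr E (obj Y (Suc n)) (obj Y (Suc n))"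
    using f g e r(2) by simp
  from null_down[OF Y'(1,1,2) k _ _ this] obtain h where
    h: "mor E h" "src E h = obj Y 1" "tgt E h = obj Y 0" "(f 0 \<cdot> g 0) \<oplus> \<ominus> Idn E (obj Y 0) = h \<cdot> dif Y 0" by auto
  define A where "A = obj Y 0"
  have A: "A \<in> Ob E" using y(1)[of 0] by (simp add: A_def)
  define \<rho> where "\<rho> = Act E (Idn E D) (f 0) \<delta>"
  have f0: "mor E (f 0)" "src E (f 0) = B" "tgt E (f 0) = A" using ff[of 0] r(4) by (auto simp: A_def)
  have rho: "\<rho> \<in> carrier (Ext E D A)" using r(1-3) f0 by (simp add: \<rho>_def)
  obtain X where X: "realises n E A D \<rho> X" using realises_exists[OF A r(2) rho] .
  note q = rzD[OF X]
  obtain l where l: "chain_map E (Suc n) M X l" "l 0 = f 0" "l (Suc n) = Idn E D"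
    by (rule realises_lift[OF M X, of "f 0" "Idn E D"]) (use f0 r(1-3) A rho in \<open>auto simp: \<rho>_def[symmetric]\<close>)
  note lg = chain_map_comp[OF gc l(1) Y'(1) r(6) q(6)]
  have "l 0 \<cdot> g 0 = Idn E A \<oplus> (h \<cdot> dif Y 0)"
    unfolding l(2) A_def by (rule diffD[OF h(4)]) (use f0 gg[of 0] r(4) A A_def in auto)
  from adjust_bot[OF Y'(1) q(6) n1 lg _ _ _ h(1,2) _ this] A h(3) q(4) obtain p where
    p: "chain_map E (Suc n) Y X p" "p 0 = Idn E A" "\<forall>i>1. p i = l i \<cdot> g i" by (auto simp: A_def)
  have "end_fixing n E Y X p" using p n1 l(3) g(2) e r(2) by (auto simp: end_fixing_def A_def)
  moreover have "Act E (Idn E D) (dif Y 0) \<rho> = \<one>\<^bsub>Ext E D (obj Y 1)\<^esub>"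
  proof -
    have "Act E (Idn E D) (dif Y 0) \<rho> = Act E (Idn E D) (dif Y 0 \<cdot> f 0) \<delta>"
      unfolding \<rho>_def using y(1-4)[of 0] f0 r(1-3) by (simp add: A_def)
    also have "dif Y 0 \<cdot> f 0 = f 1 \<cdot> dif M 0" using ff(4)[of 0] by simp
    also have "Act E (Idn E D) (f 1 \<cdot> dif M 0) \<delta> = Act E (Idn E D) (f 1) (Act E (Idn E D) (dif M 0) \<delta>)"
      using ff(1-3)[of 1] mx(1-4)[of 0] r(1-5) by simp
    also have "\<dots> = \<one>\<^bsub>Ext E D (obj Y 1)\<^esub>" unfolding r(9) using ff(1-3)[of 1] r(2) by simp
    finally show ?thesis .
  qed
  ultimately have "realises n E A D \<rho> Y" using realises_end_fixing[OF X Y] by blast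
  then show ?thesis by (auto simp: A_def)
qed

text \<open>
  The obscure axiom of exact categories: if a deflation factors through \<open>c = dif Y n\<close>, then
  \<open>c\<close> is a deflation. By (EA2), the map \<open>(c, dif X n)\<close> from the biproduct of the
  sources is a deflation. It factors through \<open>c\<close>, and conversely.
\<close>

lemma realised_if_factorisation:
  assumes Y: "exact_seq n E Y" and X: "realises n E A D \<delta> X" and e: "obj Y (Suc n) = D"
    and a: "mor E a" "src E a = obj X n" "tgt E a = obj Y n" "dif Y n \<cdot> a = dif X n"
  shows "\<exists>\<rho>. realises n E (obj Y 0) D \<rho> Y"
proof -
  note r = rzD[OF X] and x = complexD[OF rzD(6)[OF X]]
  have Y': "complex E (Suc n) Y" using Y by (auto simp: exact_seq_def)
  define c where "c = dif Y n"
  have c: "mor E c" "src E c = obj Y n" "tgt E c = D" using complexD[OF Y', of n] e by (auto simp: c_def)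
  have d: "Act E c (Idn E A) \<delta> \<in> carrier (Ext E (obj Y n) A)" using c r(1-3) by simp
  obtain P where P: "realises n E A (obj Y n) (Act E c (Idn E A) \<delta>) P"
    using realises_exists[OF r(1) complexD(1)[OF Y'] d] by auto
  obtain f where f: "chain_map E (Suc n) P X f" "f 0 = Idn E A" "f (Suc n) = c"
    by (rule realises_lift[OF P X, of "Idn E A" c]) (use c r(1-3) d complexD(1)[OF Y', of n] in auto)
  obtain M where M: "mapping_cone E n (shift_cplx P) (shift_cplx X) (\<lambda>i. f (Suc i)) M"
    using mapping_cone_exists[OF complex_shift[OF rzD(6)[OF P]] complex_shift[OF rzD(6)[OF X]] n1] by blast
  note cf = cone_realises[OF X c P f M]
  from cf(2) obtain i1 i2 p1 p2 where bp: "biproduct E (obj Y n) (obj X n) (obj M n) i1 i2 p1 p2"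
    and dM: "dif M n = (c \<cdot> p1) \<oplus> (dif X n \<cdot> p2)" by blast
  note b = biprod_mor[OF bp] biprod_eq[OF bp] biprod_eq'[OF bp]
  show ?thesis
    by (rule realised_if_mutual_factorisation[OF Y cf(1) e, of "p1 \<oplus> (a \<cdot> p2)" i1])
      (use b c a x(1-4)[of n] r(5) comp_eq[OF a(4)] in \<open>auto simp: dM c_def[symmetric]\<close>)
qed

text \<open>
  The extension is pulled back along \<open>g\<close>; the deflation of the pulled back extension factors
  through \<open>dif Y n\<close>.
\<close>

lemma realised_if_section:
  assumes Y: "exact_seq n E Y" and X: "realises n E A D \<delta> X" and f: "chain_map E (Suc n) X Y f"
    and g: "mor E g" "src E g = obj Y (Suc n)" "tgt E g = D"
    and h: "mor E h" "src E h = obj Y (Suc n)" "tgt E h = obj Y n" "f (Suc n) \<cdot> g = Idn E (obj Y (Suc n)) \<oplus> (dif Y n \<cdot> h)"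
  shows "\<exists>\<rho>. realises n E (obj Y 0) (obj Y (Suc n)) \<rho> Y"
proof -
  note r = rzD[OF X] and x = complexD[OF rzD(6)[OF X]]
  have Y': "complex E (Suc n) Y" using Y by (auto simp: exact_seq_def)
  note y = complexD[OF Y']
  note ff = chain_mapD[OF r(6) Y' f r(6) Y' order_refl]
  define D' where "D' = obj Y (Suc n)"
  have D': "D' \<in> Ob E" using y(1) by (simp add: D'_def)
  have d: "Act E g (Idn E A) \<delta> \<in> carrier (Ext E D' A)" using g r(1-3) by (simp add: D'_def)
  obtain P where P: "realises n E A D' (Act E g (Idn E A) \<delta>) P"
    using realises_exists[OF r(1) D' d] .
  note q = rzD[OF P] and p = complexD[OF rzD(6)[OF P]]
  obtain l where l: "chain_map E (Suc n) P X l" "l 0 = Idn E A" "l (Suc n) = g"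
    by (rule realises_lift[OF P X, of "Idn E A" g]) (use g r(1-3) d D' in \<open>auto simp: D'_def\<close>)
  note ll = chain_mapD[OF q(6) r(6) l(1) q(6) r(6) order_refl]
  let ?a = "(f n \<cdot> l n) \<oplus> \<ominus> (h \<cdot> dif P n)"
  have "dif Y n \<cdot> (f n \<cdot> l n) = f (Suc n) \<cdot> (dif X n \<cdot> l n)"
    using ff(5)[of n "l n"] ll(1-3)[of n] by simp
  also have "dif X n \<cdot> l n = g \<cdot> dif P n" using ll(4)[of n] l(3) by simp
  also have "f (Suc n) \<cdot> (g \<cdot> dif P n) = (Idn E (obj Y (Suc n)) \<oplus> (dif Y n \<cdot> h)) \<cdot> dif P n"
    by (rule comp_eq[OF h(4)]) (use ff(1-3)[of "Suc n"] g p(1-4)[of n] r(5) q(5) D'_def in auto)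
  also have "\<dots> = dif P n \<oplus> (dif Y n \<cdot> (h \<cdot> dif P n))"
    using y(1-4)[of n] h(1-3) p(1-4)[of n] q(5) D'_def D' by simp
  finally have "dif Y n \<cdot> ?a = dif P n"
    using y(1-4)[of n] h(1-3) p(1-4)[of n] q(5) ll(1-3)[of n] ff(1-3)[of n] by (simp add: D'_def add_assoc)
  then have "\<exists>\<rho>. realises n E (obj Y 0) D' \<rho> Y"
    by (intro realised_if_factorisation[OF Y P, of ?a]) (use y(1-4)[of n] h(1-3) p(1-4)[of n] q(5) ll(1-3)[of n] ff(1-3)[of n] D'_def in auto)
  then show ?thesis by (simp add: D'_def)
qed

end


section \<open>Direct sums and stabilisation\<close>

context additive_category
begin

lemma direct_sum_facts:
  assumes S: "direct_sum C m X Y S i1 i2 p1 p2" and X: "complex C m X" and Y: "complex C m Y"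
  shows "complex C m S" "chain_map C m X S i1" "chain_map C m Y S i2" "chain_map C m S X p1" "chain_map C m S Y p2"
    "j \<le> m \<Longrightarrow> biproduct C (obj X j) (obj Y j) (obj S j) (i1 j) (i2 j) (p1 j) (p2 j)"
    "j < m \<Longrightarrow> dif S j = (i1 (Suc j) \<cdot> (dif X j \<cdot> p1 j)) \<oplus> (i2 (Suc j) \<cdot> (dif Y j \<cdot> p2 j))"
proof -
  note x = complexD[OF X] complexD[OF Y]
  show b: "j \<le> m \<Longrightarrow> biproduct C (obj X j) (obj Y j) (obj S j) (i1 j) (i2 j) (p1 j) (p2 j)" for j
    using S by (simp add: direct_sum_def)
  note bm = biprod_mor[OF b] and be = biprod_eq(1-4)[OF b] biprod_eq'[OF b]
  show d: "j < m \<Longrightarrow> dif S j = (i1 (Suc j) \<cdot> (dif X j \<cdot> p1 j)) \<oplus> (i2 (Suc j) \<cdot> (dif Y j \<cdot> p2 j))" for j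
  proof -
    assume j: "j < m"
    then have j': "j \<le> m" "Suc j \<le> m" by auto
    show ?thesis using S[unfolded direct_sum_def, THEN conjunct2, rule_format, OF j]
      bm[OF j'(1)] bm[OF j'(2)] x(1-4)[of j] x(7-10)[of j] j by simp
  qed
  have dm: "mor C (dif S j)" "src C (dif S j) = obj S j" "tgt C (dif S j) = obj S (Suc j)" if "j < m" for j
    using bm[of j] bm[of "Suc j"] x(1-4)[of j] x(7-10)[of j] that by (auto simp: d[OF that])
  show cS: "complex C m S"
  proof (rule complexI)
    fix i assume i: "Suc i < m"
    then have i': "i < m" "i \<le> m" "Suc i \<le> m" "Suc (Suc i) \<le> m" by auto
    show "dif S (Suc i) \<cdot> dif S i = zr C (obj S i) (obj S (Suc (Suc i)))"
      unfolding d[OF i] d[OF i'(1)]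
      using bm[OF i'(2)] bm[OF i'(3)] bm[OF i'(4)] be[OF i'(3)] x[of i] x[of "Suc i"] i by simp
  qed (use bm dm in auto)
  show "chain_map C m X S i1" "chain_map C m Y S i2"
    by (rule chain_mapI[OF X cS] chain_mapI[OF Y cS];
      (use bm in simp | use bm be x in \<open>simp add: d\<close>))+
  show "chain_map C m S X p1" "chain_map C m S Y p2"
    by (rule chain_mapI[OF cS X] chain_mapI[OF cS Y];
      (use bm in simp | use bm be x in \<open>simp add: d\<close>))+
qed

lemma direct_sum_exact_seq:
  assumes S: "direct_sum C (Suc n) X Y S i1 i2 p1 p2" and X: "exact_seq n C X" and Y: "exact_seq n C Y"
  shows "exact_seq n C S"
proof -
  have X': "complex C (Suc n) X" "left_exact C (Suc n) X" "right_exact C (Suc n) X" using X by (auto simp: exact_seq_def)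
  have Y': "complex C (Suc n) Y" "left_exact C (Suc n) Y" "right_exact C (Suc n) Y" using Y by (auto simp: exact_seq_def)
  note f = direct_sum_facts[OF S X'(1) Y'(1)]
  note b = f(6) note bm = biprod_mor[OF b] and be = biprod_eq(1-4)[OF b] biprod_eq'[OF b]
  note x = complexD[OF X'(1)] complexD[OF Y'(1)] complexD[OF f(1)]
  note i1 = chain_mapD[OF X'(1) f(1) f(2) X'(1) f(1) order_refl] and i2 = chain_mapD[OF Y'(1) f(1) f(3) Y'(1) f(1) order_refl]
  note p1 = chain_mapD[OF f(1) X'(1) f(4) f(1) X'(1) order_refl] and p2 = chain_mapD[OF f(1) Y'(1) f(5) f(1) Y'(1) order_refl]
  have p1d: "dif X j \<cdot> (p1 j \<cdot> u) = zr C (src C u) (obj X (Suc j)) \<and> dif Y j \<cdot> (p2 j \<cdot> u) = zr C (src C u) (obj Y (Suc j))"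
    if "j \<le> n" "mor C u" "tgt C u = obj S j" "dif S j \<cdot> u = zr C (src C u) (obj S (Suc j))" for j u
  proof
    have j: "j \<le> Suc n" "Suc j \<le> Suc n" "j < Suc n" using that by auto
    have "dif X j \<cdot> (p1 j \<cdot> u) = p1 (Suc j) \<cdot> (dif S j \<cdot> u)"
      using p1(5)[of j u] that x(13-16)[of j] by simp
    then show "dif X j \<cdot> (p1 j \<cdot> u) = zr C (src C u) (obj X (Suc j))" using that bm[OF j(2)] by simp
    have "dif Y j \<cdot> (p2 j \<cdot> u) = p2 (Suc j) \<cdot> (dif S j \<cdot> u)"
      using p2(5)[of j u] that x(13-16)[of j] by simp
    then show "dif Y j \<cdot> (p2 j \<cdot> u) = zr C (src C u) (obj Y (Suc j))" using that bm[OF j(2)] by simp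
  qed
  have L: "left_exact C (Suc n) S"
    unfolding left_exact_iff[OF f(1), simplified]
  proof (intro conjI allI impI)
    fix u assume u: "mor C u" "tgt C u = obj S 0" "dif S 0 \<cdot> u = zr C (src C u) (obj S (Suc 0))"
    note m0 = bm[of 0, simplified]
    have "p1 0 \<cdot> u = zr C (src C u) (obj X 0)" "p2 0 \<cdot> u = zr C (src C u) (obj Y 0)"
      using p1d[of 0 u] u left_exactD(1)[OF X'(2,1), of "p1 0 \<cdot> u"] left_exactD(1)[OF Y'(2,1), of "p2 0 \<cdot> u"] m0 by auto
    then show "u = zr C (src C u) (obj S 0)"
      by (intro biprod_eqI[OF b[of 0, simplified], of u]) (use u m0 in auto)
  next
    fix i u assume i: "i < n" and u: "mor C u" "tgt C u = obj S (Suc i)" "dif S (Suc i) \<cdot> u = zr C (src C u) (obj S (Suc (Suc i)))"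
    have i': "Suc i \<le> Suc n" "i \<le> Suc n" "i < Suc n" using i by auto
    note m0 = bm[OF i'(1)] bm[OF i'(2)]
    have "\<exists>v. mor C v \<and> src C v = src C (p1 (Suc i) \<cdot> u) \<and> tgt C v = obj X i \<and> p1 (Suc i) \<cdot> u = dif X i \<cdot> v"
      by (rule left_exactD(2)[OF X'(2,1)]) (use p1d[of "Suc i" u] u i m0 in auto)
    then obtain v where v: "mor C v" "src C v = src C u" "tgt C v = obj X i" "p1 (Suc i) \<cdot> u = dif X i \<cdot> v"
      using u m0 by auto
    have "\<exists>v. mor C v \<and> src C v = src C (p2 (Suc i) \<cdot> u) \<and> tgt C v = obj Y i \<and> p2 (Suc i) \<cdot> u = dif Y i \<cdot> v"
      by (rule left_exactD(2)[OF Y'(2,1)]) (use p1d[of "Suc i" u] u i m0 in auto)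
    then obtain w where w: "mor C w" "src C w = src C u" "tgt C w = obj Y i" "p2 (Suc i) \<cdot> u = dif Y i \<cdot> w"
      using u m0 by auto
    have "u = (i1 (Suc i) \<cdot> (p1 (Suc i) \<cdot> u)) \<oplus> (i2 (Suc i) \<cdot> (p2 (Suc i) \<cdot> u))"
      using biprod_id(1)[OF b[OF i'(1)] u(1,2)] by simp
    also have "\<dots> = dif S i \<cdot> ((i1 i \<cdot> v) \<oplus> (i2 i \<cdot> w))"
      unfolding v(4) w(4) using i1(5)[of i v] i2(5)[of i w] v(1-3) w(1-3) m0 x(13-16)[of i] i'(3) by simp
    finally show "\<exists>v. mor C v \<and> src C v = src C u \<and> tgt C v = obj S i \<and> u = dif S i \<cdot> v"
      using v(1-3) w(1-3) m0 by (intro exI[of _ "(i1 i \<cdot> v) \<oplus> (i2 i \<cdot> w)"]) auto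
  qed
  have d1: "(u \<cdot> i1 (Suc j)) \<cdot> dif X j = zr C (obj X j) (tgt C u) \<and> (u \<cdot> i2 (Suc j)) \<cdot> dif Y j = zr C (obj Y j) (tgt C u)"
    if "j \<le> n" "mor C u" "src C u = obj S (Suc j)" "u \<cdot> dif S j = zr C (obj S j) (tgt C u)" for j u
  proof
    have j: "j \<le> Suc n" "Suc j \<le> Suc n" "j < Suc n" using that by auto
    have "(u \<cdot> i1 (Suc j)) \<cdot> dif X j = u \<cdot> (dif S j \<cdot> i1 j)"
      using i1(4)[of j] that x(1-4)[of j] j bm[OF j(2)] by simp
    also have "\<dots> = zr C (obj S j) (tgt C u) \<cdot> i1 j"
      by (rule comp_eq[OF that(4)]) (use that(2,3) x(13-16)[of j] j bm[OF j(1)] in auto)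
    finally show "(u \<cdot> i1 (Suc j)) \<cdot> dif X j = zr C (obj X j) (tgt C u)" using that(2) bm[OF j(1)] by simp
    have "(u \<cdot> i2 (Suc j)) \<cdot> dif Y j = u \<cdot> (dif S j \<cdot> i2 j)"
      using i2(4)[of j] that x(7-10)[of j] j bm[OF j(2)] by simp
    also have "\<dots> = zr C (obj S j) (tgt C u) \<cdot> i2 j"
      by (rule comp_eq[OF that(4)]) (use that(2,3) x(13-16)[of j] j bm[OF j(1)] in auto)
    finally show "(u \<cdot> i2 (Suc j)) \<cdot> dif Y j = zr C (obj Y j) (tgt C u)" using that(2) bm[OF j(1)] by simp
  qed
  have R: "right_exact C (Suc n) S"
    unfolding right_exact_iff[OF f(1), simplified]
  proof (intro conjI allI impI)
    fix u assume u: "mor C u" "src C u = obj S (Suc n)" "u \<cdot> dif S n = zr C (obj S n) (tgt C u)"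
    note m0 = bm[of "Suc n", simplified]
    have "u \<cdot> i1 (Suc n) = zr C (obj X (Suc n)) (tgt C u)" "u \<cdot> i2 (Suc n) = zr C (obj Y (Suc n)) (tgt C u)"
      using d1[of n u] u right_exactD(1)[OF X'(3,1), of "u \<cdot> i1 (Suc n)"] right_exactD(1)[OF Y'(3,1), of "u \<cdot> i2 (Suc n)"] m0
      by (simp_all del: comp_asc)
    then show "u = zr C (obj S (Suc n)) (tgt C u)"
      by (intro biprod_coeqI[OF b[of "Suc n", simplified], of u]) (use u m0 in auto)
  next
    fix i u assume i: "i < n" and u: "mor C u" "src C u = obj S (Suc i)" "u \<cdot> dif S i = zr C (obj S i) (tgt C u)"
    have i': "Suc i \<le> Suc n" "Suc (Suc i) \<le> Suc n" "Suc i < Suc n" using i by auto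
    note m0 = bm[OF i'(1)] bm[OF i'(2)]
    have "\<exists>v. mor C v \<and> src C v = obj X (Suc (Suc i)) \<and> tgt C v = tgt C (u \<cdot> i1 (Suc i)) \<and> u \<cdot> i1 (Suc i) = v \<cdot> dif X (Suc i)"
      by (rule right_exactD(2)[OF X'(3,1)]) (use d1[of i u] u i m0 in \<open>auto simp del: comp_asc\<close>)
    then obtain v where v: "mor C v" "src C v = obj X (Suc (Suc i))" "tgt C v = tgt C u" "u \<cdot> i1 (Suc i) = v \<cdot> dif X (Suc i)"
      using u m0 by auto
    have "\<exists>v. mor C v \<and> src C v = obj Y (Suc (Suc i)) \<and> tgt C v = tgt C (u \<cdot> i2 (Suc i)) \<and> u \<cdot> i2 (Suc i) = v \<cdot> dif Y (Suc i)"
      by (rule right_exactD(2)[OF Y'(3,1)]) (use d1[of i u] u i m0 in \<open>auto simp del: comp_asc\<close>)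
    then obtain w where w: "mor C w" "src C w = obj Y (Suc (Suc i))" "tgt C w = tgt C u" "u \<cdot> i2 (Suc i) = w \<cdot> dif Y (Suc i)"
      using u m0 by auto
    let ?v = "(v \<cdot> p1 (Suc (Suc i))) \<oplus> (w \<cdot> p2 (Suc (Suc i)))"
    note xx = x(1-4)[of "Suc i"] x(7-10)[of "Suc i"]
    have "?v \<cdot> dif S (Suc i) = (v \<cdot> (dif X (Suc i) \<cdot> p1 (Suc i))) \<oplus> (w \<cdot> (dif Y (Suc i) \<cdot> p2 (Suc i)))"
      unfolding f(7)[OF i'(3)] using v(1-3) w(1-3) m0 be[OF i'(2)] xx i'(3) by simp
    also have "\<dots> = ((v \<cdot> dif X (Suc i)) \<cdot> p1 (Suc i)) \<oplus> ((w \<cdot> dif Y (Suc i)) \<cdot> p2 (Suc i))"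
      using v(1-3) w(1-3) m0 xx i'(3) by simp
    also have "\<dots> = u"
      unfolding v(4)[symmetric] w(4)[symmetric] using biprod_id(2)[OF b[OF i'(1)] u(1,2)] u m0 by simp
    finally have "u = ?v \<cdot> dif S (Suc i)" by (rule sym)
    moreover have "mor C ?v" "src C ?v = obj S (Suc (Suc i))" "tgt C ?v = tgt C u"
      using v(1-3) w(1-3) m0 by simp_all
    ultimately show "\<exists>v. mor C v \<and> src C v = obj S (Suc (Suc i)) \<and> tgt C v = tgt C u \<and> u = v \<cdot> dif S (Suc i)"
      by blast
  qed
  show ?thesis using f(1) L R by (simp add: exact_seq_def)
qed

lemma zero_complex_exact_seq:
  assumes X: "complex C (Suc n) X" and z: "\<And>i. i \<le> Suc n \<Longrightarrow> zero_object C (obj X i)"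
  shows "exact_seq n C X"
proof -
  note x = complexD[OF X]
  have zt: "u = zr C (src C u) (obj X i)" if "mor C u" "tgt C u = obj X i" "i \<le> Suc n" for u i
    using zero_ob_eq(2)[OF z[OF that(3)] that(1) refl that(2)] .
  have zs: "u = zr C (obj X i) (tgt C u)" if "mor C u" "src C u = obj X i" "i \<le> Suc n" for u i
    using zero_ob_eq(3)[OF z[OF that(3)] that(1,2) refl] .
  have L: "left_exact C (Suc n) X"
    unfolding left_exact_iff[OF X, simplified]
  proof (intro conjI allI impI)
    fix u assume "mor C u" "tgt C u = obj X 0" then show "u = zr C (src C u) (obj X 0)" using zt[of u 0] by simp
  next
    fix i u assume i: "i < n" and u: "mor C u" "tgt C u = obj X (Suc i)"
    have "u = dif X i \<cdot> zr C (src C u) (obj X i)" using zt[OF u] x(1-4)[of i] u(1) i by simp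
    then show "\<exists>v. mor C v \<and> src C v = src C u \<and> tgt C v = obj X i \<and> u = dif X i \<cdot> v"
      using u(1) i x(1)[of i] by (intro exI[of _ "zr C (src C u) (obj X i)"]) simp
  qed
  have R: "right_exact C (Suc n) X"
    unfolding right_exact_iff[OF X, simplified]
  proof (intro conjI allI impI)
    fix u assume "mor C u" "src C u = obj X (Suc n)" then show "u = zr C (obj X (Suc n)) (tgt C u)" using zs[of u "Suc n"] by simp
  next
    fix i u assume i: "i < n" and u: "mor C u" "src C u = obj X (Suc i)"
    have "u = zr C (obj X (Suc (Suc i))) (tgt C u) \<cdot> dif X (Suc i)" using zs[OF u] x(1-4)[of "Suc i"] u(1) i by simp
    then show "\<exists>v. mor C v \<and> src C v = obj X (Suc (Suc i)) \<and> tgt C v = tgt C u \<and> u = v \<cdot> dif X (Suc i)"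
      using u(1) i x(1)[of "Suc (Suc i)"] by (intro exI[of _ "zr C (obj X (Suc (Suc i))) (tgt C u)"]) simp
  qed
  show ?thesis using X L R by (simp add: exact_seq_def)
qed

text \<open>
  Contractible complexes, which are added to a realisation in order to enlarge it.
\<close>

definition trivial_cplx :: "nat \<Rightarrow> 'o \<Rightarrow> 'o \<Rightarrow> ('o, 'm) cplx" where
  "trivial_cplx k N B = Cplx (\<lambda>i. if i = k \<or> i = Suc k then B else N)
    (\<lambda>i. if i = k then Idn C B else zr C (if i = k \<or> i = Suc k then B else N) (if Suc i = k \<or> i = k then B else N))"

lemma trivial_exact_seq:
  assumes N: "zero_object C N" and B: "B \<in> Ob C" and k: "k \<le> n"
  shows "exact_seq n C (trivial_cplx k N B)"
proof -
  let ?X = "trivial_cplx k N B"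
  note n = zero_ob_eq[OF N]
  have o: "obj ?X i = (if i = k \<or> i = Suc k then B else N)" for i by (simp add: trivial_cplx_def)
  have d: "dif ?X i = (if i = k then Idn C B else zr C (obj ?X i) (obj ?X (Suc i)))" for i
    by (simp add: trivial_cplx_def)
  have ob: "obj ?X i \<in> Ob C" for i using B n by (simp add: o)
  have X: "complex C (Suc n) ?X"
    by (rule complexI) (use B n ob in \<open>auto simp: d o\<close>)
  have L: "left_exact C (Suc n) ?X"
    unfolding left_exact_iff[OF X, simplified]
  proof (intro conjI allI impI)
    fix u assume u: "mor C u" "tgt C u = obj ?X 0" "dif ?X 0 \<cdot> u = zr C (src C u) (obj ?X (Suc 0))"
    show "u = zr C (src C u) (obj ?X 0)"
    proof (cases "k = 0")
      case True then show ?thesis using u unfolding d o by auto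
    next
      case False then show ?thesis using n(2)[OF u(1) refl] u(2) by (simp add: o)
    qed
  next
    fix i u assume i: "i < n" and u: "mor C u" "tgt C u = obj ?X (Suc i)" "dif ?X (Suc i) \<cdot> u = zr C (src C u) (obj ?X (Suc (Suc i)))"
    show "\<exists>v. mor C v \<and> src C v = src C u \<and> tgt C v = obj ?X i \<and> u = dif ?X i \<cdot> v"
    proof (cases "i = k")
      case True then show ?thesis using u(1,2) unfolding d o by (intro exI[of _ u]) auto
    next
      case False
      have "u = zr C (src C u) (obj ?X (Suc i))"
      proof (cases "Suc i = k")
        case True then show ?thesis using u unfolding d o by auto
      next
        case c: False then show ?thesis using n(2)[OF u(1) refl] u(2) False by (simp add: o)
      qed
      then have "u = dif ?X i \<cdot> zr C (src C u) (obj ?X i)" using u(1) ob False by (simp add: d)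
      then show ?thesis using u(1) ob by (intro exI[of _ "zr C (src C u) (obj ?X i)"]) simp
    qed
  qed
  have R: "right_exact C (Suc n) ?X"
    unfolding right_exact_iff[OF X, simplified]
  proof (intro conjI allI impI)
    fix u assume u: "mor C u" "src C u = obj ?X (Suc n)" "u \<cdot> dif ?X n = zr C (obj ?X n) (tgt C u)"
    show "u = zr C (obj ?X (Suc n)) (tgt C u)"
    proof (cases "k = n")
      case True then show ?thesis using u unfolding d o by auto
    next
      case False then show ?thesis using n(3)[OF u(1) _ refl] u(2) k by (simp add: o)
    qed
  next
    fix i u assume i: "i < n" and u: "mor C u" "src C u = obj ?X (Suc i)" "u \<cdot> dif ?X i = zr C (obj ?X i) (tgt C u)"
    show "\<exists>v. mor C v \<and> src C v = obj ?X (Suc (Suc i)) \<and> tgt C v = tgt C u \<and> u = v \<cdot> dif ?X (Suc i)"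
    proof (cases "Suc i = k")
      case True then show ?thesis using u(1,2) unfolding d o by (intro exI[of _ u]) auto
    next
      case False
      have "u = zr C (obj ?X (Suc i)) (tgt C u)"
      proof (cases "i = k")
        case True then show ?thesis using u unfolding d o by auto
      next
        case c: False then show ?thesis using n(3)[OF u(1) _ refl] u(2) False by (simp add: o)
      qed
      then have "u = zr C (obj ?X (Suc (Suc i))) (tgt C u) \<cdot> dif ?X (Suc i)" using u(1) ob False by (simp add: d)
      then show ?thesis using u(1) ob by (intro exI[of _ "zr C (obj ?X (Suc (Suc i))) (tgt C u)"]) simp
    qed
  qed
  show ?thesis using X L R by (simp add: exact_seq_def)
qed

lemma biproduct_zero:
  assumes N: "zero_object C N" and A: "A \<in> Ob C"
  shows "biproduct C A N A (Idn C A) (zr C N A) (Idn C A) (zr C A N)"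
  using zero_ob_eq(1,4)[OF N] A by (simp add: biproduct_def)

end

context exact_exang
begin

lemma act_zero_l [simp]:
  assumes "mor E a" "\<delta> \<in> carrier (Ext E Z (src E a))" "Z \<in> Ob E" "Z' \<in> Ob E"
  shows "Act E (zr E Z' Z) a \<delta> = \<one>\<^bsub>Ext E Z' (tgt E a)\<^esub>"
proof -
  interpret op: additive_bifunctor "op_exang n E" by (rule additive_bifunctor_op)
  have sc: "mor (op_exang n E) = mor E" "src (op_exang n E) = tgt E" "tgt (op_exang n E) = src E"
    using same_cat_cong[OF same_cat_op_exang[of n E]] by simp_all
  show ?thesis using op.act_zero_r[of a \<delta> Z Z'] assms by (simp add: sc)
qed

text \<open>
  The injections and the projections are morphisms between the sum of the extensions and its summands. Their
  lifts combine to end-fixing maps between the direct sum and any realisation of the sum.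
\<close>

lemma realises_direct_sum:
  assumes X: "realises n E A Z \<delta> X" and Y: "realises n E B D \<rho> Y" and S: "direct_sum E (Suc n) X Y S i1 i2 p1 p2"
  shows "realises n E (obj S 0) (obj S (Suc n))
     (Act E (p1 (Suc n)) (i1 0) \<delta> \<otimes>\<^bsub>Ext E (obj S (Suc n)) (obj S 0)\<^esub> Act E (p2 (Suc n)) (i2 0) \<rho>) S"
proof -
  note r = rzD[OF X] and s = rzD[OF Y]
  note f = direct_sum_facts[OF S r(6) s(6)]
  note b0 = biprod_mor[OF f(6)[of 0, simplified], unfolded r(4) s(4)] biprod_eq[OF f(6)[of 0, simplified], unfolded r(4) s(4)]
  note bn = biprod_mor[OF f(6)[of "Suc n", simplified], unfolded r(5) s(5)] biprod_eq[OF f(6)[of "Suc n", simplified], unfolded r(5) s(5)]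
  define P where "P = obj S 0" define Q where "Q = obj S (Suc n)"
  have PQ: "P \<in> Ob E" "Q \<in> Ob E" using b0(15) bn(15) by (auto simp: P_def Q_def)
  note b0' = b0[folded P_def] and bn' = bn[folded Q_def]
  define d1 where "d1 = Act E (p1 (Suc n)) (i1 0) \<delta>" define d2 where "d2 = Act E (p2 (Suc n)) (i2 0) \<rho>"
  have d: "d1 \<in> carrier (Ext E Q P)" "d2 \<in> carrier (Ext E Q P)" using b0' bn' r(1-3) s(1-3) by (auto simp: d1_def d2_def)
  interpret G: comm_group "Ext E Q P" using PQ by (intro ext_group)
  interpret G1: comm_group "Ext E Z P" using PQ r by (intro ext_group)
  interpret G2: comm_group "Ext E D P" using PQ s by (intro ext_group)
  interpret G3: comm_group "Ext E Q A" using PQ r by (intro ext_group)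
  interpret G4: comm_group "Ext E Q B" using PQ s by (intro ext_group)
  define \<eta> where "\<eta> = d1 \<otimes>\<^bsub>Ext E Q P\<^esub> d2"
  have eta: "\<eta> \<in> carrier (Ext E Q P)" using d by (simp add: \<eta>_def)
  obtain T where T: "realises n E P Q \<eta> T" using realises_exists[OF PQ eta] .
  note t = rzD[OF T]
  have e1: "Act E (Idn E Z) (i1 0) \<delta> = Act E (i1 (Suc n)) (Idn E P) \<eta>"
    using act_mult[of "i1 (Suc n)" "Idn E P" Q P Z P d1 d2] d b0' bn' r(1-3) s(1-3) PQ
    by (simp add: \<eta>_def) (simp add: d1_def d2_def)
  have e2: "Act E (Idn E D) (i2 0) \<rho> = Act E (i2 (Suc n)) (Idn E P) \<eta>"
    using act_mult[of "i2 (Suc n)" "Idn E P" Q P D P d1 d2] d b0' bn' r(1-3) s(1-3) PQ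
    by (simp add: \<eta>_def) (simp add: d1_def d2_def)
  have e3: "Act E (Idn E Q) (p1 0) \<eta> = Act E (p1 (Suc n)) (Idn E A) \<delta>"
    using act_mult[of "Idn E Q" "p1 0" Q P Q A d1 d2] d b0' bn' r(1-3) s(1-3) PQ
    by (simp add: \<eta>_def) (simp add: d1_def d2_def)
  have e4: "Act E (Idn E Q) (p2 0) \<eta> = Act E (p2 (Suc n)) (Idn E B) \<rho>"
    using act_mult[of "Idn E Q" "p2 0" Q P Q B d1 d2] d b0' bn' r(1-3) s(1-3) PQ
    by (simp add: \<eta>_def) (simp add: d1_def d2_def)
  obtain a where a: "chain_map E (Suc n) X T a" "a 0 = i1 0" "a (Suc n) = i1 (Suc n)"
    by (rule realises_lift[OF X T, of "i1 0" "i1 (Suc n)"]) (use e1 b0' bn' in auto)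
  obtain b where b: "chain_map E (Suc n) Y T b" "b 0 = i2 0" "b (Suc n) = i2 (Suc n)"
    by (rule realises_lift[OF Y T, of "i2 0" "i2 (Suc n)"]) (use e2 b0' bn' in auto)
  obtain a' where a': "chain_map E (Suc n) T X a'" "a' 0 = p1 0" "a' (Suc n) = p1 (Suc n)"
    by (rule realises_lift[OF T X, of "p1 0" "p1 (Suc n)"]) (use e3 b0' bn' in auto)
  obtain b' where b': "chain_map E (Suc n) T Y b'" "b' 0 = p2 0" "b' (Suc n) = p2 (Suc n)"
    by (rule realises_lift[OF T Y, of "p2 0" "p2 (Suc n)"]) (use e4 b0' bn' in auto)
  have F: "end_fixing n E S T (\<lambda>i. (a i \<cdot> p1 i) \<oplus> (b i \<cdot> p2 i))"
    unfolding end_fixing_def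
    using chain_map_add[OF chain_map_comp[OF f(4) a(1) f(1) r(6) t(6)] chain_map_comp[OF f(5) b(1) f(1) s(6) t(6)] f(1) t(6)]
      a b b0(20) bn(20) by simp
  have G: "end_fixing n E T S (\<lambda>i. (i1 i \<cdot> a' i) \<oplus> (i2 i \<cdot> b' i))"
    unfolding end_fixing_def
    using chain_map_add[OF chain_map_comp[OF a'(1) f(2) t(6) r(6) f(1)] chain_map_comp[OF b'(1) f(3) t(6) s(6) f(1)] t(6) f(1)]
      a' b' b0(20) bn(20) t(4,5) by (simp add: P_def Q_def)
  have "realises n E P Q \<eta> S"
    by (rule realises_end_fixing2[OF T direct_sum_exact_seq[OF S realises_exact[OF X] realises_exact[OF Y]] G F])
  then show ?thesis by (simp add: P_def Q_def \<eta>_def d1_def d2_def)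
qed

lemma realises_zero_complex:
  assumes X: "complex E (Suc n) X" and z: "\<And>i. i \<le> Suc n \<Longrightarrow> zero_object E (obj X i)"
  shows "realises n E (obj X 0) (obj X (Suc n)) \<one>\<^bsub>Ext E (obj X (Suc n)) (obj X 0)\<^esub> X"
proof -
  define A where "A = obj X 0" define N where "N = obj X (Suc n)"
  have A: "zero_object E A" "zero_object E N" using z by (auto simp: A_def N_def)
  note za = zero_ob_eq[OF A(1)] and zn = zero_ob_eq[OF A(2)]
  let ?Y = "Cplx (\<lambda>i. if i \<le> 1 then A else N) (\<lambda>i. if i = 0 then Idn E A else if i = 1 then zr E A N else zr E N N)"
  have Y: "realises n E A N \<one>\<^bsub>Ext E N A\<^esub> ?Y" using R2_left[OF za(1) A(2)] za(1) zn(1) by (simp add: realises_def)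
  note r = rzD[OF Y]
  have zy: "zero_object E (obj ?Y i)" for i using A by simp
  have cm: "end_fixing n E V W (\<lambda>i. zr E (obj V i) (obj W i))"
    if V: "complex E (Suc n) V" and W: "complex E (Suc n) W" and "\<And>i. i \<le> Suc n \<Longrightarrow> zero_object E (obj V i)"
     "obj V 0 = A" "obj V (Suc n) = N" "obj W 0 = A" "obj W (Suc n) = N" for V W
    unfolding end_fixing_def
  proof (intro conjI)
    have "chain_map E (Suc n) V W (\<lambda>i. zr E (obj V i) (obj W i))"
      by (rule chain_mapI[OF V W]) (use complexD[OF V] complexD[OF W] in auto)
    then show "chain_map E (n + 1) V W (\<lambda>i. zr E (obj V i) (obj W i))" by simp
  qed (use that za(4) zn(4) in auto)
  have "realises n E A N \<one>\<^bsub>Ext E N A\<^esub> X"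
    by (rule realises_end_fixing2[OF Y zero_complex_exact_seq[OF X z] cm[OF r(6) X zy] cm[OF X r(6) z]])
      (use A_def N_def n1 in auto)
  then show ?thesis by (simp add: A_def N_def)
qed

text \<open>
  The direct sum with a contractible complex is an exact sequence, and the injection of \<open>X\<close> has a
  section in the top degree up to a map through the last differential: an identity if \<open>k < n\<close>, a
  projection if \<open>k = n\<close>.
\<close>

lemma stabilise:
  assumes X: "realises n E A Z \<delta> X" and k: "k \<le> n"
    and b: "biproduct E (obj X k) B P i1 i2 p1 p2" and b': "biproduct E (obj X (Suc k)) B P' i1' i2' p1' p2'"
  shows "\<exists>S \<rho>. realises n E (obj S 0) (obj S (Suc n)) \<rho> S \<and> obj S k = P \<and> obj S (Suc k) = P' \<and>
     (\<forall>i. i \<noteq> k \<longrightarrow> i \<noteq> Suc k \<longrightarrow> obj S i = obj X i) \<and>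
     (\<forall>i. Suc i < k \<longrightarrow> dif S i = dif X i) \<and> (\<forall>i. Suc i = k \<longrightarrow> dif S i = i1 \<cdot> dif X i) \<and>
     dif S k = (i1' \<cdot> (dif X k \<cdot> p1)) \<oplus> (i2' \<cdot> p2)"
proof -
  note r = rzD[OF X] and x = complexD[OF rzD(6)[OF X]]
  obtain N where N: "zero_object E N" using zero_object_exists by blast
  note zn = zero_ob_eq[OF N]
  note bm = biprod_mor[OF b] biprod_eq[OF b] biprod_eq'[OF b] and bm' = biprod_mor[OF b'] biprod_eq[OF b'] biprod_eq'[OF b']
  let ?T = "trivial_cplx k N B"
  have T: "exact_seq n E ?T" by (rule trivial_exact_seq[OF N bm(14) k])
  define I1 where "I1 i = (if i = k then i1 else if i = Suc k then i1' else Idn E (obj X i))" for i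
  define I2 where "I2 i = (if i = k then i2 else if i = Suc k then i2' else zr E N (obj X i))" for i
  define P1 where "P1 i = (if i = k then p1 else if i = Suc k then p1' else Idn E (obj X i))" for i
  define P2 where "P2 i = (if i = k then p2 else if i = Suc k then p2' else zr E (obj X i) N)" for i
  define Q where "Q i = (if i = k then P else if i = Suc k then P' else obj X i)" for i
  define S where "S = Cplx Q (\<lambda>i. (I1 (Suc i) \<cdot> dif X i \<cdot> P1 i) \<otimes>\<^bsub>Hom E (Q i) (Q (Suc i))\<^esub> (I2 (Suc i) \<cdot> dif ?T i \<cdot> P2 i))"
  have DS: "direct_sum E (Suc n) X ?T S I1 I2 P1 P2"
    unfolding direct_sum_def
  proof (intro conjI allI impI)
    fix j assume j: "j \<le> Suc n"
    consider "j = k" | "j = Suc k" | "j \<noteq> k" "j \<noteq> Suc k" by blast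
    then show "biproduct E (obj X j) (obj ?T j) (obj S j) (I1 j) (I2 j) (P1 j) (P2 j)"
      using b b' biproduct_zero[OF N x(1)[OF j]]
      by cases (simp_all add: S_def Q_def I1_def I2_def P1_def P2_def trivial_cplx_def)
  qed (simp add: S_def)
  have T': "complex E (Suc n) ?T" using T by (simp add: exact_seq_def)
  note f = direct_sum_facts[OF DS r(6) T']
  have nS: "exact_seq n E S" by (rule direct_sum_exact_seq[OF DS realises_exact[OF X] T])
  have dk: "dif S k = (i1' \<cdot> (dif X k \<cdot> p1)) \<oplus> (i2' \<cdot> p2)"
    using f(7)[of k] k bm by (simp add: I1_def I2_def P1_def P2_def trivial_cplx_def)
  have dl: "dif S i = dif X i" if "Suc i < k" for i
    using f(7)[of i] x(1-4)[of i] x(1)[of "Suc i"] that k zn(1) by (simp add: I1_def I2_def P1_def P2_def trivial_cplx_def)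
  have dl2: "dif S i = i1 \<cdot> dif X i" if "Suc i = k" for i
    using f(7)[of i] x(1-4)[of i] that k zn(1) bm by (auto simp: I1_def I2_def P1_def P2_def trivial_cplx_def)
  have "\<exists>\<rho>. realises n E (obj S 0) (obj S (Suc n)) \<rho> S"
  proof (cases "k = n")
    case False
    show ?thesis
      by (rule realised_if_section[OF nS X f(2), of "Idn E (obj X (Suc n))" "zr E (obj X (Suc n)) (obj S n)"])
        (use False k x(1)[of "Suc n"] r(2,5) complexD[OF f(1), of n] in \<open>auto simp: I1_def S_def Q_def\<close>)
  next
    case True
    have "i1' \<cdot> p1' = Idn E P' \<oplus> \<ominus> (i2' \<cdot> p2')"
      unfolding bm'(20)[symmetric] using bm'(1-15) by (simp add: add_assoc)
    then show ?thesis
      by (intro realised_if_section[OF nS X f(2), of p1' "\<ominus> (i2 \<cdot> p2')"])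
        (use True bm bm' x(1-4)[of n] r(5) dk in \<open>auto simp: I1_def S_def Q_def\<close>)
  qed
  then show ?thesis using dk dl dl2
    by (intro exI[of _ S]) (auto simp: S_def Q_def)
qed

end


section \<open>The \<open>n\<close>-exact structure formed by the realisations\<close>

definition realised_set :: "nat \<Rightarrow> ('o, 'm, 'x) exang \<Rightarrow> ('o, 'm) cplx set" where
  "realised_set n E = {X. \<exists>A Z \<delta>. realises n E A Z \<delta> X}"

lemma isomorphism_op: "isomorphism (op_cat C) Y X f \<longleftrightarrow> isomorphism C X Y f"
  by (auto simp: isomorphism_def)

context additive_category
begin

lemma isoD:
  assumes "isomorphism C X Y f" "X \<in> Ob C" "Y \<in> Ob C"
  obtains g where "mor C f" "src C f = X" "tgt C f = Y" "mor C g" "src C g = Y" "tgt C g = X"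
    "g \<cdot> f = Idn C X" "f \<cdot> g = Idn C Y"
  using assms by (auto simp: isomorphism_def)

lemma complex_le: "complex C (Suc m) X \<Longrightarrow> complex C m X"
  by (rule complexI) (auto simp: complexD)

lemma chain_map_le: "complex C (Suc m) X \<Longrightarrow> complex C (Suc m) Y \<Longrightarrow> chain_map C (Suc m) X Y f \<Longrightarrow> chain_map C m X Y f"
  by (simp add: chain_map_def)

lemma neg_eq_zero:
  assumes "\<ominus> u = zr C V W" "mor C u" "src C u = V" "tgt C u = W" shows "u = zr C V W"
  using assms by (metis neg_neg neg_zero mor_ob)

lemma direct_sum_exists:
  assumes X: "complex C m X" and Y: "complex C m Y"
  shows "\<exists>S i1 i2 p1 p2. direct_sum C m X Y S i1 i2 p1 p2"
proof -
  have "\<forall>j. \<exists>t. j \<le> m \<longrightarrow> (case t of (P, i1, i2, p1, p2) \<Rightarrow> biproduct C (obj X j) (obj Y j) P i1 i2 p1 p2)"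
    using biproduct_exists complexD(1)[OF X] complexD(1)[OF Y] by (metis (mono_tags, lifting) case_prodI)
  then obtain T where T: "\<And>j. j \<le> m \<Longrightarrow> case T j of (P, i1, i2, p1, p2) \<Rightarrow> biproduct C (obj X j) (obj Y j) P i1 i2 p1 p2"
    by metis
  define P where "P j = fst (T j)" for j
  define i1 where "i1 j = fst (snd (T j))" for j
  define i2 where "i2 j = fst (snd (snd (T j)))" for j
  define p1 where "p1 j = fst (snd (snd (snd (T j))))" for j
  define p2 where "p2 j = snd (snd (snd (snd (T j))))" for j
  have b: "j \<le> m \<Longrightarrow> biproduct C (obj X j) (obj Y j) (P j) (i1 j) (i2 j) (p1 j) (p2 j)" for j
    using T[of j] by (simp add: P_def i1_def i2_def p1_def p2_def split: prod.splits)
  have "direct_sum C m X Y (Cplx P (\<lambda>j. (i1 (Suc j) \<cdot> dif X j \<cdot> p1 j)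
          \<otimes>\<^bsub>Hom C (P j) (P (Suc j))\<^esub> (i2 (Suc j) \<cdot> dif Y j \<cdot> p2 j))) i1 i2 p1 p2"
    unfolding direct_sum_def using b by simp
  then show ?thesis by blast
qed

end

context exact_exang
begin

text \<open>
  At both ends of the cone, exactness comes from the extension: degree \<open>n + 1\<close>, which is missing,
  is shared by \<open>X\<close> and \<open>Y\<close>, and a map \<open>b\<close> on \<open>Y\<^sub>0\<close>
  extends to \<open>Y\<^sub>1\<close> iff it annihilates the pushed extension.
\<close>

lemma lift_pushout:
  assumes X: "realises n E A Z \<delta> X" and a: "mor E a" "src E a = A" "tgt E a = B"
    and Y: "realises n E B Z (Act E (Idn E Z) a \<delta>) Y"
    and f: "chain_map E (Suc n) X Y f" "f 0 = a" "f (Suc n) = Idn E Z"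
  shows "n_pushout n E X Y f"
proof -
  note r = rzD[OF X] and s = rzD[OF Y]
  note x = complexD[OF r(6)] and y = complexD[OF s(6)]
  note ff = chain_mapD[OF r(6) s(6) f(1) r(6) s(6) order_refl]
  note cX = complex_le[OF r(6)] and cY = complex_le[OF s(6)]
  have n': "0 < n" "Suc (n - Suc 0) = n" using n1 by auto
  note g = chain_map_le[OF r(6) s(6) f(1)]
  obtain M where M: "mapping_cone E n X Y f M" using mapping_cone_exists[OF cX cY n1] by blast
  obtain i1 i2 p1 p2 where T: "twisted_cone E n (neg_cplx E X) Y f M i1 i2 p1 p2"
    using mapping_cone_twisted_cone[OF M g cX cY n1] .
  note cN = complex_neg[OF cX] and an = anticommuting_neg[OF g cX cY]
  have "right_exact E (Suc n) M"
  proof (rule twisted_cone_right_exact[OF T cN cY n1 an], goal_cases)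
    case (1 u)
    have "\<exists>v. mor E v \<and> src E v = obj Y (Suc (Suc (n - 1))) \<and> tgt E v = tgt E u \<and> u = v \<cdot> dif Y (Suc (n - 1))"
      by (rule right_exactD(2)[OF s(8) s(6)]) (use 1 n' in auto)
    then obtain v where v: "mor E v" "src E v = Z" "tgt E v = tgt E u" "u = v \<cdot> dif Y n" using n' s(5) by auto
    have "v \<cdot> dif X n = v \<cdot> (f (Suc n) \<cdot> dif X n)" using f(3) x(1-4)[of n] r(5) by simp
    also have "\<dots> = (v \<cdot> dif Y n) \<cdot> f n" using ff(4)[of n] v(1,2) ff(1-3)[of n] y(1-4)[of n] s(5) by simp
    also have "\<dots> = zr E (obj X n) (tgt E v)" using 1(3) unfolding v(3) v(4)[symmetric] by simp
    finally have "v = zr E Z (tgt E u)"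
      using right_exactD(1)[OF r(8) r(6) _ v(1)] v(2,3) r(5) by simp
    then have "u = zr E Z (tgt E u) \<cdot> dif Y n" using v(4) by metis
    also have "\<dots> = zr E (obj Y n) (tgt E u)" using y(1-4)[of n] s(5) mor_ob(2)[OF 1(1)] by simp
    finally show ?case .
  next
    case (2 u b)
    have "u \<cdot> dif X 0 = b \<cdot> a"
      using eq_iff_diff[of "b \<cdot> a" "u \<cdot> dif X 0"] 2 x(1-4)[of 0] a f(2) r(4) s(4) by (simp add: add_comm)
    moreover have "Act E (Idn E Z) (u \<cdot> dif X 0) \<delta> = Act E (Idn E Z) u (Act E (Idn E Z) (dif X 0) \<delta>)"
      using 2 x(1-4)[of 0] r(1-5) by simp
    ultimately have "Act E (Idn E Z) (b \<cdot> a) \<delta> = \<one>\<^bsub>Ext E Z (tgt E b)\<^esub>"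
      unfolding r(9) using 2 r(2) by simp
    then have "Act E (Idn E Z) b (Act E (Idn E Z) a \<delta>) = \<one>\<^bsub>Ext E Z (tgt E b)\<^esub>"
      using 2 a r(1-5) s(4) by simp
    then show ?case using realises_push[OF Y, of b] 2 s(4) by simp
  next
    case (3 j b) then show ?case using right_exactD(2)[OF s(8) s(6), of j b] by simp
  next
    case (4 j d)
    have "d \<cdot> dif X j = zr E (obj X j) (tgt E d)"
      by (rule neg_eq_zero) (use 4 x(1-4)[of j] in auto)
    then obtain v where v: "mor E v" "src E v = obj X (Suc (Suc j))" "tgt E v = tgt E d" "d = v \<cdot> dif X (Suc j)"
      using right_exactD(2)[OF r(8) r(6), of j d] 4 by auto
    then show ?case using x(1-4)[of "Suc j"] 4 by (intro exI[of _ "\<ominus> v"]) simp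
  next
    case (5 d)
    have d0: "d \<cdot> dif X (n - 1) = zr E (obj X (n - 1)) (tgt E d)"
      by (rule neg_eq_zero) (use 5 x(1-4)[of "n - 1"] n' in auto)
    have "\<exists>v. mor E v \<and> src E v = obj X (Suc (Suc (n - 1))) \<and> tgt E v = tgt E d \<and> d = v \<cdot> dif X (Suc (n - 1))"
      by (rule right_exactD(2)[OF r(8) r(6)]) (use 5 n' d0 in auto)
    then obtain v where v: "mor E v" "src E v = Z" "tgt E v = tgt E d" "d = v \<cdot> dif X n" using n' r(5) by auto
    have "(v \<cdot> dif Y n) \<cdot> f n = v \<cdot> (f (Suc n) \<cdot> dif X n)" using ff(4)[of n] v(1,2) ff(1-3)[of n] y(1-4)[of n] s(5) by simp
    also have "\<dots> = d" unfolding v(4) using f(3) x(1-4)[of n] r(5) by simp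
    finally have "(v \<cdot> dif Y n) \<cdot> f n = d" .
    moreover have "(v \<cdot> dif Y n) \<cdot> dif Y (n - 1) = zr E (obj Y (n - 1)) (tgt E d)"
      using v(1-3) y(1-4)[of n] y(1-5)[of "n - 1"] n' s(5) by simp
    moreover have "mor E (v \<cdot> dif Y n)" "src E (v \<cdot> dif Y n) = obj Y n" "tgt E (v \<cdot> dif Y n) = tgt E d"
      using v(1-3) y(1-4)[of n] s(5) by simp_all
    ultimately show ?case by blast
  qed
  then show ?thesis using cX cY g M by (auto simp: n_pushout_def)
qed

lemma realises_realised_set: "realises n E A Z \<delta> X \<Longrightarrow> X \<in> realised_set n E"
  by (auto simp: realised_set_def)

lemma rsetE:
  assumes "X \<in> realised_set n E" obtains \<delta> where "realises n E (obj X 0) (obj X (Suc n)) \<delta> X"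
proof -
  from assms obtain A Z \<delta> where X: "realises n E A Z \<delta> X" by (auto simp: realised_set_def)
  then show thesis using that[of \<delta>] rzD(4,5)[OF X] by simp
qed

lemma realised_set_op: "realised_set n (op_exang n E) = rev_cplx (Suc n) -` realised_set n E"
  by (auto simp: realised_set_def realises_op)

lemma realised_pushouts: "has_n_pushouts n E (realised_set n E)"
  unfolding has_n_pushouts_def
proof (intro ballI)
  fix X B a assume "X \<in> realised_set n E" and B: "B \<in> Ob E" and "a \<in> arr E (obj X 0) B"
  then obtain \<delta> where X: "realises n E (obj X 0) (obj X (Suc n)) \<delta> X" using rsetE by blast
  note r = rzD[OF X]
  have a: "mor E a" "src E a = obj X 0" "tgt E a = B" using \<open>a \<in> arr E (obj X 0) B\<close> B r(1) by auto
  have d: "Act E (Idn E (obj X (Suc n))) a \<delta> \<in> carrier (Ext E (obj X (Suc n)) B)" using a r(1-3) by simp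
  obtain Y where Y: "realises n E B (obj X (Suc n)) (Act E (Idn E (obj X (Suc n))) a \<delta>) Y" using realises_exists[OF B r(2) d] .
  obtain f where f: "chain_map E (Suc n) X Y f" "f 0 = a" "f (Suc n) = Idn E (obj X (Suc n))"
    by (rule realises_lift[OF X Y, of a "Idn E (obj X (Suc n))"]) (use a r(1-3) B d in auto)
  show "\<exists>Y f. obj Y 0 = B \<and> f 0 = a \<and> n_pushout n E X Y f \<and> adm_mono (realised_set n E) (dif Y 0)"
    using lift_pushout[OF X a Y f] rzD(4)[OF Y] f(2) realises_realised_set[OF Y] by (auto simp: adm_mono_def)
qed

lemma weak_last:
  assumes X: "X \<in> realised_set n E" and Y: "exact_seq n E Y" and f: "chain_map E (Suc n) X Y f"
    and i: "isomorphism E (obj X (Suc n)) (obj Y (Suc n)) (f (Suc n))"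
  shows "Y \<in> realised_set n E"
proof -
  obtain \<delta> where X: "realises n E (obj X 0) (obj X (Suc n)) \<delta> X" using rsetE X by blast
  have Y': "complex E (Suc n) Y" using Y by (auto simp: exact_seq_def)
  note y = complexD[OF Y']
  obtain g where g: "mor E g" "src E g = obj Y (Suc n)" "tgt E g = obj X (Suc n)" "f (Suc n) \<cdot> g = Idn E (obj Y (Suc n))"
    using isoD[OF i rzD(2)[OF X] y(1)[OF order_refl]] by metis
  have "\<exists>\<rho>. realises n E (obj Y 0) (obj Y (Suc n)) \<rho> Y"
    by (rule realised_if_section[OF Y X f g(1-3), of "zr E (obj Y (Suc n)) (obj Y n)"]) (use g y(1-4)[of n] y(1)[of "Suc n"] in auto)
  then show ?thesis using realises_realised_set by blast
qed

text \<open>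
  The inverses in degrees \<open>j\<close> and \<open>j + 1\<close> extend upwards to a chain map from
  \<open>Y\<close> to \<open>X\<close>. It is inverse to \<open>f\<close> in degree \<open>j + 1\<close>,
  hence up to homotopy above, and in particular a section of \<open>f\<close> up to a map through
  \<open>dif Y n\<close>.
\<close>

lemma weak_mid:
  assumes X: "X \<in> realised_set n E" and Y: "exact_seq n E Y" and f: "chain_map E (Suc n) X Y f" and j: "j < n"
    and g: "mor E g" "src E g = obj Y j" "tgt E g = obj X j" "g \<cdot> f j = Idn E (obj X j)" "f j \<cdot> g = Idn E (obj Y j)"
    and g': "mor E g'" "src E g' = obj Y (Suc j)" "tgt E g' = obj X (Suc j)" "g' \<cdot> f (Suc j) = Idn E (obj X (Suc j))" "f (Suc j) \<cdot> g' = Idn E (obj Y (Suc j))"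
    and gg: "g' \<cdot> dif Y j = dif X j \<cdot> g"
  shows "Y \<in> realised_set n E"
proof -
  obtain \<delta> where X: "realises n E (obj X 0) (obj X (Suc n)) \<delta> X" using rsetE X by blast
  have Y': "complex E (Suc n) Y" "right_exact E (Suc n) Y" using Y by (auto simp: exact_seq_def)
  note r = rzD[OF X]
  have "chain_on E j (Suc j) Y X (\<lambda>i. if i = j then g else g')"
    unfolding chain_on_def using g g' gg by (auto simp: le_Suc_eq dest: antisym)
  from extend_up[OF Y'(1) r(6) Y'(2) this] j obtain G where
    G: "\<forall>i\<le>Suc j. G i = (if i = j then g else g')" "chain_on E j (Suc n) Y X G" by auto
  have f1: "chain_on E 0 (Suc n) X Y f" using f chain_map_iff[OF r(6) Y'(1)] by blast
  have f2: "chain_on E (Suc j) (Suc n) X Y f" and G2: "chain_on E (Suc j) (Suc n) Y X G"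
    using f1 G(2) by (auto simp: chain_on_def)
  have i2: "chain_on E (Suc j) (Suc n) Y Y (\<lambda>i. Idn E (obj Y i))"
    using chain_on_id[OF Y'(1) order_refl] by (auto simp: chain_on_def)
  have k: "chain_on E (Suc j) (Suc n) Y Y (\<lambda>i. (f i \<cdot> G i) \<oplus> \<ominus> Idn E (obj Y i))"
    using chain_on_add[OF chain_on_comp[OF G2 f2 Y'(1) r(6) Y'(1) order_refl] chain_on_neg[OF i2 Y'(1,1) order_refl] Y'(1,1) order_refl] .
  have "(f (Suc j) \<cdot> G (Suc j)) \<oplus> \<ominus> Idn E (obj Y (Suc j)) = zr E (obj Y (Suc j)) (obj Y (Suc j))"
    using G(1) g' complexD(1)[OF Y'(1), of "Suc j"] j by simp
  from null_up[OF Y'(1,1,2) k _ this] j obtain h where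
    h: "\<forall>i. Suc j \<le> i \<and> i < Suc n \<longrightarrow> mor E (h (Suc i)) \<and> src E (h (Suc i)) = obj Y (Suc i) \<and> tgt E (h (Suc i)) = obj Y i"
      "(f (Suc n) \<cdot> G (Suc n)) \<oplus> \<ominus> Idn E (obj Y (Suc n)) = dif Y n \<cdot> h (Suc n)" by auto
  note ff = chain_onD[OF f1 r(6) Y'(1) order_refl] and GG = chain_onD[OF G(2) Y'(1) r(6) order_refl]
  have Gn: "mor E (G (Suc n))" "src E (G (Suc n)) = obj Y (Suc n)" "tgt E (G (Suc n)) = obj X (Suc n)"
    using GG(1-3)[of "Suc n"] j by auto
  have "f (Suc n) \<cdot> G (Suc n) = Idn E (obj Y (Suc n)) \<oplus> (dif Y n \<cdot> h (Suc n))"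
    by (rule diffD[OF h(2)]) (use ff(1-3)[of "Suc n"] Gn complexD(1)[OF Y'(1), of "Suc n"] in auto)
  then have "\<exists>\<rho>. realises n E (obj Y 0) (obj Y (Suc n)) \<rho> Y"
    using h(1) j by (intro realised_if_section[OF Y X f Gn, of "h (Suc n)"]) auto
  then show ?thesis using realises_realised_set by blast
qed

text \<open>
  For isomorphisms in degrees \<open>n + 1\<close> and \<open>0\<close> the two directions are dual to each
  other. Otherwise the inverses in two consecutive degrees extend to a chain map from \<open>Y\<close> to
  \<open>X\<close>, so that the directions are symmetric.
\<close>

lemma weak_iso_closed:
  assumes X: "exact_seq n E X" and Y: "exact_seq n E Y" and w: "weak_isomorphism n E X Y f"
  shows "X \<in> realised_set n E \<longleftrightarrow> Y \<in> realised_set n E"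
proof -
  have X': "complex E (Suc n) X" "left_exact E (Suc n) X" "right_exact E (Suc n) X" using X by (auto simp: exact_seq_def)
  have Y': "complex E (Suc n) Y" "left_exact E (Suc n) Y" "right_exact E (Suc n) Y" using Y by (auto simp: exact_seq_def)
  note x = complexD[OF X'(1)] and y = complexD[OF Y'(1)]
  from w obtain i where f: "chain_map E (Suc n) X Y f" and i: "i \<le> Suc n"
    and iso: "isomorphism E (obj X i) (obj Y i) (f i)"
      "isomorphism E (obj X (Suc i mod (n + 2))) (obj Y (Suc i mod (n + 2))) (f (Suc i mod (n + 2)))"
    by (auto simp: weak_isomorphism_def)
  note ff = chain_mapD[OF X'(1) Y'(1) f X'(1) Y'(1) order_refl]
  show ?thesis
  proof (cases "i = Suc n")
    case True
    then have iso': "isomorphism E (obj X (Suc n)) (obj Y (Suc n)) (f (Suc n))" "isomorphism E (obj X 0) (obj Y 0) (f 0)"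
      using iso by auto
    interpret op: exact_exang n "op_exang n E" by (rule exact_exang_op)
    note sc = same_cat_cong[OF same_cat_op_exang[of n E]] same_cat_cong2[OF same_cat_op_exang[of n E]]
    have "X \<in> realised_set n E" if "Y \<in> realised_set n E"
    proof -
      have r: "agree (Suc n) (rev_cplx (Suc n) (rev_cplx (Suc n) V)) V" for V :: "('o, 'm) cplx" by (rule agree_rev_rev)
      have in_op: "rev_cplx (Suc n) V \<in> realised_set n (op_exang n E) \<longleftrightarrow> V \<in> realised_set n E" for V
        unfolding realised_set_def by (auto simp: realises_op')
      have "rev_cplx (Suc n) X \<in> realised_set n (op_exang n E)"
      proof (rule op.weak_last)
        show "rev_cplx (Suc n) Y \<in> realised_set n (op_exang n E)" using that in_op by simp
        show "exact_seq n (op_exang n E) (rev_cplx (Suc n) X)"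
          using exact_seq_op[OF additive_category_axioms X] by (simp add: exact_seq_def sc)
        show "chain_map (op_exang n E) (Suc n) (rev_cplx (Suc n) Y) (rev_cplx (Suc n) X) (\<lambda>i. f (Suc n - i))"
          using chain_map_op[OF additive_category_axioms X'(1) Y'(1) f] by (simp add: sc)
        show "isomorphism (op_exang n E) (obj (rev_cplx (Suc n) Y) (Suc n)) (obj (rev_cplx (Suc n) X) (Suc n)) (f (Suc n - Suc n))"
          using iso'(2) by (simp add: sc isomorphism_op)
      qed
      then show ?thesis using in_op by simp
    qed
    then show ?thesis using weak_last[OF _ Y f iso'(1)] by blast
  next
    case False
    then have i: "i \<le> n" "Suc i mod (n + 2) = Suc i" using i by auto
    have ob: "obj X i \<in> Ob E" "obj Y i \<in> Ob E" "obj X (Suc i) \<in> Ob E" "obj Y (Suc i) \<in> Ob E" using x(1) y(1) i(1) by auto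
    note iso' = iso[unfolded i(2)]
    obtain g where g: "mor E g" "src E g = obj Y i" "tgt E g = obj X i" "g \<cdot> f i = Idn E (obj X i)" "f i \<cdot> g = Idn E (obj Y i)"
      using isoD[OF iso'(1) ob(1,2)] by metis
    obtain g' where g': "mor E g'" "src E g' = obj Y (Suc i)" "tgt E g' = obj X (Suc i)" "g' \<cdot> f (Suc i) = Idn E (obj X (Suc i))" "f (Suc i) \<cdot> g' = Idn E (obj Y (Suc i))"
      using isoD[OF iso'(2) ob(3,4)] by metis
    note fi = ff(1-3)[of i] ff(1-3)[of "Suc i"]
    have "g' \<cdot> dif Y i = g' \<cdot> (dif Y i \<cdot> (f i \<cdot> g))" using g y(1-4)[of i] i(1) by simp
    also have "\<dots> = g' \<cdot> (f (Suc i) \<cdot> (dif X i \<cdot> g))" using ff(5)[of i g] comp_eq2[OF ff(4)[of i], of g] fi g x(1-4)[of i] y(1-4)[of i] i(1) by simp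
    also have "\<dots> = dif X i \<cdot> g" using comp_eq[OF g'(4), of "dif X i \<cdot> g"] fi g g' x(1-4)[of i] i(1) by simp
    finally have gg: "g' \<cdot> dif Y i = dif X i \<cdot> g" .
    have c: "chain_on E i (Suc i) Y X (\<lambda>j. if j = i then g else g')"
      unfolding chain_on_def using g g' gg by (auto simp: le_Suc_eq dest: antisym)
    obtain G where G: "\<forall>j\<le>Suc i. G j = (if j = i then g else g')" "chain_on E i (Suc n) Y X G"
      using extend_up[OF Y'(1) X'(1) Y'(3) c] i(1) by auto
    obtain K where K: "\<forall>j. i \<le> j \<and> j \<le> Suc n \<longrightarrow> K j = G j" "chain_on E 0 (Suc n) Y X K"
      using extend_down[OF Y'(1) X'(1,2) G(2)] i(1) by auto
    have Kc: "chain_map E (Suc n) Y X K" using K(2) chain_map_iff[OF Y'(1) X'(1)] by simp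
    have Ki: "K i = g" "K (Suc i) = g'" using K(1) G(1) i(1) by auto
    show ?thesis
    proof (cases "i = n")
      case True
      have "isomorphism E (obj Y (Suc n)) (obj X (Suc n)) (K (Suc n))"
        using True Ki(2) g' fi ob unfolding isomorphism_def by auto
      then show ?thesis using weak_last[OF _ Y f] weak_last[OF _ X Kc] iso'(2) True by auto
    next
      case False
      then have j: "i < n" using i(1) by simp
      show ?thesis
        using weak_mid[OF _ Y f j g g' gg]
          weak_mid[OF _ X Kc j, of "f i" "f (Suc i)", unfolded Ki] fi g g' ff(4)[of i] j by auto
    qed
  qed
qed

lemma n_exact_structure_realised_set:
  assumes I: "closed_under_comp E (inflation n E)" and D: "closed_under_comp E (deflation n E)"
  shows "n_exact_structure n E (realised_set n E)"
  unfolding n_exact_structure_def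
proof (intro conjI allI ballI impI)
  interpret op: exact_exang n "op_exang n E" by (rule exact_exang_op)
  show "n_exact_sequence n E X" if "X \<in> realised_set n E" for X
    using that realises_exact by (auto simp: realised_set_def n_exact_sequence_iff)
  show "X \<in> realised_set n E \<longleftrightarrow> Y \<in> realised_set n E" if "n_exact_sequence n E X" "n_exact_sequence n E Y" "weak_isomorphism n E X Y f" for X Y f
    using weak_iso_closed that by (simp add: n_exact_sequence_iff)
  show "X \<in> realised_set n E" if "complex E (n + 1) X" "\<forall>i\<le>n + 1. zero_object E (obj X i)" for X
    using realises_realised_set[OF realises_zero_complex[of X]] that by simp
  have "adm_mono (realised_set n E) = inflation n E"
    by (auto simp: fun_eq_iff adm_mono_def inflation_def realised_set_def realises_def)
  then show "closed_under_comp E (adm_mono (realised_set n E))" using I by simp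
  have "adm_epi n (realised_set n E) = deflation n E"
    by (auto simp: fun_eq_iff adm_epi_def deflation_def realised_set_def realises_def)
  then show "closed_under_comp E (adm_epi n (realised_set n E))" using D by simp
  show "has_n_pushouts n E (realised_set n E)" by (rule realised_pushouts)
  show "has_n_pushouts n (op_cat E) (rev_cplx (n + 1) -` realised_set n E)"
    using op.realised_pushouts unfolding realised_set_op same_cat_cong4(2)[OF same_cat_op_exang] by simp
qed

text \<open>
  Whichever \<open>n\<close>-pushout is chosen, by naturality it realises the extension pushed along
  \<open>a\<close>.
\<close>

lemma ext_push_realised_set:
  assumes X: "realises n E A Z \<delta> X0" and a: "mor E a" "src E a = A" "tgt E a = B"
  shows "ext_push n E (realised_set n E) a (Rlz E Z A \<delta>) = Rlz E Z B (Act E (Idn E Z) a \<delta>)"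
proof -
  note r = rzD[OF X]
  have B: "B \<in> Ob E" using a by auto
  have d: "Act E (Idn E Z) a \<delta> \<in> carrier (Ext E Z B)" using a r(1-3) by simp
  obtain Y0 where Y: "realises n E B Z (Act E (Idn E Z) a \<delta>) Y0" using realises_exists[OF B r(2) d] .
  obtain f where f: "chain_map E (Suc n) X0 Y0 f" "f 0 = a" "f (Suc n) = Idn E Z"
    by (rule realises_lift[OF X Y, of a "Idn E Z"]) (use a r(1-3) B d in auto)
  let ?P = "\<lambda>Y. Y \<in> realised_set n E \<and> (\<exists>X\<in>Rlz E Z A \<delta>. \<exists>f.
     chain_map E (n + 1) X Y f \<and> f 0 = a \<and> obj Y (n + 1) = obj X (n + 1) \<and> f (n + 1) = Idn E (obj X (n + 1)) \<and>
     n_pushout n E X Y f)"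
  have "X0 \<in> Rlz E Z A \<delta>" using realises_Rlz[OF X] htpy_class_self[OF realises_exact[OF X]] by simp
  then have "?P Y0" using f r(5) rzD(5)[OF Y] realises_realised_set[OF Y] lift_pushout[OF X a Y f] by auto
  then have "?P (SOME Y. ?P Y)" by (rule someI)
  then obtain Y X g where YX: "Y = (SOME Y. ?P Y)" "Y \<in> realised_set n E" "X \<in> Rlz E Z A \<delta>" "chain_map E (Suc n) X Y g" "g 0 = a"
    "obj Y (Suc n) = obj X (Suc n)" "g (Suc n) = Idn E (obj X (Suc n))" by auto
  have X1: "realises n E A Z \<delta> X" using realises_class[OF X] YX(3) realises_Rlz[OF X] by simp
  obtain \<rho> where Y1: "realises n E (obj Y 0) (obj Y (Suc n)) \<rho> Y" using rsetE[OF YX(2)] .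
  note q = rzD[OF X1] and s = rzD[OF Y1]
  have "obj Y 0 = B"
    using chain_mapD(3)[OF q(6) s(6) YX(4) q(6) s(6) order_refl, of 0] YX(5) a by simp
  then have Y2: "realises n E B Z \<rho> Y" using Y1 YX(6) q(5) by simp
  have "\<rho> = Act E (Idn E Z) a \<delta>"
    using naturality[OF X1 Y2 YX(4)] YX(5,7) q(5) rzD(1-3)[OF Y2] by simp
  then have "Rlz E Z B (Act E (Idn E Z) a \<delta>) = htpy_class n E Y" using realises_Rlz Y2 by simp
  then show ?thesis unfolding ext_push_def YX(1) by simp
qed

lemma rev_vimage_Rlz:
  assumes X: "realises n E A Z \<delta> X0"
  shows "rev_cplx (Suc n) -` rev_cplx (Suc n) -` Rlz E Z A \<delta> = Rlz E Z A \<delta>"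
proof -
  have "rev_cplx (Suc n) (rev_cplx (Suc n) Y) \<in> htpy_class n E X0 \<longleftrightarrow> Y \<in> htpy_class n E X0" for Y
    using htpy_class_closed[OF agree_rev_rev] htpy_class_closed[OF agree_sym[OF agree_rev_rev]] by blast
  then show ?thesis using realises_Rlz[OF X] by auto
qed

lemma ext_pull_realised_set:
  assumes X: "realises n E A Z \<delta> X0" and c: "mor E c" "src E c = Z'" "tgt E c = Z"
  shows "ext_pull n E (realised_set n E) c (Rlz E Z A \<delta>) = Rlz E Z' A (Act E c (Idn E A) \<delta>)"
proof -
  interpret op: exact_exang n "op_exang n E" by (rule exact_exang_op)
  note sc = same_cat_cong[OF same_cat_op_exang[of n E]]
  note r = rzD[OF X]
  have Z': "Z' \<in> Ob E" using c by auto
  have d: "Act E c (Idn E A) \<delta> \<in> carrier (Ext E Z' A)" using c r(1-3) by simp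
  obtain Y where Y: "realises n E A Z' (Act E c (Idn E A) \<delta>) Y" using realises_exists[OF r(1) Z' d] .
  have "ext_push n (op_exang n E) (realised_set n (op_exang n E)) c (Rlz (op_exang n E) A Z \<delta>) =
     Rlz (op_exang n E) A Z' (Act (op_exang n E) (Idn (op_exang n E) A) c \<delta>)"
    by (rule op.ext_push_realised_set[OF iffD2[OF realises_op' X]]) (use c in \<open>simp_all add: sc\<close>)
  then have "ext_push n (op_cat E) (rev_cplx (Suc n) -` realised_set n E) c (rev_cplx (Suc n) -` Rlz E Z A \<delta>) =
     rev_cplx (Suc n) -` Rlz E Z' A (Act E c (Idn E A) \<delta>)"
    by (simp add: realised_set_op same_cat_cong5[OF same_cat_op_exang])
  then show ?thesis using rev_vimage_Rlz[OF Y] by (simp add: ext_pull_def)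
qed

lemma ext_classes_realised_set:
  assumes "A \<in> Ob E" "Z \<in> Ob E"
  shows "ext_classes n E (realised_set n E) Z A = Rlz E Z A ` carrier (Ext E Z A)"
proof (rule subset_antisym; rule subsetI)
  fix \<xi> assume "\<xi> \<in> ext_classes n E (realised_set n E) Z A"
  then obtain X where X: "\<xi> = htpy_class n E X" "X \<in> realised_set n E" "obj X 0 = A" "obj X (Suc n) = Z"
    by (auto simp: ext_classes_def cplx_between_def)
  then obtain \<delta> where d: "realises n E A Z \<delta> X" using rsetE by metis
  show "\<xi> \<in> Rlz E Z A ` carrier (Ext E Z A)" unfolding X(1) realises_Rlz[OF d, symmetric] using rzD(3)[OF d] by blast
next
  fix \<xi> assume "\<xi> \<in> Rlz E Z A ` carrier (Ext E Z A)"
  then obtain \<delta> where d: "\<delta> \<in> carrier (Ext E Z A)" "\<xi> = Rlz E Z A \<delta>" by blast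
  obtain X where X: "realises n E A Z \<delta> X" using realises_exists[OF assms d(1)] .
  then have "X \<in> realised_set n E \<inter> cplx_between n E A Z" using realises_realised_set rzD(4-6)[OF X] by (auto simp: cplx_between_def)
  then show "\<xi> \<in> ext_classes n E (realised_set n E) Z A" using d(2) realises_Rlz[OF X] by (auto simp: ext_classes_def)
qed

lemma baer_sum_realised_set:
  assumes d: "A \<in> Ob E" "Z \<in> Ob E" "\<delta> \<in> carrier (Ext E Z A)" "\<rho> \<in> carrier (Ext E Z A)"
  shows "baer_sum n E (realised_set n E) Z A (Rlz E Z A \<delta>) (Rlz E Z A \<rho>) = Rlz E Z A (\<delta> \<otimes>\<^bsub>Ext E Z A\<^esub> \<rho>)"
  unfolding baer_sum_def
proof (rule some_equality)
  interpret G: comm_group "Ext E Z A" using d by (intro ext_group)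
  have main: "ext_pull n E (realised_set n E) (i1 (n + 1) \<otimes>\<^bsub>Hom E Z (obj S (n + 1))\<^esub> i2 (n + 1))
           (ext_push n E (realised_set n E) (p1 0 \<otimes>\<^bsub>Hom E (obj S 0) A\<^esub> p2 0) (htpy_class n E S)) = Rlz E Z A (\<delta> \<otimes>\<^bsub>Ext E Z A\<^esub> \<rho>)"
    if X: "X \<in> Rlz E Z A \<delta>" and Y: "Y \<in> Rlz E Z A \<rho>" and S: "direct_sum E (n + 1) X Y S i1 i2 p1 p2" for X Y S i1 i2 p1 p2
  proof -
    have X: "realises n E A Z \<delta> X" using X realises_exists[OF d(1-3)] realises_class realises_Rlz by metis
    have Y: "realises n E A Z \<rho> Y" using Y realises_exists[OF d(1,2,4)] realises_class realises_Rlz by metis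
    have S: "direct_sum E (Suc n) X Y S i1 i2 p1 p2" using S by simp
    note r = rzD[OF X] and s = rzD[OF Y]
    note f = direct_sum_facts[OF S r(6) s(6)]
    note b0 = biprod_mor[OF f(6)[of 0, simplified], unfolded r(4) s(4)] biprod_eq[OF f(6)[of 0, simplified], unfolded r(4) s(4)]
    note bn = biprod_mor[OF f(6)[of "Suc n", simplified], unfolded r(5) s(5)] biprod_eq[OF f(6)[of "Suc n", simplified], unfolded r(5) s(5)]
    define P where "P = obj S 0" define Q where "Q = obj S (Suc n)"
    have PQ: "P \<in> Ob E" "Q \<in> Ob E" using b0(15) bn(15) by (auto simp: P_def Q_def)
    note b0' = b0[folded P_def] and bn' = bn[folded Q_def]
    define d1 where "d1 = Act E (p1 (Suc n)) (i1 0) \<delta>" define d2 where "d2 = Act E (p2 (Suc n)) (i2 0) \<rho>"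
    have dd: "d1 \<in> carrier (Ext E Q P)" "d2 \<in> carrier (Ext E Q P)" using b0' bn' d by (auto simp: d1_def d2_def)
    interpret GQ: comm_group "Ext E Q P" using PQ by (intro ext_group)
    define \<eta> where "\<eta> = d1 \<otimes>\<^bsub>Ext E Q P\<^esub> d2"
    have eta: "\<eta> \<in> carrier (Ext E Q P)" using dd by (simp add: \<eta>_def)
    have S1: "realises n E P Q \<eta> S" using realises_direct_sum[OF X Y S] by (simp add: P_def Q_def \<eta>_def d1_def d2_def)
    define i where "i = i1 (Suc n) \<oplus> i2 (Suc n)" define p where "p = p1 0 \<oplus> p2 0"
    have i: "mor E i" "src E i = Z" "tgt E i = Q" and p: "mor E p" "src E p = P" "tgt E p = A"
      using b0' bn' by (simp_all add: i_def p_def)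
    have e1: "ext_push n E (realised_set n E) p (Rlz E Q P \<eta>) = Rlz E Q A (Act E (Idn E Q) p \<eta>)"
      by (rule ext_push_realised_set[OF S1 p])
    have c: "Act E (Idn E Q) p \<eta> \<in> carrier (Ext E Q A)" using p PQ eta by simp
    obtain T where T: "realises n E A Q (Act E (Idn E Q) p \<eta>) T" using realises_exists[OF d(1) PQ(2) c] .
    have e2: "ext_pull n E (realised_set n E) i (Rlz E Q A (Act E (Idn E Q) p \<eta>)) = Rlz E Z A (Act E i (Idn E A) (Act E (Idn E Q) p \<eta>))"
      by (rule ext_pull_realised_set[OF T i])
    have e3: "Act E i (Idn E A) (Act E (Idn E Q) p \<eta>) = Act E i p \<eta>"
      using i p PQ eta d(1) by simp
    have q1: "p1 (Suc n) \<cdot> i = Idn E Z" "p2 (Suc n) \<cdot> i = Idn E Z" "p \<cdot> i1 0 = Idn E A" "p \<cdot> i2 0 = Idn E A"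
      using b0' bn' by (simp_all add: i_def p_def)
    have "Act E i p \<eta> = Act E i p d1 \<otimes>\<^bsub>Ext E Z A\<^esub> Act E i p d2"
      unfolding \<eta>_def by (rule act_mult) (use i p dd in auto)
    also have "Act E i p d1 = \<delta>" using b0' bn' i p d q1 by (simp add: d1_def)
    also have "Act E i p d2 = \<rho>" using b0' bn' i p d q1 by (simp add: d2_def)
    finally have e4: "Act E i p \<eta> = \<delta> \<otimes>\<^bsub>Ext E Z A\<^esub> \<rho>" .
    have "i1 (n + 1) \<otimes>\<^bsub>Hom E Z (obj S (n + 1))\<^esub> i2 (n + 1) = i" "p1 0 \<otimes>\<^bsub>Hom E (obj S 0) A\<^esub> p2 0 = p"
      using b0 bn by (simp_all add: i_def p_def)
    then show ?thesis using e1 e2 e3 e4 realises_Rlz[OF S1] by simp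
  qed
  show "\<zeta> = Rlz E Z A (\<delta> \<otimes>\<^bsub>Ext E Z A\<^esub> \<rho>)"
    if "\<exists>X\<in>Rlz E Z A \<delta>. \<exists>Y\<in>Rlz E Z A \<rho>. \<exists>S i1 i2 p1 p2. direct_sum E (n + 1) X Y S i1 i2 p1 p2 \<and>
     \<zeta> = ext_pull n E (realised_set n E) (i1 (n + 1) \<otimes>\<^bsub>Hom E Z (obj S (n + 1))\<^esub> i2 (n + 1))
           (ext_push n E (realised_set n E) (p1 0 \<otimes>\<^bsub>Hom E (obj S 0) A\<^esub> p2 0) (htpy_class n E S))" for \<zeta>
    using that main by blast
  obtain X where X: "realises n E A Z \<delta> X" using realises_exists[OF d(1-3)] .
  obtain Y where Y: "realises n E A Z \<rho> Y" using realises_exists[OF d(1,2,4)] .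
  have XY: "X \<in> Rlz E Z A \<delta>" "Y \<in> Rlz E Z A \<rho>"
    using realises_Rlz[OF X] realises_Rlz[OF Y] htpy_class_self[OF realises_exact[OF X]] htpy_class_self[OF realises_exact[OF Y]] by auto
  obtain S i1 i2 p1 p2 where S: "direct_sum E (n + 1) X Y S i1 i2 p1 p2"
    using direct_sum_exists[OF rzD(6)[OF X] rzD(6)[OF Y]] by auto
  show "\<exists>X\<in>Rlz E Z A \<delta>. \<exists>Y\<in>Rlz E Z A \<rho>. \<exists>S i1 i2 p1 p2. direct_sum E (n + 1) X Y S i1 i2 p1 p2 \<and>
     Rlz E Z A (\<delta> \<otimes>\<^bsub>Ext E Z A\<^esub> \<rho>) = ext_pull n E (realised_set n E) (i1 (n + 1) \<otimes>\<^bsub>Hom E Z (obj S (n + 1))\<^esub> i2 (n + 1))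
           (ext_push n E (realised_set n E) (p1 0 \<otimes>\<^bsub>Hom E (obj S 0) A\<^esub> p2 0) (htpy_class n E S))"
    using main[OF XY S] S XY by metis
qed

text \<open>
  The identification of extensions with classes of sequences is the realisation itself. It is injective by
  naturality.
\<close>

lemma realisations_same_structure: "same_exang_structure E (exact_to_exang n E (realised_set n E))"
proof -
  let ?F = "exact_to_exang n E (realised_set n E)"
  have s: "Ext ?F Z A = ext_group n E (realised_set n E) Z A" "Act ?F c a \<xi> = ext_pull n E (realised_set n E) c (ext_push n E (realised_set n E) a \<xi>)"
    "Rlz ?F Z A \<xi> = \<xi>" for Z A c a \<xi> by (simp_all add: exact_to_exang_def)
  have g: "carrier (ext_group n E (realised_set n E) Z A) = ext_classes n E (realised_set n E) Z A"
    "mult (ext_group n E (realised_set n E) Z A) = baer_sum n E (realised_set n E) Z A" for Z A by (simp_all add: ext_group_def)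
  have "addcat.truncate E = addcat.truncate ?F" by (simp add: exact_to_exang_def addcat.defs)
  moreover have "Rlz E Z A \<in> iso (Ext E Z A) (Ext ?F Z A)" if d: "Z \<in> Ob E" "A \<in> Ob E" for Z A
  proof -
    have "inj_on (Rlz E Z A) (carrier (Ext E Z A))"
    proof (rule inj_onI)
      fix \<delta> \<rho> assume a: "\<delta> \<in> carrier (Ext E Z A)" "\<rho> \<in> carrier (Ext E Z A)" "Rlz E Z A \<delta> = Rlz E Z A \<rho>"
      obtain X where X: "realises n E A Z \<delta> X" using realises_exists[OF d(2,1) a(1)] .
      then have "realises n E A Z \<rho> X" using a by (simp add: realises_def realised_by_def)
      then show "\<delta> = \<rho>" using realises_inj[OF X] by blast
    qed
    then show ?thesis using baer_sum_realised_set[OF d(2,1)] ext_classes_realised_set[OF d(2,1)]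
      by (auto simp: iso_def hom_def bij_betw_def s g)
  qed
  moreover have "Rlz E Z' A' (Act E c a \<delta>) = Act ?F c a (Rlz E Z A \<delta>)"
    if d: "Z \<in> Ob E" "Z' \<in> Ob E" "A \<in> Ob E" "A' \<in> Ob E" "c \<in> arr E Z' Z" "a \<in> arr E A A'" "\<delta> \<in> carrier (Ext E Z A)" for Z Z' A A' c a \<delta>
  proof -
    have c: "mor E c" "src E c = Z'" "tgt E c = Z" and a: "mor E a" "src E a = A" "tgt E a = A'" using d by auto
    obtain X where X: "realises n E A Z \<delta> X" using realises_exists[OF d(3,1,7)] .
    have k: "Act E (Idn E Z) a \<delta> \<in> carrier (Ext E Z A')" using a d by simp
    obtain Y where Y: "realises n E A' Z (Act E (Idn E Z) a \<delta>) Y" using realises_exists[OF d(4,1) k] .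
    have "Act E c (Idn E A') (Act E (Idn E Z) a \<delta>) = Act E c a \<delta>" using c a d by simp
    then show ?thesis unfolding s ext_push_realised_set[OF X a] ext_pull_realised_set[OF Y c] by simp
  qed
  ultimately show ?thesis unfolding same_exang_structure_def
    by (intro conjI exI[of _ "Rlz E"]) (auto simp: s simp del: arr_iff)
qed

theorem exact_exangulated:
  assumes I: "closed_under_comp E (inflation n E)" and D: "closed_under_comp E (deflation n E)"
  shows "n_exact_exangulated n E"
proof -
  interpret op: exact_exang n "op_exang n E" by (rule exact_exang_op)
  have "n_exangulated n E"
    using I D EA2_holds op.EA2_holds additive_category_axioms biadditive_functor_axioms exact_realisation_axioms
    by (simp add: n_exangulated_def)
  then show ?thesis
    using n_exact_structure_realised_set[OF I D] realisations_same_structure additive_category_axioms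
    by (auto simp: n_exact_exangulated_def n_exact_category_def)
qed

end

text \<open>
  Being an exact sequence is invariant under homotopy equivalence. Hence it holds for all representatives of a
  class in \<open>Ext\<close> of an \<open>n\<close>-exact category, not only for those in the given structure.
\<close>

lemma exact_exangI:
  assumes n: "1 \<le> n" and E: "n_exact_exangulated n E"
  shows "exact_exang n E"
proof -
  from E obtain XX where ex: "n_exangulated n E" and XX: "n_exact_category n E XX" and s: "same_exang_structure E (exact_to_exang n E XX)"
    by (auto simp: n_exact_exangulated_def)
  have l: "additive_category E" "biadditive_functor E" "exact_realisation n E"
    using ex by (auto simp: n_exangulated_def)
  interpret additive_category E by (rule l)
  interpret exact_realisation n E by (rule l)
  have "exact_seq n E X" if X: "realises n E A Z \<delta> X" for A Z \<delta> X
  proof -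
    from s obtain G where
      "\<forall>Z\<in>Ob E. \<forall>A\<in>Ob E. G Z A \<in> iso (Ext E Z A) (Ext (exact_to_exang n E XX) Z A)"
      "\<forall>Z\<in>Ob E. \<forall>A\<in>Ob E. \<forall>\<delta>\<in>carrier (Ext E Z A). Rlz E Z A \<delta> = Rlz (exact_to_exang n E XX) Z A (G Z A \<delta>)"
      unfolding same_exang_structure_def by blast
    then have "Rlz E Z A \<delta> \<in> ext_classes n E XX Z A"
      using X by (auto simp: realises_def iso_def hom_def exact_to_exang_def ext_group_def Pi_iff)
    then obtain W where W: "W \<in> XX" "Rlz E Z A \<delta> = htpy_class n E W" "W \<in> cplx_between n E A Z"
      by (auto simp: ext_classes_def)
    have nW: "exact_seq n E W" using W(1) XX by (simp add: n_exact_category_def n_exact_structure_def n_exact_sequence_iff)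
    have cX: "X \<in> cplx_between n E A Z" "htpy_class n E X = htpy_class n E W"
      using X W(2) by (auto simp: realises_def realised_by_def)
    have "W \<in> htpy_class n E X" using htpy_class_self[OF nW] cX(2) by simp
    then have "htpy_equiv n E W X" using htpy_equiv_sym by (auto simp: htpy_class_def)
    then show ?thesis using exact_seq_htpy[OF nW] cX(1) by (simp add: cplx_between_def)
  qed
  then show ?thesis using l n by (intro exact_exang.intro exact_exang_axioms.intro) (simp_all add: additive_bifunctor_def)
qed


section \<open>Inflations and idempotents\<close>

context additive_category
begin

lemma biproduct_swap:
  assumes "biproduct C A B P i1 i2 p1 p2" shows "biproduct C B A P i2 i1 p2 p1"
  using biprod_mor[OF assms] biprod_eq[OF assms] by (simp add: biproduct_def add_comm)

lemma homotopic_same: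
  assumes X: "complex C m X" and Y: "complex C m Y" and m: "1 \<le> m" and f: "chain_map C m X Y f"
    and g: "\<And>i. i \<le> m \<Longrightarrow> g i = f i"
  shows "homotopic C m X Y f g"
proof -
  note x = complexD[OF X] complexD[OF Y] and ff = chain_mapD[OF X Y f X Y order_refl]
  obtain c where c: "m = Suc c" using m by (cases m) auto
  show ?thesis unfolding homotopic_def
  proof (intro exI[of _ "\<lambda>i. zr C (obj X i) (obj Y (i - 1))"] conjI allI impI)
    show "f 0 = g 0 \<otimes>\<^bsub>Hom C (obj X 0) (obj Y 0)\<^esub> (zr C (obj X 1) (obj Y (1 - 1)) \<cdot> dif X 0)"
      using ff(1-3)[of 0] x(1-4)[of 0] x(7)[of 0] m g by simp
    show "f m = g m \<otimes>\<^bsub>Hom C (obj X m) (obj Y m)\<^esub> (dif Y (m - 1) \<cdot> zr C (obj X m) (obj Y (m - 1)))"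
      using ff(1-3)[of m] x(7-10)[of c] x(1)[of m] g c by simp
    fix i assume i: "Suc i < m"
    show "f (Suc i) = g (Suc i) \<otimes>\<^bsub>Hom C (obj X (Suc i)) (obj Y (Suc i))\<^esub>
          ((zr C (obj X (Suc (Suc i))) (obj Y (Suc (Suc i) - 1)) \<cdot> dif X (Suc i))
             \<otimes>\<^bsub>Hom C (obj X (Suc i)) (obj Y (Suc i))\<^esub> (dif Y i \<cdot> zr C (obj X (Suc i)) (obj Y (Suc i - 1))))"
      using ff(1-3)[of "Suc i"] x(1-4)[of "Suc i"] x(7-10)[of i] x(7)[of "Suc i"] g i by simp
  qed (use x in auto)
qed

end

context exact_exang
begin

lemma inflationI: "realises n E A Z \<delta> X \<Longrightarrow> inflation n E (dif X 0)"
  by (auto simp: inflation_def realises_def)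

lemma inflationE:
  assumes "inflation n E f" obtains A Z \<delta> X where "realises n E A Z \<delta> X" "f = dif X 0"
  using assms by (auto simp: inflation_def realises_def)

lemma iso_inflation:
  assumes f: "inflation n E f" and t: "mor E t" "src E t = tgt E f" and s: "mor E s" "src E s = tgt E t" "tgt E s = src E t"
    and ts: "s \<cdot> t = Idn E (src E t)" "t \<cdot> s = Idn E (tgt E t)"
  shows "inflation n E (t \<cdot> f)"
proof -
  obtain A Z \<delta> X where X: "realises n E A Z \<delta> X" and fX: "f = dif X 0" using inflationE[OF f] .
  note r = rzD[OF X] and x = complexD[OF rzD(6)[OF X]]
  define B where "B = tgt E t"
  have t: "mor E t" "src E t = obj X 1" "tgt E t = B" and s: "mor E s" "src E s = B" "tgt E s = obj X 1"
    and B: "B \<in> Ob E" using t s fX x(1-4)[of 0] by (auto simp: B_def)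
  note ts = ts[unfolded t(2,3)]
  let ?Y = "Cplx ((obj X)(1 := B)) ((dif X)(0 := t \<cdot> dif X 0, 1 := dif X 1 \<cdot> s))"
  note n1' = n1[unfolded One_nat_def]
  have st: "s \<cdot> (t \<cdot> z) = z" if "mor E z" "tgt E z = obj X 1" for z
    using comp_eq[OF ts(1)] that t s by simp
  have Y: "complex E (Suc n) ?Y"
  proof (rule complexI)
    show "obj ?Y i \<in> Ob E" if "i \<le> Suc n" for i using that x(1) B by simp
    show "mor E (dif ?Y i) \<and> src E (dif ?Y i) = obj ?Y i \<and> tgt E (dif ?Y i) = obj ?Y (Suc i)" if "i < Suc n" for i
      using that x(1-4)[of i] t s n1' by auto
    fix i assume i: "Suc i < Suc n"
    consider "i = 0" | "i = 1" | "i > 1" by linarith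
    then show "dif ?Y (Suc i) \<cdot> dif ?Y i = zr E (obj ?Y i) (obj ?Y (Suc (Suc i)))"
      by cases (use i x(1-5)[of i] x(1-5)[of "Suc i"] x(1-5)[of 0] x(6)[of 1 s] x(6)[of 0] t s st n1' in auto)
  qed
  have f1: "chain_map E (Suc n) X ?Y (\<lambda>i. if i = 1 then t else Idn E (obj X i))"
  proof (rule chain_mapI[OF r(6) Y])
    fix i assume i: "i < Suc n"
    consider "i = 0" | "i = 1" | "i > 1" by linarith
    then show "(if Suc i = 1 then t else Idn E (obj X (Suc i))) \<cdot> dif X i = dif ?Y i \<cdot> (if i = 1 then t else Idn E (obj X i))"
      by cases (use i x(1-4)[of i] x(1-4)[of 1] t s ts n1' in auto)
  qed (use t x(1) in auto)
  have f2: "chain_map E (Suc n) ?Y X (\<lambda>i. if i = 1 then s else Idn E (obj X i))"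
  proof (rule chain_mapI[OF Y r(6)])
    fix i assume i: "i < Suc n"
    consider "i = 0" | "i = 1" | "i > 1" by linarith
    then show "(if Suc i = 1 then s else Idn E (obj X (Suc i))) \<cdot> dif ?Y i = dif X i \<cdot> (if i = 1 then s else Idn E (obj X i))"
      by cases (use i x(1-4)[of i] x(1-4)[of 1] t s st n1' in auto)
  qed (use s x(1) in auto)
  have e: "end_fixing n E X ?Y (\<lambda>i. if i = 1 then t else Idn E (obj X i))" "end_fixing n E ?Y X (\<lambda>i. if i = 1 then s else Idn E (obj X i))"
    using f1 f2 n1' by (auto simp: end_fixing_def)
  have "htpy_equiv n E X ?Y"
    unfolding htpy_equiv_def
  proof (intro exI conjI, rule e(1), rule e(2))
    have "homotopic E (Suc n) X X (\<lambda>i. (if i = 1 then s else Idn E (obj X i)) \<cdot> (if i = 1 then t else Idn E (obj X i))) (\<lambda>i. Idn E (obj X i))"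
      by (rule homotopic_same[OF r(6,6) _ chain_map_comp[OF f1 f2 r(6) Y r(6)]]) (use x(1) ts in auto)
    then show "homotopic E (n + 1) X X (\<lambda>i. (if i = 1 then s else Idn E (obj X i)) \<cdot> (if i = 1 then t else Idn E (obj X i))) (\<lambda>i. Idn E (obj X i))"
      by simp
    have "homotopic E (Suc n) ?Y ?Y (\<lambda>i. (if i = 1 then t else Idn E (obj X i)) \<cdot> (if i = 1 then s else Idn E (obj X i))) (\<lambda>i. Idn E (obj ?Y i))"
      by (rule homotopic_same[OF Y Y _ chain_map_comp[OF f2 f1 Y r(6) Y]]) (use x(1) ts in auto)
    then show "homotopic E (n + 1) ?Y ?Y (\<lambda>i. (if i = 1 then t else Idn E (obj X i)) \<cdot> (if i = 1 then s else Idn E (obj X i))) (\<lambda>i. Idn E (obj ?Y i))"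
      by simp
  qed
  then have "realises n E A Z \<delta> ?Y" using realises_end_fixing2[OF X exact_seq_htpy[OF realises_exact[OF X] Y] e] by simp
  from inflationI[OF this] show ?thesis by (simp add: fX)
qed

text \<open>
  Elementary operations on the components are automorphisms of the biproduct.
\<close>

lemma transvection:
  assumes b: "biproduct E A B P i1 i2 p1 p2" and f: "inflation n E ((i1 \<cdot> u) \<oplus> (i2 \<cdot> v))"
    and u: "mor E u" "tgt E u = A" and v: "mor E v" "tgt E v = B" "src E v = src E u" and t: "mor E t" "src E t = B" "tgt E t = A"
  shows "inflation n E ((i1 \<cdot> (u \<oplus> (t \<cdot> v))) \<oplus> (i2 \<cdot> v))"
proof -
  note b = biprod_mor[OF b] biprod_eq[OF b] biprod_eq'[OF b]
  let ?T = "Idn E P \<oplus> (i1 \<cdot> (t \<cdot> p2))" and ?S = "Idn E P \<oplus> \<ominus> (i1 \<cdot> (t \<cdot> p2))"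
  have "inflation n E (?T \<cdot> ((i1 \<cdot> u) \<oplus> (i2 \<cdot> v)))"
    by (rule iso_inflation[OF f, of _ ?S]) (use b u v t in \<open>simp_all add: add_assoc\<close>)
  moreover have "?T \<cdot> ((i1 \<cdot> u) \<oplus> (i2 \<cdot> v)) = (i1 \<cdot> (u \<oplus> (t \<cdot> v))) \<oplus> (i2 \<cdot> v)"
    using b u v t by (simp add: add_ac)
  ultimately show ?thesis by simp
qed

text \<open>
  The complementary idempotents \<open>a = 1 - e\<close> and \<open>c = 1 - e'\<close> annihilate
  \<open>\<delta>\<close> and hence factor as \<open>a = s \<cdot> d\<^sub>0\<close> and
  \<open>c = d\<^sub>n \<cdot> t\<close>. Therefore they lift to idempotent chain maps \<open>k\<close> and
  \<open>l\<close> that are concentrated in degrees \<open>0, 1\<close> and \<open>n, n + 1\<close>. As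
  \<open>l \<cdot> k = 0\<close>, the chain map \<open>(1 - k) \<cdot> (1 - l)\<close> is idempotent.
\<close>

lemma idempotent_lift:
  assumes X: "realises n E A Z \<delta> X"
    and e: "mor E e" "src E e = A" "tgt E e = A" "e \<cdot> e = e" "Act E (Idn E Z) e \<delta> = \<delta>"
    and e': "mor E e'" "src E e' = Z" "tgt E e' = Z" "e' \<cdot> e' = e'" "Act E e' (Idn E A) \<delta> = \<delta>"
  shows "\<exists>\<eta>. chain_map E (Suc n) X X \<eta> \<and> (\<forall>i\<le>Suc n. \<eta> i \<cdot> \<eta> i = \<eta> i) \<and> \<eta> 0 = e \<and> \<eta> (Suc n) = e'"
proof -
  note r = rzD[OF X] and x = complexD[OF rzD(6)[OF X]]
  interpret G: comm_group "Ext E Z A" using r by (intro ext_group)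
  define a where "a = Idn E A \<oplus> \<ominus> e" define c where "c = Idn E Z \<oplus> \<ominus> e'"
  have a: "mor E a" "src E a = A" "tgt E a = A" "a \<cdot> a = a" using e r(1) by (auto simp: a_def add_assoc)
  have c: "mor E c" "src E c = Z" "tgt E c = Z" "c \<cdot> c = c" using e' r(2) by (auto simp: c_def add_assoc)
  have "Act E (Idn E Z) a \<delta> = \<one>\<^bsub>Ext E Z A\<^esub>"
    using act_add_r[of "Idn E A" "\<ominus> e" "Idn E Z" \<delta>] act_neg_r[of "Idn E Z" e \<delta>] e r(1-3) by (simp add: a_def)
  then obtain s where s: "mor E s" "src E s = obj X 1" "tgt E s = A" "a = s \<cdot> dif X 0"
    using realises_push[OF X, of a] a by auto
  have "Act E c (Idn E A) \<delta> = \<one>\<^bsub>Ext E Z A\<^esub>"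
  proof -
    have "Act E e' (Idn E A) \<delta> \<otimes>\<^bsub>Ext E Z A\<^esub> Act E (\<ominus> e') (Idn E A) \<delta> = \<one>\<^bsub>Ext E Z A\<^esub>"
      using act_add_l[of e' "\<ominus> e'" "Idn E A" \<delta>] e' r(1-3) by simp
    then show ?thesis
      using act_add_l[of "Idn E Z" "\<ominus> e'" "Idn E A" \<delta>] e' r(1-3) by (simp add: c_def)
  qed
  then obtain t where t: "mor E t" "src E t = Z" "tgt E t = obj X n" "c = dif X n \<cdot> t"
    using realises_pull[OF X, of c] c by auto
  have n': "0 < n" "Suc (n - Suc 0) = n" using n1 by auto
  \<comment> \<open>lifts of \<open>(a, 0)\<close> and \<open>(0, c)\<close>\<close>
  define k where "k i = (if i = 0 then a else if i = 1 then dif X 0 \<cdot> (a \<cdot> s) else zr E (obj X i) (obj X i))" for i :: nat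
  define l where "l i = (if i = Suc n then c else if i = n then t \<cdot> (c \<cdot> dif X n) else zr E (obj X i) (obj X i))" for i :: nat
  have aa: "a \<cdot> (a \<cdot> z) = a \<cdot> z" if "mor E z" "tgt E z = A" for z using comp_eq[OF a(4)] a that by simp
  have cc: "c \<cdot> (c \<cdot> z) = c \<cdot> z" if "mor E z" "tgt E z = Z" for z using comp_eq[OF c(4)] c that by simp
  have sd: "s \<cdot> dif X 0 = a" "s \<cdot> (dif X 0 \<cdot> z) = a \<cdot> z" if "mor E z" "tgt E z = A" for z
    using s(4) comp_eq[OF s(4)[symmetric]] s x(1-4)[of 0] r(4) that by auto
  have dt: "dif X n \<cdot> t = c" "dif X n \<cdot> (t \<cdot> z) = c \<cdot> z" if "mor E z" "tgt E z = Z" for z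
    using t(4) comp_eq[OF t(4)[symmetric]] t x(1-4)[of n] r(5) that by auto
  have km: "mor E (k i)" "src E (k i) = obj X i" "tgt E (k i) = obj X i" if "i \<le> Suc n" for i
    using that a s x(1-4)[of 0] x(1)[of i] r(4) by (auto simp: k_def)
  have lm: "mor E (l i)" "src E (l i) = obj X i" "tgt E (l i) = obj X i" if "i \<le> Suc n" for i
    using that c t x(1-4)[of n] x(1)[of i] r(5) by (auto simp: l_def)
  have kc: "chain_map E (Suc n) X X k"
  proof (rule chain_mapI[OF r(6,6)])
    fix i assume i: "i < Suc n"
    consider "i = 0" | "i = 1" | "i > 1" by linarith
    then show "k (Suc i) \<cdot> dif X i = dif X i \<cdot> k i"
    proof cases
      case 1
      have "k (Suc i) \<cdot> dif X i = dif X 0 \<cdot> (a \<cdot> (s \<cdot> dif X 0))"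
        using 1 a s(1-3) x(1-4)[of 0] r(4) by (simp add: k_def)
      then show ?thesis using 1 s(4) a(4) by (simp add: k_def)
    next
      case 2 then show ?thesis using i a s(1-3) x(1-4)[of 0] x(6)[of 0 "a \<cdot> s"] x(1-4)[of 1] x(1)[of 2] r(4) by (simp add: k_def numeral_2_eq_2)
    next
      case 3 then show ?thesis using i x(1-4)[of i] x(1)[of "Suc i"] by (simp add: k_def)
    qed
  qed (use km in auto)
  have lc: "chain_map E (Suc n) X X l"
  proof (rule chain_mapI[OF r(6,6)])
    fix i assume i: "i < Suc n"
    consider "i = n" | "Suc i = n" | "Suc i < n" using i by linarith
    then show "l (Suc i) \<cdot> dif X i = dif X i \<cdot> l i"
    proof cases
      case 1
      have "dif X n \<cdot> (t \<cdot> (c \<cdot> dif X n)) = c \<cdot> (c \<cdot> dif X n)"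
        by (rule comp_eq[OF t(4)[symmetric]]) (use t c x(1-4)[of n] r(5) in auto)
      then show ?thesis using 1 c x(1-4)[of n] r(5) cc[of "dif X n"] by (simp add: l_def)
    next
      case 2
      have "dif X n \<cdot> dif X i = zr E (obj X i) Z" using x(5)[of i] 2 i r(5) by simp
      then show ?thesis using 2 i c t(1-3) x(1-4)[of n] x(1-4)[of i] r(5) by (auto simp: l_def)
    next
      case 3 then show ?thesis using i x(1-4)[of i] x(1)[of "Suc i"] by (simp add: l_def)
    qed
  qed (use lm in auto)
  have kk: "k i \<cdot> k i = k i" if "i \<le> Suc n" for i
  proof -
    consider "i = 0" | "i = 1" | "i > 1" by linarith
    then show ?thesis
    proof cases
      case 2
      have "s \<cdot> (dif X 0 \<cdot> (a \<cdot> s)) = a \<cdot> (a \<cdot> s)"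
        by (rule comp_eq[OF s(4)[symmetric]]) (use s a x(1-4)[of 0] r(4) in auto)
      then show ?thesis using 2 a s(1-3) x(1-4)[of 0] r(4) aa[of s] by (simp add: k_def)
    qed (use that a x(1)[of i] in \<open>auto simp: k_def\<close>)
  qed
  have ll: "l i \<cdot> l i = l i" if iS: "i \<le> Suc n" for i
  proof -
    consider "i = Suc n" | "i = n" | "i < n" using iS by linarith
    then show ?thesis
    proof cases
      case 2
      have "dif X n \<cdot> (t \<cdot> (c \<cdot> dif X n)) = c \<cdot> (c \<cdot> dif X n)"
        by (rule comp_eq[OF t(4)[symmetric]]) (use t c x(1-4)[of n] r(5) in auto)
      then show ?thesis using 2 c t(1-3) x(1-4)[of n] r(5) cc[of "dif X n"] by (simp add: l_def)
    qed (use that c x(1)[of i] in \<open>auto simp: l_def\<close>)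
  qed
  have lk: "l i \<cdot> k i = zr E (obj X i) (obj X i)" if "i \<le> Suc n" for i
  proof -
    consider "i = 0" | "i = 1" | "i > 1" by linarith
    then show ?thesis
    proof cases
      case 1 then show ?thesis using a n' x(1)[of 0] r(4) by (simp add: l_def k_def)
    next
      case 2
      show ?thesis
      proof (cases "n = 1")
        case True
        have "dif X 1 \<cdot> (dif X 0 \<cdot> (a \<cdot> s)) = zr E (obj X 1) Z" using x(6)[of 0 "a \<cdot> s"] True a s r(4,5) by simp
        then show ?thesis using 2 True a s(1-3) c t(1-3) x(1-4)[of 0] x(1-4)[of 1] r(4,5) by (simp add: l_def k_def)
      next
        case False then show ?thesis using 2 n' km[of 1] x(1)[of 1] by (simp add: l_def)
      qed
    next
      case 3 then show ?thesis using that lm[of i] x(1)[of i] by (simp add: k_def)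
    qed
  qed
  define p where "p i = Idn E (obj X i) \<oplus> \<ominus> k i" for i
  define m where "m i = Idn E (obj X i) \<oplus> \<ominus> l i" for i
  have idc: "chain_on E 0 (Suc n) X X (\<lambda>i. Idn E (obj X i))" by (rule chain_on_id[OF r(6) order_refl])
  have pc: "chain_map E (Suc n) X X p" and mc: "chain_map E (Suc n) X X m"
    unfolding p_def m_def
    using chain_on_add[OF idc chain_on_neg[OF _ r(6,6) order_refl] r(6,6) order_refl] kc lc chain_map_iff[OF r(6,6)] by blast+
  have "(p i \<cdot> m i) \<cdot> (p i \<cdot> m i) = p i \<cdot> m i" if "i \<le> Suc n" for i
  proof -
    note K = km[OF that] lm[OF that] kk[OF that] ll[OF that] lk[OF that] x(1)[OF that]
    have pm: "mor E (p i)" "src E (p i) = obj X i" "tgt E (p i) = obj X i" "mor E (m i)" "src E (m i) = obj X i" "tgt E (m i) = obj X i"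
      using K by (auto simp: p_def m_def)
    have "m i \<cdot> p i = m i \<oplus> \<ominus> k i" using K by (simp add: p_def m_def add_ac)
    then have 1: "(m i \<cdot> p i) \<cdot> m i = m i \<oplus> \<ominus> (k i \<cdot> m i)" using K pm by (simp add: m_def add_ac)
    have "p i \<cdot> k i = zr E (obj X i) (obj X i)" using K by (simp add: p_def)
    then have 2: "p i \<cdot> (k i \<cdot> m i) = zr E (obj X i) (obj X i)" using comp_eq[of "p i" "k i" _ "m i"] K pm by simp
    have "(p i \<cdot> m i) \<cdot> (p i \<cdot> m i) = p i \<cdot> ((m i \<cdot> p i) \<cdot> m i)" using pm by simp
    also have "\<dots> = p i \<cdot> m i" unfolding 1 using K pm 2 by simp
    finally show ?thesis .
  qed
  moreover have "p 0 \<cdot> m 0 = e" using n' r(4) e r(1) by (simp add: p_def m_def k_def l_def a_def)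
  moreover have "p (Suc n) \<cdot> m (Suc n) = e'" using n' r(5) e' r(2) by (simp add: p_def m_def k_def l_def c_def)
  ultimately show ?thesis using chain_map_comp[OF mc pc r(6,6,6)] by (intro exI[of _ "\<lambda>i. p i \<cdot> m i"]) simp
qed

text \<open>
  Two given idempotents in degrees \<open>0\<close> and \<open>1\<close> extend to a chain endomorphism of
  \<open>X\<close>, which is made idempotent degree by degree: if it has component \<open>q\<close> in degree
  \<open>k\<close> and idempotent components below, then the contractible complex on \<open>X\<^sub>k\<close> is
  added in degrees \<open>k\<close> and \<open>k + 1\<close>, and \<open>q\<close> is replaced by the matrix
  with rows \<open>(q, -1)\<close> and \<open>(q\<^sup>2 - q, 1 - q)\<close>. It is idempotent for every
  \<open>q\<close>, and since \<open>q\<^sup>2 - q\<close> vanishes on the differential from degree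
  \<open>k - 1\<close>, it is compatible with the lower components. In the top degree nothing has to be done,
  as the last differential is an epimorphism.
\<close>

lemma rigidify:
  assumes X: "realises n E A Z \<delta> X"
    and a: "mor E a" "src E a = A" "tgt E a = A" "a \<cdot> a = a"
    and b: "mor E b" "src E b = obj X 1" "tgt E b = obj X 1" "b \<cdot> b = b"
    and ab: "b \<cdot> dif X 0 = dif X 0 \<cdot> a"
  shows "\<exists>Y D \<rho> \<eta>. realises n E A D \<rho> Y \<and> obj Y 1 = obj X 1 \<and> dif Y 0 = dif X 0 \<and> chain_map E (Suc n) Y Y \<eta> \<and>
    (\<forall>i\<le>Suc n. \<eta> i \<cdot> \<eta> i = \<eta> i) \<and> \<eta> 0 = a \<and> \<eta> 1 = b"
proof -
  define G where "G k Y \<eta> \<longleftrightarrow> (\<exists>D \<rho>. realises n E A D \<rho> Y) \<and> obj Y 1 = obj X 1 \<and> dif Y 0 = dif X 0 \<and> chain_map E (Suc n) Y Y \<eta> \<and>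
    (\<forall>i<k. \<eta> i \<cdot> \<eta> i = \<eta> i) \<and> \<eta> 0 = a \<and> \<eta> 1 = b" for k Y \<eta>
  have "2 + k \<le> Suc n \<Longrightarrow> \<exists>Y \<eta>. G (2 + k) Y \<eta>" for k
  proof (induction k)
    case 0
    note r = rzD[OF X] and x = complexD[OF rzD(6)[OF X]]
    have "chain_on E 0 1 X X (\<lambda>i. if i = 0 then a else b)"
      unfolding chain_on_def using a b ab r(4) by (auto simp: le_Suc_eq)
    from extend_up[OF r(6,6,8) this] obtain \<eta> where
      h: "\<forall>i\<le>1. \<eta> i = (if i = 0 then a else b)" "chain_on E 0 (Suc n) X X \<eta>" by auto
    have "\<forall>i<2. \<eta> i \<cdot> \<eta> i = \<eta> i" using h(1) a(4) b(4) by (auto simp: less_Suc_eq numeral_2_eq_2)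
    then have "G 2 X \<eta>" using X h chain_map_iff[OF r(6,6)] by (auto simp: G_def)
    then show ?case by auto
  next
    case (Suc j)
    define k where "k = 2 + j"
    have k: "k \<le> n" "2 \<le> k" "Suc (k - 1) = k" "Suc (k - 2) = k - 1" "k \<le> Suc n" using Suc.prems by (auto simp: k_def)
    obtain Y \<eta> where "G k Y \<eta>" using Suc k by (auto simp: k_def)
    then obtain D \<rho> where Y: "realises n E A D \<rho> Y" and g: "obj Y 1 = obj X 1" "dif Y 0 = dif X 0" "chain_map E (Suc n) Y Y \<eta>"
      "\<forall>i<k. \<eta> i \<cdot> \<eta> i = \<eta> i" "\<eta> 0 = a" "\<eta> 1 = b" by (auto simp: G_def)
    note r = rzD[OF Y] and y = complexD[OF rzD(6)[OF Y]]
    note hh = chain_mapD[OF r(6,6) g(3) r(6,6) order_refl]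
    obtain P i1 i2 p1 p2 where bp: "biproduct E (obj Y k) (obj Y k) P i1 i2 p1 p2"
      using biproduct_exists[OF y(1)[of k] y(1)[of k]] k by auto
    obtain P' i1' i2' p1' p2' where bp': "biproduct E (obj Y (Suc k)) (obj Y k) P' i1' i2' p1' p2'"
      using biproduct_exists[OF y(1)[of "Suc k"] y(1)[of k]] k by auto
    obtain S \<sigma> where S: "realises n E (obj S 0) (obj S (Suc n)) \<sigma> S" "obj S k = P"
      "\<forall>i. i \<noteq> k \<longrightarrow> i \<noteq> Suc k \<longrightarrow> obj S i = obj Y i"
      "\<forall>i. Suc i < k \<longrightarrow> dif S i = dif Y i" "\<forall>i. Suc i = k \<longrightarrow> dif S i = i1 \<cdot> dif Y i"
      using stabilise[OF Y k(1) bp bp'] by blast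
    note s = rzD[OF S(1)]
    note bm = biprod_mor[OF bp] biprod_eq[OF bp] biprod_eq'[OF bp]
    define q where "q = \<eta> k" define d where "d = dif Y (k - 1)"
    have q: "mor E q" "src E q = obj Y k" "tgt E q = obj Y k" using hh(1-3)[of k] k by (auto simp: q_def)
    have d: "mor E d" "src E d = obj Y (k - 1)" "tgt E d = obj Y k" using y(1-4)[of "k - 1"] k by (auto simp: d_def)
    define z where "z = (q \<cdot> q) \<oplus> \<ominus> q"
    have z: "mor E z" "src E z = obj Y k" "tgt E z = obj Y k" using q by (auto simp: z_def)
    define w where "w = \<eta> (k - 1)"
    have w: "mor E w" "src E w = obj Y (k - 1)" "tgt E w = obj Y (k - 1)" "w \<cdot> w = w"
      using hh(1-3)[of "k - 1"] g(4) k by (auto simp: w_def)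
    have qd: "q \<cdot> d = d \<cdot> w" using hh(4)[of "k - 1"] k by (simp add: q_def d_def w_def)
    have "q \<cdot> (q \<cdot> d) = d \<cdot> w"
      using comp_eq2[OF qd, of w] q d w by (simp add: qd)
    then have zd: "z \<cdot> d = zr E (obj Y (k - 1)) (obj Y k)" using q d w qd by (simp add: z_def)
    \<comment> \<open>the matrix with rows \<open>(q, -1)\<close> and \<open>(q\<^sup>2 - q, 1 - q)\<close>\<close>
    define Q where "Q = ((i1 \<cdot> (q \<cdot> p1)) \<oplus> \<ominus> (i1 \<cdot> p2)) \<oplus> ((i2 \<cdot> (z \<cdot> p1)) \<oplus> ((i2 \<cdot> p2) \<oplus> \<ominus> (i2 \<cdot> (q \<cdot> p2))))"
    have Q: "mor E Q" "src E Q = P" "tgt E Q = P" using bm(1-15) q z by (auto simp: Q_def)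
    have P: "p1 \<cdot> Q = (q \<cdot> p1) \<oplus> \<ominus> p2" "p2 \<cdot> Q = (z \<cdot> p1) \<oplus> (p2 \<oplus> \<ominus> (q \<cdot> p2))"
      using bm q z by (simp_all add: Q_def)
    have QQ: "Q \<cdot> Q = Q"
    proof (rule biprod_eqI[OF bp])
      have "p1 \<cdot> (Q \<cdot> Q) = (p1 \<cdot> Q) \<cdot> Q" using Q bm(1-15) by simp
      also have "\<dots> = ((q \<cdot> p1) \<oplus> \<ominus> p2) \<cdot> Q" by (simp only: P(1))
      also have "\<dots> = (q \<cdot> (p1 \<cdot> Q)) \<oplus> \<ominus> (p2 \<cdot> Q)" using Q bm(1-15) q by simp
      also have "\<dots> = (q \<cdot> p1) \<oplus> \<ominus> p2" unfolding P z_def using bm(1-15) q by (simp add: add_ac)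
      finally show "p1 \<cdot> (Q \<cdot> Q) = p1 \<cdot> Q" unfolding P .
      have "p2 \<cdot> (Q \<cdot> Q) = (p2 \<cdot> Q) \<cdot> Q" using Q bm(1-15) by simp
      also have "\<dots> = ((z \<cdot> p1) \<oplus> (p2 \<oplus> \<ominus> (q \<cdot> p2))) \<cdot> Q" by (simp only: P(2))
      also have "\<dots> = (z \<cdot> (p1 \<cdot> Q)) \<oplus> ((p2 \<cdot> Q) \<oplus> \<ominus> (q \<cdot> (p2 \<cdot> Q)))" using Q bm(1-15) q z by simp
      also have "\<dots> = (z \<cdot> p1) \<oplus> (p2 \<oplus> \<ominus> (q \<cdot> p2))" unfolding P z_def using bm(1-15) q by (simp add: add_ac)
      finally show "p2 \<cdot> (Q \<cdot> Q) = p2 \<cdot> Q" unfolding P .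
    qed (use Q in auto)
    have ok: "obj Y (k - 1) \<in> Ob E" using y(1)[of "k - 1"] k by simp
    have Qd: "Q \<cdot> (i1 \<cdot> d) = i1 \<cdot> (d \<cdot> w)"
      using ok bm q z d w qd zd comp_eq[OF qd, of w] by (simp add: Q_def)
    have c: "chain_on E 0 k S S (\<eta>(k := Q))"
      unfolding chain_on_def
    proof (intro conjI allI impI; (elim conjE)?)
      fix i assume i: "0 \<le> i" "i < k"
      show "(\<eta>(k := Q)) (Suc i) \<cdot> dif S i = dif S i \<cdot> (\<eta>(k := Q)) i"
      proof (cases "Suc i = k")
        case True
        then have "i = k - 1" by simp
        then have "dif S i = i1 \<cdot> d" "\<eta> i = w" using S(5) True by (simp_all add: d_def w_def)
        then show ?thesis using True i Qd d w bm(1-15) by simp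
      next
        case False
        then show ?thesis using i S(4) hh(4)[of i] k by simp
      qed
    next
      fix i assume "0 \<le> i" "i \<le> k"
      then show "mor E ((\<eta>(k := Q)) i)" "src E ((\<eta>(k := Q)) i) = obj S i" "tgt E ((\<eta>(k := Q)) i) = obj S i"
        using Q S(2,3) hh(1-3)[of i] k by auto
    qed
    have k0: "0 < k" using k by simp
    from extend_up[OF s(6,6,8) c k0 k(5)] obtain \<theta> where t: "\<forall>i\<le>k. \<theta> i = (\<eta>(k := Q)) i" "chain_on E 0 (Suc n) S S \<theta>" by blast
    have "\<forall>i<Suc k. \<theta> i \<cdot> \<theta> i = \<theta> i" using t(1) QQ g(4) by (auto simp: less_Suc_eq)
    moreover have "obj S 0 = A" "obj S 1 = obj X 1" "dif S 0 = dif X 0" "\<theta> 0 = a" "\<theta> 1 = b"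
      using S(3,4) k r(4) g t(1) by auto
    ultimately have "G (Suc k) S \<theta>" using S(1) t(2) chain_map_iff[OF s(6,6)] by (auto simp: G_def)
    then show ?case by (auto simp: k_def)
  qed
  from this[of "n - 1"] n1 obtain Y \<eta> where "G (Suc n) Y \<eta>" by auto
  then obtain D \<rho> where Y: "realises n E A D \<rho> Y" and g: "obj Y 1 = obj X 1" "dif Y 0 = dif X 0" "chain_map E (Suc n) Y Y \<eta>"
      "\<forall>i<Suc n. \<eta> i \<cdot> \<eta> i = \<eta> i" "\<eta> 0 = a" "\<eta> 1 = b" by (auto simp: G_def)
  note r = rzD[OF Y] and y = complexD[OF rzD(6)[OF Y]]
  note hh = chain_mapD[OF r(6,6) g(3) r(6,6) order_refl]
  define q where "q = \<eta> (Suc n)"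
  have q: "mor E q" "src E q = D" "tgt E q = D" "q \<cdot> dif Y n = dif Y n \<cdot> \<eta> n"
    using hh(1-3)[of "Suc n"] hh(4)[of n] r(5) by (auto simp: q_def)
  have "q \<cdot> (q \<cdot> dif Y n) = dif Y n \<cdot> \<eta> n"
    using comp_eq2[OF q(4), of "\<eta> n"] q y(1-4)[of n] hh(1-3)[of n] g(4) r(5) by simp
  then have "(q \<cdot> q \<oplus> \<ominus> q) \<cdot> dif Y n = zr E (obj Y n) D" using q y(1-4)[of n] hh(1-3)[of n] r(5) by simp
  then have "q \<cdot> q \<oplus> \<ominus> q = zr E D D"
    using right_exactD(1)[OF r(8,6), of "q \<cdot> q \<oplus> \<ominus> q"] q r(5) by simp
  then have "q \<cdot> q = q" using eq_iff_diff[of "q \<cdot> q" q] q by simp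
  then have "\<forall>i\<le>Suc n. \<eta> i \<cdot> \<eta> i = \<eta> i" using g(4) by (auto simp: le_Suc_eq less_Suc_eq_le q_def)
  then show ?thesis using Y g by blast
qed

end


section \<open>Additive categories of idempotents\<close>

lemma comm_group_transport:
  assumes G: "comm_group G" and inj: "inj_on U (carrier H)"
    and U: "\<And>x. x \<in> carrier H \<Longrightarrow> U x \<in> carrier G"
    and m: "\<And>x y. x \<in> carrier H \<Longrightarrow> y \<in> carrier H \<Longrightarrow> x \<otimes>\<^bsub>H\<^esub> y \<in> carrier H \<and> U (x \<otimes>\<^bsub>H\<^esub> y) = U x \<otimes>\<^bsub>G\<^esub> U y"
    and one: "\<one>\<^bsub>H\<^esub> \<in> carrier H \<and> U \<one>\<^bsub>H\<^esub> = \<one>\<^bsub>G\<^esub>"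
    and i: "\<And>x. x \<in> carrier H \<Longrightarrow> \<exists>y\<in>carrier H. U y = inv\<^bsub>G\<^esub> (U x)"
  shows "comm_group H"
proof -
  interpret G: comm_group G by fact
  have eq: "x = y" if "U x = U y" "x \<in> carrier H" "y \<in> carrier H" for x y using inj that by (auto dest: inj_onD)
  show ?thesis
  proof (rule comm_groupI)
    show "\<exists>y\<in>carrier H. y \<otimes>\<^bsub>H\<^esub> x = \<one>\<^bsub>H\<^esub>" if x: "x \<in> carrier H" for x
    proof -
      obtain y where y: "y \<in> carrier H" "U y = inv\<^bsub>G\<^esub> (U x)" using i[OF x] by blast
      have "y \<otimes>\<^bsub>H\<^esub> x = \<one>\<^bsub>H\<^esub>" by (rule eq) (use x y m one U in auto)
      then show ?thesis using y by blast
    qed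
  qed (use m one U in \<open>auto intro!: eq simp: G.m_ac\<close>)
qed

text \<open>
  The idempotent completion \<open>I\<close> as seen from \<open>E\<close>: an object \<open>P\<close> of
  \<open>I\<close> is an object \<open>base P\<close> with an idempotent \<open>e P\<close>, and
  \<open>U\<close> and \<open>V\<close> forget the idempotents that decorate morphisms and extensions. The
  opposite of the completion is not literally the completion of the opposite, as the decorations come in the
  other order; but this description is self-dual.
\<close>

locale idem_rep = exact_exang n E for n :: nat and E :: "('o, 'm, 'x) exang" (structure) +
  fixes I :: "('p, 'q, 'y) exang" and base :: "'p \<Rightarrow> 'o" and e :: "'p \<Rightarrow> 'm" and U :: "'q \<Rightarrow> 'm" and V :: "'y \<Rightarrow> 'x"
  assumes ob: "P \<in> Ob I \<Longrightarrow> base P \<in> Ob E \<and> e P \<in> arr E (base P) (base P) \<and> e P \<cdot> e P = e P"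
    and ob_inj: "P \<in> Ob I \<Longrightarrow> Q \<in> Ob I \<Longrightarrow> base P = base Q \<Longrightarrow> e P = e Q \<Longrightarrow> P = Q"
    and ob_surj: "X \<in> Ob E \<Longrightarrow> r \<in> arr E X X \<Longrightarrow> r \<cdot> r = r \<Longrightarrow> \<exists>P\<in>Ob I. base P = X \<and> e P = r"
    and hom_disj: "P \<in> Ob I \<Longrightarrow> Q \<in> Ob I \<Longrightarrow> P' \<in> Ob I \<Longrightarrow> Q' \<in> Ob I \<Longrightarrow> f \<in> arr I P Q \<Longrightarrow> f \<in> arr I P' Q' \<Longrightarrow> P = P' \<and> Q = Q'"
    and U_in: "P \<in> Ob I \<Longrightarrow> Q \<in> Ob I \<Longrightarrow> f \<in> arr I P Q \<Longrightarrow> U f \<in> arr E (base P) (base Q) \<and> e Q \<cdot> U f = U f \<and> U f \<cdot> e P = U f"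
    and U_inj: "P \<in> Ob I \<Longrightarrow> Q \<in> Ob I \<Longrightarrow> inj_on U (arr I P Q)"
    and U_surj: "P \<in> Ob I \<Longrightarrow> Q \<in> Ob I \<Longrightarrow> r \<in> arr E (base P) (base Q) \<Longrightarrow> e Q \<cdot> r = r \<Longrightarrow> r \<cdot> e P = r \<Longrightarrow> \<exists>f\<in>arr I P Q. U f = r"
    and U_mult: "P \<in> Ob I \<Longrightarrow> Q \<in> Ob I \<Longrightarrow> f \<in> arr I P Q \<Longrightarrow> g \<in> arr I P Q \<Longrightarrow>
        f \<otimes>\<^bsub>Hom I P Q\<^esub> g \<in> arr I P Q \<and> U (f \<otimes>\<^bsub>Hom I P Q\<^esub> g) = U f \<otimes>\<^bsub>Hom E (base P) (base Q)\<^esub> U g"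
    and U_one: "P \<in> Ob I \<Longrightarrow> Q \<in> Ob I \<Longrightarrow> zr I P Q \<in> arr I P Q \<and> U (zr I P Q) = zr E (base P) (base Q)"
    and U_idn: "P \<in> Ob I \<Longrightarrow> Idn I P \<in> arr I P P \<and> U (Idn I P) = e P"
    and U_comp: "P \<in> Ob I \<Longrightarrow> Q \<in> Ob I \<Longrightarrow> R \<in> Ob I \<Longrightarrow> f \<in> arr I P Q \<Longrightarrow> g \<in> arr I Q R \<Longrightarrow>
        g \<cdot>\<^bsub>I\<^esub> f \<in> arr I P R \<and> U (g \<cdot>\<^bsub>I\<^esub> f) = U g \<cdot> U f"
    and V_in: "Z \<in> Ob I \<Longrightarrow> A \<in> Ob I \<Longrightarrow> \<delta> \<in> carrier (Ext I Z A) \<Longrightarrow>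
        V \<delta> \<in> carrier (Ext E (base Z) (base A)) \<and> Act E (Idn E (base Z)) (e A) (V \<delta>) = V \<delta> \<and> Act E (e Z) (Idn E (base A)) (V \<delta>) = V \<delta>"
    and V_inj: "Z \<in> Ob I \<Longrightarrow> A \<in> Ob I \<Longrightarrow> inj_on V (carrier (Ext I Z A))"
    and V_surj: "Z \<in> Ob I \<Longrightarrow> A \<in> Ob I \<Longrightarrow> x \<in> carrier (Ext E (base Z) (base A)) \<Longrightarrow> Act E (Idn E (base Z)) (e A) x = x \<Longrightarrow>
        Act E (e Z) (Idn E (base A)) x = x \<Longrightarrow> \<exists>\<delta>\<in>carrier (Ext I Z A). V \<delta> = x"
    and V_mult: "Z \<in> Ob I \<Longrightarrow> A \<in> Ob I \<Longrightarrow> \<delta> \<in> carrier (Ext I Z A) \<Longrightarrow> \<rho> \<in> carrier (Ext I Z A) \<Longrightarrow>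
        \<delta> \<otimes>\<^bsub>Ext I Z A\<^esub> \<rho> \<in> carrier (Ext I Z A) \<and> V (\<delta> \<otimes>\<^bsub>Ext I Z A\<^esub> \<rho>) = V \<delta> \<otimes>\<^bsub>Ext E (base Z) (base A)\<^esub> V \<rho>"
    and V_one: "Z \<in> Ob I \<Longrightarrow> A \<in> Ob I \<Longrightarrow> \<one>\<^bsub>Ext I Z A\<^esub> \<in> carrier (Ext I Z A) \<and> V \<one>\<^bsub>Ext I Z A\<^esub> = \<one>\<^bsub>Ext E (base Z) (base A)\<^esub>"
    and V_act: "Z \<in> Ob I \<Longrightarrow> Z' \<in> Ob I \<Longrightarrow> A \<in> Ob I \<Longrightarrow> A' \<in> Ob I \<Longrightarrow> c \<in> arr I Z' Z \<Longrightarrow> a \<in> arr I A A' \<Longrightarrow> \<delta> \<in> carrier (Ext I Z A) \<Longrightarrow>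
        Act I c a \<delta> \<in> carrier (Ext I Z' A') \<and> V (Act I c a \<delta>) = Act E (U c) (U a) (V \<delta>)"
    and rlz_rep: "Z \<in> Ob I \<Longrightarrow> A \<in> Ob I \<Longrightarrow> \<delta> \<in> carrier (Ext I Z A) \<Longrightarrow> \<exists>S X \<eta>. realises n E (base A) (base Z) (V \<delta>) X \<and>
        chain_map E (Suc n) X X \<eta> \<and> (\<forall>i\<le>Suc n. \<eta> i \<cdot> \<eta> i = \<eta> i \<and> obj S i \<in> Ob I \<and> base (obj S i) = obj X i \<and> e (obj S i) = \<eta> i) \<and>
        (\<forall>i\<le>n. dif S i \<in> arr I (obj S i) (obj S (Suc i)) \<and> U (dif S i) = \<eta> (Suc i) \<cdot> (dif X i \<cdot> \<eta> i)) \<and>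
        obj S 0 = A \<and> obj S (Suc n) = Z \<and> Rlz I Z A \<delta> = htpy_class n I S"
begin

lemma ob_facts [simp]:
  assumes "P \<in> Ob I"
  shows "base P \<in> Ob E" "mor E (e P)" "src E (e P) = base P" "tgt E (e P) = base P" "e P \<cdot> e P = e P"
  using ob[OF assms] by auto

lemma U_eqI:
  assumes "P \<in> Ob I" "Q \<in> Ob I" "f \<in> arr I P Q" "g \<in> arr I P Q" "U f = U g" shows "f = g"
  using U_inj[OF assms(1,2)] assms(3-5) by (auto dest: inj_onD)

lemma V_eqI:
  assumes "Z \<in> Ob I" "A \<in> Ob I" "\<delta> \<in> carrier (Ext I Z A)" "\<rho> \<in> carrier (Ext I Z A)" "V \<delta> = V \<rho>" shows "\<delta> = \<rho>"
  using V_inj[OF assms(1,2)] assms(3-5) by (auto dest: inj_onD)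

lemma U_facts:
  assumes "P \<in> Ob I" "Q \<in> Ob I" "f \<in> arr I P Q"
  shows "mor E (U f)" "src E (U f) = base P" "tgt E (U f) = base Q" "e Q \<cdot> U f = U f" "U f \<cdot> e P = U f"
  using U_in[OF assms] assms by auto

lemma comm_group_Hom:
  assumes P: "P \<in> Ob I" and Q: "Q \<in> Ob I" shows "comm_group (Hom I P Q)"
proof (rule comm_group_transport[of "Hom E (base P) (base Q)" U])
  show "comm_group (Hom E (base P) (base Q))" using hom_group P Q by simp
  show "inj_on U (arr I P Q)" by (rule U_inj[OF P Q])
  show "U x \<in> arr E (base P) (base Q)" if "x \<in> arr I P Q" for x using U_in[OF P Q that] by blast
  show "x \<otimes>\<^bsub>Hom I P Q\<^esub> y \<in> arr I P Q \<and> U (x \<otimes>\<^bsub>Hom I P Q\<^esub> y) = U x \<otimes>\<^bsub>Hom E (base P) (base Q)\<^esub> U y"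
    if "x \<in> arr I P Q" "y \<in> arr I P Q" for x y using U_mult[OF P Q that] .
  show "zr I P Q \<in> arr I P Q \<and> U (zr I P Q) = zr E (base P) (base Q)" by (rule U_one[OF P Q])
  show "\<exists>y\<in>arr I P Q. U y = inv\<^bsub>Hom E (base P) (base Q)\<^esub> (U x)" if x: "x \<in> arr I P Q" for x
    by (rule U_surj[OF P Q]) (use U_facts[OF P Q x] P Q in auto)
qed

lemma comm_group_Ext:
  assumes Z: "Z \<in> Ob I" and A: "A \<in> Ob I" shows "comm_group (Ext I Z A)"
proof (rule comm_group_transport[of "Ext E (base Z) (base A)" V])
  interpret G: comm_group "Ext E (base Z) (base A)" using ext_group Z A by simp
  show "comm_group (Ext E (base Z) (base A))" using ext_group Z A by simp
  show "inj_on V (carrier (Ext I Z A))" by (rule V_inj[OF Z A])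
  show "V x \<in> carrier (Ext E (base Z) (base A))" if "x \<in> carrier (Ext I Z A)" for x using V_in[OF Z A that] by blast
  show "x \<otimes>\<^bsub>Ext I Z A\<^esub> y \<in> carrier (Ext I Z A) \<and> V (x \<otimes>\<^bsub>Ext I Z A\<^esub> y) = V x \<otimes>\<^bsub>Ext E (base Z) (base A)\<^esub> V y"
    if "x \<in> carrier (Ext I Z A)" "y \<in> carrier (Ext I Z A)" for x y using V_mult[OF Z A that] .
  show "\<one>\<^bsub>Ext I Z A\<^esub> \<in> carrier (Ext I Z A) \<and> V \<one>\<^bsub>Ext I Z A\<^esub> = \<one>\<^bsub>Ext E (base Z) (base A)\<^esub>" by (rule V_one[OF Z A])
  show "\<exists>y\<in>carrier (Ext I Z A). V y = inv\<^bsub>Ext E (base Z) (base A)\<^esub> (V x)" if x: "x \<in> carrier (Ext I Z A)" for x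
  proof (rule V_surj[OF Z A])
    note v = V_in[OF Z A x]
    have "Act E (Idn E (base Z)) (e A) \<in> hom (Ext E (base Z) (base A)) (Ext E (base Z) (base A))"
      "Act E (e Z) (Idn E (base A)) \<in> hom (Ext E (base Z) (base A)) (Ext E (base Z) (base A))"
      by (rule act_hom; use Z A in simp)+
    then have h: "group_hom (Ext E (base Z) (base A)) (Ext E (base Z) (base A)) (Act E (Idn E (base Z)) (e A))"
      "group_hom (Ext E (base Z) (base A)) (Ext E (base Z) (base A)) (Act E (e Z) (Idn E (base A)))"
      by (simp_all add: group_hom_def group_hom_axioms_def G.is_group)
    show "Act E (Idn E (base Z)) (e A) (inv\<^bsub>Ext E (base Z) (base A)\<^esub> (V x)) = inv\<^bsub>Ext E (base Z) (base A)\<^esub> (V x)"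
      "Act E (e Z) (Idn E (base A)) (inv\<^bsub>Ext E (base Z) (base A)\<^esub> (V x)) = inv\<^bsub>Ext E (base Z) (base A)\<^esub> (V x)"
      using group_hom.hom_inv[OF h(1)] group_hom.hom_inv[OF h(2)] v by simp_all
  qed (use V_in[OF Z A x] in simp)
qed

lemma completion_additive: "additive_category I"
proof (rule additive_category.intro)
  show "comm_group (Hom I P Q)" if "P \<in> Ob I" "Q \<in> Ob I" for P Q using comm_group_Hom that .
  show "P = P' \<and> Q = Q'" if "P \<in> Ob I" "Q \<in> Ob I" "P' \<in> Ob I" "Q' \<in> Ob I" "f \<in> arr I P Q" "f \<in> arr I P' Q'" for P Q P' Q' f
    using hom_disj that by blast
  show "Idn I P \<in> arr I P P" if "P \<in> Ob I" for P using U_idn that by blast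
  show "g \<cdot>\<^bsub>I\<^esub> f \<in> arr I P R" if "P \<in> Ob I" "Q \<in> Ob I" "R \<in> Ob I" "f \<in> arr I P Q" "g \<in> arr I Q R" for P Q R f g
    using U_comp that by blast
  show "h \<cdot>\<^bsub>I\<^esub> g \<cdot>\<^bsub>I\<^esub> f = h \<cdot>\<^bsub>I\<^esub> (g \<cdot>\<^bsub>I\<^esub> f)"
    if a: "W \<in> Ob I" "P \<in> Ob I" "Q \<in> Ob I" "R \<in> Ob I" "f \<in> arr I W P" "g \<in> arr I P Q" "h \<in> arr I Q R" for W P Q R f g h
  proof -
    note 1 = U_comp[OF a(1-3,5,6)] and 2 = U_comp[OF a(2-4,6,7)]
    note 3 = U_comp[OF a(1,3,4) conjunct1[OF 1] a(7)] and 4 = U_comp[OF a(1,2,4,5) conjunct1[OF 2]]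
    show ?thesis
      by (rule U_eqI[OF a(1,4)]) (use 1 2 3 4 U_facts[OF a(1,2,5)] U_facts[OF a(2,3,6)] U_facts[OF a(3,4,7)] in \<open>simp_all del: arr_iff\<close>)
  qed
  show "Idn I Q \<cdot>\<^bsub>I\<^esub> f = f" "f \<cdot>\<^bsub>I\<^esub> Idn I P = f" if a: "P \<in> Ob I" "Q \<in> Ob I" "f \<in> arr I P Q" for P Q f
    using U_eqI[OF a(1,2) _ a(3)] U_comp[OF a(1,2,2,3) conjunct1[OF U_idn[OF a(2)]]] U_comp[OF a(1,1,2) conjunct1[OF U_idn[OF a(1)]] a(3)]
      U_facts[OF a] U_idn[OF a(1)] U_idn[OF a(2)] by (auto simp del: arr_iff)
  show "(g \<otimes>\<^bsub>Hom I Q R\<^esub> g') \<cdot>\<^bsub>I\<^esub> f = (g \<cdot>\<^bsub>I\<^esub> f) \<otimes>\<^bsub>Hom I P R\<^esub> (g' \<cdot>\<^bsub>I\<^esub> f)"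
    if a: "P \<in> Ob I" "Q \<in> Ob I" "R \<in> Ob I" "f \<in> arr I P Q" "g \<in> arr I Q R" "g' \<in> arr I Q R" for P Q R f g g'
  proof -
    note 1 = U_comp[OF a(1-5)] and 2 = U_comp[OF a(1-4,6)] and 3 = U_mult[OF a(2,3,5,6)]
    note 4 = U_comp[OF a(1-4) conjunct1[OF 3]] and 5 = U_mult[OF a(1,3) conjunct1[OF 1] conjunct1[OF 2]]
    show ?thesis
      by (rule U_eqI[OF a(1,3)]) (use 1 2 3 4 5 U_facts[OF a(1,2,4)] U_facts[OF a(2,3,5)] U_facts[OF a(2,3,6)] in \<open>simp_all del: arr_iff\<close>)
  qed
  show "g \<cdot>\<^bsub>I\<^esub> (f \<otimes>\<^bsub>Hom I P Q\<^esub> f') = (g \<cdot>\<^bsub>I\<^esub> f) \<otimes>\<^bsub>Hom I P R\<^esub> (g \<cdot>\<^bsub>I\<^esub> f')"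
    if a: "P \<in> Ob I" "Q \<in> Ob I" "R \<in> Ob I" "f \<in> arr I P Q" "f' \<in> arr I P Q" "g \<in> arr I Q R" for P Q R f f' g
  proof -
    note 1 = U_comp[OF a(1-4,6)] and 2 = U_comp[OF a(1-3,5,6)] and 3 = U_mult[OF a(1,2,4,5)]
    note 4 = U_comp[OF a(1-3) conjunct1[OF 3] a(6)] and 5 = U_mult[OF a(1,3) conjunct1[OF 1] conjunct1[OF 2]]
    show ?thesis
      by (rule U_eqI[OF a(1,3)]) (use 1 2 3 4 5 U_facts[OF a(1,2,4)] U_facts[OF a(1,2,5)] U_facts[OF a(2,3,6)] in \<open>simp_all del: arr_iff\<close>)
  qed
  show "\<exists>N. zero_object I N"
  proof -
    obtain N0 where N0: "zero_object E N0" using zero_object_exists by blast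
    note z = zero_ob_eq[OF N0]
    obtain N where N: "N \<in> Ob I" "base N = N0" using ob_surj[of N0 "Idn E N0"] z(1) by auto
    have "\<exists>!f. f \<in> arr I P N" "\<exists>!f. f \<in> arr I N P" if P: "P \<in> Ob I" for P
    proof -
      have "f = zr I P N" if f: "f \<in> arr I P N" for f
        by (rule U_eqI[OF P N(1) f conjunct1[OF U_one[OF P N(1)]]]) (use U_one[OF P N(1)] U_facts[OF P N(1) f] z(2) N(2) in auto)
      then show "\<exists>!f. f \<in> arr I P N" using U_one[OF P N(1)] by blast
      have "f = zr I N P" if f: "f \<in> arr I N P" for f
        by (rule U_eqI[OF N(1) P f conjunct1[OF U_one[OF N(1) P]]]) (use U_one[OF N(1) P] U_facts[OF N(1) P f] z(3) N(2) in auto)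
      then show "\<exists>!f. f \<in> arr I N P" using U_one[OF N(1) P] by blast
    qed
    then show ?thesis using N(1) unfolding zero_object_def by blast
  qed
  show "\<exists>P i1 i2 p1 p2. biproduct I A B P i1 i2 p1 p2" if A: "A \<in> Ob I" and B: "B \<in> Ob I" for A B
  proof -
    obtain P0 j1 j2 q1 q2 where b0: "biproduct E (base A) (base B) P0 j1 j2 q1 q2" using biproduct_exists A B by (metis ob_facts(1))
    note b = biprod_mor[OF b0] biprod_eq[OF b0] biprod_eq'[OF b0]
    \<comment> \<open>the biproduct is the image of the sum of the two idempotents\<close>
    define w where "w = (j1 \<cdot> (e A \<cdot> q1)) \<oplus> (j2 \<cdot> (e B \<cdot> q2))"
    have ee: "e P \<cdot> (e P \<cdot> x) = e P \<cdot> x" if "P \<in> Ob I" "mor E x" "tgt E x = base P" for P x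
      using comp_eq[OF ob_facts(5)[OF that(1)]] that by simp
    have w: "mor E w" "src E w = P0" "tgt E w = P0" using b A B by (auto simp: w_def)
    have "w \<cdot> w = w" using b A B by (simp add: w_def ee)
    then obtain P where P: "P \<in> Ob I" "base P = P0" "e P = w" using ob_surj[of P0 w] w b by auto
    obtain i1 where i1: "i1 \<in> arr I A P" "U i1 = j1 \<cdot> e A"
      using U_surj[OF A P(1), of "j1 \<cdot> e A"] P b A B by (auto simp: w_def)
    obtain i2 where i2: "i2 \<in> arr I B P" "U i2 = j2 \<cdot> e B"
      using U_surj[OF B P(1), of "j2 \<cdot> e B"] P b A B by (auto simp: w_def)
    obtain p1 where p1: "p1 \<in> arr I P A" "U p1 = e A \<cdot> q1"
      using U_surj[OF P(1) A, of "e A \<cdot> q1"] P b A B by (auto simp: w_def ee)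
    obtain p2 where p2: "p2 \<in> arr I P B" "U p2 = e B \<cdot> q2"
      using U_surj[OF P(1) B, of "e B \<cdot> q2"] P b A B by (auto simp: w_def ee)
    note c11 = U_comp[OF A P(1) A i1(1) p1(1)] and c22 = U_comp[OF B P(1) B i2(1) p2(1)]
      and c12 = U_comp[OF B P(1) A i2(1) p1(1)] and c21 = U_comp[OF A P(1) B i1(1) p2(1)]
      and d1 = U_comp[OF P(1) A P(1) p1(1) i1(1)] and d2 = U_comp[OF P(1) B P(1) p2(1) i2(1)]
    note d = U_mult[OF P(1,1) conjunct1[OF d1] conjunct1[OF d2]]
    have "biproduct I A B P i1 i2 p1 p2"
      unfolding biproduct_def
    proof (intro conjI)
      show "p1 \<cdot>\<^bsub>I\<^esub> i1 = Idn I A" by (rule U_eqI[OF A A]) (use c11 U_idn[OF A] i1 p1 b A B ee in \<open>simp_all del: arr_iff\<close>)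
      show "p2 \<cdot>\<^bsub>I\<^esub> i2 = Idn I B" by (rule U_eqI[OF B B]) (use c22 U_idn[OF B] i2 p2 b A B ee in \<open>simp_all del: arr_iff\<close>)
      show "p1 \<cdot>\<^bsub>I\<^esub> i2 = zr I B A" by (rule U_eqI[OF B A]) (use c12 U_one[OF B A] i2 p1 b A B ee in \<open>simp_all del: arr_iff\<close>)
      show "p2 \<cdot>\<^bsub>I\<^esub> i1 = zr I A B" by (rule U_eqI[OF A B]) (use c21 U_one[OF A B] i1 p2 b A B ee in \<open>simp_all del: arr_iff\<close>)
      show "(i1 \<cdot>\<^bsub>I\<^esub> p1) \<otimes>\<^bsub>Hom I P P\<^esub> (i2 \<cdot>\<^bsub>I\<^esub> p2) = Idn I P"
        by (rule U_eqI[OF P(1,1)]) (use d d1 d2 U_idn[OF P(1)] i1 i2 p1 p2 b A B ee P in \<open>simp_all del: arr_iff add: w_def\<close>)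
    qed (use A B P i1 i2 p1 p2 in auto)
    then show ?thesis by blast
  qed
qed

lemma completion_biadditive: "biadditive_functor I"
proof (rule biadditive_functor.intro)
  show "comm_group (Ext I Z A)" if "Z \<in> Ob I" "A \<in> Ob I" for Z A using comm_group_Ext that .
  show "Act I c a \<in> hom (Ext I Z A) (Ext I Z' A')"
    if d: "Z \<in> Ob I" "Z' \<in> Ob I" "A \<in> Ob I" "A' \<in> Ob I" "c \<in> arr I Z' Z" "a \<in> arr I A A'" for Z Z' A A' c a
  proof -
    note u = U_facts[OF d(2,1,5)] U_facts[OF d(3,4,6)] and v = V_act[OF d]
    have "Act I c a (\<delta> \<otimes>\<^bsub>Ext I Z A\<^esub> \<rho>) = Act I c a \<delta> \<otimes>\<^bsub>Ext I Z' A'\<^esub> Act I c a \<rho>"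
      if x: "\<delta> \<in> carrier (Ext I Z A)" "\<rho> \<in> carrier (Ext I Z A)" for \<delta> \<rho>
    proof -
      note m = V_mult[OF d(1,3) x]
      note w = v[OF conjunct1[OF m]] and k = V_mult[OF d(2,4) conjunct1[OF v[OF x(1)]] conjunct1[OF v[OF x(2)]]]
      show ?thesis
        by (rule V_eqI[OF d(2,4)])
          (use m w k v[OF x(1)] v[OF x(2)] V_in[OF d(1,3) x(1)] V_in[OF d(1,3) x(2)] u act_mult[of "U c" "U a" "base Z" "base A" "base Z'" "base A'" "V \<delta>" "V \<rho>"] in simp_all)
    qed
    then show ?thesis using v by (auto simp: hom_def)
  qed
  show "Act I (Idn I Z) (Idn I A) \<delta> = \<delta>" if d: "Z \<in> Ob I" "A \<in> Ob I" "\<delta> \<in> carrier (Ext I Z A)" for Z A \<delta>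
  proof (rule V_eqI[OF d(1,2)])
    note v = V_act[OF d(1,1,2,2) conjunct1[OF U_idn[OF d(1)]] conjunct1[OF U_idn[OF d(2)]] d(3)]
    show "Act I (Idn I Z) (Idn I A) \<delta> \<in> carrier (Ext I Z A)" using v by blast
    note w = V_in[OF d]
    have "Act E (e Z) (e A) (V \<delta>) = V \<delta>"
      using act_act[of "Idn E (base Z)" "e A" "e Z" "Idn E (base A)" "V \<delta>"] w d(1,2) by simp
    then show "V (Act I (Idn I Z) (Idn I A) \<delta>) = V \<delta>" using v w U_idn[OF d(1)] U_idn[OF d(2)] by simp
  qed (rule d(3))
  show "Act I (c \<cdot>\<^bsub>I\<^esub> c') (a' \<cdot>\<^bsub>I\<^esub> a) \<delta> = Act I c' a' (Act I c a \<delta>)"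
    if d: "Z \<in> Ob I" "Z' \<in> Ob I" "Z'' \<in> Ob I" "A \<in> Ob I" "A' \<in> Ob I" "A'' \<in> Ob I"
      "c \<in> arr I Z' Z" "c' \<in> arr I Z'' Z'" "a \<in> arr I A A'" "a' \<in> arr I A' A''" "\<delta> \<in> carrier (Ext I Z A)"
    for Z Z' Z'' A A' A'' c c' a a' \<delta>
  proof -
    note c = U_comp[OF d(3,2,1,8,7)] and a = U_comp[OF d(4,5,6,9,10)]
    note v1 = V_act[OF d(1,2,4,5,7,9,11)]
    note v2 = V_act[OF d(2,3,5,6,8,10) conjunct1[OF v1]]
    note v3 = V_act[OF d(1,3,4,6) conjunct1[OF c] conjunct1[OF a] d(11)]
    show ?thesis
      by (rule V_eqI[OF d(3,6)])
        (use c a v1 v2 v3 U_facts[OF d(2,1,7)] U_facts[OF d(3,2,8)] U_facts[OF d(4,5,9)] U_facts[OF d(5,6,10)] V_in[OF d(1,4,11)] in \<open>simp_all del: arr_iff\<close>)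
  qed
  show "Act I (c \<otimes>\<^bsub>Hom I Z' Z\<^esub> c') a \<delta> = Act I c a \<delta> \<otimes>\<^bsub>Ext I Z' A'\<^esub> Act I c' a \<delta>"
    if d: "Z \<in> Ob I" "Z' \<in> Ob I" "A \<in> Ob I" "A' \<in> Ob I" "c \<in> arr I Z' Z" "c' \<in> arr I Z' Z" "a \<in> arr I A A'" "\<delta> \<in> carrier (Ext I Z A)"
    for Z Z' A A' c c' a \<delta>
  proof -
    note c = U_mult[OF d(2,1,5,6)]
    note v1 = V_act[OF d(1-4,5,7,8)] and v2 = V_act[OF d(1-4,6,7,8)] and v3 = V_act[OF d(1-4) conjunct1[OF c] d(7,8)]
    note k = V_mult[OF d(2,4) conjunct1[OF v1] conjunct1[OF v2]]
    show ?thesis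
      by (rule V_eqI[OF d(2,4)])
        (use c v1 v2 v3 k U_facts[OF d(2,1,5)] U_facts[OF d(2,1,6)] U_facts[OF d(3,4,7)] V_in[OF d(1,3,8)] act_add_l[of "U c" "U c'" "U a" "V \<delta>"] in \<open>simp_all del: arr_iff\<close>)
  qed
  show "Act I c (a \<otimes>\<^bsub>Hom I A A'\<^esub> a') \<delta> = Act I c a \<delta> \<otimes>\<^bsub>Ext I Z' A'\<^esub> Act I c a' \<delta>"
    if d: "Z \<in> Ob I" "Z' \<in> Ob I" "A \<in> Ob I" "A' \<in> Ob I" "c \<in> arr I Z' Z" "a \<in> arr I A A'" "a' \<in> arr I A A'" "\<delta> \<in> carrier (Ext I Z A)"
    for Z Z' A A' c a a' \<delta>
  proof -
    note c = U_mult[OF d(3,4,6,7)]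
    note v1 = V_act[OF d(1-4,5,6,8)] and v2 = V_act[OF d(1-4,5,7,8)] and v3 = V_act[OF d(1-4,5) conjunct1[OF c] d(8)]
    note k = V_mult[OF d(2,4) conjunct1[OF v1] conjunct1[OF v2]]
    show ?thesis
      by (rule V_eqI[OF d(2,4)])
        (use c v1 v2 v3 k U_facts[OF d(2,1,5)] U_facts[OF d(3,4,6)] U_facts[OF d(3,4,7)] V_in[OF d(1,3,8)] act_add_r[of "U a" "U a'" "U c" "V \<delta>"] in \<open>simp_all del: arr_iff\<close>)
  qed
qed

lemma completion_additive_bifunctor: "additive_bifunctor I" using completion_additive completion_biadditive by (simp add: additive_bifunctor_def)

sublocale I: additive_bifunctor I by (rule completion_additive_bifunctor)

end


section \<open>Realisations by complexes of idempotents\<close>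

text \<open>
  The part of \<open>\<langle>X, \<delta>\<rangle>\<close> being an \<open>n\<close>-exangle that is not a
  matter of \<open>X\<close> being an exact sequence, on the covariant side.
\<close>

definition pull_exact :: "nat \<Rightarrow> ('o, 'm, 'x) exang \<Rightarrow> ('o, 'm) cplx \<Rightarrow> 'x \<Rightarrow> bool" where
  "pull_exact n E X \<delta> \<longleftrightarrow> \<delta> \<in> carrier (Ext E (obj X (Suc n)) (obj X 0)) \<and>
    Act E (dif X n) (Idn E (obj X 0)) \<delta> = \<one>\<^bsub>Ext E (obj X n) (obj X 0)\<^esub> \<and>
    (\<forall>u. mor E u \<longrightarrow> tgt E u = obj X (Suc n) \<longrightarrow> Act E u (Idn E (obj X 0)) \<delta> = \<one>\<^bsub>Ext E (src E u) (obj X 0)\<^esub> \<longrightarrow>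
      (\<exists>v. mor E v \<and> src E v = src E u \<and> tgt E v = obj X n \<and> u = dif X n \<cdot>\<^bsub>E\<^esub> v))"

context additive_category
begin

text \<open>
  Needed for (R2): a realisation of the zero extension of a zero object has a retraction of its first
  differential, and then is trivial.
\<close>

lemma trivial_retract_left:
  assumes S: "complex C (Suc n) S" and N: "zero_object C N" and n: "1 \<le> n" and A: "obj S 0 = A" "obj S (Suc n) = N"
    and s: "mor C s" "src C s = obj S 1" "tgt C s = A" "s \<cdot> dif S 0 = Idn C A"
  shows "\<exists>f g. end_fixing n C S (trivial_cplx 0 N A) f \<and> end_fixing n C (trivial_cplx 0 N A) S g"
proof -
  note x = complexD[OF S] and z = zero_ob_eq[OF N]
  have Aob: "A \<in> Ob C" using x(1)[of 0] A by simp
  let ?T = "trivial_cplx 0 N A"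
  have T: "complex C (Suc n) ?T" using trivial_exact_seq[OF N Aob, of 0 n] by (simp add: exact_seq_def)
  let ?f = "\<lambda>i::nat. if i = 0 then Idn C A else if i = 1 then s else zr C (obj S i) N"
  let ?g = "\<lambda>i::nat. if i = 0 then Idn C A else if i = 1 then dif S 0 else zr C N (obj S i)"
  have t: "obj ?T i = (if i = 0 \<or> i = 1 then A else N)" "dif ?T 0 = Idn C A" "dif ?T 1 = zr C A N" "1 < i \<Longrightarrow> dif ?T i = zr C N N" for i
    by (auto simp: trivial_cplx_def)
  have f: "chain_map C (Suc n) S ?T ?f"
  proof (rule chain_mapI[OF S T])
    show "mor C (?f i) \<and> src C (?f i) = obj S i \<and> tgt C (?f i) = obj ?T i" if "i \<le> Suc n" for i
      using s A Aob x(1)[OF that] z(1) unfolding t by auto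
    fix i assume i: "i < Suc n"
    consider "i = 0" | "i = 1" | "1 < i" by linarith
    then show "?f (Suc i) \<cdot> dif S i = dif ?T i \<cdot> ?f i"
    proof cases
      case 1 then show ?thesis using s Aob by (simp add: t)
    next
      case 2 then show ?thesis using s i x(1-4)[of 1] x(1)[of 2] z(1) Aob by (simp add: t t(3)[unfolded One_nat_def] numeral_2_eq_2)
    next
      case 3 then show ?thesis using i x(1-4)[of i] x(1)[of "Suc i"] z(1) by (simp add: t)
    qed
  qed
  have g: "chain_map C (Suc n) ?T S ?g"
  proof (rule chain_mapI[OF T S])
    show "mor C (?g i) \<and> src C (?g i) = obj ?T i \<and> tgt C (?g i) = obj S i" if "i \<le> Suc n" for i
      using A Aob x(1)[OF that] x(2-4)[of 0] z(1) unfolding t by auto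
    fix i assume i: "i < Suc n"
    consider "i = 0" | "i = 1" | "1 < i" by linarith
    then show "?g (Suc i) \<cdot> dif ?T i = dif S i \<cdot> ?g i"
    proof cases
      case 1 then show ?thesis using x(1-4)[of 0] A Aob by (simp add: t)
    next
      case 2 then show ?thesis using i x(5)[of 0] x(1)[of 2] A z(1) Aob by (simp add: t t(3)[unfolded One_nat_def] numeral_2_eq_2)
    next
      case 3 then show ?thesis using i x(1-4)[of i] x(1)[of "Suc i"] z(1) by (simp add: t)
    qed
  qed
  have "end_fixing n C S ?T ?f" "end_fixing n C ?T S ?g"
    using f g n A z(4) by (auto simp: end_fixing_def t)
  then show ?thesis by blast
qed

lemma trivial_retract_right:
  assumes S: "complex C (Suc n) S" and N: "zero_object C N" and n: "1 \<le> n" and A: "obj S 0 = N" "obj S (Suc n) = A"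
    and s: "mor C s" "src C s = A" "tgt C s = obj S n" "dif S n \<cdot> s = Idn C A"
  shows "\<exists>f g. end_fixing n C S (trivial_cplx n N A) f \<and> end_fixing n C (trivial_cplx n N A) S g"
proof -
  note x = complexD[OF S] and z = zero_ob_eq[OF N]
  have Aob: "A \<in> Ob C" using x(1)[of "Suc n"] A by simp
  let ?T = "trivial_cplx n N A"
  have T: "complex C (Suc n) ?T" using trivial_exact_seq[OF N Aob, of n n] by (simp add: exact_seq_def)
  let ?f = "\<lambda>i::nat. if i = Suc n then Idn C A else if i = n then dif S n else zr C (obj S i) N"
  let ?g = "\<lambda>i::nat. if i = Suc n then Idn C A else if i = n then s else zr C N (obj S i)"
  have t: "obj ?T i = (if i = n \<or> i = Suc n then A else N)" "dif ?T n = Idn C A" "Suc i = n \<Longrightarrow> dif ?T i = zr C N A" "Suc i < n \<Longrightarrow> dif ?T i = zr C N N" for i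
    by (auto simp: trivial_cplx_def)
  have f: "chain_map C (Suc n) S ?T ?f"
  proof (rule chain_mapI[OF S T])
    show "mor C (?f i) \<and> src C (?f i) = obj S i \<and> tgt C (?f i) = obj ?T i" if "i \<le> Suc n" for i
      using A Aob x(1)[OF that] x(2-4)[of n] z(1) unfolding t by auto
    fix i assume i: "i < Suc n"
    consider "i = n" | "Suc i = n" | "Suc i < n" using i by linarith
    then show "?f (Suc i) \<cdot> dif S i = dif ?T i \<cdot> ?f i"
    proof cases
      case 1 then show ?thesis using x(1-4)[of n] A Aob by (simp add: t)
    next
      case 2 then show ?thesis using i x(5)[of i] x(1)[of i] A z(1) Aob by (auto simp: t)
    next
      case 3 then show ?thesis using i x(1-4)[of i] x(1)[of "Suc i"] z(1) by (simp add: t)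
    qed
  qed
  have g: "chain_map C (Suc n) ?T S ?g"
  proof (rule chain_mapI[OF T S])
    show "mor C (?g i) \<and> src C (?g i) = obj ?T i \<and> tgt C (?g i) = obj S i" if "i \<le> Suc n" for i
      using s A Aob x(1)[OF that] z(1) unfolding t by auto
    fix i assume i: "i < Suc n"
    consider "i = n" | "Suc i = n" | "Suc i < n" using i by linarith
    then show "?g (Suc i) \<cdot> dif ?T i = dif S i \<cdot> ?g i"
    proof cases
      case 1 then show ?thesis using s Aob by (simp add: t)
    next
      case 2 then show ?thesis using s i x(1-4)[of i] z(1) Aob by (auto simp: t)
    next
      case 3 then show ?thesis using i x(1-4)[of i] x(1)[of "Suc i"] z(1) by (simp add: t)
    qed
  qed
  have "end_fixing n C S ?T ?f" "end_fixing n C ?T S ?g"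
    using f g n A z(4) by (auto simp: end_fixing_def t)
  then show ?thesis by blast
qed

end

context additive_bifunctor
begin

lemma pull_exact_htpy:
  assumes X: "complex E (Suc n) X" and Y: "complex E (Suc n) Y" and e: "htpy_equiv n E X Y" and h: "pull_exact n E X \<delta>"
  shows "pull_exact n E Y \<delta>"
proof -
  from e obtain f g where fg: "end_fixing n E X Y f" "end_fixing n E Y X g" by (auto simp: htpy_equiv_def)
  note ends = end_fixing_op(2,3)[OF additive_category_axioms X Y fg(1)]
  have f: "chain_map E (Suc n) X Y f" "f (Suc n) = Idn E (obj X (Suc n))" and g: "chain_map E (Suc n) Y X g" "g (Suc n) = Idn E (obj Y (Suc n))"
    using fg by (auto simp: end_fixing_def)
  note x = complexD[OF X] and y = complexD[OF Y]
  note ff = chain_mapD[OF X Y f(1) X Y order_refl] and gg = chain_mapD[OF Y X g(1) Y X order_refl]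
  have h1: "\<delta> \<in> carrier (Ext E (obj Y (Suc n)) (obj Y 0))"
    "Act E (dif X n) (Idn E (obj Y 0)) \<delta> = \<one>\<^bsub>Ext E (obj X n) (obj Y 0)\<^esub>" using h ends by (auto simp: pull_exact_def)
  have dX: "dif Y n \<cdot> f n = dif X n" using ff(4)[of n] f(2) x(1-4)[of n] by simp
  have dY: "dif X n \<cdot> g n = dif Y n" using gg(4)[of n] g(2) y(1-4)[of n] ends by simp
  have "Act E (dif Y n) (Idn E (obj Y 0)) \<delta> = Act E (g n) (Idn E (obj Y 0)) (Act E (dif X n) (Idn E (obj Y 0)) \<delta>)"
    unfolding dY[symmetric] using gg(1-3)[of n] x(1-4)[of n] y(1)[of 0] h1(1) ends by simp
  also have "\<dots> = \<one>\<^bsub>Ext E (obj Y n) (obj Y 0)\<^esub>" unfolding h1(2) using gg(1-3)[of n] y(1)[of 0] by simp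
  finally have 1: "Act E (dif Y n) (Idn E (obj Y 0)) \<delta> = \<one>\<^bsub>Ext E (obj Y n) (obj Y 0)\<^esub>" .
  have "\<exists>v. mor E v \<and> src E v = src E u \<and> tgt E v = obj Y n \<and> u = dif Y n \<cdot> v"
    if u: "mor E u" "tgt E u = obj Y (Suc n)" "Act E u (Idn E (obj Y 0)) \<delta> = \<one>\<^bsub>Ext E (src E u) (obj Y 0)\<^esub>" for u
  proof -
    obtain v where v: "mor E v" "src E v = src E u" "tgt E v = obj X n" "u = dif X n \<cdot> v"
      using h u unfolding pull_exact_def ends by blast
    have "dif Y n \<cdot> (f n \<cdot> v) = u" unfolding v(4)
      by (rule comp_eq[OF dX]) (use v(1-3) ff(1-3)[of n] y(1-4)[of n] in auto)
    then have "u = dif Y n \<cdot> (f n \<cdot> v)" by (rule sym)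
    moreover have "mor E (f n \<cdot> v)" "src E (f n \<cdot> v) = src E u" "tgt E (f n \<cdot> v) = obj Y n"
      using v(1-3) ff(1-3)[of n] by simp_all
    ultimately show ?thesis by blast
  qed
  then show ?thesis using h1(1) 1 by (auto simp: pull_exact_def)
qed

lemma exangleI:
  assumes X: "exact_seq n E X" and n: "1 \<le> n" and h: "pull_exact n E X \<delta>" and h': "pull_exact n (op_exang n E) (rev_cplx (Suc n) X) \<delta>"
  shows "exangle n E X \<delta>"
proof -
  interpret op: additive_bifunctor "op_exang n E" by (rule additive_bifunctor_op)
  note sc = same_cat_cong[OF same_cat_op_exang[of n E]]
  have X': "complex E (Suc n) X" "left_exact E (Suc n) X" "right_exact E (Suc n) X" using X by (auto simp: exact_seq_def)
  have 1: "covariant_exact n E X \<delta>"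
    by (rule covariant_exactI[OF X'(1,2) n]) (use h in \<open>auto simp: pull_exact_def\<close>)
  have 2: "covariant_exact n (op_exang n E) (rev_cplx (Suc n) X) \<delta>"
    by (rule op.covariant_exactI[OF _ _ n])
      (use X' h' complex_op[OF additive_category_axioms X'(1)] in \<open>auto simp: pull_exact_def sc right_exact_def\<close>)
  show ?thesis using 1 2 X' h h' by (simp add: exangle_def attached_def pull_exact_def push_def pull_def)
qed

end

context idem_rep
begin

lemma U_mor [simp]:
  assumes "mor I f"
  shows "mor E (U f)" "src E (U f) = base (src I f)" "tgt E (U f) = base (tgt I f)"
    "e (tgt I f) \<cdot> U f = U f" "U f \<cdot> e (src I f) = U f"
  using U_facts[of "src I f" "tgt I f" f] assms by auto

lemma U_cmp [simp]:
  assumes "mor I g" "mor I f" "src I g = tgt I f" shows "U (g \<cdot>\<^bsub>I\<^esub> f) = U g \<cdot> U f"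
  using U_comp[of "src I f" "tgt I f" "tgt I g" f g] assms by simp

lemma U_zr [simp]: "P \<in> Ob I \<Longrightarrow> Q \<in> Ob I \<Longrightarrow> U (zr I P Q) = zr E (base P) (base Q)"
  using U_one by blast

lemma U_id [simp]: "P \<in> Ob I \<Longrightarrow> U (Idn I P) = e P"
  using U_idn by blast

lemma I_eqI:
  assumes "mor I f" "mor I g" "src I g = src I f" "tgt I g = tgt I f" "U f = U g" shows "f = g"
  using U_eqI[of "src I f" "tgt I f" f g] assms by simp

lemma mkE:
  assumes "P \<in> Ob I" "Q \<in> Ob I" "mor E r" "src E r = base P" "tgt E r = base Q" "e Q \<cdot> r = r" "r \<cdot> e P = r"
  obtains f where "mor I f" "src I f = P" "tgt I f = Q" "U f = r"
  using U_surj[OF assms(1,2), of r] assms by auto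

text \<open>
  \<open>S\<close> is the complex \<open>(X, \<eta>)\<close> for an idempotent endomorphism
  \<open>\<eta>\<close> of \<open>X\<close>.
\<close>

definition represented :: "('p, 'q) cplx \<Rightarrow> ('o, 'm) cplx \<Rightarrow> (nat \<Rightarrow> 'm) \<Rightarrow> bool" where
  "represented S X \<eta> \<longleftrightarrow> complex E (Suc n) X \<and> chain_map E (Suc n) X X \<eta> \<and>
     (\<forall>i\<le>Suc n. \<eta> i \<cdot> \<eta> i = \<eta> i \<and> obj S i \<in> Ob I \<and> base (obj S i) = obj X i \<and> e (obj S i) = \<eta> i) \<and>
     (\<forall>i\<le>n. mor I (dif S i) \<and> src I (dif S i) = obj S i \<and> tgt I (dif S i) = obj S (Suc i) \<and> U (dif S i) = dif X i \<cdot> \<eta> i)"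

lemma stdD:
  assumes "represented S X \<eta>"
  shows "complex E (Suc n) X" "chain_map E (Suc n) X X \<eta>"
    "i \<le> Suc n \<Longrightarrow> \<eta> i \<cdot> \<eta> i = \<eta> i" "i \<le> Suc n \<Longrightarrow> obj S i \<in> Ob I" "i \<le> Suc n \<Longrightarrow> base (obj S i) = obj X i"
    "i \<le> Suc n \<Longrightarrow> e (obj S i) = \<eta> i"
    "i \<le> n \<Longrightarrow> mor I (dif S i)" "i \<le> n \<Longrightarrow> src I (dif S i) = obj S i" "i \<le> n \<Longrightarrow> tgt I (dif S i) = obj S (Suc i)"
    "i \<le> n \<Longrightarrow> U (dif S i) = dif X i \<cdot> \<eta> i"
    "i \<le> Suc n \<Longrightarrow> mor E (\<eta> i)" "i \<le> Suc n \<Longrightarrow> src E (\<eta> i) = obj X i" "i \<le> Suc n \<Longrightarrow> tgt E (\<eta> i) = obj X i"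
    "i \<le> n \<Longrightarrow> \<eta> (Suc i) \<cdot> dif X i = dif X i \<cdot> \<eta> i"
    "i \<le> n \<Longrightarrow> mor E x \<Longrightarrow> tgt E x = obj X i \<Longrightarrow> \<eta> (Suc i) \<cdot> (dif X i \<cdot> x) = dif X i \<cdot> (\<eta> i \<cdot> x)"
    "i \<le> Suc n \<Longrightarrow> mor E x \<Longrightarrow> tgt E x = obj X i \<Longrightarrow> \<eta> i \<cdot> (\<eta> i \<cdot> x) = \<eta> i \<cdot> x"
proof -
  show a: "complex E (Suc n) X" "chain_map E (Suc n) X X \<eta>"
    "i \<le> Suc n \<Longrightarrow> \<eta> i \<cdot> \<eta> i = \<eta> i" "i \<le> Suc n \<Longrightarrow> obj S i \<in> Ob I" "i \<le> Suc n \<Longrightarrow> base (obj S i) = obj X i"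
    "i \<le> Suc n \<Longrightarrow> e (obj S i) = \<eta> i"
    "i \<le> n \<Longrightarrow> mor I (dif S i)" "i \<le> n \<Longrightarrow> src I (dif S i) = obj S i" "i \<le> n \<Longrightarrow> tgt I (dif S i) = obj S (Suc i)"
    "i \<le> n \<Longrightarrow> U (dif S i) = dif X i \<cdot> \<eta> i" for i
    using assms by (auto simp: represented_def)
  note c = chain_mapD[OF a(1,1,2,1,1) order_refl]
  show b: "i \<le> Suc n \<Longrightarrow> mor E (\<eta> i)" "i \<le> Suc n \<Longrightarrow> src E (\<eta> i) = obj X i" "i \<le> Suc n \<Longrightarrow> tgt E (\<eta> i) = obj X i"
    "i \<le> n \<Longrightarrow> \<eta> (Suc i) \<cdot> dif X i = dif X i \<cdot> \<eta> i" for i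
    using c by auto
  show "i \<le> n \<Longrightarrow> mor E x \<Longrightarrow> tgt E x = obj X i \<Longrightarrow> \<eta> (Suc i) \<cdot> (dif X i \<cdot> x) = dif X i \<cdot> (\<eta> i \<cdot> x)"
    using c(5)[of i x] by auto
  show "i \<le> Suc n \<Longrightarrow> mor E x \<Longrightarrow> tgt E x = obj X i \<Longrightarrow> \<eta> i \<cdot> (\<eta> i \<cdot> x) = \<eta> i \<cdot> x"
    using comp_eq[OF a(3)] b by auto
qed

lemma represented_exists:
  assumes X: "complex E (Suc n) X" and h: "chain_map E (Suc n) X X \<eta>" "\<forall>i\<le>Suc n. \<eta> i \<cdot> \<eta> i = \<eta> i"
  obtains S where "represented S X \<eta>"
proof -
  note x = complexD[OF X] and hh = chain_mapD[OF X X h(1) X X order_refl]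
  have "\<exists>P. i \<le> Suc n \<longrightarrow> P \<in> Ob I \<and> base P = obj X i \<and> e P = \<eta> i" for i
    using ob_surj[of "obj X i" "\<eta> i"] x(1)[of i] hh(1-3)[of i] h(2) by auto
  then obtain P where P: "\<And>i. i \<le> Suc n \<Longrightarrow> P i \<in> Ob I \<and> base (P i) = obj X i \<and> e (P i) = \<eta> i" by metis
  have "\<exists>f. i \<le> n \<longrightarrow> mor I f \<and> src I f = P i \<and> tgt I f = P (Suc i) \<and> U f = dif X i \<cdot> \<eta> i" for i
  proof (cases "i \<le> n")
    case True
    then have i: "i \<le> Suc n" "Suc i \<le> Suc n" "i < Suc n" by auto
    have "\<eta> (Suc i) \<cdot> (dif X i \<cdot> \<eta> i) = dif X i \<cdot> \<eta> i"
      using hh(5)[of i "\<eta> i"] hh(1-3)[of i] h(2) i by simp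
    moreover have "\<eta> i \<cdot> \<eta> i = \<eta> i" using h(2) i by simp
    moreover have "(dif X i \<cdot> \<eta> i) \<cdot> \<eta> i = dif X i \<cdot> \<eta> i"
      using calculation(2) x(1-4)[of i] hh(1-3)[of i] i by simp
    moreover have "mor E (dif X i \<cdot> \<eta> i)" "src E (dif X i \<cdot> \<eta> i) = obj X i" "tgt E (dif X i \<cdot> \<eta> i) = obj X (Suc i)"
      using x(1-4)[of i] hh(1-3)[of i] i by simp_all
    ultimately have "\<exists>f. mor I f \<and> src I f = P i \<and> tgt I f = P (Suc i) \<and> U f = dif X i \<cdot> \<eta> i"
      using mkE[of "P i" "P (Suc i)" "dif X i \<cdot> \<eta> i"] P[OF i(1)] P[OF i(2)] by metis
    then show ?thesis by blast
  qed auto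
  then obtain f where f: "\<And>i. i \<le> n \<Longrightarrow> mor I (f i) \<and> src I (f i) = P i \<and> tgt I (f i) = P (Suc i) \<and> U (f i) = dif X i \<cdot> \<eta> i" by metis
  have "represented (Cplx P f) X \<eta>" using X h P f by (simp add: represented_def)
  then show thesis using that by blast
qed

lemma rlz_represented:
  assumes "Z \<in> Ob I" "A \<in> Ob I" "\<delta> \<in> carrier (Ext I Z A)"
  obtains S X \<eta> where "realises n E (base A) (base Z) (V \<delta>) X" "represented S X \<eta>" "obj S 0 = A" "obj S (Suc n) = Z" "Rlz I Z A \<delta> = htpy_class n I S"
proof -
  obtain S X \<eta> where s: "realises n E (base A) (base Z) (V \<delta>) X" "chain_map E (Suc n) X X \<eta>"
    "\<forall>i\<le>Suc n. \<eta> i \<cdot> \<eta> i = \<eta> i \<and> obj S i \<in> Ob I \<and> base (obj S i) = obj X i \<and> e (obj S i) = \<eta> i"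
    "\<forall>i\<le>n. dif S i \<in> arr I (obj S i) (obj S (Suc i)) \<and> U (dif S i) = \<eta> (Suc i) \<cdot> (dif X i \<cdot> \<eta> i)"
    "obj S 0 = A" "obj S (Suc n) = Z" "Rlz I Z A \<delta> = htpy_class n I S"
    using rlz_rep[OF assms] by blast
  note r = rzD[OF s(1)] and x = complexD[OF rzD(6)[OF s(1)]]
  note hh = chain_mapD[OF r(6,6) s(2) r(6,6) order_refl]
  have "mor I (dif S i) \<and> src I (dif S i) = obj S i \<and> tgt I (dif S i) = obj S (Suc i) \<and> U (dif S i) = dif X i \<cdot> \<eta> i" if i: "i \<le> n" for i
  proof -
    have i': "i \<le> Suc n" "Suc i \<le> Suc n" using i by auto
    have "\<eta> (Suc i) \<cdot> (dif X i \<cdot> \<eta> i) = dif X i \<cdot> \<eta> i"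
      using hh(5)[of i "\<eta> i"] hh(1-3)[of i] s(3) i i' by simp
    then show ?thesis using s(4) i s(3) i' by auto
  qed
  then have "represented S X \<eta>" using s(2,3) r(6) by (auto simp: represented_def)
  then show thesis using that s by blast
qed

lemma represented_complex:
  assumes "represented S X \<eta>" shows "complex I (Suc n) S"
proof (rule I.complexI)
  note s = stdD[OF assms] and x = complexD[OF stdD(1)[OF assms]]
  show "obj S i \<in> Ob I" if "i \<le> Suc n" for i using s(4) that .
  show "mor I (dif S i) \<and> src I (dif S i) = obj S i \<and> tgt I (dif S i) = obj S (Suc i)" if "i < Suc n" for i
    using s(7-9)[of i] that by simp
  fix i assume i: "Suc i < Suc n"
  then have i': "i \<le> n" "Suc i \<le> n" "i < n" by auto
  have "U (dif S (Suc i) \<cdot>\<^bsub>I\<^esub> dif S i) = dif X (Suc i) \<cdot> (\<eta> (Suc i) \<cdot> (dif X i \<cdot> \<eta> i))"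
    using s(7-10)[of i] s(7-10)[of "Suc i"] i' x(1-4)[of i] x(1-4)[of "Suc i"] s(11-13)[of i] s(11-13)[of "Suc i"] by simp
  also have "\<dots> = dif X (Suc i) \<cdot> (dif X i \<cdot> \<eta> i)" using s(15)[of i "\<eta> i"] s(3)[of i] s(11-13)[of i] i' by simp
  also have "\<dots> = zr E (obj X i) (obj X (Suc (Suc i)))" using x(6)[of i "\<eta> i"] s(11-13)[of i] i' by simp
  finally show "dif S (Suc i) \<cdot>\<^bsub>I\<^esub> dif S i = zr I (obj S i) (obj S (Suc (Suc i)))"
    by (intro I_eqI) (use i' s(4)[of i] s(4)[of "Suc (Suc i)"] s(5)[of i] s(5)[of "Suc (Suc i)"] s(7-9)[of i] s(7-9)[of "Suc i"] in auto)
qed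

lemma U_e:
  assumes "mor I u" shows "tgt I u = P \<Longrightarrow> e P \<cdot> U u = U u" "src I u = P \<Longrightarrow> U u \<cdot> e P = U u"
  using U_mor[OF assms] by auto

text \<open>
  As a retract of \<open>X\<close>, the complex \<open>(X, \<eta>)\<close> inherits exactness: applying
  \<open>\<eta>\<close> to a preimage in \<open>X\<close> gives one in \<open>S\<close>.
\<close>

lemma represented_left_exact:
  assumes S: "represented S X \<eta>" and L: "left_exact E (Suc n) X"
  shows "left_exact I (Suc n) S"
  unfolding I.left_exact_iff[OF represented_complex[OF S], simplified]
proof (intro conjI allI impI)
  note s = stdD[OF S] and x = complexD[OF stdD(1)[OF S]]
  have du: "dif X i \<cdot> U u = zr E (base (src I u)) (obj X (Suc i))"
    if i: "i \<le> n" and u: "mor I u" "tgt I u = obj S i" "dif S i \<cdot>\<^bsub>I\<^esub> u = zr I (src I u) (obj S (Suc i))" for i u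
  proof -
    have i': "i \<le> Suc n" "Suc i \<le> Suc n" using i by auto
    have "dif X i \<cdot> U u = dif X i \<cdot> (\<eta> i \<cdot> U u)" using U_e(1)[OF u(1,2)] s(6)[OF i'(1)] by simp
    also have "\<dots> = U (dif S i \<cdot>\<^bsub>I\<^esub> u)"
      using u(1,2) s(7-10)[OF i] x(1-4)[of i] i s(11-13)[OF i'(1)] s(5)[OF i'(1)] by simp
    also have "\<dots> = zr E (base (src I u)) (obj X (Suc i))" unfolding u(3) using u(1) s(4,5)[OF i'(2)] by simp
    finally show ?thesis .
  qed
  fix u assume u: "mor I u" "tgt I u = obj S 0" "dif S 0 \<cdot>\<^bsub>I\<^esub> u = zr I (src I u) (obj S (Suc 0))"
  have "U u = zr E (src E (U u)) (obj X 0)"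
    by (rule left_exactD(1)[OF L s(1)]) (use du[OF _ u] u s(5)[of 0] in auto)
  then show "u = zr I (src I u) (obj S 0)"
    by (intro I_eqI) (use u s(4)[of 0] s(5)[of 0] in auto)
next
  note s = stdD[OF S] and x = complexD[OF stdD(1)[OF S]]
  fix i u assume i: "i < n" and u: "mor I u" "tgt I u = obj S (Suc i)" "dif S (Suc i) \<cdot>\<^bsub>I\<^esub> u = zr I (src I u) (obj S (Suc (Suc i)))"
  have i': "Suc i \<le> n" "Suc i \<le> Suc n" "Suc (Suc i) \<le> Suc n" "i \<le> Suc n" "i \<le> n" using i by auto
  have "dif X (Suc i) \<cdot> U u = dif X (Suc i) \<cdot> (\<eta> (Suc i) \<cdot> U u)" using U_e(1)[OF u(1,2)] s(6)[OF i'(2)] by simp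
  also have "\<dots> = U (dif S (Suc i) \<cdot>\<^bsub>I\<^esub> u)"
    using u(1,2) s(7-10)[OF i'(1)] x(1-4)[of "Suc i"] i s(11-13)[OF i'(2)] s(5)[OF i'(2)] by simp
  also have "\<dots> = zr E (base (src I u)) (obj X (Suc (Suc i)))" unfolding u(3) using u(1) s(4,5)[OF i'(3)] by simp
  finally have "dif X (Suc i) \<cdot> U u = zr E (src E (U u)) (obj X (Suc (Suc i)))" using u(1) by simp
  then obtain v where v: "mor E v" "src E v = base (src I u)" "tgt E v = obj X i" "U u = dif X i \<cdot> v"
    using left_exactD(2)[OF L s(1), of i "U u"] u i s(5)[OF i'(2)] by auto
  have sP: "src I u \<in> Ob I" using u(1) by simp
  have eS: "e (obj S i) = \<eta> i" "base (obj S i) = obj X i" "obj S i \<in> Ob I" using s(4-6)[OF i'(4)] by auto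
  obtain w where w: "mor I w" "src I w = src I u" "tgt I w = obj S i" "U w = \<eta> i \<cdot> (v \<cdot> e (src I u))"
    by (rule mkE[of "src I u" "obj S i" "\<eta> i \<cdot> (v \<cdot> e (src I u))"])
      (use sP eS v(1-3) s(11-13)[OF i'(4)] s(16)[OF i'(4)] in auto)
  have "U (dif S i \<cdot>\<^bsub>I\<^esub> w) = dif X i \<cdot> (\<eta> i \<cdot> (\<eta> i \<cdot> (v \<cdot> e (src I u))))"
    using w s(7-10)[OF i'(5)] x(1-4)[of i] i sP v(1-3) s(11-13)[OF i'(4)] by simp
  also have "\<dots> = dif X i \<cdot> (\<eta> i \<cdot> (v \<cdot> e (src I u)))" using s(16)[OF i'(4)] v(1-3) sP by simp
  also have "\<dots> = \<eta> (Suc i) \<cdot> (dif X i \<cdot> (v \<cdot> e (src I u)))" using s(15)[OF i'(5)] v(1-3) sP by simp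
  also have "\<dots> = \<eta> (Suc i) \<cdot> (U u \<cdot> e (src I u))" unfolding v(4) using v(1-3) x(1-4)[of i] i sP by simp
  also have "\<dots> = U u" using U_e[OF u(1)] s(6)[OF i'(2)] u(2) by simp
  finally have "u = dif S i \<cdot>\<^bsub>I\<^esub> w"
    by (intro I_eqI) (use u w s(7-9)[OF i'(5)] in auto)
  then show "\<exists>v. mor I v \<and> src I v = src I u \<and> tgt I v = obj S i \<and> u = dif S i \<cdot>\<^bsub>I\<^esub> v"
    using w(1-3) by blast
qed

lemma represented_pull_exact:
  assumes S: "represented S X \<eta>" and X: "realises n E (base A) (base Z) (V \<delta>) X" and d: "Z \<in> Ob I" "A \<in> Ob I" "\<delta> \<in> carrier (Ext I Z A)"
    and SA: "obj S 0 = A" "obj S (Suc n) = Z"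
  shows "pull_exact n I S \<delta>"
proof -
  note s = stdD[OF S] and x = complexD[OF stdD(1)[OF S]] and r = rzD[OF X]
  note v = V_in[OF d]
  have act: "V (Act I u (Idn I A) \<delta>) = Act E (U u) (Idn E (base A)) (V \<delta>)" and acti: "Act I u (Idn I A) \<delta> \<in> carrier (Ext I (src I u) A)"
    if u: "mor I u" "tgt I u = Z" for u
  proof -
    have a: "V (Act I u (Idn I A) \<delta>) = Act E (U u) (e A) (V \<delta>)" "Act I u (Idn I A) \<delta> \<in> carrier (Ext I (src I u) A)"
      using V_act[of Z "src I u" A A u "Idn I A" \<delta>] u d by auto
    have "Act E (U u) (Idn E (base A)) (Act E (Idn E (base Z)) (e A) (V \<delta>)) = Act E (U u) (e A) (V \<delta>)"
      using act_act[of "Idn E (base Z)" "e A" "U u" "Idn E (base A)" "V \<delta>"] u v d by simp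
    then show "V (Act I u (Idn I A) \<delta>) = Act E (U u) (Idn E (base A)) (V \<delta>)" "Act I u (Idn I A) \<delta> \<in> carrier (Ext I (src I u) A)"
      using a v by auto
  qed
  note dn = s(7-10)[of n, simplified]
  have 1: "Act I (dif S n) (Idn I A) \<delta> = \<one>\<^bsub>Ext I (obj S n) A\<^esub>"
  proof (rule V_eqI[of "obj S n" A])
    have "Act E (dif X n \<cdot> \<eta> n) (Idn E (base A)) (V \<delta>) = Act E (\<eta> n) (Idn E (base A)) (Act E (dif X n) (Idn E (base A)) (V \<delta>))"
      using v d x(1-4)[of n] s(11-13)[of n] r(5) by simp
    also have "\<dots> = \<one>\<^bsub>Ext E (obj X n) (base A)\<^esub>" unfolding r(10) using s(11-13)[of n] d by simp
    finally show "V (Act I (dif S n) (Idn I A) \<delta>) = V \<one>\<^bsub>Ext I (obj S n) A\<^esub>"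
      using act[of "dif S n"] dn SA V_one[of "obj S n" A] s(4,5)[of n] d by simp
    show "Act I (dif S n) (Idn I A) \<delta> \<in> carrier (Ext I (obj S n) A)" using acti[of "dif S n"] dn SA by simp
  qed (use s(4)[of n] d V_one[of "obj S n" A] in auto)
  have 2: "\<exists>w. mor I w \<and> src I w = src I u \<and> tgt I w = obj S n \<and> u = dif S n \<cdot>\<^bsub>I\<^esub> w"
    if u: "mor I u" "tgt I u = Z" "Act I u (Idn I A) \<delta> = \<one>\<^bsub>Ext I (src I u) A\<^esub>" for u
  proof -
    have sP: "src I u \<in> Ob I" using u(1) by simp
    have "Act E (U u) (Idn E (base A)) (V \<delta>) = \<one>\<^bsub>Ext E (src E (U u)) (base A)\<^esub>"
      using act[OF u(1,2)] V_one[OF sP d(2)] u(1,3) by simp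
    then obtain y where y: "mor E y" "src E y = base (src I u)" "tgt E y = obj X n" "U u = dif X n \<cdot> y"
      using realises_pull[OF X, of "U u"] u(1,2) by auto
    have eS: "e (obj S n) = \<eta> n" "base (obj S n) = obj X n" "obj S n \<in> Ob I" using s(4-6)[of n] by auto
    obtain w where w: "mor I w" "src I w = src I u" "tgt I w = obj S n" "U w = \<eta> n \<cdot> (y \<cdot> e (src I u))"
      by (rule mkE[of "src I u" "obj S n" "\<eta> n \<cdot> (y \<cdot> e (src I u))"])
        (use sP eS y(1-3) s(11-13)[of n] s(16)[of n] in auto)
    have "U (dif S n \<cdot>\<^bsub>I\<^esub> w) = dif X n \<cdot> (\<eta> n \<cdot> (\<eta> n \<cdot> (y \<cdot> e (src I u))))"
      using w dn x(1-4)[of n] sP y(1-3) s(11-13)[of n] by simp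
    also have "\<dots> = dif X n \<cdot> (\<eta> n \<cdot> (y \<cdot> e (src I u)))" using s(16)[of n] y(1-3) sP by simp
    also have "\<dots> = \<eta> (Suc n) \<cdot> (dif X n \<cdot> (y \<cdot> e (src I u)))" using s(15)[of n] y(1-3) sP by simp
    also have "\<dots> = \<eta> (Suc n) \<cdot> (U u \<cdot> e (src I u))" unfolding y(4) using y(1-3) x(1-4)[of n] sP by simp
    also have "\<dots> = U u" using U_e[OF u(1)] s(6)[of "Suc n"] u(2) SA by simp
    finally have "u = dif S n \<cdot>\<^bsub>I\<^esub> w"
      by (intro I_eqI) (use u w dn SA in auto)
    then show ?thesis using w(1-3) by blast
  qed
  show ?thesis using 1 2 d SA by (auto simp: pull_exact_def)
qed

lemma represented_map:
  assumes S: "represented S X \<eta>" and T: "represented T Y \<theta>" and f: "chain_map E (Suc n) X Y f"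
  obtains F where "chain_map I (Suc n) S T F" "\<And>i. i \<le> Suc n \<Longrightarrow> U (F i) = \<theta> i \<cdot> (f i \<cdot> \<eta> i)"
proof -
  note s = stdD[OF S] and t = stdD[OF T]
  note ff = chain_mapD[OF s(1) t(1) f s(1) t(1) order_refl]
  note x = complexD[OF s(1)] and y = complexD[OF t(1)]
  have "\<exists>g. i \<le> Suc n \<longrightarrow> mor I g \<and> src I g = obj S i \<and> tgt I g = obj T i \<and> U g = \<theta> i \<cdot> (f i \<cdot> \<eta> i)" for i
  proof (cases "i \<le> Suc n")
    case True
    have "mor E (\<theta> i \<cdot> (f i \<cdot> \<eta> i))" "src E (\<theta> i \<cdot> (f i \<cdot> \<eta> i)) = base (obj S i)" "tgt E (\<theta> i \<cdot> (f i \<cdot> \<eta> i)) = base (obj T i)"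
      "e (obj T i) \<cdot> (\<theta> i \<cdot> (f i \<cdot> \<eta> i)) = \<theta> i \<cdot> (f i \<cdot> \<eta> i)" "(\<theta> i \<cdot> (f i \<cdot> \<eta> i)) \<cdot> e (obj S i) = \<theta> i \<cdot> (f i \<cdot> \<eta> i)"
      using True s(3-6)[OF True] t(3-6)[OF True] s(11-13)[OF True] t(11-13)[OF True] t(16)[OF True] ff(1-3)[OF True] by simp_all
    then show ?thesis using mkE[OF s(4)[OF True] t(4)[OF True]] by metis
  qed auto
  then obtain F where F: "\<And>i. i \<le> Suc n \<Longrightarrow> mor I (F i) \<and> src I (F i) = obj S i \<and> tgt I (F i) = obj T i \<and> U (F i) = \<theta> i \<cdot> (f i \<cdot> \<eta> i)" by metis
  have "chain_map I (Suc n) S T F"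
  proof (rule I.chain_mapI[OF represented_complex[OF S] represented_complex[OF T]])
    fix i assume "i < Suc n"
    then have i: "i \<le> n" "i \<le> Suc n" "Suc i \<le> Suc n" "i < Suc n" by auto
    note F1 = F[OF i(2)] and F2 = F[OF i(3)]
    note m = s(11-13)[OF i(2)] s(11-13)[OF i(3)] t(11-13)[OF i(2)] t(11-13)[OF i(3)] ff(1-3)[of i] ff(1-3)[of "Suc i"] x(1-4)[of i] y(1-4)[of i]
    have "U (F (Suc i) \<cdot>\<^bsub>I\<^esub> dif S i) = \<theta> (Suc i) \<cdot> (f (Suc i) \<cdot> (\<eta> (Suc i) \<cdot> (dif X i \<cdot> \<eta> i)))"
      using F2 s(7-10)[OF i(1)] m i by simp
    also have "\<dots> = \<theta> (Suc i) \<cdot> (dif Y i \<cdot> (f i \<cdot> \<eta> i))"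
      using s(15)[OF i(1), of "\<eta> i"] s(3)[OF i(2)] ff(5)[of i "\<eta> i"] m i by simp
    also have "\<dots> = dif Y i \<cdot> (\<theta> i \<cdot> (\<theta> i \<cdot> (f i \<cdot> \<eta> i)))"
      using t(15)[OF i(1), of "f i \<cdot> \<eta> i"] t(16)[OF i(2), of "f i \<cdot> \<eta> i"] m i by simp
    also have "\<dots> = U (dif T i \<cdot>\<^bsub>I\<^esub> F i)"
      using F1 t(7-10)[OF i(1)] m i by simp
    finally show "F (Suc i) \<cdot>\<^bsub>I\<^esub> dif S i = dif T i \<cdot>\<^bsub>I\<^esub> F i"
      by (intro I_eqI) (use F1 F2 s(7-9)[OF i(1)] t(7-9)[OF i(1)] in auto)
  qed (use F in auto)
  then show thesis using that F by blast
qed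

end

context idem_rep
begin

lemma op_rep: "idem_rep n (op_exang n E) (op_exang n I) base e U V"
proof -
  note sc = same_cat_cong[OF same_cat_op_exang[of n E]]
  interpret op: exact_exang n "op_exang n E" by (rule exact_exang_op)
  note [simp del] = arr_iff I.arr_iff op.arr_iff
  show ?thesis
  proof (intro idem_rep.intro idem_rep_axioms.intro op.exact_exang_axioms)
    fix Z A \<delta> assume "Z \<in> Ob (op_exang n I)" "A \<in> Ob (op_exang n I)" "\<delta> \<in> carrier (Ext (op_exang n I) Z A)"
    then have d: "Z \<in> Ob I" "A \<in> Ob I" "\<delta> \<in> carrier (Ext I A Z)" by auto
    obtain S X \<eta> where s: "realises n E (base Z) (base A) (V \<delta>) X" "represented S X \<eta>" "obj S 0 = Z" "obj S (Suc n) = A" "Rlz I A Z \<delta> = htpy_class n I S"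
      by (rule rlz_represented[OF d(2,1,3)])
    note t = stdD[OF s(2)] and x = complexD[OF stdD(1)[OF s(2)]]
    have c: "complex I (Suc n) S" by (rule represented_complex[OF s(2)])
    have 1: "Rlz (op_exang n I) Z A \<delta> = htpy_class n (op_exang n I) (rev_cplx (Suc n) S)"
      using s(5) htpy_class_op[OF I.additive_category_axioms c] by (simp add: same_cat_cong4(1)[OF same_cat_op_exang])
    have 2: "chain_map (op_exang n E) (Suc n) (rev_cplx (Suc n) X) (rev_cplx (Suc n) X) (\<lambda>i. \<eta> (Suc n - i))"
      using chain_map_op[OF additive_category_axioms t(1,1,2)] by (simp add: sc)
    have 3: "dif S (n - i) \<in> arr I (obj S (n - i)) (obj S (Suc n - i)) \<and> U (dif S (n - i)) = \<eta> (Suc n - i) \<cdot> (dif X (n - i) \<cdot> \<eta> (n - i))"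
      if i: "i \<le> n" for i
    proof -
      define j where "j = n - i"
      have j: "Suc n - i = Suc j" "n - i = j" "j \<le> n" "j \<le> Suc n" using i by (auto simp: j_def)
      have "\<eta> (Suc j) \<cdot> (dif X j \<cdot> \<eta> j) = dif X j \<cdot> \<eta> j"
        using t(15)[OF j(3), of "\<eta> j"] t(3)[OF j(4)] t(11-13)[OF j(4)] by simp
      then show ?thesis using t(7-10)[OF j(3)] by (auto simp: j(1,2) intro!: I.arrI)
    qed
    have 4: "\<eta> (Suc n - i) \<cdot> (dif X (n - i) \<cdot> \<eta> (n - i)) = (\<eta> (Suc n - i) \<cdot> dif X (n - i)) \<cdot> \<eta> (n - i)" if i: "i \<le> n" for i
    proof -
      define j where "j = n - i"
      have j: "Suc n - i = Suc j" "n - i = j" "j \<le> n" "j \<le> Suc n" "Suc j \<le> Suc n" using i by (auto simp: j_def)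
      show ?thesis unfolding j(1,2) using t(11-13)[OF j(4)] t(11-13)[OF j(5)] x(2-4)[of j] j(3) by simp
    qed
    show "\<exists>S X \<eta>. realises n (op_exang n E) (base A) (base Z) (V \<delta>) X \<and>
        chain_map (op_exang n E) (Suc n) X X \<eta> \<and> (\<forall>i\<le>Suc n. \<eta> i \<cdot>\<^bsub>op_exang n E\<^esub> \<eta> i = \<eta> i \<and> obj S i \<in> Ob (op_exang n I) \<and> base (obj S i) = obj X i \<and> e (obj S i) = \<eta> i) \<and>
        (\<forall>i\<le>n. dif S i \<in> arr (op_exang n I) (obj S i) (obj S (Suc i)) \<and> U (dif S i) = \<eta> (Suc i) \<cdot>\<^bsub>op_exang n E\<^esub> (dif X i \<cdot>\<^bsub>op_exang n E\<^esub> \<eta> i)) \<and>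
        obj S 0 = A \<and> obj S (Suc n) = Z \<and> Rlz (op_exang n I) Z A \<delta> = htpy_class n (op_exang n I) S"
      using 1 2 3 4 s t(3-6) realises_op'[of "base A" "base Z" "V \<delta>" X]
      by (intro exI[of _ "rev_cplx (Suc n) S"] exI[of _ "rev_cplx (Suc n) X"] exI[of _ "\<lambda>i. \<eta> (Suc n - i)"]) auto
  next
    show "inj_on U (arr (op_exang n I) P Q)" if "P \<in> Ob (op_exang n I)" "Q \<in> Ob (op_exang n I)" for P Q using U_inj[of Q P] that by simp
    show "inj_on V (carrier (Ext (op_exang n I) P Q))" if "P \<in> Ob (op_exang n I)" "Q \<in> Ob (op_exang n I)" for P Q using V_inj[of Q P] that by simp
    show "P = P' \<and> Q = Q'" if "P \<in> Ob (op_exang n I)" "Q \<in> Ob (op_exang n I)" "P' \<in> Ob (op_exang n I)" "Q' \<in> Ob (op_exang n I)"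
      "f \<in> arr (op_exang n I) P Q" "f \<in> arr (op_exang n I) P' Q'" for P Q P' Q' f
      using hom_disj[of Q P Q' P' f] that by simp
    show "\<exists>P\<in>Ob (op_exang n I). base P = X \<and> e P = r" if "X \<in> Ob (op_exang n E)" "r \<in> arr (op_exang n E) X X" "r \<cdot>\<^bsub>op_exang n E\<^esub> r = r" for X r
      using ob_surj[of X r] that by simp
    show "P = Q" if "P \<in> Ob (op_exang n I)" "Q \<in> Ob (op_exang n I)" "base P = base Q" "e P = e Q" for P Q
      using ob_inj that by simp
    show "\<exists>f\<in>arr (op_exang n I) P Q. U f = r" if "P \<in> Ob (op_exang n I)" "Q \<in> Ob (op_exang n I)"
      "r \<in> arr (op_exang n E) (base P) (base Q)" "e Q \<cdot>\<^bsub>op_exang n E\<^esub> r = r" "r \<cdot>\<^bsub>op_exang n E\<^esub> e P = r" for P Q r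
      using U_surj[of Q P r] that by simp
    show "\<exists>\<delta>\<in>carrier (Ext (op_exang n I) Z A). V \<delta> = x" if "Z \<in> Ob (op_exang n I)" "A \<in> Ob (op_exang n I)"
      "x \<in> carrier (Ext (op_exang n E) (base Z) (base A))"
      "Act (op_exang n E) (Idn (op_exang n E) (base Z)) (e A) x = x" "Act (op_exang n E) (e Z) (Idn (op_exang n E) (base A)) x = x" for Z A x
      using V_surj[of A Z x] that by simp
  qed (use ob U_in U_mult U_one U_idn U_comp V_in V_mult V_one V_act in simp_all)
qed

lemma represented_op:
  assumes "represented S X \<eta>" shows "idem_rep.represented n (op_exang n E) (op_exang n I) base e U (rev_cplx (Suc n) S) (rev_cplx (Suc n) X) (\<lambda>i. \<eta> (Suc n - i))"
proof -
  interpret op: idem_rep n "op_exang n E" "op_exang n I" base e U V by (rule op_rep)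
  note sc = same_cat_cong[OF same_cat_op_exang[of n E]] same_cat_cong[OF same_cat_op_exang[of n I]]
  note t = stdD[OF assms]
  have 3: "mor I (dif S (n - i)) \<and> src I (dif S (n - i)) = obj S (n - i) \<and> tgt I (dif S (n - i)) = obj S (Suc n - i) \<and> U (dif S (n - i)) = \<eta> (Suc n - i) \<cdot> dif X (n - i)"
    if i: "i \<le> n" for i
  proof -
    have j: "Suc n - i = Suc (n - i)" "n - i \<le> n" using i by auto
    show ?thesis unfolding j(1) using t(7-10)[OF j(2)] t(14)[OF j(2)] by simp
  qed
  show ?thesis unfolding op.represented_def
    using complex_op[OF additive_category_axioms t(1)] chain_map_op[OF additive_category_axioms t(1,1,2)] t(3-6) 3
    by (simp add: sc)
qed

lemma represented_exact_seq:
  assumes S: "represented S X \<eta>" and X: "exact_seq n E X" shows "exact_seq n I S"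
proof -
  interpret op: idem_rep n "op_exang n E" "op_exang n I" base e U V by (rule op_rep)
  note sc = same_cat_cong[OF same_cat_op_exang[of n E]] same_cat_cong[OF same_cat_op_exang[of n I]]
  have "left_exact (op_exang n I) (Suc n) (rev_cplx (Suc n) S)"
    by (rule op.represented_left_exact[OF represented_op[OF S]]) (use X in \<open>simp add: exact_seq_def right_exact_def sc\<close>)
  then show ?thesis
    using represented_complex[OF S] represented_left_exact[OF S] X by (simp add: exact_seq_def right_exact_def sc)
qed

lemma pull_exact_op:
  assumes S: "represented S X \<eta>" and X: "realises n E (base A) (base Z) (V \<delta>) X" and d: "Z \<in> Ob I" "A \<in> Ob I" "\<delta> \<in> carrier (Ext I Z A)"
    and SA: "obj S 0 = A" "obj S (Suc n) = Z"
  shows "pull_exact n (op_exang n I) (rev_cplx (Suc n) S) \<delta>"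
proof -
  interpret op: idem_rep n "op_exang n E" "op_exang n I" base e U V by (rule op_rep)
  show ?thesis
    by (rule op.represented_pull_exact[OF represented_op[OF S], of Z A]) (use X d SA in \<open>simp_all add: realises_op'\<close>)
qed

lemma realised_rep:
  assumes d: "Z \<in> Ob I" "A \<in> Ob I" "\<delta> \<in> carrier (Ext I Z A)" and X': "realised_by n I A Z \<delta> X'"
  obtains S X \<eta> f g where "realises n E (base A) (base Z) (V \<delta>) X" "represented S X \<eta>" "obj S 0 = A" "obj S (Suc n) = Z"
    "exact_seq n I X'" "end_fixing n I X' S f" "end_fixing n I S X' g" "exangle n I X' \<delta>"
proof -
  obtain S X \<eta> where s: "realises n E (base A) (base Z) (V \<delta>) X" "represented S X \<eta>" "obj S 0 = A" "obj S (Suc n) = Z" "Rlz I Z A \<delta> = htpy_class n I S"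
    by (rule rlz_represented[OF d])
  interpret Iop: additive_bifunctor "op_exang n I" by (rule I.additive_bifunctor_op)
  note sc = same_cat_cong3(1)[OF same_cat_op_exang[of n I]] same_cat_cong[OF same_cat_op_exang[of n I]]
  have nS: "exact_seq n I S" by (rule represented_exact_seq[OF s(2) realises_exact[OF s(1)]])
  have cX: "X' \<in> cplx_between n I A Z" "htpy_class n I S = htpy_class n I X'" using X' s(5) by (auto simp: realised_by_def)
  then have "S \<in> htpy_class n I X'" using I.htpy_class_self[OF nS] by simp
  then have eq: "htpy_equiv n I S X'" using htpy_equiv_sym by (auto simp: htpy_class_def)
  have c: "complex I (Suc n) S" "complex I (Suc n) X'" using nS cX by (auto simp: exact_seq_def cplx_between_def)
  have nX: "exact_seq n I X'" by (rule I.exact_seq_htpy[OF nS c(2) eq])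
  have "pull_exact n I X' \<delta>" by (rule I.pull_exact_htpy[OF c eq represented_pull_exact[OF s(2,1) d s(3,4)]])
  moreover have "pull_exact n (op_exang n I) (rev_cplx (Suc n) X') \<delta>"
    by (rule Iop.pull_exact_htpy[OF _ _ _ pull_exact_op[OF s(2,1) d s(3,4)]])
      (use complex_op[OF I.additive_category_axioms c(1)] complex_op[OF I.additive_category_axioms c(2)]
         htpy_equiv_op[OF I.additive_category_axioms c eq] in \<open>simp_all add: sc\<close>)
  ultimately have "exangle n I X' \<delta>" by (rule I.exangleI[OF nX n1])
  moreover obtain g f where "end_fixing n I S X' g" "end_fixing n I X' S f" using eq by (auto simp: htpy_equiv_def)
  ultimately show thesis using that s nX by blast
qed

lemma completion_realisation: "exact_realisation n I"
proof
  fix A Z \<delta> assume d: "A \<in> Ob I" "Z \<in> Ob I" "\<delta> \<in> carrier (Ext I Z A)"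
  obtain S X \<eta> where s: "represented S X \<eta>" "obj S 0 = A" "obj S (Suc n) = Z" "Rlz I Z A \<delta> = htpy_class n I S"
    by (rule rlz_represented[OF d(2,1,3)])
  then show "\<exists>X. realised_by n I A Z \<delta> X" using represented_complex[OF s(1)] by (auto simp: realised_by_def cplx_between_def)
next
  fix A Z B D \<delta> \<rho> a c X' Y'
  assume d: "A \<in> Ob I" "Z \<in> Ob I" "B \<in> Ob I" "D \<in> Ob I" "\<delta> \<in> carrier (Ext I Z A)" "\<rho> \<in> carrier (Ext I D B)"
    "a \<in> arr I A B" "c \<in> arr I Z D" "push I Z a \<delta> = pull I B c \<rho>" "realised_by n I A Z \<delta> X'" "realised_by n I B D \<rho> Y'"
  obtain S X \<eta> f1 g1 where s: "realises n E (base A) (base Z) (V \<delta>) X" "represented S X \<eta>" "obj S 0 = A" "obj S (Suc n) = Z"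
    "exact_seq n I X'" "end_fixing n I X' S f1" "end_fixing n I S X' g1" by (rule realised_rep[OF d(2,1,5,10)])
  obtain T Y \<theta> f2 g2 where t: "realises n E (base B) (base D) (V \<rho>) Y" "represented T Y \<theta>" "obj T 0 = B" "obj T (Suc n) = D"
    "exact_seq n I Y'" "end_fixing n I Y' T f2" "end_fixing n I T Y' g2" by (rule realised_rep[OF d(4,3,6,11)])
  note ua = U_facts[OF d(1,3,7)] and uc = U_facts[OF d(2,4,8)]
  have i: "Idn I Z \<in> arr I Z Z" "Idn I B \<in> arr I B B" using U_idn d by blast+
  have "V (push I Z a \<delta>) = Act E (e Z) (U a) (V \<delta>)" "V (pull I B c \<rho>) = Act E (U c) (e B) (V \<rho>)"
    using V_act[OF d(2,2,1,3) i(1) d(7,5)] V_act[OF d(4,2,3,3,8) i(2) d(6)] d by (simp_all add: push_def pull_def)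
  moreover have "Act E (e Z) (U a) (V \<delta>) = Act E (Idn E (base Z)) (U a) (V \<delta>)"
    using act_act[of "e Z" "Idn E (base A)" "Idn E (base Z)" "U a" "V \<delta>"] V_in[OF d(2,1,5)] ua d by simp
  moreover have "Act E (U c) (e B) (V \<rho>) = Act E (U c) (Idn E (base B)) (V \<rho>)"
    using act_act[of "Idn E (base D)" "e B" "U c" "Idn E (base B)" "V \<rho>"] V_in[OF d(4,3,6)] uc d by simp
  ultimately have eq: "Act E (Idn E (base Z)) (U a) (V \<delta>) = Act E (U c) (Idn E (base B)) (V \<rho>)" using d(9) by simp
  obtain f where f: "chain_map E (Suc n) X Y f" "f 0 = U a" "f (Suc n) = U c"
    by (rule realises_lift[OF s(1) t(1), of "U a" "U c"]) (use ua uc eq in auto)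
  obtain F where F: "chain_map I (Suc n) S T F" "\<And>i. i \<le> Suc n \<Longrightarrow> U (F i) = \<theta> i \<cdot> (f i \<cdot> \<eta> i)"
    using represented_map[OF s(2) t(2) f(1)] by blast
  have cS: "complex I (Suc n) S" "complex I (Suc n) T" "complex I (Suc n) X'" "complex I (Suc n) Y'"
    using represented_complex s(2,5) t(2,5) by (auto simp: exact_seq_def)
  note FF = I.chain_mapD[OF cS(1,2) F(1) cS(1,2) order_refl]
  note s' = stdD[OF s(2)] and t' = stdD[OF t(2)]
  have F0: "F 0 = a"
    by (rule U_eqI[OF d(1,3) _ d(7)]) (use FF[of 0] F(2)[of 0] f(2) s'(6)[of 0] t'(6)[of 0] s(3) t(3) ua d in auto)
  have Fn: "F (Suc n) = c"
    by (rule U_eqI[OF d(2,4) _ d(8)]) (use FF[of "Suc n"] F(2)[of "Suc n"] f(3) s'(6)[of "Suc n"] t'(6)[of "Suc n"] s(4) t(4) uc d in auto)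
  have ch: "chain_map I (Suc n) X' S f1" "chain_map I (Suc n) T Y' g2" using s(6) t(7) by (auto simp: end_fixing_def)
  have ends: "obj X' 0 = A" "obj X' (Suc n) = Z" using d(10) by (auto simp: realised_by_def cplx_between_def)
  have ac: "mor I a" "src I a = A" "tgt I a = B" "mor I c" "src I c = Z" "tgt I c = D" using d by auto
  have "chain_map I (Suc n) X' Y' (\<lambda>i. g2 i \<cdot>\<^bsub>I\<^esub> (F i \<cdot>\<^bsub>I\<^esub> f1 i))"
    by (rule I.chain_map_comp[OF I.chain_map_comp[OF ch(1) F(1) cS(3,1,2)] ch(2) cS(3,2,4)])
  moreover have "g2 0 \<cdot>\<^bsub>I\<^esub> (F 0 \<cdot>\<^bsub>I\<^esub> f1 0) = a" "g2 (Suc n) \<cdot>\<^bsub>I\<^esub> (F (Suc n) \<cdot>\<^bsub>I\<^esub> f1 (Suc n)) = c"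
    using s(6) t(7) ac ends t(3,4) by (simp_all add: end_fixing_def F0 Fn)
  ultimately show "\<exists>f. chain_map I (n + 1) X' Y' f \<and> f 0 = a \<and> f (n + 1) = c"
    by (intro exI[of _ "\<lambda>i. g2 i \<cdot>\<^bsub>I\<^esub> (F i \<cdot>\<^bsub>I\<^esub> f1 i)"]) simp
next
  fix A Z \<delta> X' assume "A \<in> Ob I" "Z \<in> Ob I" "\<delta> \<in> carrier (Ext I Z A)" "realised_by n I A Z \<delta> X'"
  then show "exangle n I X' \<delta>" using realised_rep by metis
next
  fix A N assume A: "A \<in> Ob I" and N: "zero_object I N"
  note z = I.zero_ob_eq[OF N]
  let ?R = "Cplx (\<lambda>i. if i \<le> 1 then A else N) (\<lambda>i. if i = 0 then Idn I A else if i = 1 then zr I A N else zr I N N)"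
  let ?T = "I.trivial_cplx 0 N A"
  have ag: "agree (Suc n) ?T ?R" by (auto simp: agree_def I.trivial_cplx_def)
  obtain S X \<eta> where s: "realises n E (base A) (base N) (V \<one>\<^bsub>Ext I N A\<^esub>) X" "represented S X \<eta>" "obj S 0 = A" "obj S (Suc n) = N" "Rlz I N A \<one>\<^bsub>Ext I N A\<^esub> = htpy_class n I S"
    by (rule rlz_represented[OF z(1) A I.ext_one[OF z(1) A]])
  have nS: "exact_seq n I S" by (rule represented_exact_seq[OF s(2) realises_exact[OF s(1)]])
  have nT: "exact_seq n I ?T" by (rule I.trivial_exact_seq[OF N A]) simp
  have cS: "complex I (Suc n) S" using nS by (simp add: exact_seq_def)
  note h = pull_exact_op[OF s(2,1) z(1) A I.ext_one[OF z(1) A] s(3,4), unfolded pull_exact_def, THEN conjunct2, THEN conjunct2, rule_format, of "Idn I A"]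
  obtain v where v: "mor I v" "src I v = obj S 1" "tgt I v = A" "v \<cdot>\<^bsub>I\<^esub> dif S 0 = Idn I A"
    using h same_cat_cong[OF same_cat_op_exang[of n I]] A z(1) s(3,4) by (simp, metis)
  obtain f g where "end_fixing n I S ?T f" "end_fixing n I ?T S g"
    using I.trivial_retract_left[OF cS N n1 s(3,4) v] by blast
  then have "htpy_class n I S = htpy_class n I ?R" using I.htpy_class_eqI[OF nS nT] htpy_class_agree[OF ag] by metis
  moreover have "?R \<in> cplx_between n I A N"
    using nT complex_agree[OF ag] n1 by (auto simp: exact_seq_def cplx_between_def)
  ultimately show "realised_by n I A N \<one>\<^bsub>Ext I N A\<^esub> ?R" using s(5) by (simp add: realised_by_def)
next
  fix A N assume A: "A \<in> Ob I" and N: "zero_object I N"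
  note z = I.zero_ob_eq[OF N]
  let ?R = "Cplx (\<lambda>i. if i < n then N else A) (\<lambda>i. if i = n then Idn I A else if i + 1 = n then zr I N A else zr I N N)"
  let ?T = "I.trivial_cplx n N A"
  have ag: "agree (Suc n) ?T ?R" by (auto simp: agree_def I.trivial_cplx_def)
  obtain S X \<eta> where s: "realises n E (base N) (base A) (V \<one>\<^bsub>Ext I A N\<^esub>) X" "represented S X \<eta>" "obj S 0 = N" "obj S (Suc n) = A" "Rlz I A N \<one>\<^bsub>Ext I A N\<^esub> = htpy_class n I S"
    by (rule rlz_represented[OF A z(1) I.ext_one[OF A z(1)]])
  have nS: "exact_seq n I S" by (rule represented_exact_seq[OF s(2) realises_exact[OF s(1)]])
  have nT: "exact_seq n I ?T" by (rule I.trivial_exact_seq[OF N A]) simp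
  have cS: "complex I (Suc n) S" using nS by (simp add: exact_seq_def)
  note h = represented_pull_exact[OF s(2,1) A z(1) I.ext_one[OF A z(1)] s(3,4), unfolded pull_exact_def, THEN conjunct2, THEN conjunct2, rule_format, of "Idn I A"]
  obtain v where v: "mor I v" "src I v = A" "tgt I v = obj S n" "dif S n \<cdot>\<^bsub>I\<^esub> v = Idn I A"
    using h A z(1) s(3,4) by (simp, metis)
  obtain f g where "end_fixing n I S ?T f" "end_fixing n I ?T S g"
    using I.trivial_retract_right[OF cS N n1 s(3,4) v] by blast
  then have "htpy_class n I S = htpy_class n I ?R" using I.htpy_class_eqI[OF nS nT] htpy_class_agree[OF ag] by metis
  moreover have "?R \<in> cplx_between n I N A"
    using nT complex_agree[OF ag] n1 by (auto simp: exact_seq_def cplx_between_def)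
  ultimately show "realised_by n I N A \<one>\<^bsub>Ext I A N\<^esub> ?R" using s(5) by (simp add: realised_by_def)
qed

lemma completion_exact_exang: "exact_exang n I"
proof (intro exact_exang.intro exact_exang_axioms.intro I.additive_bifunctor_axioms completion_realisation n1)
  show "exact_seq n I X" if "realises n I A Z \<delta> X" for A Z \<delta> X
    using realised_rep[of Z A \<delta> X] that unfolding realises_def by metis
qed

end


section \<open>Composition of inflations between idempotents\<close>

sublocale idem_rep \<subseteq> I: exact_exang n I by (rule completion_exact_exang)

context exact_exang
begin

lemma inflation_op_iff: "inflation n (op_exang n E) = deflation n E"
proof
  interpret op: exact_exang n "op_exang n E" by (rule exact_exang_op)
  fix f
  show "inflation n (op_exang n E) f = deflation n E f"
  proof
    assume "inflation n (op_exang n E) f"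
    then obtain A Z \<delta> X where X: "realises n (op_exang n E) A Z \<delta> X" "f = dif X 0" by (rule op.inflationE)
    then have "realises n E Z A \<delta> (rev_cplx (Suc n) X)" by (simp add: realises_op)
    moreover have "f = dif (rev_cplx (Suc n) X) n" using X(2) by (simp add: rev_cplx_def)
    ultimately show "deflation n E f" unfolding deflation_def realises_def by blast
  next
    assume "deflation n E f"
    then obtain A Z \<delta> X where X: "realises n E A Z \<delta> X" "f = dif X n" by (auto simp: deflation_def realises_def)
    then have "realises n (op_exang n E) Z A \<delta> (rev_cplx (Suc n) X)" by (simp add: realises_op')
    moreover have "f = dif (rev_cplx (Suc n) X) 0" using X(2) by (simp add: rev_cplx_def)
    ultimately show "inflation n (op_exang n E) f" using op.inflationI by metis
  qed
qed

end

context idem_rep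
begin

text \<open>
  By naturality the end components of \<open>\<eta>\<close> turn \<open>\<rho>\<close> into the same extension
  \<open>\<epsilon>\<close>, which is then fixed by both. Between \<open>Y\<close> and a realisation
  \<open>X\<close> of \<open>\<epsilon>\<close> there are lifts of \<open>(\<eta>\<^sub>0, 1)\<close> and
  \<open>(1, \<eta>\<^bsub>n+1\<^esub>)\<close>; restricted to the idempotents, they fix the end terms.
\<close>

lemma represented_realises:
  assumes S: "represented S Y \<eta>" and Y: "realises n E A D \<rho> Y"
  obtains \<delta> where "realises n I (obj S 0) (obj S (Suc n)) \<delta> S"
proof -
  note s = stdD[OF S] and r = rzD[OF Y]
  let ?A = "obj S 0" and ?Z = "obj S (Suc n)"
  have b: "?A \<in> Ob I" "?Z \<in> Ob I" "base ?A = A" "base ?Z = D" "e ?A = \<eta> 0" "e ?Z = \<eta> (Suc n)"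
    using s(4-6)[of 0] s(4-6)[of "Suc n"] r(4,5) by simp_all
  have h: "mor E (\<eta> 0)" "src E (\<eta> 0) = A" "tgt E (\<eta> 0) = A" "\<eta> 0 \<cdot> \<eta> 0 = \<eta> 0"
    "mor E (\<eta> (Suc n))" "src E (\<eta> (Suc n)) = D" "tgt E (\<eta> (Suc n)) = D" "\<eta> (Suc n) \<cdot> \<eta> (Suc n) = \<eta> (Suc n)"
    using s(3)[of 0] s(3)[of "Suc n"] s(11-13)[of 0] s(11-13)[of "Suc n"] r(4,5) by simp_all
  define \<epsilon> where "\<epsilon> = Act E (Idn E D) (\<eta> 0) \<rho>"
  have e': "\<epsilon> = Act E (\<eta> (Suc n)) (Idn E A) \<rho>" unfolding \<epsilon>_def by (rule naturality[OF Y Y s(2)])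
  have ei: "\<epsilon> \<in> carrier (Ext E D A)" using h r(1-3) by (simp add: \<epsilon>_def)
  have e1: "Act E (Idn E D) (\<eta> 0) \<epsilon> = \<epsilon>" unfolding \<epsilon>_def using h r(1-3) act_act[of "Idn E D" "\<eta> 0" "Idn E D" "\<eta> 0" \<rho>] by simp
  have e2: "Act E (\<eta> (Suc n)) (Idn E A) \<epsilon> = \<epsilon>" unfolding e' using h r(1-3) act_act[of "\<eta> (Suc n)" "Idn E A" "\<eta> (Suc n)" "Idn E A" \<rho>] by simp
  have "\<exists>\<delta>\<in>carrier (Ext I ?Z ?A). V \<delta> = \<epsilon>"
    by (rule V_surj[OF b(2,1)]) (use b ei e1 e2 in simp_all)
  then obtain \<delta> where d: "\<delta> \<in> carrier (Ext I ?Z ?A)" "V \<delta> = \<epsilon>" by blast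
  obtain S' X \<theta> where x: "realises n E (base ?A) (base ?Z) (V \<delta>) X" "represented S' X \<theta>" "obj S' 0 = ?A" "obj S' (Suc n) = ?Z" "Rlz I ?Z ?A \<delta> = htpy_class n I S'"
    by (rule rlz_represented[OF b(2,1) d(1)])
  have X: "realises n E A D \<epsilon> X" using x(1) b(3,4) d(2) by simp
  note t = stdD[OF x(2)]
  have th: "\<theta> 0 = \<eta> 0" "\<theta> (Suc n) = \<eta> (Suc n)" using t(6)[of 0] t(6)[of "Suc n"] b(5,6) x(3,4) by simp_all
  obtain f where f: "chain_map E (Suc n) Y X f" "f 0 = \<eta> 0" "f (Suc n) = Idn E D"
    by (rule realises_lift[OF Y X, of "\<eta> 0" "Idn E D"]) (use h r(1-3) ei in \<open>simp_all add: \<epsilon>_def\<close>)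
  obtain g where g: "chain_map E (Suc n) X Y g" "g 0 = Idn E A" "g (Suc n) = \<eta> (Suc n)"
    by (rule realises_lift[OF X Y, of "Idn E A" "\<eta> (Suc n)"]) (use h r(1-3) ei e' in simp_all)
  obtain F where F: "chain_map I (Suc n) S S' F" "\<And>i. i \<le> Suc n \<Longrightarrow> U (F i) = \<theta> i \<cdot> (f i \<cdot> \<eta> i)"
    using represented_map[OF S x(2) f(1)] by blast
  obtain G where G: "chain_map I (Suc n) S' S G" "\<And>i. i \<le> Suc n \<Longrightarrow> U (G i) = \<eta> i \<cdot> (g i \<cdot> \<theta> i)"
    using represented_map[OF x(2) S g(1)] by blast
  have cS: "complex I (Suc n) S" "complex I (Suc n) S'" using represented_complex[OF S] represented_complex[OF x(2)] .
  note FF = I.chain_mapD(1-3)[OF cS F(1) cS order_refl] and GG = I.chain_mapD(1-3)[OF cS(2,1) G(1) cS(2,1) order_refl]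
  have F0: "F 0 = Idn I ?A"
    by (rule I_eqI) (use FF[of 0] F(2)[of 0] f(2) h(1-4) b(1,5) x(3) th(1) in simp_all)
  have F1: "F (Suc n) = Idn I ?Z"
    by (rule I_eqI) (use FF[of "Suc n"] F(2)[of "Suc n"] f(3) h(5-8) b(2,6) x(4) th(2) in simp_all)
  have G0: "G 0 = Idn I ?A"
    by (rule I_eqI) (use GG[of 0] G(2)[of 0] g(2) h(1-4) b(1,5) x(3) th(1) in simp_all)
  have G1: "G (Suc n) = Idn I ?Z"
    by (rule I_eqI) (use GG[of "Suc n"] G(2)[of "Suc n"] g(3) h(5-8) b(2,6) x(4) th(2) in simp_all)
  have ef: "end_fixing n I S' S G" "end_fixing n I S S' F"
    using F(1) G(1) F0 F1 G0 G1 x(3,4) by (simp_all add: end_fixing_def)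
  have "realises n I ?A ?Z \<delta> S'" using b(1,2) d(1) x(3-5) cS(2) by (simp add: realises_def realised_by_def cplx_between_def)
  from that[OF I.realises_end_fixing2[OF this represented_exact_seq[OF S realises_exact[OF Y]] ef]] show thesis .
qed

text \<open>
  Forgetting the idempotents does not preserve inflations, but \<open>U f\<close> is one component of an
  inflation whose other component \<open>u\<close> is supported on the complement of the idempotent. Let
  \<open>d\<close> be the first differential of a realisation \<open>X\<close> of \<open>V \<delta>\<close>.
  Then \<open>(d, 0)\<close> is an inflation. In degree \<open>1\<close> the comparison maps \<open>a\<close>
  and \<open>b\<close> between the two complexes in \<open>I\<close> satisfy
  \<open>U b \<cdot> d = U f\<close> and \<open>U a \<cdot> U f = d \<cdot> e\<close>; thus two
  transvections transform \<open>(d, 0)\<close> first into \<open>(d, U f)\<close> and then into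
  \<open>(d - d \<cdot> e, U f)\<close>.
\<close>

lemma inflation_rep:
  assumes f: "inflation n I f"
  obtains W P i1 i2 p1 p2 u where "mor I f" "biproduct E W (base (tgt I f)) P i1 i2 p1 p2"
    "mor E u" "src E u = base (src I f)" "tgt E u = W" "u \<cdot> e (src I f) = zr E (base (src I f)) W"
    "inflation n E ((i1 \<cdot> u) \<oplus> (i2 \<cdot> U f))"
proof -
  obtain A Z \<delta> S' where S': "realises n I A Z \<delta> S'" "f = dif S' 0" by (rule I.inflationE[OF f])
  note r = I.rzD[OF S'(1)]
  have rb: "realised_by n I A Z \<delta> S'" using S'(1) by (simp add: realises_def)
  obtain S X \<eta> a b where s: "realises n E (base A) (base Z) (V \<delta>) X" "represented S X \<eta>" "obj S 0 = A" "obj S (Suc n) = Z"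
    "end_fixing n I S' S a" "end_fixing n I S S' b"
    by (rule realised_rep[OF r(2,1,3) rb])
  note t = stdD[OF s(2)] and x = complexD[OF stdD(1)[OF s(2)]] and x' = I.complexD[OF r(6)]
  have cS: "complex I (Suc n) S" by (rule represented_complex[OF s(2)])
  have ab: "chain_map I (Suc n) S' S a" "chain_map I (Suc n) S S' b" "a 0 = Idn I A" "b 0 = Idn I A"
    using s(3,5,6) r(4) by (simp_all add: end_fixing_def)
  note aa = I.chain_mapD[OF r(6) cS ab(1) r(6) cS order_refl] and bb = I.chain_mapD[OF cS r(6) ab(2) cS r(6) order_refl]
  let ?Q = "obj S' 1" and ?d = "dif X 0" and ?W = "obj X 1"
  have f: "mor I f" "src I f = A" "tgt I f = ?Q" using x'(2-4)[of 0] r(4) S'(2) by simp_all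
  have Q: "?Q \<in> Ob I" "base ?Q \<in> Ob E" using f(1,3) ob_facts(1)[of ?Q] I.mor_ob(2)[OF f(1)] by auto
  have a1: "mor I (a 1)" "src I (a 1) = ?Q" "tgt I (a 1) = obj S 1" "a 1 \<cdot>\<^bsub>I\<^esub> f = dif S 0"
    using aa(1-3)[of 1] aa(4)[of 0] ab(3) S'(2) t(7-9)[of 0] s(3) by simp_all
  have b1: "mor I (b 1)" "src I (b 1) = obj S 1" "tgt I (b 1) = ?Q" "b 1 \<cdot>\<^bsub>I\<^esub> dif S 0 = f"
    using bb(1-3)[of 1] bb(4)[of 0] ab(4) S'(2) f s(3) by simp_all
  have d: "mor E ?d" "src E ?d = base A" "tgt E ?d = ?W" "?W \<in> Ob E" using x(1-4)[of 0] x(1)[of 1] rzD(4)[OF s(1)] by simp_all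
  have h: "\<eta> 0 = e A" "base (obj S 1) = ?W" "e (obj S 1) = \<eta> 1" "U (dif S 0) = ?d \<cdot> e A" "\<eta> 1 \<cdot> ?d = ?d \<cdot> e A"
    using t(6)[of 0] t(5,6)[of 1] t(10,14)[of 0] s(3) by simp_all
  have eA: "mor E (e A)" "src E (e A) = base A" "tgt E (e A) = base A" "e A \<cdot> e A = e A" using ob_facts[OF r(1)] by simp_all
  have ua: "mor E (U (a 1))" "src E (U (a 1)) = base ?Q" "tgt E (U (a 1)) = ?W" "U (a 1) \<cdot> U f = ?d \<cdot> e A"
    using a1 f(1,3) U_mor(1-3)[OF a1(1)] U_cmp[OF a1(1) f(1)] h by simp_all
  have ub: "mor E (U (b 1))" "src E (U (b 1)) = ?W" "tgt E (U (b 1)) = base ?Q" "U (b 1) \<cdot> (?d \<cdot> e A) = U f" "U (b 1) \<cdot> \<eta> 1 = U (b 1)"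
    using b1 U_mor[OF b1(1)] U_cmp[OF b1(1) t(7)[of 0]] t(9)[of 0] h by simp_all
  have h1: "mor E (\<eta> 1)" "src E (\<eta> 1) = ?W" "tgt E (\<eta> 1) = ?W" using t(11-13)[of 1] by simp_all
  have "U (b 1) \<cdot> ?d = U (b 1) \<cdot> (\<eta> 1 \<cdot> ?d)" by (rule comp_eq[OF ub(5), symmetric]) (use ub(1-3) h1 d in simp_all)
  then have ub': "U (b 1) \<cdot> ?d = U f" using h(5) ub(4) by simp
  have Uf: "mor E (U f)" "src E (U f) = base A" "tgt E (U f) = base ?Q" using U_mor(1-3)[OF f(1)] f by simp_all
  have o2: "obj X (Suc 1) \<in> Ob E" using x(1)[of "Suc 1"] n1 by simp
  obtain P i1 i2 p1 p2 where bp: "biproduct E ?W (base ?Q) P i1 i2 p1 p2" using biproduct_exists[OF d(4) Q(2)] by blast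
  obtain P' i1' i2' p1' p2' where bp': "biproduct E (obj X (Suc 1)) (base ?Q) P' i1' i2' p1' p2'" using biproduct_exists[OF o2 Q(2)] by blast
  obtain T \<rho> where T: "realises n E (obj T 0) (obj T (Suc n)) \<rho> T" "\<forall>i. Suc i = 1 \<longrightarrow> dif T i = i1 \<cdot> dif X i"
    using stabilise[OF s(1) n1 bp bp'] by blast
  have 0: "inflation n E (i1 \<cdot> ?d)" using inflationI[OF T(1)] T(2) by simp
  note bm = biprod_mor[OF bp]
  have 1: "inflation n E ((i2 \<cdot> zr E (base A) (base ?Q)) \<oplus> (i1 \<cdot> ?d))" using 0 bm d Q ob_facts(1)[OF r(1)] by simp
  have 2: "inflation n E ((i2 \<cdot> (zr E (base A) (base ?Q) \<oplus> (U (b 1) \<cdot> ?d))) \<oplus> (i1 \<cdot> ?d))"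
    by (rule transvection[OF biproduct_swap[OF bp] 1]) (use d Q ub ob_facts(1)[OF r(1)] in simp_all)
  have 3: "(i2 \<cdot> (zr E (base A) (base ?Q) \<oplus> (U (b 1) \<cdot> ?d))) \<oplus> (i1 \<cdot> ?d) = (i1 \<cdot> ?d) \<oplus> (i2 \<cdot> U f)"
    using ub' Uf bm d add_comm[of "i2 \<cdot> U f" "i1 \<cdot> ?d"] by simp
  let ?u = "?d \<oplus> (\<ominus> U (a 1) \<cdot> U f)"
  have 4: "inflation n E ((i1 \<cdot> ?u) \<oplus> (i2 \<cdot> U f))"
    by (rule transvection[OF bp 2[unfolded 3]]) (use d Uf ua in simp_all)
  have u: "?u = ?d \<oplus> \<ominus> (?d \<cdot> e A)" using ua Uf by simp
  have "?u \<cdot> e A = zr E (base A) ?W" unfolding u using d eA by simp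
  moreover have "mor E ?u" "src E ?u = base A" "tgt E ?u = ?W" unfolding u using d eA by simp_all
  ultimately show thesis using that[of ?W P i1 i2 p1 p2 ?u] f bp 4 by simp
qed

text \<open>
  By the previous lemma \<open>f\<close> and \<open>g\<close> are components of inflations
  \<open>(u, U f)\<close> and \<open>(u', U g)\<close> of \<open>E\<close>. The sum of the latter with an
  identity can be composed with the former; since \<open>u' \<cdot> U f = 0\<close>, the result
  \<open>K\<close> has \<open>U (g \<cdot> f)\<close> and \<open>u\<close> as its only components. The
  idempotent \<open>q\<close> onto the summand that belongs to the target of \<open>g\<close> satisfies
  \<open>q \<cdot> K = K \<cdot> e\<close> as \<open>u \<cdot> e = 0\<close>. Hence \<open>e\<close>
  and \<open>q\<close> extend to an idempotent endomorphism \<open>\<eta>\<close> of a realisation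
  \<open>Y\<close> with first differential \<open>K\<close>, and the first differential of
  \<open>(Y, \<eta>)\<close> is \<open>g \<cdot> f\<close> up to an isomorphism of the target.
\<close>

lemma inflations_compose:
  assumes cl: "closed_under_comp E (inflation n E)" and f: "inflation n I f" and g: "inflation n I g" and fg: "src I g = tgt I f"
  shows "inflation n I (g \<cdot>\<^bsub>I\<^esub> f)"
proof -
  obtain W P i1 i2 p1 p2 u where F: "mor I f" "biproduct E W (base (tgt I f)) P i1 i2 p1 p2"
    "mor E u" "src E u = base (src I f)" "tgt E u = W" "u \<cdot> e (src I f) = zr E (base (src I f)) W" "inflation n E ((i1 \<cdot> u) \<oplus> (i2 \<cdot> U f))"
    by (rule inflation_rep[OF f])
  obtain W' P' j1 j2 m1 m2 u' where G: "mor I g" "biproduct E W' (base (tgt I g)) P' j1 j2 m1 m2"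
    "mor E u'" "src E u' = base (src I g)" "tgt E u' = W'" "u' \<cdot> e (src I g) = zr E (base (src I g)) W'" "inflation n E ((j1 \<cdot> u') \<oplus> (j2 \<cdot> U g))"
    by (rule inflation_rep[OF g])
  define A where "A = src I f" define Q where "Q = tgt I f" define R where "R = tgt I g"
  have obs: "A \<in> Ob I" "Q \<in> Ob I" "R \<in> Ob I" using F(1) G(1) by (simp_all add: A_def Q_def R_def)
  note eA = ob_facts[OF obs(1)] and eQ = ob_facts[OF obs(2)] and eR = ob_facts[OF obs(3)]
  have Uf: "mor E (U f)" "src E (U f) = base A" "tgt E (U f) = base Q" "e Q \<cdot> U f = U f" "U f \<cdot> e A = U f"
    using U_mor[OF F(1)] by (simp_all add: A_def Q_def)
  have Ug: "mor E (U g)" "src E (U g) = base Q" "tgt E (U g) = base R" "e R \<cdot> U g = U g" "U g \<cdot> e Q = U g"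
    using U_mor[OF G(1)] fg by (simp_all add: Q_def R_def)
  note bi = F(2)[folded Q_def] and bj = G(2)[folded R_def]
  note im = biprod_mor[OF bi] and jm = biprod_mor[OF bj]
  note iq = biprod_eq(1-4)[OF bi] biprod_eq'[OF bi] and jq = biprod_eq(1-4)[OF bj] biprod_eq'[OF bj]
  have u: "mor E u" "src E u = base A" "tgt E u = W" "u \<cdot> e A = zr E (base A) W" using F(3-6) by (simp_all add: A_def)
  have u': "mor E u'" "src E u' = base Q" "tgt E u' = W'" "u' \<cdot> e Q = zr E (base Q) W'" using G(3-6) fg by (simp_all add: Q_def)
  let ?f = "(i1 \<cdot> u) \<oplus> (i2 \<cdot> U f)" and ?g = "(j1 \<cdot> u') \<oplus> (j2 \<cdot> U g)"
  have fm: "mor E ?f" "src E ?f = base A" "tgt E ?f = P" using u Uf im by simp_all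
  have gm: "mor E ?g" "src E ?g = base Q" "tgt E ?g = P'" using u' Ug jm by simp_all
  obtain A0 Z0 \<delta>0 X where X: "realises n E A0 Z0 \<delta>0 X" "?g = dif X 0" by (rule inflationE[OF G(7)])
  have x: "obj X 0 = base Q" "obj X (Suc 0) = P'" using complexD(2-4)[OF rzD(6)[OF X(1)], of 0] gm X(2) by simp_all
  obtain T k1 k2 q1 q2 where bk: "biproduct E P' W T k1 k2 q1 q2" using biproduct_exists[OF jm(15) im(13)] by blast
  note km = biprod_mor[OF bk] and kq = biprod_eq(1-4)[OF bk] biprod_eq'[OF bk]
  obtain S0 \<rho>0 where S0: "realises n E (obj S0 0) (obj S0 (Suc n)) \<rho>0 S0" "dif S0 0 = (k1 \<cdot> (dif X 0 \<cdot> p2)) \<oplus> (k2 \<cdot> p1)"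
    using stabilise[OF X(1) le0, of W P i2 i1 p2 p1 T k1 k2 q1 q2] biproduct_swap[OF bi] bk x by metis
  have i0: "inflation n E ((k1 \<cdot> (?g \<cdot> p2)) \<oplus> (k2 \<cdot> p1))" using inflationI[OF S0(1)] S0(2) X(2) by simp
  let ?k = "(k1 \<cdot> (?g \<cdot> p2)) \<oplus> (k2 \<cdot> p1)"
  have km': "mor E ?k" "src E ?k = P" "tgt E ?k = T" using gm im km by simp_all
  have cl': "inflation n E (b \<cdot> a)" if "inflation n E a" "inflation n E b" "mor E a" "mor E b" "src E b = tgt E a" for a b
    using cl that mor_arr[of a] mor_arr[of b] mor_ob[of a] mor_ob[of b] unfolding closed_under_comp_def by metis
  have i1: "inflation n E (?k \<cdot> ?f)" by (rule cl'[OF F(7) i0 fm(1) km'(1)]) (use km' fm in simp)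
  let ?K = "(k1 \<cdot> (j2 \<cdot> (U g \<cdot> U f))) \<oplus> (k2 \<cdot> u)"
  have p: "p1 \<cdot> ?f = u" "p2 \<cdot> ?f = U f" using iq u Uf im by simp_all
  have "u' \<cdot> U f = u' \<cdot> (e Q \<cdot> U f)" using Uf(4) by simp
  also have "\<dots> = zr E (base A) W'" by (subst comp_eq[OF u'(4)]) (use u'(1-3) Uf(1-3) eQ jm in simp_all)
  finally have z: "u' \<cdot> U f = zr E (base A) W'" .
  have "?g \<cdot> U f = j2 \<cdot> (U g \<cdot> U f)" using u' Ug Uf jm eA z by simp
  moreover have "?k \<cdot> ?f = (k1 \<cdot> (?g \<cdot> (p2 \<cdot> ?f))) \<oplus> (k2 \<cdot> (p1 \<cdot> ?f))"
    using gm fm im km by (simp del: add_comp comp_add add: add_comp[of "k1 \<cdot> (?g \<cdot> p2)" "k2 \<cdot> p1" ?f])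
  ultimately have "?k \<cdot> ?f = ?K" unfolding p by simp
  then have iK: "inflation n E ?K" using i1 by simp
  have w: "mor E (U g \<cdot> U f)" "src E (U g \<cdot> U f) = base A" "tgt E (U g \<cdot> U f) = base R" "e R \<cdot> (U g \<cdot> U f) = U g \<cdot> U f" "(U g \<cdot> U f) \<cdot> e A = U g \<cdot> U f"
    using Uf Ug eA eR comp_eq[OF Ug(4), of "U f"] by simp_all
  define w where "w = U g \<cdot> U f"
  note w = w[folded w_def]
  obtain A1 Z1 \<delta>1 Y0 where Y0: "realises n E A1 Z1 \<delta>1 Y0" "(k1 \<cdot> (j2 \<cdot> w)) \<oplus> (k2 \<cdot> u) = dif Y0 0" by (rule inflationE[OF iK[folded w_def]])
  \<comment> \<open>the idempotent \<open>q\<close>: the idempotent of the target of \<open>g\<close> on the corresponding summand of \<open>T\<close>\<close>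
  let ?q = "k1 \<cdot> (j2 \<cdot> (e R \<cdot> (m2 \<cdot> q1)))"
  have Km: "mor E (dif Y0 0)" "src E (dif Y0 0) = base A" "tgt E (dif Y0 0) = T" using w u jm km Y0(2)[symmetric] by simp_all
  have y: "A1 = base A" "obj Y0 1 = T" using complexD(2-4)[OF rzD(6)[OF Y0(1)], of 0] Km rzD(4)[OF Y0(1)] by simp_all
  have qm: "mor E ?q" "src E ?q = T" "tgt E ?q = T" using jm km eR by simp_all
  have er2: "e R \<cdot> (e R \<cdot> x) = e R \<cdot> x" if "mor E x" "tgt E x = base R" for x
    using comp_eq[OF eR(5), of x] eR that by simp
  have qq: "?q \<cdot> ?q = ?q" using jm km eR jq kq er2 by simp
  have Ke: "dif Y0 0 \<cdot> e A = k1 \<cdot> (j2 \<cdot> w)" unfolding Y0(2)[symmetric] using w u jm km eA by simp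
  have qK: "?q \<cdot> dif Y0 0 = dif Y0 0 \<cdot> e A" unfolding Ke unfolding Y0(2)[symmetric] using w u jm km eR jq kq ob_facts(1)[OF obs(1)] by simp
  obtain Y D \<rho> \<eta> where Y: "realises n E A1 D \<rho> Y" "obj Y 1 = obj Y0 1" "dif Y 0 = dif Y0 0" "chain_map E (Suc n) Y Y \<eta>"
    "\<forall>i\<le>Suc n. \<eta> i \<cdot> \<eta> i = \<eta> i" "\<eta> 0 = e A" "\<eta> 1 = ?q"
    using rigidify[OF Y0(1), of "e A" ?q] eA qm qq qK y by metis
  obtain S where S: "represented S Y \<eta>" by (rule represented_exists[OF rzD(6)[OF Y(1)] Y(4,5)])
  obtain \<delta> where d: "realises n I (obj S 0) (obj S (Suc n)) \<delta> S" by (rule represented_realises[OF S Y(1)])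
  note s = stdD[OF S]
  have S0': "obj S 0 = A"
    by (rule ob_inj) (use s(4-6)[of 0] obs Y(6) rzD(4)[OF Y(1)] y in simp_all)
  have S1: "obj S 1 \<in> Ob I" "base (obj S 1) = T" "e (obj S 1) = ?q" using s(4-6)[of 1] Y(2,7) y by simp_all
  have h: "mor I (dif S 0)" "src I (dif S 0) = A" "tgt I (dif S 0) = obj S 1" "U (dif S 0) = k1 \<cdot> (j2 \<cdot> w)"
    using s(7-10)[of 0] S0' Y(3,6) Ke by simp_all
  obtain \<theta> where th: "mor I \<theta>" "src I \<theta> = obj S 1" "tgt I \<theta> = R" "U \<theta> = e R \<cdot> (m2 \<cdot> q1)"
    by (rule mkE[of "obj S 1" R "e R \<cdot> (m2 \<cdot> q1)"]) (use S1 obs jm km eR jq kq er2 in simp_all)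
  obtain \<theta>' where th': "mor I \<theta>'" "src I \<theta>' = R" "tgt I \<theta>' = obj S 1" "U \<theta>' = k1 \<cdot> (j2 \<cdot> e R)"
    by (rule mkE[of R "obj S 1" "k1 \<cdot> (j2 \<cdot> e R)"]) (use S1 obs jm km eR jq kq er2 in simp_all)
  have iso: "\<theta>' \<cdot>\<^bsub>I\<^esub> \<theta> = Idn I (src I \<theta>)" "\<theta> \<cdot>\<^bsub>I\<^esub> \<theta>' = Idn I (tgt I \<theta>)"
    by (rule I_eqI; use th th' S1 obs jm km eR jq kq er2 in simp)+
  have "inflation n I (\<theta> \<cdot>\<^bsub>I\<^esub> dif S 0)"
    by (rule I.iso_inflation[OF I.inflationI[OF d] th(1) _ th'(1) _ _ iso]) (use th th' h in simp_all)
  moreover have "\<theta> \<cdot>\<^bsub>I\<^esub> dif S 0 = g \<cdot>\<^bsub>I\<^esub> f"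
    by (rule I_eqI) (use th h F(1) G(1) fg w jm km eR jq kq in \<open>simp_all add: A_def R_def w_def\<close>)
  ultimately show ?thesis by simp
qed

lemma EA1_inflation:
  assumes "closed_under_comp E (inflation n E)" shows "closed_under_comp I (inflation n I)"
  unfolding closed_under_comp_def using inflations_compose[OF assms] by simp

lemma EA1_deflation:
  assumes "closed_under_comp E (deflation n E)" shows "closed_under_comp I (deflation n I)"
proof -
  interpret op: idem_rep n "op_exang n E" "op_exang n I" base e U V by (rule op_rep)
  have "closed_under_comp (op_exang n E) (inflation n (op_exang n E))"
    using assms unfolding inflation_op_iff closed_under_comp_def by auto
  then have "closed_under_comp (op_exang n I) (inflation n (op_exang n I))" by (rule op.EA1_inflation)
  then show ?thesis unfolding I.inflation_op_iff closed_under_comp_def by auto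
qed

end


section \<open>The idempotent completion\<close>

lemma idem_completion_simps [simp]:
  "Ob (idem_completion n E) = idem_objects E" "Hom (idem_completion n E) P Q = idem_hom E P Q"
  "Idn (idem_completion n E) P = (snd P, snd P, snd P)"
  "Cmp (idem_completion n E) g f = (fst g, fst (snd g) \<cdot>\<^bsub>E\<^esub> fst (snd f), snd (snd f))"
  "Ext (idem_completion n E) Z A = idem_ext E Z A"
  "Act (idem_completion n E) c a \<delta> = (fst a, Act E (fst (snd c)) (fst (snd a)) (fst (snd \<delta>)), snd (snd c))"
  "Rlz (idem_completion n E) Z A \<delta> = idem_rlz n E Z A \<delta>"
  by (simp_all add: idem_completion_def idem_cat_def idem_act_def split_def)

lemma same_cat_idem_completion: "same_cat (idem_completion n E) (idem_cat E)"
  by (simp add: same_cat_def fun_eq_iff idem_completion_def)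

lemma idem_hom_simps:
  "f \<in> carrier (idem_hom E P Q) \<longleftrightarrow>
     (\<exists>r. f = (snd Q, r, snd P) \<and> r \<in> arr E (fst P) (fst Q) \<and> r \<cdot>\<^bsub>E\<^esub> snd P = r \<and> snd Q \<cdot>\<^bsub>E\<^esub> r = r)"
  "f \<otimes>\<^bsub>idem_hom E P Q\<^esub> g = (snd Q, fst (snd f) \<otimes>\<^bsub>Hom E (fst P) (fst Q)\<^esub> fst (snd g), snd P)"
  "\<one>\<^bsub>idem_hom E P Q\<^esub> = (snd Q, \<one>\<^bsub>Hom E (fst P) (fst Q)\<^esub>, snd P)"
  by (auto simp: idem_hom_def split_def)

lemma idem_ext_simps:
  "x \<in> carrier (idem_ext E Z A) \<longleftrightarrow>
     (\<exists>\<delta>. x = (snd A, \<delta>, snd Z) \<and> \<delta> \<in> carrier (Ext E (fst Z) (fst A)) \<and>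
       Act E (Idn E (fst Z)) (snd A) \<delta> = \<delta> \<and> Act E (snd Z) (Idn E (fst A)) \<delta> = \<delta>)"
  "x \<otimes>\<^bsub>idem_ext E Z A\<^esub> y = (snd A, fst (snd x) \<otimes>\<^bsub>Ext E (fst Z) (fst A)\<^esub> fst (snd y), snd Z)"
  "\<one>\<^bsub>idem_ext E Z A\<^esub> = (snd A, \<one>\<^bsub>Ext E (fst Z) (fst A)\<^esub>, snd Z)"
  by (auto simp: idem_ext_def split_def push_def pull_def)

context exact_exang
begin

text \<open>
  The choice in the definition of \<open>\<t>\<close> is possible because idempotents lift.
\<close>

lemma idem_choice_exists:
  assumes Z: "Z \<in> idem_objects E" and A: "A \<in> idem_objects E" and x: "x \<in> carrier (idem_ext E Z A)"
  obtains X \<eta> where "idem_choice n E (fst A) (fst Z) x = (X, \<eta>)" "realises n E (fst A) (fst Z) (fst (snd x)) X"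
    "chain_map E (Suc n) X X \<eta>" "\<forall>i\<le>Suc n. \<eta> i \<cdot> \<eta> i = \<eta> i" "\<eta> 0 = snd A" "\<eta> (Suc n) = snd Z"
proof -
  obtain \<delta> where d: "x = (snd A, \<delta>, snd Z)" "\<delta> \<in> carrier (Ext E (fst Z) (fst A))"
    "Act E (Idn E (fst Z)) (snd A) \<delta> = \<delta>" "Act E (snd Z) (Idn E (fst A)) \<delta> = \<delta>"
    using x unfolding idem_ext_simps by blast
  have o: "fst Z \<in> Ob E" "mor E (snd Z)" "src E (snd Z) = fst Z" "tgt E (snd Z) = fst Z" "snd Z \<cdot> snd Z = snd Z"
    "fst A \<in> Ob E" "mor E (snd A)" "src E (snd A) = fst A" "tgt E (snd A) = fst A" "snd A \<cdot> snd A = snd A"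
    using Z A by (auto simp: idem_objects_def)
  define Q where "Q = (\<lambda>(X, \<eta>). realised_by n E (fst A) (fst Z) \<delta> X \<and> chain_map E (n + 1) X X \<eta> \<and>
     (\<forall>i\<le>n + 1. \<eta> i \<cdot> \<eta> i = \<eta> i) \<and> \<eta> 0 = snd A \<and> \<eta> (n + 1) = snd Z)"
  obtain X where X: "realises n E (fst A) (fst Z) \<delta> X" using realises_exists[OF o(6,1) d(2)] by blast
  obtain \<eta> where "chain_map E (Suc n) X X \<eta>" "\<forall>i\<le>Suc n. \<eta> i \<cdot> \<eta> i = \<eta> i" "\<eta> 0 = snd A" "\<eta> (Suc n) = snd Z"
    using idempotent_lift[OF X o(7-10) d(3) o(2-5) d(4)] by blast
  then have "Q (X, \<eta>)" using X by (simp add: Q_def realises_def)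
  then have s: "Q (SOME p. Q p)" by (rule someI)
  have c: "idem_choice n E (fst A) (fst Z) x = (SOME p. Q p)" by (simp add: idem_choice_def d(1) Q_def)
  obtain X' \<eta>' where p: "(SOME p. Q p) = (X', \<eta>')" by (cases "SOME p. Q p")
  have "Q (X', \<eta>')" using s p by simp
  then show thesis using that[of X' \<eta>'] c p o(1,6) d(1,2) by (simp add: Q_def realises_def)
qed

lemma idem_completion_rep: "idem_rep n E (idem_completion n E) fst snd (\<lambda>f. fst (snd f)) (\<lambda>\<delta>. fst (snd \<delta>))"
proof (intro idem_rep.intro idem_rep_axioms.intro exact_exang_axioms)
  have o: "fst P \<in> Ob E \<and> mor E (snd P) \<and> src E (snd P) = fst P \<and> tgt E (snd P) = fst P \<and> snd P \<cdot> snd P = snd P"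
    if "P \<in> idem_objects E" for P using that by (auto simp: idem_objects_def)
  note s = idem_hom_simps idem_ext_simps
  let ?I = "idem_completion n E"
  show "fst P \<in> Ob E \<and> snd P \<in> arr E (fst P) (fst P) \<and> snd P \<cdot> snd P = snd P" if "P \<in> Ob ?I" for P
    using o[of P] that by simp
  show "P = Q" if "P \<in> Ob ?I" "Q \<in> Ob ?I" "fst P = fst Q" "snd P = snd Q" for P Q using that(3,4) by (rule prod_eqI)
  show "\<exists>P\<in>Ob ?I. fst P = X \<and> snd P = r" if "X \<in> Ob E" "r \<in> arr E X X" "r \<cdot> r = r" for X r
    by (rule bexI[of _ "(X, r)"]) (use that in \<open>simp_all add: idem_objects_def\<close>)
  show "P = P' \<and> Q = Q'" if "P \<in> Ob ?I" "Q \<in> Ob ?I" "P' \<in> Ob ?I" "Q' \<in> Ob ?I" "f \<in> arr ?I P Q" "f \<in> arr ?I P' Q'" for P Q P' Q' f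
  proof -
    have "snd P = snd P'" "snd Q = snd Q'" using that(5,6) by (auto simp: s)
    then show ?thesis using o[of P] o[of Q] o[of P'] o[of Q'] that(1-4) by (metis idem_completion_simps(1) prod_eqI)
  qed
  show "fst (snd f) \<in> arr E (fst P) (fst Q) \<and> snd Q \<cdot> fst (snd f) = fst (snd f) \<and> fst (snd f) \<cdot> snd P = fst (snd f)"
    if "P \<in> Ob ?I" "Q \<in> Ob ?I" "f \<in> arr ?I P Q" for P Q f using that(3) by (auto simp: s simp del: arr_iff)
  show "inj_on (\<lambda>f. fst (snd f)) (arr ?I P Q)" if "P \<in> Ob ?I" "Q \<in> Ob ?I" for P Q by (auto simp: s inj_on_def)
  show "\<exists>f\<in>arr ?I P Q. fst (snd f) = r" if "P \<in> Ob ?I" "Q \<in> Ob ?I" "r \<in> arr E (fst P) (fst Q)" "snd Q \<cdot> r = r" "r \<cdot> snd P = r" for P Q r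
    by (rule bexI[of _ "(snd Q, r, snd P)"]) (use that in \<open>simp_all add: s del: arr_iff\<close>)
  show "f \<otimes>\<^bsub>Hom ?I P Q\<^esub> g \<in> arr ?I P Q \<and> fst (snd (f \<otimes>\<^bsub>Hom ?I P Q\<^esub> g)) = fst (snd f) \<otimes>\<^bsub>Hom E (fst P) (fst Q)\<^esub> fst (snd g)"
    if "P \<in> Ob ?I" "Q \<in> Ob ?I" "f \<in> arr ?I P Q" "g \<in> arr ?I P Q" for P Q f g
    using that o[of P] o[of Q] by (auto simp: s)
  show "zr ?I P Q \<in> arr ?I P Q \<and> fst (snd (zr ?I P Q)) = zr E (fst P) (fst Q)" if "P \<in> Ob ?I" "Q \<in> Ob ?I" for P Q
    using that o[of P] o[of Q] by (simp add: s)
  show "Idn ?I P \<in> arr ?I P P \<and> fst (snd (Idn ?I P)) = snd P" if "P \<in> Ob ?I" for P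
    using that o[of P] by (simp add: s)
  show "g \<cdot>\<^bsub>?I\<^esub> f \<in> arr ?I P R \<and> fst (snd (g \<cdot>\<^bsub>?I\<^esub> f)) = fst (snd g) \<cdot> fst (snd f)"
    if h: "P \<in> Ob ?I" "Q \<in> Ob ?I" "R \<in> Ob ?I" "f \<in> arr ?I P Q" "g \<in> arr ?I Q R" for P Q R f g
  proof -
    obtain r q where r: "f = (snd Q, r, snd P)" "mor E r" "src E r = fst P" "tgt E r = fst Q" "r \<cdot> snd P = r"
      and q: "g = (snd R, q, snd Q)" "mor E q" "src E q = fst Q" "tgt E q = fst R" "snd R \<cdot> q = q"
      using h o[of P] o[of Q] o[of R] by (auto simp: s)
    have "snd R \<cdot> (q \<cdot> r) = q \<cdot> r" by (rule comp_eq[OF q(5)]) (use r q h o[of R] in simp_all)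
    then show ?thesis using r q h o[of P] o[of R] by (simp add: s)
  qed
  show "fst (snd x) \<in> carrier (Ext E (fst Z) (fst A)) \<and> Act E (Idn E (fst Z)) (snd A) (fst (snd x)) = fst (snd x) \<and>
      Act E (snd Z) (Idn E (fst A)) (fst (snd x)) = fst (snd x)" if "Z \<in> Ob ?I" "A \<in> Ob ?I" "x \<in> carrier (Ext ?I Z A)" for Z A x
    using that(3) by (auto simp: s)
  show "inj_on (\<lambda>\<delta>. fst (snd \<delta>)) (carrier (Ext ?I Z A))" if "Z \<in> Ob ?I" "A \<in> Ob ?I" for Z A by (auto simp: s inj_on_def)
  show "\<exists>\<delta>\<in>carrier (Ext ?I Z A). fst (snd \<delta>) = x" if "Z \<in> Ob ?I" "A \<in> Ob ?I" "x \<in> carrier (Ext E (fst Z) (fst A))"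
    "Act E (Idn E (fst Z)) (snd A) x = x" "Act E (snd Z) (Idn E (fst A)) x = x" for Z A x
    by (rule bexI[of _ "(snd A, x, snd Z)"]) (use that in \<open>simp_all add: s\<close>)
  show "x \<otimes>\<^bsub>Ext ?I Z A\<^esub> y \<in> carrier (Ext ?I Z A) \<and> fst (snd (x \<otimes>\<^bsub>Ext ?I Z A\<^esub> y)) = fst (snd x) \<otimes>\<^bsub>Ext E (fst Z) (fst A)\<^esub> fst (snd y)"
    if h: "Z \<in> Ob ?I" "A \<in> Ob ?I" "x \<in> carrier (Ext ?I Z A)" "y \<in> carrier (Ext ?I Z A)" for Z A x y
  proof -
    obtain \<delta> \<rho> where d: "x = (snd A, \<delta>, snd Z)" "\<delta> \<in> carrier (Ext E (fst Z) (fst A))"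
        "Act E (Idn E (fst Z)) (snd A) \<delta> = \<delta>" "Act E (snd Z) (Idn E (fst A)) \<delta> = \<delta>"
      and r: "y = (snd A, \<rho>, snd Z)" "\<rho> \<in> carrier (Ext E (fst Z) (fst A))"
        "Act E (Idn E (fst Z)) (snd A) \<rho> = \<rho>" "Act E (snd Z) (Idn E (fst A)) \<rho> = \<rho>"
      using h(3,4) by (auto simp: s)
    have ob: "fst Z \<in> Ob E" "fst A \<in> Ob E" using o h by simp_all
    interpret G: comm_group "Ext E (fst Z) (fst A)" using ob by (rule ext_group)
    have 1: "\<delta> \<otimes>\<^bsub>Ext E (fst Z) (fst A)\<^esub> \<rho> \<in> carrier (Ext E (fst Z) (fst A))" using d(2) r(2) by simp
    have "Act E (Idn E (fst Z)) (snd A) (\<delta> \<otimes>\<^bsub>Ext E (fst Z) (fst A)\<^esub> \<rho>) = \<delta> \<otimes>\<^bsub>Ext E (fst Z) (fst A)\<^esub> \<rho>"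
      using hom_mult[OF act_hom[of "fst Z" "fst Z" "fst A" "fst A" "Idn E (fst Z)" "snd A"] d(2) r(2)] ob o[of A] h d(3) r(3) by simp
    moreover have "Act E (snd Z) (Idn E (fst A)) (\<delta> \<otimes>\<^bsub>Ext E (fst Z) (fst A)\<^esub> \<rho>) = \<delta> \<otimes>\<^bsub>Ext E (fst Z) (fst A)\<^esub> \<rho>"
      using hom_mult[OF act_hom[of "fst Z" "fst Z" "fst A" "fst A" "snd Z" "Idn E (fst A)"] d(2) r(2)] ob o[of Z] h d(4) r(4) by simp
    ultimately show ?thesis using d(1) r(1) 1 by (simp add: s)
  qed
  show "\<one>\<^bsub>Ext ?I Z A\<^esub> \<in> carrier (Ext ?I Z A) \<and> fst (snd \<one>\<^bsub>Ext ?I Z A\<^esub>) = \<one>\<^bsub>Ext E (fst Z) (fst A)\<^esub>"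
    if h: "Z \<in> Ob ?I" "A \<in> Ob ?I" for Z A
    using o[of Z] o[of A] h by (simp add: s)
  show "Act ?I c a x \<in> carrier (Ext ?I Z' A') \<and> fst (snd (Act ?I c a x)) = Act E (fst (snd c)) (fst (snd a)) (fst (snd x))"
    if h: "Z \<in> Ob ?I" "Z' \<in> Ob ?I" "A \<in> Ob ?I" "A' \<in> Ob ?I" "c \<in> arr ?I Z' Z" "a \<in> arr ?I A A'" "x \<in> carrier (Ext ?I Z A)" for Z Z' A A' c a x
  proof -
    note oo = o[of Z] o[of Z'] o[of A] o[of A']
    obtain \<delta> where d: "x = (snd A, \<delta>, snd Z)" "\<delta> \<in> carrier (Ext E (fst Z) (fst A))"
        "Act E (Idn E (fst Z)) (snd A) \<delta> = \<delta>" "Act E (snd Z) (Idn E (fst A)) \<delta> = \<delta>"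
      using h(7) by (auto simp: s)
    obtain q r where q: "c = (snd Z, q, snd Z')" "mor E q" "src E q = fst Z'" "tgt E q = fst Z" "q \<cdot> snd Z' = q"
      and r: "a = (snd A', r, snd A)" "mor E r" "src E r = fst A" "tgt E r = fst A'" "snd A' \<cdot> r = r"
      using h(1-6) oo by (auto simp: s)
    have 1: "Act E q r \<delta> \<in> carrier (Ext E (fst Z') (fst A'))" using q(2-4) r(2-4) d(2) by simp
    have 2: "Act E (Idn E (fst Z')) (snd A') (Act E q r \<delta>) = Act E q r \<delta>"
      using act_act[of q r "Idn E (fst Z')" "snd A'" \<delta>] q r d(2) oo h by simp
    have 3: "Act E (snd Z') (Idn E (fst A')) (Act E q r \<delta>) = Act E q r \<delta>"
      using act_act[of q r "snd Z'" "Idn E (fst A')" \<delta>] q r d(2) oo h by simp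
    show ?thesis using 1 2 3 q(1) r(1) d(1) by (simp add: s)
  qed
  show "\<exists>S X \<eta>. realises n E (fst A) (fst Z) (fst (snd x)) X \<and>
        chain_map E (Suc n) X X \<eta> \<and> (\<forall>i\<le>Suc n. \<eta> i \<cdot> \<eta> i = \<eta> i \<and> obj S i \<in> Ob ?I \<and> fst (obj S i) = obj X i \<and> snd (obj S i) = \<eta> i) \<and>
        (\<forall>i\<le>n. dif S i \<in> arr ?I (obj S i) (obj S (Suc i)) \<and> fst (snd (dif S i)) = \<eta> (Suc i) \<cdot> (dif X i \<cdot> \<eta> i)) \<and>
        obj S 0 = A \<and> obj S (Suc n) = Z \<and> Rlz ?I Z A x = htpy_class n ?I S"
    if h: "Z \<in> Ob ?I" "A \<in> Ob ?I" "x \<in> carrier (Ext ?I Z A)" for Z A x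
  proof -
    obtain X \<eta> where X: "idem_choice n E (fst A) (fst Z) x = (X, \<eta>)" "realises n E (fst A) (fst Z) (fst (snd x)) X"
      "chain_map E (Suc n) X X \<eta>" "\<forall>i\<le>Suc n. \<eta> i \<cdot> \<eta> i = \<eta> i" "\<eta> 0 = snd A" "\<eta> (Suc n) = snd Z"
      by (rule idem_choice_exists[of Z A x]) (use h in simp_all)
    note r = rzD[OF X(2)] and c = complexD[OF rzD(6)[OF X(2)]]
    note m = chain_mapD(1-3)[OF r(6,6) X(3) r(6,6) order_refl]
    let ?S = "idem_cplx E X \<eta>"
    have 1: "obj ?S i \<in> idem_objects E" if "i \<le> Suc n" for i
      using c(1)[of i] m[of i] X(4) that by (simp add: idem_cplx_def idem_objects_def)
    have 2: "(\<eta> (Suc i) \<cdot> dif X i) \<cdot> \<eta> i = \<eta> (Suc i) \<cdot> (dif X i \<cdot> \<eta> i)" if "i \<le> n" for i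
      using c(1-4)[of i] m[of i] m[of "Suc i"] that by simp
    have 3: "dif ?S i \<in> arr ?I (obj ?S i) (obj ?S (Suc i))" if i: "i \<le> n" for i
    proof -
      have hi: "\<eta> i \<cdot> \<eta> i = \<eta> i" "\<eta> (Suc i) \<cdot> \<eta> (Suc i) = \<eta> (Suc i)" using X(4) i by simp_all
      note mm = c(1-4)[of i] c(1)[of "Suc i"] m[of i] m[of "Suc i"]
      have "\<eta> (Suc i) \<cdot> (\<eta> (Suc i) \<cdot> (dif X i \<cdot> \<eta> i)) = \<eta> (Suc i) \<cdot> (dif X i \<cdot> \<eta> i)"
        by (rule comp_eq[OF hi(2)]) (use mm i in simp_all)
      then show ?thesis using mm i hi(1) 2[OF i] by (simp add: idem_cplx_def s)
    qed
    have 4: "obj ?S 0 = A" "obj ?S (Suc n) = Z" using X(5,6) r(4,5) by (simp_all add: idem_cplx_def)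
    have 5: "Rlz ?I Z A x = htpy_class n ?I ?S"
      using X(1) same_cat_cong4(1)[OF same_cat_idem_completion[of n E]] by (simp add: idem_rlz_def split_def)
    show ?thesis
      by (intro exI[of _ ?S] exI[of _ X] exI[of _ \<eta>] conjI allI impI)
        (use X 1 2 3 4 5 in \<open>simp_all add: idem_cplx_def\<close>)
  qed
qed

end

theorem corollaryB:
  fixes n :: nat
    and E :: "('o, 'm, 'x) exang"
  assumes "n \<ge> 1"
    and "n_exact_exangulated n E"
  shows "n_exact_exangulated n (idem_completion n E)"
proof -
  interpret exact_exang n E using assms by (rule exact_exangI)
  interpret I: idem_rep n E "idem_completion n E" fst snd "\<lambda>f. fst (snd f)" "\<lambda>\<delta>. fst (snd \<delta>)"
    by (rule idem_completion_rep)
  have "closed_under_comp E (inflation n E)" "closed_under_comp E (deflation n E)"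
    using assms(2) by (simp_all add: n_exact_exangulated_def n_exangulated_def)
  then show ?thesis by (intro I.I.exact_exangulated I.EA1_inflation I.EA1_deflation)
qed

end
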